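(* Let $\mathcal H$ be a separable Hilbert space with inner product $\langle\cdot,\cdot\rangle$ and norm $\|\cdot\|$. Let $(X_i,Y_i)$, $i=1,\dots,n$, be i.i.d. $\mathcal H\times\mathbb R$-valued random variables satisfying $Y_i=\alpha+\langle X_i,\beta\rangle+\varepsilon_i$ with $\alpha\in\mathbb R$, $\beta\in\mathcal H$, where $\varepsilon_1,\dots,\varepsilon_n$ are independent of $X_1,\dots,X_n$ and i.i.d. $N(0,\vartheta^2)$ for some $\vartheta>0$, and $E\|X_1\|^4<\infty$. Let $W$ be a non-negative symmetric weight function with $\int t^4W(t)dt<\infty$. Let $\hat\varepsilon_j=Y_j-\hat\alpha-\langle X_j,\hat\beta\rangle$, $\hat\vartheta^2=\frac1n\sum_j\hat\varepsilon_j^2$, $\hat\varphi_n(t)=\frac1n\sum_j\exp(it\hat\varepsilon_j)$, $\varphi_1(t)=\exp(-\frac12t^2)$, $\tilde\varepsilon_j=\varepsilon_j/\vartheta$, and $$T_{n,C_2}=n\int|\hat\varphi_n(t/\hat\vartheta)-\varphi_1(t)|^2W(t)dt=n\int\Big(\frac1n\sum_{j=1}^n\big[\sin(t\hat\varepsilon_j/\hat\vartheta)+\cos(t\hat\varepsilon_j/\hat\vartheta)\big]-\varphi_1(t)\Big)^2W(t)dt.$$ (i) If $\hat\alpha=\overline Y_n-\langle\overline X_n,\hat\beta\rangle$ and $\|\hat\beta-\beta\|=o_{\mathbb P}(n^{-1/4})$, then $$T_{n,C_2}=n\int\Big(\frac1n\sum_{j=1}^n\Big[\sin(t\tilde\varepsilon_j)-E[\cos(t\tilde\varepsilon_1)]t\tilde\varepsilon_j-E[\cos(t\tilde\varepsilon_1)\tilde\varepsilon_1]\tfrac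 t2(\tilde\varepsilon_j^2-1)+\cos(t\tilde\varepsilon_j)+E[\sin(t\tilde\varepsilon_1)]t\tilde\varepsilon_j+E[\sin(t\tilde\varepsilon_1)\tilde\varepsilon_1]\tfrac t2(\tilde\varepsilon_j^2-1)\Big]-\varphi_1(t)\Big)^2W(t)dt+o_{\mathbb P}(1),$$ and $T_{n,C_2}$ converges in distribution to $\int(G_{C_{2,1}}(t))^2W(t)dt$ for a Gaussian process $G_{C_{2,1}}$ with $\mathrm{Cov}(G_{C_{2,1}}(s),G_{C_{2,1}}(t))=\exp(-\frac12(s-t)^2)-(\frac12s^2t^2+st+1)\exp(-\frac12(s^2+t^2))$. (ii) If $\alpha=\hat\alpha=0$, $\|\hat\beta-\beta\|=o_{\mathbb P}(n^{-1/4})$ and $E[X_1]=0$, then $$T_{n,C_2}=n\int\Big(\frac1n\sum_{j=1}^n\Big[\sin(t\tilde\varepsilon_j)-E[\cos(t\tilde\varepsilon_1)\tilde\varepsilon_1]\tfrac t2(\tilde\varepsilon_j^2-1)+\cos(t\tilde\varepsilon_j)+E[\sin(t\tilde\varepsilon_1)\tilde\varepsilon_1]\tfrac t2(\tilde\varepsilon_j^2-1)\Big]-\varphi_1(t)\Big)^2W(t)dt+o_{\mathbb P}(1),$$ and $T_{n,C_2}$ converges in distribution to $\int(G_{C_{2,2}}(t))^2W(t)dt$ for a centred Gaussian process $G_{C_{2,2}}$ with $\mathrm{Cov}(G_{C_{2,2}}(s),G_{C_{2,2}}(t))=\exp(-\frac12(s-t)^2)-(\frac12s^2t^2+1)\e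xp(-\frac12(s^2+t^2))$.
   Context: $\overline Y_n=\frac1n\sum Y_i$, $\overline X_n=\frac1n\sum X_i$; $\hat\alpha,\hat\beta$ are estimators of $\alpha,\beta$ computed from the sample. *)

theory Defs
  imports "HOL-Probability.Probability"
begin

definition phi1 :: "real \<Rightarrow> real" where
  "phi1 t = exp (- (1/2) * t\<^sup>2)"

definition theta_hat :: "nat \<Rightarrow> (nat \<Rightarrow> real) \<Rightarrow> real" where
  "theta_hat n e = sqrt ((\<Sum>j<n. (e j)\<^sup>2) / real n)"

definition phi_hat :: "nat \<Rightarrow> (nat \<Rightarrow> real) \<Rightarrow> real \<Rightarrow> complex" where
  "phi_hat n e t = (\<Sum>j<n. cis (t * e j)) / of_nat n"

definition T_C2 :: "(real \<Rightarrow> real) \<Rightarrow> nat \<Rightarrow> (nat \<Rightarrow> real) \<Rightarrow> real" where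
  "T_C2 W n e = real n * (LINT t|lborel.
      (cmod (phi_hat n e (t / theta_hat n e) - complex_of_real (phi1 t)))\<^sup>2 * W t)"

text \<open>The approximating statistic: e are the standardized errors, and a b c d are the
  coefficient functions E[cos(t e)], E[cos(t e) e], E[sin(t e)], E[sin(t e) e].\<close>
definition R_C2 :: "(real \<Rightarrow> real) \<Rightarrow> (real \<Rightarrow> real) \<Rightarrow> (real \<Rightarrow> real) \<Rightarrow> (real \<Rightarrow> real)
    \<Rightarrow> (real \<Rightarrow> real) \<Rightarrow> nat \<Rightarrow> (nat \<Rightarrow> real) \<Rightarrow> real" where
  "R_C2 W a b c d n e = real n * (LINT t|lborel.
      ((1 / real n) * (\<Sum>j<n. sin (t * e j) - a t * t * e j - b t * (t / 2) * ((e j)\<^sup>2 - 1)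
                        + cos (t * e j) + c t * t * e j + d t * (t / 2) * ((e j)\<^sup>2 - 1))
        - phi1 t)\<^sup>2 * W t)"

text \<open>Z n = o_P(r n): for all eps > 0, the (outer) probability of |Z n| > eps * r n tends to 0.\<close>
definition o_P :: "'a measure \<Rightarrow> (nat \<Rightarrow> 'a \<Rightarrow> real) \<Rightarrow> (nat \<Rightarrow> real) \<Rightarrow> bool" where
  "o_P M Z r \<longleftrightarrow> (\<forall>\<epsilon>>0. \<forall>\<delta>>0. eventually (\<lambda>n. \<exists>A\<in>sets M.
       {\<omega>\<in>space M. \<epsilon> * r n < \<bar>Z n \<omega>\<bar>} \<subseteq> A \<and> measure M A < \<delta>) sequentially)"

definition conv_distr :: "'a measure \<Rightarrow> (nat \<Rightarrow> 'a \<Rightarrow> real) \<Rightarrow> 'b measure \<Rightarrow> ('b \<Rightarrow> real) \<Rightarrow> bool" where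
  "conv_distr M T N L \<longleftrightarrow> (\<forall>n. T n \<in> borel_measurable M) \<and> L \<in> borel_measurable N \<and>
     weak_conv_m (\<lambda>n. distr M borel (T n)) (distr N borel L)"

definition centred_gaussian_process ::
    "'b measure \<Rightarrow> (real \<Rightarrow> 'b \<Rightarrow> real) \<Rightarrow> (real \<Rightarrow> real \<Rightarrow> real) \<Rightarrow> bool" where
  "centred_gaussian_process N G C \<longleftrightarrow> prob_space N \<and> (\<forall>t. G t \<in> borel_measurable N) \<and>
     (\<forall>I c. finite I \<longrightarrow>
        (let v = (\<Sum>s\<in>I. \<Sum>t\<in>I. c s * c t * C s t) in
          (if v = 0 then (AE \<omega> in N. (\<Sum>t\<in>I. c t * G t \<omega>) = 0)
           else distributed N lborel (\<lambda>\<omega>. \<Sum>t\<in>I. c t * G t \<omega>) (normal_density 0 (sqrt v)))))"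

end

theory Submission imports Defs "HOL-Real_Asymp.Real_Asymp"
begin

text \<open>
  Write the standardised residuals as \<open>\<kappa> * (e j - m - (X j - xb) \<bullet> b)\<close> with \<open>e j\<close> the standardised errors. A second order
  Taylor expansion of \<open>sin + cos\<close>, in which the linear part is split off, shows that the empirical process of the
  residuals and the normalised sum of the scores \<open>score c t (e j)\<close> differ by terms that are bounded by \<open>t\<^sup>2\<close> (or by
  centred sample means of that size) times factors of order \<open>o_P 1\<close>; hence the two square norms with weight \<open>W\<close>
  differ by \<open>o_P 1\<close>.

  For the limit law no central limit theorem in function space is needed. The Laplace transform of the square norm
  of a sum of i.i.d. centred random fields changes by \<open>o(1)\<close> when the fields are replaced one at a time by Gaussian
  ones with the same covariance (Lindeberg), and the norm of the normalised sum of \<open>n\<close> independent copies of the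
  Gaussian field \<open>\<Sum>k. gauss_coeff c k t * Z k\<close> has the same law for every \<open>n\<close>, by rotation invariance. Convergence of
  the Laplace transforms gives weak convergence.

  In part (ii) the integrand behaves like \<open>t\<^sup>2\<close> times a random factor that is almost surely nonzero, so a weight
  with infinite second moment makes the integrals diverge. They then have the value 0 by convention, on both sides
  and also in the limit, and the claims remain true.
\<close>

subsection \<open>Stochastic order symbols\<close>

text \<open>\<open>W\<close> may fail to be integrable near 0, since only \<open>t ^ 4 * W t\<close>
  is assumed integrable; an error term of size O(t^2) is then harmless, while one of size |t| need
  not be. This dictates splitting off the linear part of \<open>sin + cos\<close>. In part (i) the
  residuals have mean zero, so the linear discrepancy vanishes identically; in part (ii) it
  survives, and the second moment of \<open>W\<close> separates the regular from the degenerate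
  case. The estimator may depend on the sample in any way. In the first order term Cauchy-Schwarz
  separates it from means of centred functions of the errors times covariates, which are of order
  n^(-1/2); the second order term spends the rate n^(-1/4) through sqrt n * norm b ^ 2. Passing from
  \<open>sin + cos\<close> to the score is an L2 projection off 1, x^2 - 1 and, for c = 1, also x,
  hence off Hermite polynomials. The functional exp(-norm u ^ 2) suits the Lindeberg argument
  because its second order expansion sees a random field only through its mean and covariance, with
  a remainder bounded uniformly in the base point.\<close>

definition outer_lt :: "'a measure \<Rightarrow> 'a set \<Rightarrow> real \<Rightarrow> bool" where
  "outer_lt M E \<delta> \<longleftrightarrow> (\<exists>A\<in>sets M. E \<subseteq> A \<and> measure M A < \<delta>)"

definition O_P :: "'a measure \<Rightarrow> (nat \<Rightarrow> 'a \<Rightarrow> real) \<Rightarrow> bool" where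
  "O_P M Z \<longleftrightarrow> (\<forall>\<delta>>0. \<exists>K. eventually (\<lambda>n. outer_lt M {\<omega>\<in>space M. K < \<bar>Z n \<omega>\<bar>} \<delta>) sequentially)"

lemma o_P_iff: "o_P M Z r \<longleftrightarrow> (\<forall>\<epsilon>>0. \<forall>\<delta>>0. eventually (\<lambda>n.
    outer_lt M {\<omega>\<in>space M. \<epsilon> * r n < \<bar>Z n \<omega>\<bar>} \<delta>) sequentially)"
  by (simp add: o_P_def outer_lt_def)

lemma outer_lt_mono: "outer_lt M E \<delta> \<Longrightarrow> F \<subseteq> E \<Longrightarrow> \<delta> \<le> \<eta> \<Longrightarrow> outer_lt M F \<eta>"
  unfolding outer_lt_def
  by (elim bexE conjE, rule bexI, rule conjI, erule (1) subset_trans, erule (1) less_le_trans)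

lemma (in finite_measure) outer_lt_Un:
  assumes "outer_lt M E \<delta>" "outer_lt M F \<eta>" "G \<subseteq> E \<union> F"
  shows "outer_lt M G (\<delta> + \<eta>)"
proof -
  obtain A B where "A \<in> sets M" "E \<subseteq> A" "measure M A < \<delta>" "B \<in> sets M" "F \<subseteq> B" "measure M B < \<eta>"
    using assms(1,2) unfolding outer_lt_def by (elim bexE conjE)
  moreover from this have "measure M (A \<union> B) \<le> measure M A + measure M B"
    by (intro measure_Un_le)
  ultimately show ?thesis unfolding outer_lt_def using assms(3)
    by (intro bexI[of _ "A \<union> B"] conjI) auto
qed

lemma (in finite_measure) ev_outer_lt_Un:
  assumes "eventually (\<lambda>n. outer_lt M (E n) (\<delta>/2)) F" "eventually (\<lambda>n. outer_lt M (E' n) (\<delta>/2)) F"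
    "eventually (\<lambda>n. G n \<subseteq> E n \<union> E' n) F"
  shows "eventually (\<lambda>n. outer_lt M (G n) \<delta>) F"
  using assms
proof eventually_elim
  case (elim n)
  from outer_lt_Un[OF elim] show ?case by simp
qed

context finite_measure
begin

lemma o_P_imp_O_P: "o_P M Z (\<lambda>_. 1) \<Longrightarrow> O_P M Z"
  unfolding O_P_def o_P_iff by (intro allI impI exI[of _ 1]) (drule spec[of _ 1], simp)

lemma O_P_dom:
  assumes "O_P M Z" "\<And>n \<omega>. n > 0 \<Longrightarrow> \<omega> \<in> space M \<Longrightarrow> \<bar>Z' n \<omega>\<bar> \<le> \<bar>Z n \<omega>\<bar>"
  shows "O_P M Z'"
  unfolding O_P_def
proof (intro allI impI)
  fix \<delta> :: real assume "\<delta> > 0"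
  with assms obtain K where K: "eventually (\<lambda>n. outer_lt M {\<omega>\<in>space M. K < \<bar>Z n \<omega>\<bar>} \<delta>) sequentially"
    unfolding O_P_def by blast
  have "eventually (\<lambda>n. outer_lt M {\<omega>\<in>space M. K < \<bar>Z' n \<omega>\<bar>} \<delta>) sequentially"
    using K eventually_gt_at_top[of 0]
  proof eventually_elim
    case (elim n)
    then show ?case
      by (elim outer_lt_mono) (use assms(2)[OF elim(2)] in \<open>auto intro: less_le_trans\<close>)
  qed
  then show "\<exists>K. eventually (\<lambda>n. outer_lt M {\<omega>\<in>space M. K < \<bar>Z' n \<omega>\<bar>} \<delta>) sequentially" by blast
qed

text \<open>The inequality is asked for only where \<open>Z0\<close> is small, because the
  expansions of 1 / sqrt (1 + s) used later hold only near s = 0. The event that \<open>Z0\<close>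
  is large has vanishing outer probability; it receives half of \<delta>, the other two events a
  quarter each.\<close>

lemma o_P_local:
  assumes "o_P M Z (\<lambda>_. 1)" "O_P M Y" "o_P M Z0 (\<lambda>_. 1)" "\<eta> > 0"
    "\<And>n \<omega>. n > 0 \<Longrightarrow> \<omega> \<in> space M \<Longrightarrow> \<bar>Z0 n \<omega>\<bar> \<le> \<eta> \<Longrightarrow> \<bar>Z' n \<omega>\<bar> \<le> \<bar>Z n \<omega>\<bar> * \<bar>Y n \<omega>\<bar>"
  shows "o_P M Z' (\<lambda>_. 1)"
  unfolding o_P_iff
proof (intro allI impI)
  fix \<epsilon> \<delta> :: real assume e: "\<epsilon> > 0" "\<delta> > 0"
  obtain K where "eventually (\<lambda>n. outer_lt M {\<omega>\<in>space M. K < \<bar>Y n \<omega>\<bar>} (\<delta>/2/2)) sequentially"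
    using assms(2) e unfolding O_P_def by (meson half_gt_zero)
  moreover define K' where "K' = max K 1"
  ultimately have K: "eventually (\<lambda>n. outer_lt M {\<omega>\<in>space M. K' < \<bar>Y n \<omega>\<bar>} (\<delta>/2/2)) sequentially"
    by (auto elim!: eventually_mono outer_lt_mono)
  have K1: "K' \<ge> 1" by (simp add: K'_def)
  have "eventually (\<lambda>n. outer_lt M {\<omega>\<in>space M. (\<epsilon>/K') * 1 < \<bar>Z n \<omega>\<bar>} (\<delta>/2/2)) sequentially"
    using assms(1) e K1 unfolding o_P_iff by simp
  from ev_outer_lt_Un[OF this K order_refl[THEN always_eventually[OF allI]]]
  have 1: "eventually (\<lambda>n. outer_lt M ({\<omega>\<in>space M. (\<epsilon>/K') * 1 < \<bar>Z n \<omega>\<bar>} \<union> {\<omega>\<in>space M. K' < \<bar>Y n \<omega>\<bar>}) (\<delta>/2)) sequentially" .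
  have 2: "eventually (\<lambda>n. outer_lt M {\<omega>\<in>space M. \<eta> * 1 < \<bar>Z0 n \<omega>\<bar>} (\<delta>/2)) sequentially"
    using assms(3,4) e unfolding o_P_iff by simp
  have 3: "{\<omega> \<in> space M. \<epsilon> * 1 < \<bar>Z' n \<omega>\<bar>} \<subseteq>
     ({\<omega>\<in>space M. (\<epsilon>/K') * 1 < \<bar>Z n \<omega>\<bar>} \<union> {\<omega>\<in>space M. K' < \<bar>Y n \<omega>\<bar>}) \<union> {\<omega>\<in>space M. \<eta> * 1 < \<bar>Z0 n \<omega>\<bar>}" if "n > 0" for n
  proof (rule subsetI, rule ccontr)
    fix \<omega> assume "\<omega> \<in> {\<omega> \<in> space M. \<epsilon> * 1 < \<bar>Z' n \<omega>\<bar>}"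
      and "\<omega> \<notin> ({\<omega>\<in>space M. (\<epsilon>/K') * 1 < \<bar>Z n \<omega>\<bar>} \<union> {\<omega>\<in>space M. K' < \<bar>Y n \<omega>\<bar>}) \<union> {\<omega>\<in>space M. \<eta> * 1 < \<bar>Z0 n \<omega>\<bar>}"
    then have a: "\<omega> \<in> space M" "\<epsilon> < \<bar>Z' n \<omega>\<bar>" "\<bar>Z n \<omega>\<bar> \<le> \<epsilon>/K'" "\<bar>Y n \<omega>\<bar> \<le> K'" "\<bar>Z0 n \<omega>\<bar> \<le> \<eta>" by auto
    have "\<bar>Z' n \<omega>\<bar> \<le> \<bar>Z n \<omega>\<bar> * \<bar>Y n \<omega>\<bar>" using assms(5) that a by auto
    also have "\<dots> \<le> \<epsilon>/K' * K'" using a e K1 by (intro mult_mono) auto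
    also have "\<dots> = \<epsilon>" using K1 by simp
    finally show False using a by simp
  qed
  show "eventually (\<lambda>n. outer_lt M {\<omega> \<in> space M. \<epsilon> * 1 < \<bar>Z' n \<omega>\<bar>} \<delta>) sequentially"
    by (rule ev_outer_lt_Un[OF 1 2]) (rule eventually_mono[OF eventually_gt_at_top[of 0] 3])
qed

lemma O_P_local:
  assumes "O_P M Y" "o_P M Z0 (\<lambda>_. 1)" "\<eta> > 0"
    "\<And>n \<omega>. n > 0 \<Longrightarrow> \<omega> \<in> space M \<Longrightarrow> \<bar>Z0 n \<omega>\<bar> \<le> \<eta> \<Longrightarrow> \<bar>Z' n \<omega>\<bar> \<le> \<bar>Y n \<omega>\<bar>"
  shows "O_P M Z'"
  unfolding O_P_def
proof (intro allI impI)
  fix \<delta> :: real assume e: "\<delta> > 0"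
  obtain K where 1: "eventually (\<lambda>n. outer_lt M {\<omega>\<in>space M. K < \<bar>Y n \<omega>\<bar>} (\<delta>/2)) sequentially"
    using assms(1) e unfolding O_P_def by (meson half_gt_zero)
  have 2: "eventually (\<lambda>n. outer_lt M {\<omega>\<in>space M. \<eta> * 1 < \<bar>Z0 n \<omega>\<bar>} (\<delta>/2)) sequentially"
    using assms(2,3) e unfolding o_P_iff by simp
  have 3: "{\<omega> \<in> space M. K < \<bar>Z' n \<omega>\<bar>} \<subseteq> {\<omega>\<in>space M. K < \<bar>Y n \<omega>\<bar>} \<union> {\<omega>\<in>space M. \<eta> * 1 < \<bar>Z0 n \<omega>\<bar>}" if "n > 0" for n
    using assms(4)[OF that] by force
  show "\<exists>K. eventually (\<lambda>n. outer_lt M {\<omega> \<in> space M. K < \<bar>Z' n \<omega>\<bar>} \<delta>) sequentially"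
    by (rule exI[of _ K], rule ev_outer_lt_Un[OF 1 2]) (rule eventually_mono[OF eventually_gt_at_top[of 0] 3])
qed

lemma o_P_0: "o_P M (\<lambda>_ _. 0) (\<lambda>_. 1)"
  unfolding o_P_iff outer_lt_def by (auto intro!: always_eventually bexI[of _ "{}"])

lemma o_P_mult: "o_P M Z (\<lambda>_. 1) \<Longrightarrow> O_P M Y \<Longrightarrow> o_P M (\<lambda>n \<omega>. Z n \<omega> * Y n \<omega>) (\<lambda>_. 1)"
  by (erule o_P_local[OF _ _ o_P_0 zero_less_one]) (auto simp: abs_mult)

lemma O_P_mult_o_P: "O_P M Y \<Longrightarrow> o_P M Z (\<lambda>_. 1) \<Longrightarrow> o_P M (\<lambda>n \<omega>. Y n \<omega> * Z n \<omega>) (\<lambda>_. 1)"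
  using o_P_mult[of Z Y] by (simp add: mult.commute)

lemma O_P_const: "O_P M (\<lambda>_ _. c)"
  unfolding O_P_def outer_lt_def by (auto intro!: exI[of _ "\<bar>c\<bar>"] always_eventually bexI[of _ "{}"])

text \<open>Pointwise domination suffices because the events are covered by measurable sets instead
  of being measured: the dominated family may be arbitrary.\<close>

lemma o_P_dom:
  assumes "o_P M Z (\<lambda>_. 1)" "\<And>n \<omega>. n > 0 \<Longrightarrow> \<omega> \<in> space M \<Longrightarrow> \<bar>Z' n \<omega>\<bar> \<le> \<bar>Z n \<omega>\<bar>"
  shows "o_P M Z' (\<lambda>_. 1)"
  by (rule o_P_local[OF assms(1) O_P_const[of 1] o_P_0 zero_less_one]) (use assms(2) in auto)

lemma O_P_add:
  assumes "O_P M Y" "O_P M Z" shows "O_P M (\<lambda>n \<omega>. Y n \<omega> + Z n \<omega>)"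
  unfolding O_P_def
proof (intro allI impI)
  fix \<delta> :: real assume e: "\<delta> > 0"
  obtain K L where 1: "eventually (\<lambda>n. outer_lt M {\<omega>\<in>space M. K < \<bar>Y n \<omega>\<bar>} (\<delta>/2)) sequentially"
    and 2: "eventually (\<lambda>n. outer_lt M {\<omega>\<in>space M. L < \<bar>Z n \<omega>\<bar>} (\<delta>/2)) sequentially"
    using assms e unfolding O_P_def by (meson half_gt_zero)
  show "\<exists>K. eventually (\<lambda>n. outer_lt M {\<omega> \<in> space M. K < \<bar>Y n \<omega> + Z n \<omega>\<bar>} \<delta>) sequentially"
    by (rule exI[of _ "K + L"], rule ev_outer_lt_Un[OF 1 2 always_eventually[OF allI]]) auto
qed

lemma O_P_mult:
  assumes "O_P M Y" "O_P M Z" shows "O_P M (\<lambda>n \<omega>. Y n \<omega> * Z n \<omega>)"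
  unfolding O_P_def
proof (intro allI impI)
  fix \<delta> :: real assume e: "\<delta> > 0"
  obtain K L where 1: "eventually (\<lambda>n. outer_lt M {\<omega>\<in>space M. K < \<bar>Y n \<omega>\<bar>} (\<delta>/2)) sequentially"
    and 2: "eventually (\<lambda>n. outer_lt M {\<omega>\<in>space M. L < \<bar>Z n \<omega>\<bar>} (\<delta>/2)) sequentially"
    using assms e unfolding O_P_def by (meson half_gt_zero)
  have *: "\<bar>y * z\<bar> \<le> \<bar>K\<bar> * \<bar>L\<bar>" if "\<not> K < \<bar>y\<bar>" "\<not> L < \<bar>z\<bar>" for y z
    using that by (auto simp: abs_mult intro!: mult_mono)
  have "{\<omega> \<in> space M. \<bar>K\<bar> * \<bar>L\<bar> < \<bar>Y n \<omega> * Z n \<omega>\<bar>} \<subseteq> {\<omega>\<in>space M. K < \<bar>Y n \<omega>\<bar>} \<union> {\<omega>\<in>space M. L < \<bar>Z n \<omega>\<bar>}" for n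
    using *[of "Y n \<omega>" "Z n \<omega>" for \<omega>] by force
  from ev_outer_lt_Un[OF 1 2 always_eventually[OF allI[OF this]]]
  show "\<exists>K. eventually (\<lambda>n. outer_lt M {\<omega> \<in> space M. K < \<bar>Y n \<omega> * Z n \<omega>\<bar>} \<delta>) sequentially"
    by blast
qed

lemma o_P_add:
  assumes "o_P M Y (\<lambda>_. 1)" "o_P M Z (\<lambda>_. 1)" shows "o_P M (\<lambda>n \<omega>. Y n \<omega> + Z n \<omega>) (\<lambda>_. 1)"
  unfolding o_P_iff
proof (intro allI impI)
  fix \<epsilon> \<delta> :: real assume e: "\<epsilon> > 0" "\<delta> > 0"
  have 1: "eventually (\<lambda>n. outer_lt M {\<omega>\<in>space M. \<epsilon>/2 * 1 < \<bar>Y n \<omega>\<bar>} (\<delta>/2)) sequentially"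
    and 2: "eventually (\<lambda>n. outer_lt M {\<omega>\<in>space M. \<epsilon>/2 * 1 < \<bar>Z n \<omega>\<bar>} (\<delta>/2)) sequentially"
    using assms[unfolded o_P_iff, rule_format, of "\<epsilon>/2" "\<delta>/2"] e by (auto simp del: mult_1_right)
  show "eventually (\<lambda>n. outer_lt M {\<omega> \<in> space M. \<epsilon> * 1 < \<bar>Y n \<omega> + Z n \<omega>\<bar>} \<delta>) sequentially"
    by (rule ev_outer_lt_Un[OF 1 2 always_eventually[OF allI]]) auto
qed

lemma o_P_minus: "o_P M Z r \<Longrightarrow> o_P M (\<lambda>n \<omega>. - Z n \<omega>) r"
  by (simp add: o_P_def)

lemma o_P_diff:
  "o_P M Y (\<lambda>_. 1) \<Longrightarrow> o_P M Z (\<lambda>_. 1) \<Longrightarrow> o_P M (\<lambda>n \<omega>. Y n \<omega> - Z n \<omega>) (\<lambda>_. 1)"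
  using o_P_add[OF _ o_P_minus] by fastforce

lemma o_P_deterministic:
  assumes "a \<longlonglongrightarrow> 0" shows "o_P M (\<lambda>n _. a n) (\<lambda>_. 1)"
  unfolding o_P_iff
proof (intro allI impI)
  fix \<epsilon> \<delta> :: real assume e: "\<epsilon> > 0" "\<delta> > 0"
  from assms e have "eventually (\<lambda>n. \<bar>a n\<bar> < \<epsilon>) sequentially" by (auto simp: tendsto_iff dist_real_def)
  then show "eventually (\<lambda>n. outer_lt M {\<omega> \<in> space M. \<epsilon> * 1 < \<bar>a n\<bar>} \<delta>) sequentially"
    by eventually_elim (use e in \<open>auto simp: outer_lt_def intro!: bexI[of _ "{}"]\<close>)
qed

lemma O_P_power2: "O_P M Z \<Longrightarrow> O_P M (\<lambda>n \<omega>. (Z n \<omega>)\<^sup>2)"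
  using O_P_mult[of Z Z] by (simp add: power2_eq_square)

lemma o_P_power2: "o_P M Z (\<lambda>_. 1) \<Longrightarrow> o_P M (\<lambda>n \<omega>. (Z n \<omega>)\<^sup>2) (\<lambda>_. 1)"
  using o_P_mult[of Z Z] o_P_imp_O_P[of Z] by (simp add: power2_eq_square)

text \<open>\<open>sqrt\<close> is odd on the reals, so no sign condition arises; |sqrt z| \<le> z^2
  + 1 reduces the claim to products and sums.\<close>

lemma O_P_sqrt:
  assumes "O_P M Z" shows "O_P M (\<lambda>n \<omega>. sqrt (Z n \<omega>))"
proof (rule O_P_dom[OF O_P_add[OF O_P_mult[OF assms assms] O_P_const[of 1]]])
  fix n \<omega>
  have "\<bar>sqrt (Z n \<omega>)\<bar> = sqrt \<bar>Z n \<omega>\<bar>" by (simp add: real_sqrt_abs2 abs_if real_sqrt_minus)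
  also have "sqrt \<bar>Z n \<omega>\<bar> \<le> \<bar>Z n \<omega>\<bar>\<^sup>2 + 1"
  proof (rule real_le_lsqrt, simp)
    have "0 \<le> (\<bar>Z n \<omega>\<bar> - 1)\<^sup>2" by simp
    then have "\<bar>Z n \<omega>\<bar> \<le> \<bar>Z n \<omega>\<bar>\<^sup>2 + 1" unfolding power2_diff by simp
    also have "\<dots> \<le> (\<bar>Z n \<omega>\<bar>\<^sup>2 + 1)\<^sup>2"
      by (rule self_le_power) simp_all
    finally show "\<bar>Z n \<omega>\<bar> \<le> (\<bar>Z n \<omega>\<bar>\<^sup>2 + 1)\<^sup>2" .
  qed
  finally show "\<bar>sqrt (Z n \<omega>)\<bar> \<le> \<bar>Z n \<omega> * Z n \<omega> + 1\<bar>" by (simp add: power2_eq_square)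
qed

lemma o_P_sqrt:
  assumes "o_P M Z (\<lambda>_. 1)" shows "o_P M (\<lambda>n \<omega>. sqrt (Z n \<omega>)) (\<lambda>_. 1)"
  unfolding o_P_iff
proof (intro allI impI)
  fix \<epsilon> \<delta> :: real assume e: "\<epsilon> > 0" "\<delta> > 0"
  then have 1: "eventually (\<lambda>n. outer_lt M {\<omega>\<in>space M. \<epsilon>\<^sup>2 * 1 < \<bar>Z n \<omega>\<bar>} \<delta>) sequentially"
    using assms unfolding o_P_iff by auto
  have "\<epsilon>\<^sup>2 < \<bar>z\<bar>" if "\<epsilon> < \<bar>sqrt z\<bar>" for z
  proof -
    have "\<epsilon> < sqrt \<bar>z\<bar>" using that by (simp add: real_sqrt_abs2 abs_if real_sqrt_minus split: if_splits)
    then show ?thesis using e by (metis real_le_lsqrt not_less less_imp_le abs_ge_zero)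
  qed
  then show "eventually (\<lambda>n. outer_lt M {\<omega> \<in> space M. \<epsilon> * 1 < \<bar>sqrt (Z n \<omega>)\<bar>} \<delta>) sequentially"
    using 1 by (elim eventually_mono outer_lt_mono) auto
qed

text \<open>Markov's inequality. With a nonnegative integral on the left, finiteness is part of the
  bound and no integrability has to be shown beforehand.\<close>

lemma O_P_bounded_expectation:
  assumes meas: "\<And>n. n > 0 \<Longrightarrow> Z n \<in> borel_measurable M"
    and bd: "\<And>n. n > 0 \<Longrightarrow> (\<integral>\<^sup>+\<omega>. ennreal \<bar>Z n \<omega>\<bar> \<partial>M) \<le> ennreal C" and C: "C \<ge> 0"
  shows "O_P M Z"
  unfolding O_P_def
proof (intro allI impI)
  fix \<delta> :: real assume e: "\<delta> > 0"
  \<comment> \<open>\<open>C + 1\<close> in place of \<open>C\<close> keeps \<open>K\<close>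
    positive and the final inequality strict, also when C = 0.\<close>
  define K where "K = (C + 1) / \<delta>"
  have K: "K > 0" using C e by (simp add: K_def)
  have "outer_lt M {\<omega> \<in> space M. K < \<bar>Z n \<omega>\<bar>} \<delta>" if n: "n > 0" for n
  proof -
    let ?A = "{\<omega> \<in> space M. K < \<bar>Z n \<omega>\<bar>}"
    have A: "?A \<in> sets M" using meas[OF n] by measurable
    have "ennreal K * emeasure M ?A = (\<integral>\<^sup>+\<omega>. ennreal K * indicator ?A \<omega> \<partial>M)"
      using A by (simp add: nn_integral_cmult_indicator)
    also have "\<dots> \<le> (\<integral>\<^sup>+\<omega>. ennreal \<bar>Z n \<omega>\<bar> \<partial>M)"
      using K by (intro nn_integral_mono) (auto simp: indicator_def intro!: ennreal_leI)
    also have "\<dots> \<le> ennreal C" by (rule bd[OF n])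
    finally have "ennreal (K * measure M ?A) \<le> ennreal C"
      using K by (simp add: emeasure_eq_measure ennreal_mult)
    then have "K * measure M ?A \<le> C" using C by (simp add: ennreal_le_iff)
    also have "\<dots> < C + 1" by simp
    also have "\<dots> = K * \<delta>" using e by (simp add: K_def)
    finally have "measure M ?A < \<delta>" using K by (rule_tac mult_left_less_imp_less[of K]) auto
    then show ?thesis using A unfolding outer_lt_def by blast
  qed
  then show "\<exists>K. eventually (\<lambda>n. outer_lt M {\<omega> \<in> space M. K < \<bar>Z n \<omega>\<bar>} \<delta>) sequentially"
    by (intro exI[of _ K] eventually_mono[OF eventually_gt_at_top[of 0]])
qed

lemma O_P_bounded_integral:
  assumes int: "\<And>n. n > 0 \<Longrightarrow> integrable M (Z n)" "\<And>n \<omega>. n > 0 \<Longrightarrow> \<omega> \<in> space M \<Longrightarrow> 0 \<le> Z n \<omega>"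
    and bd: "\<And>n. n > 0 \<Longrightarrow> integral\<^sup>L M (Z n) \<le> C"
  shows "O_P M Z"
proof (rule O_P_bounded_expectation[of _ "max C 0"])
  fix n :: nat assume n: "n > 0"
  show "Z n \<in> borel_measurable M" using int(1)[OF n] by auto
  have "(\<integral>\<^sup>+\<omega>. ennreal \<bar>Z n \<omega>\<bar> \<partial>M) = (\<integral>\<^sup>+\<omega>. ennreal (Z n \<omega>) \<partial>M)"
    by (intro nn_integral_cong) (auto simp: int(2)[OF n])
  also have "\<dots> = ennreal (integral\<^sup>L M (Z n))"
    by (intro nn_integral_eq_integral int n AE_I2)
  also have "\<dots> \<le> ennreal (max C 0)" using bd[OF n] by (intro ennreal_leI) auto
  finally show "(\<integral>\<^sup>+\<omega>. ennreal \<bar>Z n \<omega>\<bar> \<partial>M) \<le> ennreal (max C 0)" .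
qed auto

end

text \<open>Turns closeness in probability into closeness of expectations for bounded functionals:
  off a set of probability below e/2 the integrand is at most e/2, and on it at most 1. It is
  applied to differences of Laplace transforms.\<close>

lemma (in prob_space) o_P_bounded_integral_tendsto:
  assumes o: "o_P M Z (\<lambda>_. 1)" and meas: "\<And>n. f n \<in> borel_measurable M"
    and f: "\<And>n \<omega>. \<omega> \<in> space M \<Longrightarrow> \<bar>f n \<omega>\<bar> \<le> 1 \<and> \<bar>f n \<omega>\<bar> \<le> c * \<bar>Z n \<omega>\<bar>"
    and c: "c > 0"
  shows "(\<lambda>n. integral\<^sup>L M (f n)) \<longlonglongrightarrow> 0"
  unfolding tendsto_iff
proof (intro allI impI)
  fix e :: real assume e: "e > 0"
  have "eventually (\<lambda>n. outer_lt M {\<omega>\<in>space M. (e/(2*c)) * 1 < \<bar>Z n \<omega>\<bar>} (e/2)) sequentially"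
    using o e c unfolding o_P_iff by auto
  then show "eventually (\<lambda>n. dist (integral\<^sup>L M (f n)) 0 < e) sequentially"
  proof eventually_elim
    case (elim n)
    then obtain A where A: "A \<in> sets M" "{\<omega>\<in>space M. e/(2*c) < \<bar>Z n \<omega>\<bar>} \<subseteq> A" "measure M A < e/2"
      by (auto simp: outer_lt_def)
    have int: "integrable M (f n)"
      by (rule integrable_const_bound[of _ 1]) (use f meas in auto)
    have "\<bar>integral\<^sup>L M (f n)\<bar> \<le> (\<integral>\<omega>. \<bar>f n \<omega>\<bar> \<partial>M)" by (rule integral_abs_bound)
    also have "\<dots> \<le> (\<integral>\<omega>. e/2 + indicator A \<omega> \<partial>M)"
    proof (rule integral_mono)
      fix \<omega> assume w: "\<omega> \<in> space M"
      show "\<bar>f n \<omega>\<bar> \<le> e/2 + indicator A \<omega>"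
      proof (cases "\<omega> \<in> A")
        case True then show ?thesis using f[OF w, of n] e by auto
      next
        case False
        then have "\<bar>Z n \<omega>\<bar> \<le> e/(2*c)" using A(2) w by force
        then have "c * \<bar>Z n \<omega>\<bar> \<le> e/2" using c by (simp add: field_simps)
        then show ?thesis using f[OF w, of n] False by auto
      qed
    qed (use int A in \<open>auto intro!: integrable_add integrable_real_indicator simp: emeasure_eq_measure\<close>)
    also have "\<dots> = e/2 + measure M A" using A(1) by (subst Bochner_Integration.integral_add) (auto simp: emeasure_eq_measure prob_space)
    finally show ?case using A by simp
  qed
qed

subsection \<open>Weak convergence from Laplace transforms\<close>

lemma abs_exp_neg_diff_le:
  fixes x y :: real assumes "x \<ge> 0" "y \<ge> 0"
  shows "\<bar>exp (-x) - exp (-y)\<bar> \<le> 1" "\<bar>exp (-x) - exp (-y)\<bar> \<le> \<bar>x - y\<bar>"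
proof -
  have "0 < exp (-x)" "exp (-x) \<le> 1" "0 < exp (-y)" "exp (-y) \<le> 1" using assms by auto
  then show "\<bar>exp (-x) - exp (-y)\<bar> \<le> 1" by linarith
  have *: "\<bar>exp (-x) - exp (-y)\<bar> \<le> \<bar>x - y\<bar>" if "x \<le> y" "0 \<le> x" for x y :: real
  proof -
    have "exp (-x) - exp (-y) = exp (-x) * (1 - exp (x - y))"
      using exp_add[of "-x" "x-y"] by (simp add: right_diff_distrib)
    also have "\<dots> \<le> 1 * (y - x)"
    proof (rule mult_mono)
      show "1 - exp (x - y) \<le> y - x" using exp_ge_add_one_self[of "x - y"] by linarith
    qed (use that in auto)
    finally show ?thesis using that by simp
  qed
  show "\<bar>exp (-x) - exp (-y)\<bar> \<le> \<bar>x - y\<bar>"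
    using *[of x y] *[of y x] assms by (cases "x \<le> y") (auto simp: abs_minus_commute)
qed

text \<open>Convergence of the Laplace transforms at the natural numbers is convergence of all moments of
  \<^term>\<open>\<lambda>\<omega>. exp (- T n \<omega>)\<close>, a variable with values in the unit interval, where polynomials are
  uniformly dense.\<close>

lemma weak_conv_of_laplace:
  fixes T :: "nat \<Rightarrow> 'a \<Rightarrow> real" and L :: "'b \<Rightarrow> real"
  assumes M: "prob_space M" and N: "prob_space N"
    and T: "\<And>n. T n \<in> borel_measurable M" "\<And>n \<omega>. \<omega> \<in> space M \<Longrightarrow> 0 \<le> T n \<omega>"
    and L: "L \<in> borel_measurable N" "\<And>\<omega>. \<omega> \<in> space N \<Longrightarrow> 0 \<le> L \<omega>"
    and lap: "\<And>k::nat. (\<lambda>n. \<integral>\<omega>. exp (- (real k * T n \<omega>)) \<partial>M) \<longlonglongrightarrow> (\<integral>\<omega>. exp (- (real k * L \<omega>)) \<partial>N)"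
  shows "weak_conv_m (\<lambda>n. distr M borel (T n)) (distr N borel L)"
proof (rule integral_cts_step_conv_imp_weak_conv)
  interpret M: prob_space M by fact
  interpret N: prob_space N by fact
  show "\<And>n. real_distribution (distr M borel (T n))" by (rule M.real_distribution_distr) (use T in auto)
  show "real_distribution (distr N borel L)" by (rule N.real_distribution_distr) (use L in auto)
  fix x y :: real assume xy: "x < y"
  \<comment> \<open>The test function in the variable u = exp(-s). Since \<open>cts_step x y\<close>
    vanishes above \<open>y\<close>, \<open>f\<close> is 0 on a neighbourhood of u = 0, so it is
    continuous on the whole closed unit interval although s = \<infinity> corresponds to u =
    0.\<close>
  define f where "f u = (if u \<le> 0 then 0 else cts_step x y (- ln u))" for u :: real
  have cstep: "continuous_on UNIV (cts_step x y)"
    by (rule uniformly_continuous_imp_continuous[OF cts_step_uniformly_continuous[OF xy]])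
  have "isCont f u" if "u \<in> {0..1}" for u
  proof (cases "u = 0")
    case True
    have "eventually (\<lambda>v. f v = 0) (nhds (0::real))"
    proof -
      have "f v = 0" if "dist v 0 < exp (- y)" for v
      proof (cases "v \<le> 0")
        case False
        with that have "ln v < - y" using ln_less_cancel_iff[of v "exp (-y)"] by (simp add: dist_real_def)
        then show ?thesis using False xy by (simp add: f_def cts_step_def)
      qed (simp add: f_def)
      then show ?thesis unfolding eventually_nhds_metric
        by (intro exI[of _ "exp (-y)"] conjI allI impI) (rule exp_gt_zero, assumption)
    qed
    then have "isCont f 0 \<longleftrightarrow> isCont (\<lambda>_. 0::real) (0::real)" by (rule isCont_cong)
    then show ?thesis using True by simp
  next
    case False
    with that have u: "u > 0" by simp
    have "eventually (\<lambda>v. f v = cts_step x y (- ln v)) (nhds u)"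
      using eventually_nhds_in_open[OF open_greaterThan[of 0], of u] u
      by (auto elim!: eventually_mono simp: f_def)
    then have "isCont f u \<longleftrightarrow> isCont (\<lambda>v. cts_step x y (- ln v)) u" by (rule isCont_cong)
    moreover have "isCont (\<lambda>v. cts_step x y (- ln v)) u"
    proof (rule isCont_o2[where g="cts_step x y"])
      show "isCont (\<lambda>v. - ln v) u" using u by (intro isCont_minus isCont_ln) simp
      show "isCont (cts_step x y) (- ln u)" using cstep by (simp add: continuous_on_eq_continuous_at)
    qed
    ultimately show ?thesis by simp
  qed
  then have cont: "continuous_on {0..1} f" by (simp add: continuous_at_imp_continuous_on)
  have fexp: "f (exp (- s)) = cts_step x y s" for s by (simp add: f_def)
  have cs_meas: "cts_step x y \<in> borel_measurable borel"
    by (rule borel_measurable_continuous_onI[OF cstep])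
  have cs_bd: "\<bar>cts_step x y s\<bar> \<le> 1" for s using xy by (auto simp: cts_step_def)
  have "(\<lambda>n. \<integral>\<omega>. cts_step x y (T n \<omega>) \<partial>M) \<longlonglongrightarrow> (\<integral>\<omega>. cts_step x y (L \<omega>) \<partial>N)"
    unfolding tendsto_iff
  proof (intro allI impI)
    fix e :: real assume e: "e > 0"
    obtain g where g: "real_polynomial_function g" "\<And>u. u \<in> {0..1} \<Longrightarrow> \<bar>f u - g u\<bar> < e/3"
      using Stone_Weierstrass_real_polynomial_function[OF _ cont, of "e/3"] e by auto
    then obtain a m where gs: "g = (\<lambda>u. \<Sum>i\<le>m. a i * u ^ i)"
      unfolding real_polynomial_function_iff_sum by blast
    have pw: "exp (- s) ^ i = exp (- (real i * s))" for s :: real and i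
      using exp_of_nat_mult[of i "- s"] by simp
    have iM: "integrable M (\<lambda>\<omega>. exp (- (real i * T n \<omega>)))" for i n
      by (rule M.integrable_const_bound[of _ 1]) (use T in auto)
    have iN: "integrable N (\<lambda>\<omega>. exp (- (real i * L \<omega>)))" for i
      by (rule N.integrable_const_bound[of _ 1]) (use L in auto)
    have gM: "(\<integral>\<omega>. g (exp (- T n \<omega>)) \<partial>M) = (\<Sum>i\<le>m. a i * (\<integral>\<omega>. exp (- (real i * T n \<omega>)) \<partial>M))" for n
      unfolding gs pw by (subst Bochner_Integration.integral_sum) (auto intro!: iM)
    have gN: "(\<integral>\<omega>. g (exp (- L \<omega>)) \<partial>N) = (\<Sum>i\<le>m. a i * (\<integral>\<omega>. exp (- (real i * L \<omega>)) \<partial>N))"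
      unfolding gs pw by (subst Bochner_Integration.integral_sum) (auto intro!: iN)
    have igM: "integrable M (\<lambda>\<omega>. g (exp (- T n \<omega>)))" for n
      unfolding gs pw by (intro Bochner_Integration.integrable_sum integrable_mult_right iM)
    have igN: "integrable N (\<lambda>\<omega>. g (exp (- L \<omega>)))"
      unfolding gs pw by (intro Bochner_Integration.integrable_sum integrable_mult_right iN)
    have "(\<lambda>n. \<integral>\<omega>. g (exp (- T n \<omega>)) \<partial>M) \<longlonglongrightarrow> (\<integral>\<omega>. g (exp (- L \<omega>)) \<partial>N)"
      unfolding gM gN by (intro tendsto_intros lap)
    then have "eventually (\<lambda>n. dist (\<integral>\<omega>. g (exp (- T n \<omega>)) \<partial>M) (\<integral>\<omega>. g (exp (- L \<omega>)) \<partial>N) < e/3) sequentially"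
      by (rule tendstoD) (use e in simp)
    then show "eventually (\<lambda>n. dist (\<integral>\<omega>. cts_step x y (T n \<omega>) \<partial>M) (\<integral>\<omega>. cts_step x y (L \<omega>) \<partial>N) < e) sequentially"
    proof eventually_elim
      case (elim n)
      have 1: "\<bar>(\<integral>\<omega>. cts_step x y (S \<omega>) \<partial>P) - (\<integral>\<omega>. g (exp (- S \<omega>)) \<partial>P)\<bar> \<le> e/3"
        if P: "prob_space P" and S: "S \<in> borel_measurable P" "\<And>\<omega>. \<omega> \<in> space P \<Longrightarrow> 0 \<le> S \<omega>"
          and ig: "integrable P (\<lambda>\<omega>. g (exp (- S \<omega>)))" for P :: "'c measure" and S
      proof -
        interpret P: prob_space P by fact
        have ic: "integrable P (\<lambda>\<omega>. cts_step x y (S \<omega>))"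
          by (rule P.integrable_const_bound[of _ 1]) (use cs_bd S cs_meas in auto)
        have "\<bar>(\<integral>\<omega>. cts_step x y (S \<omega>) \<partial>P) - (\<integral>\<omega>. g (exp (- S \<omega>)) \<partial>P)\<bar>
           = \<bar>\<integral>\<omega>. cts_step x y (S \<omega>) - g (exp (- S \<omega>)) \<partial>P\<bar>" using ic ig by simp
        also have "\<dots> \<le> (\<integral>\<omega>. \<bar>cts_step x y (S \<omega>) - g (exp (- S \<omega>))\<bar> \<partial>P)" by (rule integral_abs_bound)
        also have "\<dots> \<le> (\<integral>\<omega>. e/3 \<partial>P)"
        proof (rule integral_mono)
          fix \<omega> assume "\<omega> \<in> space P"
          then have "exp (- S \<omega>) \<in> {0..1}" using S(2) by simp
          from g(2)[OF this] show "\<bar>cts_step x y (S \<omega>) - g (exp (- S \<omega>))\<bar> \<le> e/3" unfolding fexp by simp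
        qed (use ic ig in auto)
        also have "\<dots> = e/3" by (simp add: P.prob_space)
        finally show ?thesis .
      qed
      show ?case using elim 1[OF M T(1) T(2) igM, of n] 1[OF N L igN] unfolding dist_real_def by linarith
    qed
  qed
  then show "(\<lambda>n. integral\<^sup>L (distr M borel (T n)) (cts_step x y)) \<longlonglongrightarrow> integral\<^sup>L (distr N borel L) (cts_step x y)"
    by (simp only: integral_distr[OF T(1) cs_meas] integral_distr[OF L(1) cs_meas])
qed

subsection \<open>Trigonometric means of the standard normal distribution\<close>

lemma integrable_std_normal_power:
  "integrable std_normal_distribution (\<lambda>x. (1 + x\<^sup>2) ^ m)"
proof -
  have "(1 + x\<^sup>2) ^ m = (\<Sum>k\<le>m. real (m choose k) * x ^ (2 * k))" for x :: real
    using binomial_ring[of "x\<^sup>2" 1 m] by (simp add: power_mult add.commute)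
  then show ?thesis
    by (simp only:) (intro Bochner_Integration.integrable_sum integrable_mult_right integrable_std_normal_distribution_moment)
qed

lemma integrable_std_normal_poly_bound:
  fixes f :: "real \<Rightarrow> real"
  assumes "f \<in> borel_measurable borel" "\<And>x. \<bar>f x\<bar> \<le> C * (1 + x\<^sup>2) ^ m"
  shows "integrable std_normal_distribution f"
proof (rule Bochner_Integration.integrable_bound)
  show "integrable std_normal_distribution (\<lambda>x. C * (1 + x\<^sup>2) ^ m)"
    by (intro integrable_mult_right integrable_std_normal_power)
qed (use assms in \<open>auto intro!: AE_I2 order_trans[OF _ abs_ge_self]\<close>)

text \<open>Stein's identity: -(f * density) has derivative x f density - f' density, and its
  boundary values vanish because the Gaussian tail beats quadratic growth. Applied repeatedly, it
  yields the moments of x^k sin and x^k cos from the characteristic function without differentiating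
  under an integral.\<close>

lemma std_normal_stein:
  fixes f f' :: "real \<Rightarrow> real"
  assumes der: "\<And>x. (f has_real_derivative f' x) (at x)" and cont: "continuous_on UNIV f'"
    and f: "\<And>x. \<bar>f x\<bar> \<le> C * (1 + x\<^sup>2)" and f': "\<And>x. \<bar>f' x\<bar> \<le> C * (1 + x\<^sup>2)"
  shows "(\<integral>x. x * f x \<partial>std_normal_distribution) = (\<integral>x. f' x \<partial>std_normal_distribution)"
proof -
  have cf: "continuous_on UNIV f" using der by (meson DERIV_isCont continuous_at_imp_continuous_on)
  have [measurable]: "f \<in> borel_measurable borel" "f' \<in> borel_measurable borel"
    using cf cont by (auto intro: borel_measurable_continuous_onI)
  have C: "C \<ge> 0" using f[of 0] by simp
  have i': "integrable std_normal_distribution f'"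
    by (rule integrable_std_normal_poly_bound[where C=C and m=1]) (use f' in auto)
  have i: "integrable std_normal_distribution (\<lambda>x. x * f x)"
  proof (rule integrable_std_normal_poly_bound[where C=C and m=2])
    fix x :: real
    have "0 \<le> (\<bar>x\<bar> - 1)\<^sup>2" by simp
    then have x: "\<bar>x\<bar> \<le> 1 + x\<^sup>2" unfolding power2_diff by simp
    have "\<bar>x * f x\<bar> \<le> (1 + x\<^sup>2) * (C * (1 + x\<^sup>2))" unfolding abs_mult by (intro mult_mono x f) auto
    then show "\<bar>x * f x\<bar> \<le> C * (1 + x\<^sup>2)\<^sup>2" by (simp add: power2_eq_square mult_ac)
  qed simp
  let ?d = std_normal_density
  let ?g = "\<lambda>x. x * f x * ?d x - f' x * ?d x"
  have dd: "(?d has_real_derivative (- x * ?d x)) (at x)" for x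
    unfolding std_normal_density_def by (auto intro!: derivative_eq_intros simp: field_simps)
  have contd: "continuous_on UNIV ?d" using dd by (meson DERIV_isCont continuous_at_imp_continuous_on)
  have int: "integrable lborel ?g"
  proof (rule Bochner_Integration.integrable_diff)
    show "integrable lborel (\<lambda>x. x * f x * ?d x)" "integrable lborel (\<lambda>x. f' x * ?d x)"
      using i i' by (simp_all add: integrable_density mult.commute)
  qed
  have lim: "((\<lambda>x. - (f x * ?d x)) \<longlongrightarrow> 0) F"
    if "((\<lambda>x. C * (1 + x\<^sup>2) * ?d x) \<longlongrightarrow> 0) F" for F
    by (rule Lim_null_comparison[OF _ that])
       (use f in \<open>auto intro!: always_eventually simp: abs_mult intro!: mult_right_mono\<close>)
  have "(LBINT x=-\<infinity>..\<infinity>. ?g x) = 0 - 0"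
  proof (rule interval_integral_FTC_integrable[where F="\<lambda>x. - (f x * ?d x)"])
    fix x :: real
    show "((\<lambda>x. - (f x * ?d x)) has_vector_derivative ?g x) (at x)"
      unfolding has_real_derivative_iff_has_vector_derivative[symmetric]
      by (rule derivative_eq_intros der dd refl)+ (simp add: algebra_simps)
    show "isCont ?g x"
      using cf cont contd by (intro continuous_intros) (auto simp: continuous_on_eq_continuous_at)
  next
    show "set_integrable lborel (einterval (-\<infinity>) \<infinity>) ?g"
      using int by (simp add: set_integrable_def)
  next
    have "((\<lambda>x. C * (1 + x\<^sup>2) * ?d x) \<longlongrightarrow> 0) at_bot"
      unfolding std_normal_density_def by real_asymp
    then show "(((\<lambda>x. - (f x * ?d x)) \<circ> real_of_ereal) \<longlongrightarrow> 0) (at_right (-\<infinity>))"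
      unfolding ereal_tendsto_simps by (rule lim)
    have "((\<lambda>x. C * (1 + x\<^sup>2) * ?d x) \<longlongrightarrow> 0) at_top"
      unfolding std_normal_density_def by real_asymp
    then show "(((\<lambda>x. - (f x * ?d x)) \<circ> real_of_ereal) \<longlongrightarrow> 0) (at_left \<infinity>)"
      unfolding ereal_tendsto_simps by (rule lim)
  qed simp
  then have "(\<integral>x. ?g x \<partial>lborel) = 0"
    by (simp add: interval_lebesgue_integral_def set_lebesgue_integral_def)
  then have "(\<integral>x. x * f x * ?d x \<partial>lborel) = (\<integral>x. f' x * ?d x \<partial>lborel)"
    using i i' by (simp add: integrable_density mult.commute)
  then show ?thesis by (simp add: integral_density mult.commute)
qed

lemma phi1_simps: "phi1 0 = 1" "phi1 (- t) = phi1 t" "0 < phi1 t" "phi1 t \<le> 1"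
  by (auto simp: phi1_def)

lemma one_minus_phi1_le: "1 - phi1 t \<le> t\<^sup>2 / 2"
  using exp_ge_add_one_self[of "- (1/2) * t\<^sup>2"] by (simp add: phi1_def)

lemma phi1_measurable[measurable]: "phi1 \<in> borel_measurable borel"
  unfolding phi1_def by measurable

abbreviation "has_std_normal_mean \<equiv> has_bochner_integral std_normal_distribution"

lemma std_normal_cos: "has_std_normal_mean (\<lambda>x. cos (t * x)) (phi1 t)"
  and std_normal_sin: "has_std_normal_mean (\<lambda>x. sin (t * x)) 0"
proof -
  interpret real_distribution std_normal_distribution by (rule real_dist_normal_dist)
  have i: "integrable std_normal_distribution (\<lambda>x. iexp (t * x))"
    by (rule integrable_const_bound[of _ 1]) auto
  have e: "(\<integral>x. iexp (t * x) \<partial>std_normal_distribution) = complex_of_real (phi1 t)"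
    using fun_cong[OF char_std_normal_distribution, of t] unfolding char_def by (simp add: phi1_def)
  have "has_bochner_integral std_normal_distribution (\<lambda>x. iexp (t * x)) (complex_of_real (phi1 t))"
    using i e by (simp add: has_bochner_integral_iff)
  from has_bochner_integral_Re[OF this] has_bochner_integral_Im[OF this]
  show "has_std_normal_mean (\<lambda>x. cos (t * x)) (phi1 t)"
    "has_std_normal_mean (\<lambda>x. sin (t * x)) 0"
    by (simp_all add: Re_exp Im_exp)
qed

lemma abs_le_1_plus_square: "\<bar>x\<bar> \<le> 1 + x\<^sup>2" for x :: real
proof -
  have "0 \<le> (\<bar>x\<bar> - 1)\<^sup>2" by simp
  then show ?thesis unfolding power2_diff by simp
qed

lemma std_normal_x_sin: "has_std_normal_mean (\<lambda>x. x * sin (t * x)) (t * phi1 t)"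
  and std_normal_x_cos: "has_std_normal_mean (\<lambda>x. x * cos (t * x)) 0"
proof -
  have b: "1 \<le> 1 + x\<^sup>2" "\<bar>x * sin (t * x)\<bar> \<le> 1 + x\<^sup>2" "\<bar>x * cos (t * x)\<bar> \<le> 1 + x\<^sup>2" for x
    using abs_le_1_plus_square[of x] mult_left_le[of "\<bar>sin (t * x)\<bar>" "\<bar>x\<bar>"] mult_left_le[of "\<bar>cos (t * x)\<bar>" "\<bar>x\<bar>"]
    by (auto simp: abs_mult)
  have c: "1 \<le> (1 + \<bar>t\<bar>) * (1 + x\<^sup>2)" "\<bar>t\<bar> \<le> (1 + \<bar>t\<bar>) * (1 + x\<^sup>2)" for x :: real
    by (auto simp: algebra_simps)
  have d: "\<bar>t\<bar> * y \<le> \<bar>t\<bar>" if "y \<le> 1" for y using that mult_left_le[of y "\<bar>t\<bar>"] by simp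
  have "(\<integral>x. x * sin (t * x) \<partial>std_normal_distribution) = (\<integral>x. t * cos (t * x) \<partial>std_normal_distribution)"
    by (rule std_normal_stein[where C="1 + \<bar>t\<bar>"])
       (auto intro!: derivative_eq_intros continuous_intros order_trans[OF abs_sin_le_one c(1)] order_trans[OF d c(2)] simp: abs_mult)
  moreover have "integrable std_normal_distribution (\<lambda>x. x * sin (t * x))"
    by (rule integrable_std_normal_poly_bound[where C=1 and m=1]) (use b in auto)
  ultimately show "has_std_normal_mean (\<lambda>x. x * sin (t * x)) (t * phi1 t)"
    using std_normal_cos[of t] by (simp add: has_bochner_integral_iff)
  have "(\<integral>x. x * cos (t * x) \<partial>std_normal_distribution) = (\<integral>x. - t * sin (t * x) \<partial>std_normal_distribution)"
    by (rule std_normal_stein[where C="1 + \<bar>t\<bar>"])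
       (auto intro!: derivative_eq_intros continuous_intros order_trans[OF abs_cos_le_one c(1)] order_trans[OF d c(2)] simp: abs_mult)
  moreover have "integrable std_normal_distribution (\<lambda>x. x * cos (t * x))"
    by (rule integrable_std_normal_poly_bound[where C=1 and m=1]) (use b in auto)
  ultimately show "has_std_normal_mean (\<lambda>x. x * cos (t * x)) 0"
    using std_normal_sin[of t] by (simp add: has_bochner_integral_iff)
qed

lemma std_normal_x2_sin: "has_std_normal_mean (\<lambda>x. x\<^sup>2 * sin (t * x)) 0"
  and std_normal_x2_cos: "has_std_normal_mean (\<lambda>x. x\<^sup>2 * cos (t * x)) ((1 - t\<^sup>2) * phi1 t)"
proof -
  have b: "\<bar>x * sin (t * x)\<bar> \<le> 1 + x\<^sup>2" "\<bar>x * cos (t * x)\<bar> \<le> 1 + x\<^sup>2" for x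
    using abs_le_1_plus_square[of x] mult_left_le[of "\<bar>sin (t * x)\<bar>" "\<bar>x\<bar>"] mult_left_le[of "\<bar>cos (t * x)\<bar>" "\<bar>x\<bar>"]
    by (auto simp: abs_mult)
  have b2: "\<bar>x\<^sup>2 * sin (t * x)\<bar> \<le> 1 + x\<^sup>2" "\<bar>x\<^sup>2 * cos (t * x)\<bar> \<le> 1 + x\<^sup>2" for x
    using mult_left_le[of "\<bar>sin (t * x)\<bar>" "x\<^sup>2"] mult_left_le[of "\<bar>cos (t * x)\<bar>" "x\<^sup>2"]
    by (auto simp: abs_mult)
  have c0: "1 + x\<^sup>2 \<le> (1 + \<bar>t\<bar>) * (1 + x\<^sup>2)" for x :: real
    by (auto simp: algebra_simps)
  have c1: "\<bar>y + t * z\<bar> \<le> (1 + \<bar>t\<bar>) * (1 + x\<^sup>2)" if "\<bar>y\<bar> \<le> 1" "\<bar>z\<bar> \<le> 1 + x\<^sup>2" for x y z :: real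
  proof -
    have "\<bar>y + t * z\<bar> \<le> \<bar>y\<bar> + \<bar>t\<bar> * \<bar>z\<bar>" by (metis abs_mult abs_triangle_ineq)
    also have "\<dots> \<le> (1 + x\<^sup>2) + \<bar>t\<bar> * (1 + x\<^sup>2)" using that by (intro add_mono mult_left_mono) (auto intro: order_trans)
    finally show ?thesis by (simp add: algebra_simps)
  qed
  have ic: "integrable std_normal_distribution (\<lambda>x. x\<^sup>2 * cos (t * x))" and ins: "integrable std_normal_distribution (\<lambda>x. x\<^sup>2 * sin (t * x))"
    by (rule integrable_std_normal_poly_bound[where C=1 and m=1]; use b2 in auto)+
  have "(\<integral>x. x * (x * sin (t * x)) \<partial>std_normal_distribution) = (\<integral>x. sin (t * x) + t * (x * cos (t * x)) \<partial>std_normal_distribution)"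
    by (rule std_normal_stein[where C="1 + \<bar>t\<bar>"])
       (auto intro!: derivative_eq_intros continuous_intros order_trans[OF b(1) c0] c1 b(2))
  then show "has_std_normal_mean (\<lambda>x. x\<^sup>2 * sin (t * x)) 0"
    using std_normal_sin[of t] std_normal_x_cos[of t] ins
    by (simp add: has_bochner_integral_iff power2_eq_square mult.assoc)
  have c2: "\<bar>y - t * z\<bar> \<le> (1 + \<bar>t\<bar>) * (1 + x\<^sup>2)" if "\<bar>y\<bar> \<le> 1" "\<bar>z\<bar> \<le> 1 + x\<^sup>2" for x y z :: real
    using c1[of y "-z" x] that by simp
  have "(\<integral>x. x * (x * cos (t * x)) \<partial>std_normal_distribution) = (\<integral>x. cos (t * x) - t * (x * sin (t * x)) \<partial>std_normal_distribution)"
  proof (rule std_normal_stein[where C="1 + \<bar>t\<bar>"])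
    show "((\<lambda>x. x * cos (t * x)) has_real_derivative cos (t * x) - t * (x * sin (t * x))) (at x)" for x
      by (auto intro!: derivative_eq_intros)
    show "continuous_on UNIV (\<lambda>x. cos (t * x) - t * (x * sin (t * x)))" by (intro continuous_intros)
    show "\<bar>x * cos (t * x)\<bar> \<le> (1 + \<bar>t\<bar>) * (1 + x\<^sup>2)" for x by (rule order_trans[OF b(2) c0])
    show "\<bar>cos (t * x) - t * (x * sin (t * x))\<bar> \<le> (1 + \<bar>t\<bar>) * (1 + x\<^sup>2)" for x by (rule c2[OF abs_cos_le_one b(1)])
  qed
  then show "has_std_normal_mean (\<lambda>x. x\<^sup>2 * cos (t * x)) ((1 - t\<^sup>2) * phi1 t)"
    using std_normal_cos[of t] std_normal_x_sin[of t] ic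
    by (simp add: has_bochner_integral_iff power2_eq_square mult.assoc left_diff_distrib)
qed

lemma std_normal_moments:
  "has_std_normal_mean (\<lambda>x. 1::real) 1" "has_std_normal_mean (\<lambda>x. x) 0"
  "has_std_normal_mean (\<lambda>x. x\<^sup>2) 1" "has_std_normal_mean (\<lambda>x. x ^ 3) 0"
  "has_std_normal_mean (\<lambda>x. x ^ 4) 3"
proof -
  interpret real_distribution std_normal_distribution by (rule real_dist_normal_dist)
  show "has_std_normal_mean (\<lambda>x. 1::real) 1" using prob_space by (simp add: has_bochner_integral_iff lebesgue_integral_const)
  note i = integrable_std_normal_distribution_moment
  note o = integral_std_normal_distribution_moment_odd
  show "has_std_normal_mean (\<lambda>x. x) 0" using i[of 1] o[of 1] by (simp add: has_bochner_integral_iff)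
  show "has_std_normal_mean (\<lambda>x. x ^ 3) 0" using i[of 3] o[of 3] by (simp add: has_bochner_integral_iff)
  show "has_std_normal_mean (\<lambda>x. x\<^sup>2) 1" "has_std_normal_mean (\<lambda>x. x ^ 4) 3"
    using i[of 2] i[of 4] std_normal_distribution_even_moments(1)[of 1] std_normal_distribution_even_moments(1)[of 2]
    by (simp_all add: has_bochner_integral_iff fact_numeral)
qed

text \<open>The summand of the approximating statistic; \<open>c = 1\<close> in part (i) and \<open>c = 0\<close> in part (ii).\<close>

definition score :: "real \<Rightarrow> real \<Rightarrow> real \<Rightarrow> real" where
  "score c t x = sin (t * x) + cos (t * x) - phi1 t * (1 + c * t * x - t\<^sup>2 / 2 * (x\<^sup>2 - 1))"

definition score_cov :: "real \<Rightarrow> real \<Rightarrow> real \<Rightarrow> real" where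
  "score_cov c s t = exp (- (1/2) * (s - t)\<^sup>2) - ((1/2) * s\<^sup>2 * t\<^sup>2 + c * s * t + 1) * exp (- (1/2) * (s\<^sup>2 + t\<^sup>2))"

lemmas has_mean_intros = has_bochner_integral_add has_bochner_integral_diff has_bochner_integral_mult_right
  std_normal_cos std_normal_sin std_normal_x_cos std_normal_x_sin std_normal_x2_cos std_normal_x2_sin std_normal_moments

lemma score_mean: "has_std_normal_mean (score c t) 0"
proof -
  have "has_std_normal_mean (\<lambda>x. sin (t * x) + cos (t * x) - phi1 t * ((1 + t\<^sup>2/2) * 1 + c * t * x - t\<^sup>2 / 2 * x\<^sup>2))
     (0 + phi1 t - phi1 t * ((1 + t\<^sup>2/2) * 1 + c * t * 0 - t\<^sup>2 / 2 * 1))"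
    by (intro has_mean_intros)
  moreover have "(\<lambda>x. sin (t * x) + cos (t * x) - phi1 t * ((1 + t\<^sup>2/2) * 1 + c * t * x - t\<^sup>2 / 2 * x\<^sup>2)) = score c t"
    by (rule ext) (simp add: score_def field_simps)
  ultimately show ?thesis by simp
qed

text \<open>Write h_t(x) = sin(tx) + cos(tx). By the moments above, E[h_t] = phi1 t, E[h_t x] = t
  phi1 t and E[h_t (x^2 - 1)] = -t^2 phi1 t, while x^2 - 1 has variance 2. So the score is h_t minus
  its L2 projection onto the span of 1, x^2 - 1 and, for c = 1, x. Its covariance is therefore
  E[h_s h_t] = phi1 (s - t) minus the inner product of the two projections, phi1 s * phi1 t * (1 + c
  s t + s^2 t^2 / 2). The condition c^2 = c says that c selects whether the direction x is projected
  out.\<close>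

lemma score_covariance:
  assumes c: "c\<^sup>2 = c"
  shows "has_std_normal_mean (\<lambda>x. score c s x * score c t x) (score_cov c s t)"
proof -
  let ?q = "\<lambda>s t x. (1 + t\<^sup>2/2) * (sin (s * x) + cos (s * x)) + c * t * (x * sin (s * x) + x * cos (s * x))
      - t\<^sup>2 / 2 * (x\<^sup>2 * sin (s * x) + x\<^sup>2 * cos (s * x))"
  let ?qv = "\<lambda>s t. (1 + t\<^sup>2/2) * (0 + phi1 s) + c * t * (s * phi1 s + 0) - t\<^sup>2 / 2 * (0 + (1 - s\<^sup>2) * phi1 s)"
  let ?p = "\<lambda>x. (1 + s\<^sup>2/2) * (1 + t\<^sup>2/2) * 1 + ((1 + s\<^sup>2/2) * c * t + (1 + t\<^sup>2/2) * c * s) * x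
     + (c * c * s * t - (1 + s\<^sup>2/2) * t\<^sup>2/2 - (1 + t\<^sup>2/2) * s\<^sup>2/2) * x\<^sup>2
     - c * (s * t\<^sup>2/2 + t * s\<^sup>2/2) * x ^ 3 + s\<^sup>2 * t\<^sup>2 / 4 * x ^ 4"
  let ?pv = "(1 + s\<^sup>2/2) * (1 + t\<^sup>2/2) * 1 + ((1 + s\<^sup>2/2) * c * t + (1 + t\<^sup>2/2) * c * s) * 0
     + (c * c * s * t - (1 + s\<^sup>2/2) * t\<^sup>2/2 - (1 + t\<^sup>2/2) * s\<^sup>2/2) * 1
     - c * (s * t\<^sup>2/2 + t * s\<^sup>2/2) * 0 + s\<^sup>2 * t\<^sup>2 / 4 * 3"
  have "has_std_normal_mean (\<lambda>x. cos ((s - t) * x) + sin ((s + t) * x) - phi1 t * ?q s t x - phi1 s * ?q t s x + phi1 s * phi1 t * ?p x)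
     (phi1 (s - t) + 0 - phi1 t * ?qv s t - phi1 s * ?qv t s + phi1 s * phi1 t * ?pv)"
    by (intro has_mean_intros)
  moreover have "(\<lambda>x. cos ((s - t) * x) + sin ((s + t) * x) - phi1 t * ?q s t x - phi1 s * ?q t s x + phi1 s * phi1 t * ?p x)
      = (\<lambda>x. score c s x * score c t x)"
  proof
    fix x
    have "cos ((s - t) * x) + sin ((s + t) * x) = (sin (s * x) + cos (s * x)) * (sin (t * x) + cos (t * x))"
      by (simp add: left_diff_distrib distrib_right cos_diff sin_add algebra_simps)
    then show "cos ((s - t) * x) + sin ((s + t) * x) - phi1 t * ?q s t x - phi1 s * ?q t s x + phi1 s * phi1 t * ?p x
      = score c s x * score c t x"
    proof -
      let ?h = "\<lambda>s. sin (s * x) + cos (s * x)"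
      let ?w = "\<lambda>t. (1 + t\<^sup>2/2) * 1 + c * t * x - t\<^sup>2/2 * x\<^sup>2"
      have sc: "score c t x = ?h t - phi1 t * ?w t" for t
      proof -
        have "1 + c * t * x - t\<^sup>2 / 2 * (x\<^sup>2 - 1) = ?w t" by (simp add: field_simps)
        then show ?thesis unfolding score_def by (simp only:)
      qed
      have q: "?q s t x = ?h s * ?w t" for s t by (simp add: algebra_simps)
      have p: "?p x = ?w s * ?w t"
        by (simp add: field_simps power2_eq_square power3_eq_cube power4_eq_xxxx)
      assume h: "cos ((s - t) * x) + sin ((s + t) * x) = ?h s * ?h t"
      have ring: "hs * ht - ft * (hs * wt) - fs * (ht * ws) + fs * ft * (ws * wt) = (hs - fs * ws) * (ht - ft * wt)"
        for hs ht fs ft ws wt :: real by (simp add: algebra_simps)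
      show ?thesis unfolding sc q p h by (rule ring)
    qed
  qed
  moreover have "phi1 (s - t) + 0 - phi1 t * ?qv s t - phi1 s * ?qv t s + phi1 s * phi1 t * ?pv = score_cov c s t"
  proof -
    have cc: "c * c = c" using c by (simp add: power2_eq_square)
    have qv: "?qv s t = phi1 s * (1 + c * s * t + s\<^sup>2 * t\<^sup>2 / 2)" for s t by (simp add: algebra_simps)
    have pv: "?pv = 1 + c * s * t + s\<^sup>2 * t\<^sup>2 / 2" unfolding cc by (simp add: field_simps)
    have "exp (- (1/2) * (s\<^sup>2 + t\<^sup>2)) = phi1 s * phi1 t"
      by (simp add: phi1_def exp_add[symmetric] algebra_simps)
    then show ?thesis unfolding score_cov_def phi1_def[of "s - t", symmetric]
      unfolding qv pv by (simp add: algebra_simps)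
  qed
  ultimately show ?thesis by simp
qed

section \<open>Behaviour of the score near t = 0\<close>

lemma sin_cos_bounds:
  fixes y :: real
  shows "\<bar>sin y - y + cos y - 1\<bar> \<le> y\<^sup>2 + y\<^sup>2 / 2"
proof -
  have 1: "\<bar>sin y - y\<bar> \<le> y\<^sup>2"
  proof -
    have "\<bar>sin y - y\<bar> \<le> inverse (fact 2) * \<bar>y\<bar>\<^sup>2"
      using Maclaurin_sin_bound[of y 2] by (simp add: numeral_2_eq_2 sin_coeff_def)
    also have "inverse (fact 2) * \<bar>y\<bar>\<^sup>2 \<le> 1 * y\<^sup>2" by (simp del: mult_1)
    finally show ?thesis by simp
  qed
  have "1 - cos y = 2 * (sin (y/2))\<^sup>2" using cos_double_sin[of "y/2"] by simp
  moreover have "(sin (y/2))\<^sup>2 \<le> (y/2)\<^sup>2"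
    using abs_sin_x_le_abs_x[of "y/2"] by (simp only: abs_le_square_iff)
  ultimately have "\<bar>cos y - 1\<bar> \<le> y\<^sup>2/2" using cos_le_one[of y] by (simp add: power_divide)
  with 1 show ?thesis by linarith
qed

text \<open>sin y + cos y = 1 + y + O(y^2), and the constant cancels against \<open>phi1 t\<close>
  up to t^2 / 2. For c = 1 the linear part cancels too, leaving (1 - phi1 t) |t x|, which is at most
  t^2 |x|; for c = 0 the full |t x| remains. This difference is why only part (ii) is sensitive to
  the second moment of the weight.\<close>

lemma score_bound:
  assumes "c \<in> {0, 1}"
  shows "\<bar>score c t x\<bar> \<le> 3 * t\<^sup>2 * (1 + x\<^sup>2) + (1 - c) * \<bar>t * x\<bar>"
proof -
  have p: "0 < phi1 t" "phi1 t \<le> 1" "1 - phi1 t \<le> t\<^sup>2/2" using phi1_simps one_minus_phi1_le by auto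
  have pt: "(1 - phi1 t) * \<bar>t\<bar> \<le> t\<^sup>2"
  proof (cases "\<bar>t\<bar> \<le> 1")
    case True
    have "(1 - phi1 t) * \<bar>t\<bar> \<le> t\<^sup>2 * 1" using p True by (intro mult_mono) auto
    then show ?thesis by simp
  next
    case False
    have "(1 - phi1 t) * \<bar>t\<bar> \<le> \<bar>t\<bar> * \<bar>t\<bar>" using p False by (intro mult_right_mono) auto
    then show ?thesis by (simp add: power2_eq_square)
  qed
  have e: "score c t x = (sin (t*x) - t*x + cos (t*x) - 1) + (1 - phi1 t) + (1 - c * phi1 t) * (t * x) + phi1 t * (t\<^sup>2/2 * (x\<^sup>2 - 1))"
    unfolding score_def by (simp add: algebra_simps)
  have 1: "\<bar>sin (t*x) - t*x + cos (t*x) - 1\<bar> \<le> 3/2 * (t\<^sup>2 * x\<^sup>2)"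
    using sin_cos_bounds[of "t*x"] by (simp add: power_mult_distrib)
  have 2: "\<bar>phi1 t * (t\<^sup>2/2 * (x\<^sup>2 - 1))\<bar> \<le> 1 * (t\<^sup>2/2 * (x\<^sup>2 + 1))"
    unfolding abs_mult using p abs_triangle_ineq4[of "x\<^sup>2" 1] by (intro mult_mono) auto
  have 3: "\<bar>(1 - c * phi1 t) * (t * x)\<bar> \<le> (1 - c) * \<bar>t * x\<bar> + t\<^sup>2 * \<bar>x\<bar>"
  proof (cases "c = 0")
    case False
    then have "c = 1" using assms by simp
    then show ?thesis using mult_right_mono[OF pt, of "\<bar>x\<bar>"] p by (simp add: abs_mult mult.assoc)
  qed simp
  have 4: "t\<^sup>2 * \<bar>x\<bar> \<le> t\<^sup>2 * ((1 + x\<^sup>2) / 2)"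
  proof (rule mult_left_mono)
    have "0 \<le> (\<bar>x\<bar> - 1)\<^sup>2" by simp
    then show "\<bar>x\<bar> \<le> (1 + x\<^sup>2) / 2" unfolding power2_diff by simp
  qed simp
  have "\<bar>score c t x\<bar> \<le> 3/2 * (t\<^sup>2 * x\<^sup>2) + t\<^sup>2/2 + ((1 - c) * \<bar>t * x\<bar> + t\<^sup>2 * ((1 + x\<^sup>2) / 2)) + t\<^sup>2/2 * (x\<^sup>2 + 1)"
    unfolding e using 1 2 3 4 p by linarith
  also have "\<dots> \<le> 3 * t\<^sup>2 * (1 + x\<^sup>2) + (1 - c) * \<bar>t * x\<bar>"
  proof -
    have "0 \<le> t\<^sup>2 * x\<^sup>2" "0 \<le> t\<^sup>2" by auto
    moreover have "3/2 * B + A/2 + (d + (A + B)/2) + (B + A)/2 \<le> 3 * A + 3 * B + d" if "0 \<le> B" "0 \<le> A" for A B d :: real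
      using that by (simp add: field_simps)
    ultimately have "3/2 * (t\<^sup>2 * x\<^sup>2) + t\<^sup>2/2 + ((1 - c) * \<bar>t * x\<bar> + (t\<^sup>2 + t\<^sup>2 * x\<^sup>2)/2) + (t\<^sup>2 * x\<^sup>2 + t\<^sup>2)/2
       \<le> 3 * t\<^sup>2 + 3 * (t\<^sup>2 * x\<^sup>2) + (1 - c) * \<bar>t * x\<bar>" by blast
    then show ?thesis by (simp add: distrib_left distrib_right)
  qed
  finally show ?thesis .
qed

subsection \<open>Lindeberg replacement for square norms of random fields\<close>

text \<open>The argument is a squared norm, so q * sqrt q is the cube of the norm. The minimum with
  q keeps the expectation finite when only second moments exist, as in Lindeberg's
  condition.\<close>

definition cubic_remainder :: "real \<Rightarrow> real" where
  "cubic_remainder q = min q (q * sqrt q)"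

lemma cubic_remainder_nonneg: "0 \<le> q \<Longrightarrow> 0 \<le> cubic_remainder q"
  by (simp add: cubic_remainder_def)

lemma cubic_remainder_le: "cubic_remainder q \<le> q"
  by (simp add: cubic_remainder_def)

lemma cubic_remainder_measurable[measurable]: "cubic_remainder \<in> borel_measurable borel"
  unfolding cubic_remainder_def by measurable

lemma mult_exp_neg_le:
  fixes p :: real assumes "0 \<le> p"
  shows "p * exp (-p) \<le> 1" "p\<^sup>2 * exp (-p) \<le> 2" "sqrt p * exp (-p) \<le> 2" "p * sqrt p * exp (-p) \<le> 3"
proof -
  have e1: "1 + p + p\<^sup>2 / 2 \<le> exp p" by (rule exp_lower_Taylor_quadratic[OF assms])
  then have a: "p \<le> exp p" "p\<^sup>2 \<le> 2 * exp p" using assms by (auto simp: algebra_simps intro: order_trans[OF _ e1])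
  have *: "x * exp (-p) \<le> c" if "x \<le> c * exp p" for x c
    using mult_right_mono[OF that, of "exp (-p)"] by (simp add: mult.assoc exp_minus_inverse)
  show 1: "p * exp (-p) \<le> 1" by (rule *) (use a in simp)
  show 2: "p\<^sup>2 * exp (-p) \<le> 2" by (rule *) (use a in simp)
  have "0 \<le> (sqrt p - 1)\<^sup>2" by simp
  then have s: "sqrt p \<le> 1 + p" unfolding power2_diff using assms by simp
  show "sqrt p * exp (-p) \<le> 2"
    by (rule *) (use s a e1 assms zero_le_power2[of p] exp_gt_zero[of p] in linarith)
  have "p * sqrt p \<le> p * (1 + p)" using s assms by (intro mult_left_mono)
  also have "\<dots> = p + p\<^sup>2" by (simp add: power2_eq_square algebra_simps)
  also have "\<dots> \<le> 3 * exp p" using a by simp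
  finally show "p * sqrt p * exp (-p) \<le> 3" by (rule *)
qed

text \<open>P, B and Q stand for the squared norm of u, the pairing of u with a, and the squared
  norm of a; the proof expands exp(-p r) along r in [0, 1], where p r is the squared norm of u + r
  a. The identity p'^2 = 4 (B^2 - P Q) + 4 Q p and Cauchy-Schwarz give p'^2 \<le> 4 Q p, so every
  power of p' produced by differentiation is absorbed by exp(-p). The derivatives are thus bounded
  by powers of Q alone, uniformly in P.\<close>

lemma exp_neg_quadratic_taylor:
  fixes P Q B :: real
  assumes "0 \<le> P" "0 \<le> Q" "B\<^sup>2 \<le> P * Q"
  shows "\<bar>exp (- (P + 2 * B + Q)) - exp (- P) * (1 - 2 * B - Q + 2 * B\<^sup>2)\<bar> \<le> 8 * cubic_remainder Q"
proof -
  define p where "p r = P + 2 * B * r + Q * r\<^sup>2" for r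
  define p' where "p' r = 2 * B + 2 * Q * r" for r
  define d where "d m r = (if m = 0 then exp (- p r) else if m = 1 then - p' r * exp (- p r)
     else if m = 2 then ((p' r)\<^sup>2 - 2 * Q) * exp (- p r)
     else (6 * Q * p' r - (p' r)^3) * exp (- p r))" for m :: nat and r
  have p_nn: "0 \<le> p r" and p'_le: "(p' r)\<^sup>2 \<le> 4 * Q * p r" for r
  proof -
    have "(p' r)\<^sup>2 = 4 * (B\<^sup>2 - P * Q) + 4 * Q * p r" by (simp add: p'_def p_def power2_eq_square algebra_simps)
    then show *: "(p' r)\<^sup>2 \<le> 4 * Q * p r" using assms by simp
    show "0 \<le> p r"
    proof (cases "Q = 0")
      case True then have "B = 0" using assms by simp
      then show ?thesis using assms True by (simp add: p_def)
    next
      case False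
      then have "Q > 0" using assms by simp
      moreover have "0 \<le> 4 * Q * p r" using * zero_le_power2[of "p' r"] by linarith
      ultimately show ?thesis by (simp add: zero_le_mult_iff)
    qed
  qed
  have dp: "(p has_real_derivative p' r) (at r)" for r
    unfolding p_def[abs_def] p'_def by (auto intro!: derivative_eq_intros)
  have dp': "(p' has_real_derivative 2 * Q) (at r)" for r
    unfolding p'_def[abs_def] by (auto intro!: derivative_eq_intros)
  have der: "DERIV (d m) t :> d (Suc m) t" if m3: "m < 3" for m t
  proof -
    consider "m = 0" | "m = 1" | "m = 2" using m3 by linarith
    then show ?thesis
    proof cases
      case 1 show ?thesis unfolding 1 d_def[abs_def]
        by (auto intro!: derivative_eq_intros dp)
    next
      case 2 show ?thesis unfolding 2 d_def[abs_def]
        by (auto intro!: derivative_eq_intros dp dp' simp: power2_eq_square algebra_simps)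
    next
      case 3 show ?thesis unfolding 3 d_def[abs_def]
        by (auto intro!: derivative_eq_intros dp dp' simp: power2_eq_square power3_eq_cube algebra_simps)
    qed
  qed
  have l: "exp (- (P + 2 * B + Q)) = d 0 1" by (simp add: d_def p_def)
  have z: "d 0 0 = exp (-P)" "d 1 0 = - 2 * B * exp (-P)" "d 2 0 = (4 * B\<^sup>2 - 2 * Q) * exp (-P)"
    by (simp_all add: d_def p_def p'_def power2_eq_square)
  have d2: "\<bar>d 2 t\<bar> \<le> 6 * Q" for t
  proof -
    have "(p' t)\<^sup>2 * exp (- p t) \<le> 4 * Q * (p t * exp (- p t))"
      using p'_le[of t] by (simp add: mult.assoc[symmetric] mult_right_mono)
    also have "\<dots> \<le> 4 * Q * 1" using assms mult_exp_neg_le(1)[OF p_nn] by (intro mult_left_mono) auto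
    finally have a: "(p' t)\<^sup>2 * exp (- p t) \<le> 4 * Q" by simp
    have b: "2 * Q * exp (- p t) \<le> 2 * Q * 1" using assms p_nn[of t] by (intro mult_left_mono) auto
    have "0 \<le> (p' t)\<^sup>2 * exp (- p t)" "0 \<le> 2 * Q * exp (- p t)" using assms by auto
    moreover have "d 2 t = (p' t)\<^sup>2 * exp (- p t) - 2 * Q * exp (- p t)" by (simp add: d_def left_diff_distrib)
    ultimately show ?thesis using a b assms by linarith
  qed
  have d3: "\<bar>d 3 t\<bar> \<le> 36 * (Q * sqrt Q) + 12 * (Q * sqrt Q)" for t
  proof -
    have ap: "\<bar>p' t\<bar> \<le> 2 * sqrt Q * sqrt (p t)"
    proof -
      have "\<bar>p' t\<bar> = sqrt ((p' t)\<^sup>2)" by simp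
      also have "\<dots> \<le> sqrt (4 * Q * p t)" using p'_le by (rule real_sqrt_le_mono)
      finally show ?thesis by (simp add: real_sqrt_mult)
    qed
    have 1: "\<bar>6 * Q * p' t * exp (- p t)\<bar> \<le> 6 * Q * (2 * sqrt Q) * 2"
    proof -
      have "\<bar>6 * Q * p' t * exp (- p t)\<bar> = 6 * Q * \<bar>p' t\<bar> * exp (- p t)" using assms by (simp add: abs_mult)
      also have "\<dots> \<le> 6 * Q * (2 * sqrt Q * sqrt (p t)) * exp (- p t)"
        using ap assms by (intro mult_right_mono mult_left_mono) auto
      also have "\<dots> = 6 * Q * (2 * sqrt Q) * (sqrt (p t) * exp (- p t))" by simp
      also have "\<dots> \<le> 6 * Q * (2 * sqrt Q) * 2" using assms p_nn by (intro mult_left_mono mult_exp_neg_le) auto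
      finally show ?thesis .
    qed
    have 2: "\<bar>(p' t)^3 * exp (- p t)\<bar> \<le> 8 * (Q * sqrt Q) * 3"
    proof -
      have "\<bar>(p' t)^3 * exp (- p t)\<bar> = (p' t)\<^sup>2 * \<bar>p' t\<bar> * exp (- p t)" by (simp add: abs_mult power3_eq_cube power2_eq_square)
      also have "\<dots> \<le> (4 * Q * p t) * (2 * sqrt Q * sqrt (p t)) * exp (- p t)"
        using ap p'_le assms p_nn[of t] by (intro mult_right_mono mult_mono) auto
      also have "\<dots> = 8 * (Q * sqrt Q) * (p t * sqrt (p t) * exp (- p t))" by simp
      also have "\<dots> \<le> 8 * (Q * sqrt Q) * 3" using assms p_nn by (intro mult_left_mono mult_exp_neg_le) auto
      finally show ?thesis .
    qed
    have "d 3 t = 6 * Q * p' t * exp (- p t) - (p' t)^3 * exp (- p t)" by (simp add: d_def left_diff_distrib)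
    then show ?thesis using 1 2 by simp
  qed
  \<comment> \<open>The same difference is estimated twice. At order two it equals (d 2 t - d 2 0) /
    2, hence at most 6 Q; at order three it equals d 3 t' / 6, hence at most (36 + 12) / 6 = 8 times
    Q * sqrt Q.\<close>
  obtain t where t: "d 0 1 = (\<Sum>m<2. d m 0 / fact m * 1 ^ m) + d 2 t / fact 2 * 1 ^ 2"
    using Maclaurin[of 1 2 d "d 0"] der by force
  obtain t' where t': "d 0 1 = (\<Sum>m<3. d m 0 / fact m * 1 ^ m) + d 3 t' / fact 3 * 1 ^ 3"
    using Maclaurin[of 1 3 d "d 0"] der by force
  have "d 0 1 - exp (- P) * (1 - 2 * B - Q + 2 * B\<^sup>2) = d 2 t / 2 - d 2 0 / 2"
    using t z by (simp add: numeral_2_eq_2 field_simps)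
  then have 1: "\<bar>d 0 1 - exp (- P) * (1 - 2 * B - Q + 2 * B\<^sup>2)\<bar> \<le> 6 * Q" using d2[of t] d2[of 0] by simp
  have "d 0 1 - exp (- P) * (1 - 2 * B - Q + 2 * B\<^sup>2) = d 3 t' / 6"
    using t' z by (simp add: eval_nat_numeral field_simps)
  then have 2: "\<bar>d 0 1 - exp (- P) * (1 - 2 * B - Q + 2 * B\<^sup>2)\<bar> \<le> 8 * (Q * sqrt Q)" using d3[of t'] by simp
  show ?thesis unfolding l cubic_remainder_def using 1 2 assms by (simp add: min_def)
qed

lemma square_sum_bound: "\<bar>x * y\<bar> \<le> x\<^sup>2 + y\<^sup>2" for x y :: real
proof -
  have "0 \<le> (\<bar>x\<bar> - \<bar>y\<bar>)\<^sup>2" by simp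
  then have "2 * (\<bar>x\<bar> * \<bar>y\<bar>) \<le> x\<^sup>2 + y\<^sup>2" unfolding power2_diff by (simp add: mult.assoc)
  moreover have "0 \<le> \<bar>x\<bar> * \<bar>y\<bar>" by simp
  ultimately show ?thesis unfolding abs_mult by linarith
qed

section \<open>Square integrable random fields\<close>

lemma Cauchy_Schwarz_integral_square:
  fixes f g :: "'t \<Rightarrow> real"
  assumes "f \<in> borel_measurable \<nu>" "g \<in> borel_measurable \<nu>"
    and f2: "integrable \<nu> (\<lambda>t. (f t)\<^sup>2)" and g2: "integrable \<nu> (\<lambda>t. (g t)\<^sup>2)"
  shows "integrable \<nu> (\<lambda>t. f t * g t)"
    and "(\<integral>t. f t * g t \<partial>\<nu>)\<^sup>2 \<le> (\<integral>t. (f t)\<^sup>2 \<partial>\<nu>) * (\<integral>t. (g t)\<^sup>2 \<partial>\<nu>)"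
proof -
  show i: "integrable \<nu> (\<lambda>t. f t * g t)"
    by (rule Bochner_Integration.integrable_bound[OF Bochner_Integration.integrable_add[OF f2 g2]])
       (use assms square_sum_bound in \<open>auto intro!: AE_I2 simp: abs_mult[symmetric]\<close>)
  define P B Q where "P = (\<integral>t. (f t)\<^sup>2 \<partial>\<nu>)" and "B = (\<integral>t. f t * g t \<partial>\<nu>)" and "Q = (\<integral>t. (g t)\<^sup>2 \<partial>\<nu>)"
  have q: "0 \<le> P - 2 * r * B + r\<^sup>2 * Q" for r
  proof -
    have "0 \<le> (\<integral>t. (f t - r * g t)\<^sup>2 \<partial>\<nu>)" by simp
    also have "(\<lambda>t. (f t - r * g t)\<^sup>2) = (\<lambda>t. (f t)\<^sup>2 - 2 * r * (f t * g t) + r\<^sup>2 * (g t)\<^sup>2)"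
      by (simp add: power2_eq_square algebra_simps)
    also have "(\<integral>t. (f t)\<^sup>2 - 2 * r * (f t * g t) + r\<^sup>2 * (g t)\<^sup>2 \<partial>\<nu>) = P - 2 * r * B + r\<^sup>2 * Q"
      unfolding P_def B_def Q_def using i f2 g2 by simp
    finally show ?thesis .
  qed
  have P: "0 \<le> P" and Q: "0 \<le> Q" by (simp_all add: P_def Q_def)
  have "B\<^sup>2 \<le> P * Q"
  proof (cases "Q = 0")
    case True
    have "B = 0"
    proof (rule ccontr)
      assume "B \<noteq> 0"
      \<comment> \<open>With Q = 0 this choice of r makes the nonnegative quadratic equal to
        -1.\<close>
      then show False using q[of "(P + 1) / (2 * B)"] True by simp
    qed
    then show ?thesis using P Q by simp
  next
    case False
    then have "Q > 0" using Q by simp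
    moreover have "0 \<le> P - 2 * (B / Q) * B + (B / Q)\<^sup>2 * Q" by (rule q)
    ultimately show ?thesis by (simp add: field_simps power2_eq_square)
  qed
  then show "(\<integral>t. f t * g t \<partial>\<nu>)\<^sup>2 \<le> (\<integral>t. (f t)\<^sup>2 \<partial>\<nu>) * (\<integral>t. (g t)\<^sup>2 \<partial>\<nu>)" by (simp add: P_def B_def Q_def)
qed

text \<open>The last clause asks for every t, whereas Fubini would give almost every t; the
  covariance kernel can then be used pointwise in its arguments.\<close>

definition square_field :: "'y measure \<Rightarrow> 't measure \<Rightarrow> ('y \<Rightarrow> 't \<Rightarrow> real) \<Rightarrow> bool" where
  "square_field S \<nu> a \<longleftrightarrow> (\<lambda>(y, t). a y t) \<in> borel_measurable (S \<Otimes>\<^sub>M \<nu>) \<and>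
     integrable (S \<Otimes>\<^sub>M \<nu>) (\<lambda>(y, t). (a y t)\<^sup>2) \<and> (\<forall>t\<in>space \<nu>. integrable S (\<lambda>y. (a y t)\<^sup>2))"

lemma square_field_scale: "square_field S \<nu> a \<Longrightarrow> square_field S \<nu> (\<lambda>y t. c * a y t)"
  unfolding square_field_def
  by (auto simp: power_mult_distrib case_prod_beta' intro!: borel_measurable_times)

locale field_pair = S: prob_space S + \<nu>: sigma_finite_measure \<nu>
  for S :: "'y measure" and \<nu> :: "'t measure"
begin

sublocale pair_sigma_finite S \<nu> ..

lemma integrable_product:
  fixes f :: "'y \<Rightarrow> real" and g :: "'t \<Rightarrow> real"
  assumes f: "integrable S f" and g: "integrable \<nu> g"
  shows "integrable (S \<Otimes>\<^sub>M \<nu>) (\<lambda>(y, t). f y * g t)"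
proof (rule Fubini_integrable)
  have [measurable]: "f \<in> borel_measurable S" "g \<in> borel_measurable \<nu>" using f g by auto
  show "(\<lambda>(y, t). f y * g t) \<in> borel_measurable (S \<Otimes>\<^sub>M \<nu>)" by measurable
  show "integrable S (\<lambda>x. \<integral>y. norm (case (x, y) of (y, t) \<Rightarrow> f y * g t) \<partial>\<nu>)"
    using f by (simp add: abs_mult)
  show "AE x in S. integrable \<nu> (\<lambda>y. case (x, y) of (y, t) \<Rightarrow> f y * g t)" using g by simp
qed

context
  fixes a :: "'y \<Rightarrow> 't \<Rightarrow> real"
  assumes a: "square_field S \<nu> a"
begin

lemma field_meas[measurable]: "(\<lambda>(y, t). a y t) \<in> borel_measurable (S \<Otimes>\<^sub>M \<nu>)"
  using a by (simp add: square_field_def)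

lemma field_path_meas[measurable]: "y \<in> space S \<Longrightarrow> a y \<in> borel_measurable \<nu>"
  using measurable_compose[OF measurable_Pair1' field_meas, of y] by simp

lemma field_path_square: "AE y in S. integrable \<nu> (\<lambda>t. (a y t)\<^sup>2)"
  using AE_integrable_fst[of "\<lambda>y t. (a y t)\<^sup>2"] a by (simp add: square_field_def)

lemma field_norm_integrable: "integrable S (\<lambda>y. \<integral>t. (a y t)\<^sup>2 \<partial>\<nu>)"
  using integrable_fst[of "\<lambda>y t. (a y t)\<^sup>2"] a by (simp add: square_field_def)

lemma field_norm_mean: "(\<integral>y. \<integral>t. (a y t)\<^sup>2 \<partial>\<nu> \<partial>S) = (\<integral>t. \<integral>y. (a y t)\<^sup>2 \<partial>S \<partial>\<nu>)"
  using Fubini_integral[of "\<lambda>y t. (a y t)\<^sup>2"] a by (simp add: square_field_def)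

context
  fixes u :: "'t \<Rightarrow> real"
  assumes u[measurable]: "u \<in> borel_measurable \<nu>" and u2: "integrable \<nu> (\<lambda>t. (u t)\<^sup>2)"
begin

lemma field_pairing_square_le:
  "AE y in S. (\<integral>t. u t * a y t \<partial>\<nu>)\<^sup>2 \<le> (\<integral>t. (u t)\<^sup>2 \<partial>\<nu>) * (\<integral>t. (a y t)\<^sup>2 \<partial>\<nu>)"
  using field_path_square AE_space
proof eventually_elim
  case (elim y)
  then show ?case by (intro Cauchy_Schwarz_integral_square u u2) auto
qed

lemma field_pairing_integrable:
  "integrable S (\<lambda>y. (\<integral>t. u t * a y t \<partial>\<nu>)\<^sup>2)" "integrable S (\<lambda>y. \<integral>t. u t * a y t \<partial>\<nu>)"
proof -
  show 1: "integrable S (\<lambda>y. (\<integral>t. u t * a y t \<partial>\<nu>)\<^sup>2)"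
  proof (rule Bochner_Integration.integrable_bound)
    show "integrable S (\<lambda>y. (\<integral>t. (u t)\<^sup>2 \<partial>\<nu>) * (\<integral>t. (a y t)\<^sup>2 \<partial>\<nu>))"
      using field_norm_integrable by simp
    show "AE y in S. norm ((\<integral>t. u t * a y t \<partial>\<nu>)\<^sup>2) \<le> norm ((\<integral>t. (u t)\<^sup>2 \<partial>\<nu>) * (\<integral>t. (a y t)\<^sup>2 \<partial>\<nu>))"
      using field_pairing_square_le by eventually_elim simp
  qed simp
  show "integrable S (\<lambda>y. \<integral>t. u t * a y t \<partial>\<nu>)"
    by (rule S.square_integrable_imp_integrable[OF _ 1]) simp
qed

lemma field_pairing_mean: "(\<integral>y. \<integral>t. u t * a y t \<partial>\<nu> \<partial>S) = (\<integral>t. u t * (\<integral>y. a y t \<partial>S) \<partial>\<nu>)"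
proof -
  have "integrable (S \<Otimes>\<^sub>M \<nu>) (\<lambda>(y, t). u t * a y t)"
  proof (rule Bochner_Integration.integrable_bound)
    show "integrable (S \<Otimes>\<^sub>M \<nu>) (\<lambda>z. (\<lambda>(y, t). 1 * (u t)\<^sup>2) z + (\<lambda>(y, t). (a y t)\<^sup>2) z)"
      using a by (intro Bochner_Integration.integrable_add integrable_product u2) (auto simp: square_field_def)
  qed (auto intro!: AE_I2 simp: square_sum_bound)
  from Fubini_integral[OF this] show ?thesis by simp
qed

text \<open>Expresses the second order term of the expansion through the covariance kernel alone.
  Fubini is applied twice: one pairing is first kept as a random variable, and is then opened for
  each fixed s.\<close>

lemma field_pairing_second_moment:
  "(\<integral>y. (\<integral>t. u t * a y t \<partial>\<nu>)\<^sup>2 \<partial>S) = (\<integral>s. \<integral>t. u s * u t * (\<integral>y. a y s * a y t \<partial>S) \<partial>\<nu> \<partial>\<nu>)"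
proof -
  let ?B = "\<lambda>y. \<integral>t. u t * a y t \<partial>\<nu>"
  have "integrable (S \<Otimes>\<^sub>M \<nu>) (\<lambda>(y, s). u s * a y s * ?B y)"
  proof (rule Bochner_Integration.integrable_bound)
    show "integrable (S \<Otimes>\<^sub>M \<nu>) (\<lambda>z. (\<lambda>(y, s). (?B y)\<^sup>2 * (u s)\<^sup>2) z + (\<lambda>(y, s). (a y s)\<^sup>2) z)"
      using a by (intro Bochner_Integration.integrable_add integrable_product u2 field_pairing_integrable) (auto simp: square_field_def)
    show "AE z in S \<Otimes>\<^sub>M \<nu>. norm (case z of (y, s) \<Rightarrow> u s * a y s * ?B y) \<le>
      norm ((\<lambda>(y, s). (?B y)\<^sup>2 * (u s)\<^sup>2) z + (\<lambda>(y, s). (a y s)\<^sup>2) z)"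
    proof (intro AE_I2, clarsimp)
      fix y s
      show "\<bar>u s * a y s * ?B y\<bar> \<le> (?B y)\<^sup>2 * (u s)\<^sup>2 + (a y s)\<^sup>2"
        using square_sum_bound[of "?B y * u s" "a y s"] by (simp add: power_mult_distrib mult_ac)
    qed
  qed simp
  from Fubini_integral[OF this]
  have "(\<integral>y. (?B y)\<^sup>2 \<partial>S) = (\<integral>s. \<integral>y. u s * a y s * ?B y \<partial>S \<partial>\<nu>)"
    by (simp add: power2_eq_square)
  also have "\<dots> = (\<integral>s. \<integral>t. u s * u t * (\<integral>y. a y s * a y t \<partial>S) \<partial>\<nu> \<partial>\<nu>)"
  proof (rule Bochner_Integration.integral_cong[OF refl])
    fix s assume s: "s \<in> space \<nu>"
    have [measurable]: "(\<lambda>y. a y s) \<in> borel_measurable S" using s by simp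
    have "integrable (S \<Otimes>\<^sub>M \<nu>) (\<lambda>(y, t). u s * a y s * (u t * a y t))"
    proof (rule Bochner_Integration.integrable_bound)
      show "integrable (S \<Otimes>\<^sub>M \<nu>) (\<lambda>z. (\<lambda>(y, t). ((u s)\<^sup>2 * (a y s)\<^sup>2) * (u t)\<^sup>2) z + (\<lambda>(y, s). (a y s)\<^sup>2) z)"
        using a s by (intro Bochner_Integration.integrable_add integrable_product u2 integrable_mult_right) (auto simp: square_field_def)
      show "AE z in S \<Otimes>\<^sub>M \<nu>. norm (case z of (y, t) \<Rightarrow> u s * a y s * (u t * a y t)) \<le>
        norm ((\<lambda>(y, t). ((u s)\<^sup>2 * (a y s)\<^sup>2) * (u t)\<^sup>2) z + (\<lambda>(y, s). (a y s)\<^sup>2) z)"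
      proof (intro AE_I2, clarsimp)
        fix y t
        show "\<bar>u s * a y s * (u t * a y t)\<bar> \<le> (u s)\<^sup>2 * (a y s)\<^sup>2 * (u t)\<^sup>2 + (a y t)\<^sup>2"
          using square_sum_bound[of "u s * a y s * u t" "a y t"] by (simp add: power_mult_distrib mult_ac)
      qed
    qed simp
    from Fubini_integral[OF this]
    have "(\<integral>y. u s * a y s * ?B y \<partial>S) = (\<integral>t. \<integral>y. u s * a y s * (u t * a y t) \<partial>S \<partial>\<nu>)" by simp
    also have "\<dots> = (\<integral>t. u s * u t * (\<integral>y. a y s * a y t \<partial>S) \<partial>\<nu>)"
      by (intro Bochner_Integration.integral_cong refl)
         (simp add: mult_ac flip: Bochner_Integration.integral_mult_right_zero)
    finally show "(\<integral>y. u s * a y s * ?B y \<partial>S) = (\<integral>t. u s * u t * (\<integral>y. a y s * a y t \<partial>S) \<partial>\<nu>)" .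
  qed
  finally show ?thesis .
qed

text \<open>The Taylor formula taken in expectation. Apart from the remainder, the right-hand side
  depends on \<open>a\<close> only through its mean function and covariance kernel, so two fields
  sharing these are interchangeable up to their remainders.\<close>

lemma field_perturbation:
  "\<bar>(\<integral>y. exp (- (\<integral>t. (u t + a y t)\<^sup>2 \<partial>\<nu>)) \<partial>S) - exp (- (\<integral>t. (u t)\<^sup>2 \<partial>\<nu>)) *
     (1 - 2 * (\<integral>t. u t * (\<integral>y. a y t \<partial>S) \<partial>\<nu>) - (\<integral>t. \<integral>y. (a y t)\<^sup>2 \<partial>S \<partial>\<nu>)
        + 2 * (\<integral>s. \<integral>t. u s * u t * (\<integral>y. a y s * a y t \<partial>S) \<partial>\<nu> \<partial>\<nu>))\<bar>
   \<le> 8 * (\<integral>y. cubic_remainder (\<integral>t. (a y t)\<^sup>2 \<partial>\<nu>) \<partial>S)"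
proof -
  define P where "P = (\<integral>t. (u t)\<^sup>2 \<partial>\<nu>)"
  define B where "B y = (\<integral>t. u t * a y t \<partial>\<nu>)" for y
  define Q where "Q y = (\<integral>t. (a y t)\<^sup>2 \<partial>\<nu>)" for y
  have iB: "integrable S B" "integrable S (\<lambda>y. (B y)\<^sup>2)" and iQ: "integrable S Q"
    using field_pairing_integrable field_norm_integrable by (simp_all add: B_def[abs_def] Q_def[abs_def])
  define F where "F y = exp (- (\<integral>t. (u t + a y t)\<^sup>2 \<partial>\<nu>))" for y
  have [measurable]: "F \<in> borel_measurable S" unfolding F_def by measurable
  have iF: "integrable S F"
    by (rule S.integrable_const_bound[of _ 1]) (auto simp: F_def intro!: AE_I2)
  define A where "A y = exp (- P) * (1 - 2 * B y - Q y + 2 * (B y)\<^sup>2)" for y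
  have iA: "integrable S A" unfolding A_def using iB iQ by simp
  have iR: "integrable S (\<lambda>y. cubic_remainder (Q y))"
    by (rule Bochner_Integration.integrable_bound[OF iQ])
       (use iQ in \<open>auto intro!: AE_I2 simp: Q_def cubic_remainder_nonneg cubic_remainder_le\<close>)
  have "AE y in S. \<bar>F y - A y\<bar> \<le> 8 * cubic_remainder (Q y)"
    using field_path_square AE_space
  proof eventually_elim
    case (elim y)
    have ay[measurable]: "a y \<in> borel_measurable \<nu>" using elim by simp
    note cs = Cauchy_Schwarz_integral_square[OF u ay u2 elim(1)]
    have "(\<integral>t. (u t + a y t)\<^sup>2 \<partial>\<nu>) = (\<integral>t. (u t)\<^sup>2 + 2 * (u t * a y t) + (a y t)\<^sup>2 \<partial>\<nu>)"
      by (simp add: power2_sum algebra_simps)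
    also have "\<dots> = P + 2 * B y + Q y" using u2 cs(1) elim(1) by (simp add: P_def B_def Q_def)
    finally show ?case unfolding F_def A_def
      using exp_neg_quadratic_taylor[of P "Q y" "B y"] cs(2) by (simp add: P_def B_def Q_def)
  qed
  then have "(\<integral>y. \<bar>F y - A y\<bar> \<partial>S) \<le> (\<integral>y. 8 * cubic_remainder (Q y) \<partial>S)"
    using iF iA iR by (intro integral_mono_AE) auto
  moreover have "\<bar>(\<integral>y. F y \<partial>S) - (\<integral>y. A y \<partial>S)\<bar> \<le> (\<integral>y. \<bar>F y - A y\<bar> \<partial>S)"
    using integral_abs_bound[of S "\<lambda>y. F y - A y"] iF iA by simp
  moreover have "(\<integral>y. A y \<partial>S) = exp (- P) * (1 - 2 * (\<integral>y. B y \<partial>S) - (\<integral>y. Q y \<partial>S) + 2 * (\<integral>y. (B y)\<^sup>2 \<partial>S))"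
    unfolding A_def using iB iQ by (simp add: S.prob_space)
  ultimately show ?thesis
    unfolding F_def P_def B_def Q_def field_pairing_mean field_pairing_second_moment field_norm_mean by simp
qed

end
end

lemma field_swap:
  assumes a: "square_field S \<nu> a" and b: "square_field S \<nu> b"
    and mean: "\<And>t. t \<in> space \<nu> \<Longrightarrow> (\<integral>y. a y t \<partial>S) = (\<integral>y. b y t \<partial>S)"
    and cov: "\<And>s t. s \<in> space \<nu> \<Longrightarrow> t \<in> space \<nu> \<Longrightarrow> (\<integral>y. a y s * a y t \<partial>S) = (\<integral>y. b y s * b y t \<partial>S)"
    and u: "u \<in> borel_measurable \<nu>" "integrable \<nu> (\<lambda>t. (u t)\<^sup>2)"
  shows "\<bar>(\<integral>y. exp (- (\<integral>t. (u t + a y t)\<^sup>2 \<partial>\<nu>)) \<partial>S) - (\<integral>y. exp (- (\<integral>t. (u t + b y t)\<^sup>2 \<partial>\<nu>)) \<partial>S)\<bar>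
    \<le> 8 * (\<integral>y. cubic_remainder (\<integral>t. (a y t)\<^sup>2 \<partial>\<nu>) \<partial>S) + 8 * (\<integral>y. cubic_remainder (\<integral>t. (b y t)\<^sup>2 \<partial>\<nu>) \<partial>S)"
proof -
  have 1: "(\<integral>t. u t * (\<integral>y. a y t \<partial>S) \<partial>\<nu>) = (\<integral>t. u t * (\<integral>y. b y t \<partial>S) \<partial>\<nu>)"
    by (rule Bochner_Integration.integral_cong) (simp_all add: mean)
  have 2: "(\<integral>t. \<integral>y. (a y t)\<^sup>2 \<partial>S \<partial>\<nu>) = (\<integral>t. \<integral>y. (b y t)\<^sup>2 \<partial>S \<partial>\<nu>)"
    by (rule Bochner_Integration.integral_cong) (simp_all add: power2_eq_square cov)
  have 3: "(\<integral>s. \<integral>t. u s * u t * (\<integral>y. a y s * a y t \<partial>S) \<partial>\<nu> \<partial>\<nu>) = (\<integral>s. \<integral>t. u s * u t * (\<integral>y. b y s * b y t \<partial>S) \<partial>\<nu> \<partial>\<nu>)"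
    by (intro Bochner_Integration.integral_cong refl) (simp_all add: cov)
  show ?thesis
    using field_perturbation[OF a u] field_perturbation[OF b u] unfolding 1 2 3 by linarith
qed

text \<open>With Q the squared norm of the field, n * cubic_remainder (Q/n) = min Q (Q * sqrt
  (Q/n)). This tends to 0 pointwise and is dominated by Q, so a finite mean of Q is enough: no third
  moment enters.\<close>

lemma cubic_remainder_field_tendsto:
  assumes a: "square_field S \<nu> a"
  shows "(\<lambda>n. real n * (\<integral>y. cubic_remainder (\<integral>t. (1 / sqrt (real n) * a y t)\<^sup>2 \<partial>\<nu>) \<partial>S)) \<longlonglongrightarrow> 0"
proof -
  define Q where "Q y = (\<integral>t. (a y t)\<^sup>2 \<partial>\<nu>)" for y
  have iQ: "integrable S Q" using field_norm_integrable[OF a] by (simp add: Q_def[abs_def])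
  have Q0: "0 \<le> Q y" for y by (simp add: Q_def)
  have e: "(\<integral>t. (1 / sqrt (real n) * a y t)\<^sup>2 \<partial>\<nu>) = Q y / n" for n y
    by (simp add: power_mult_distrib power_divide Q_def)
  have c: "real n * cubic_remainder (Q y / n) = min (Q y) (Q y * sqrt (Q y / n))" if "n > 0" for n y
    using that by (simp add: cubic_remainder_def min_mult_distrib_left)
  have "(\<lambda>n. \<integral>y. real n * cubic_remainder (Q y / n) \<partial>S) \<longlonglongrightarrow> (\<integral>y. 0 \<partial>S)"
  proof (rule integral_dominated_convergence[where w=Q])
    show "AE y in S. (\<lambda>n. real n * cubic_remainder (Q y / n)) \<longlonglongrightarrow> 0"
    proof (rule AE_I2)
      fix y
      have "(\<lambda>n. Q y / real n) \<longlonglongrightarrow> 0" by (rule lim_const_over_n)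
      from tendsto_min[OF tendsto_const[of "Q y"] tendsto_mult[OF tendsto_const[of "Q y"] tendsto_real_sqrt[OF this]]]
      have "(\<lambda>n. min (Q y) (Q y * sqrt (Q y / n))) \<longlonglongrightarrow> 0" using Q0[of y] by simp
      then show "(\<lambda>n. real n * cubic_remainder (Q y / n)) \<longlonglongrightarrow> 0"
        by (rule Lim_transform_eventually) (use c in \<open>auto intro: eventually_mono[OF eventually_gt_at_top[of 0]]\<close>)
    qed
    show "AE y in S. norm (real n * cubic_remainder (Q y / n)) \<le> Q y" for n
    proof (rule AE_I2)
      fix y show "norm (real n * cubic_remainder (Q y / n)) \<le> Q y"
        using cubic_remainder_nonneg[of "Q y / n"] cubic_remainder_le[of "Q y / n"] Q0[of y]
        by (cases "n = 0") (auto simp: abs_mult field_simps)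
    qed
  qed (use iQ in auto)
  then show ?thesis unfolding e by simp
qed

text \<open>One exchange costs at most \<open>r n\<close> by \<open>field_swap\<close>, and n
  exchanges cost n * r n, which tends to 0 by the previous lemma. The conclusion concerns the
  difference of two expectations, so neither has to be known to converge.\<close>

lemma lindeberg_field:
  assumes a: "square_field S \<nu> a" and b: "square_field S \<nu> b"
    and mean: "\<And>t. t \<in> space \<nu> \<Longrightarrow> (\<integral>y. a y t \<partial>S) = (\<integral>y. b y t \<partial>S)"
    and cov: "\<And>s t. s \<in> space \<nu> \<Longrightarrow> t \<in> space \<nu> \<Longrightarrow> (\<integral>y. a y s * a y t \<partial>S) = (\<integral>y. b y s * b y t \<partial>S)"
  shows "(\<lambda>n. (\<integral>y. exp (- (\<integral>t. ((\<Sum>i<n. a (y i) t) / sqrt (real n))\<^sup>2 \<partial>\<nu>)) \<partial>PiM {..<n} (\<lambda>_. S))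
            - (\<integral>y. exp (- (\<integral>t. ((\<Sum>i<n. b (y i) t) / sqrt (real n))\<^sup>2 \<partial>\<nu>)) \<partial>PiM {..<n} (\<lambda>_. S))) \<longlonglongrightarrow> 0"
proof -
  define r where "r n = 8 * (\<integral>y. cubic_remainder (\<integral>t. (1 / sqrt (real n) * a y t)\<^sup>2 \<partial>\<nu>) \<partial>S)
     + 8 * (\<integral>y. cubic_remainder (\<integral>t. (1 / sqrt (real n) * b y t)\<^sup>2 \<partial>\<nu>) \<partial>S)" for n
  have r: "(\<lambda>n. real n * r n) \<longlonglongrightarrow> 0"
  proof -
    have lim: "(\<lambda>n. 8 * (real n * (\<integral>y. cubic_remainder (\<integral>t. (1 / sqrt (real n) * a y t)\<^sup>2 \<partial>\<nu>) \<partial>S))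
     + 8 * (real n * (\<integral>y. cubic_remainder (\<integral>t. (1 / sqrt (real n) * b y t)\<^sup>2 \<partial>\<nu>) \<partial>S))) \<longlonglongrightarrow> 8 * 0 + 8 * 0"
      by (rule tendsto_add[OF tendsto_mult_left[OF cubic_remainder_field_tendsto[OF a]]
            tendsto_mult_left[OF cubic_remainder_field_tendsto[OF b]]])
    have ring: "8 * (x * y) + 8 * (x * z) = x * (8 * y + 8 * z)" for x y z :: real by (simp add: distrib_left)
    show ?thesis using lim unfolding ring r_def[symmetric] by simp
  qed
  interpret psf: product_sigma_finite "\<lambda>_::nat. S"
    by (rule product_sigma_finite.intro) (rule S.sigma_finite_measure_axioms)
  have ma: "(\<lambda>(y, t). a y t) \<in> borel_measurable (S \<Otimes>\<^sub>M \<nu>)" and mb: "(\<lambda>(y, t). b y t) \<in> borel_measurable (S \<Otimes>\<^sub>M \<nu>)"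
    by (rule field_meas[OF a], rule field_meas[OF b])
  have bound: "\<bar>(\<integral>y. exp (- (\<integral>t. ((\<Sum>i<n. a (y i) t) / sqrt (real n))\<^sup>2 \<partial>\<nu>)) \<partial>PiM {..<n} (\<lambda>_. S))
            - (\<integral>y. exp (- (\<integral>t. ((\<Sum>i<n. b (y i) t) / sqrt (real n))\<^sup>2 \<partial>\<nu>)) \<partial>PiM {..<n} (\<lambda>_. S))\<bar> \<le> real n * r n" for n
  proof -
    define c where "c = 1 / sqrt (real n)"
    \<comment> \<open>The hybrid sum uses \<open>a\<close> in the first k places and
      \<open>b\<close> in the others, so \<open>G 0\<close> is the functional of \<open>b\<close>
      and \<open>G n\<close> that of \<open>a\<close>.\<close>
    define ab where "ab k i = (if i < k then a else b)" for k i :: nat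
    define G where "G k y = exp (- (\<integral>t. (\<Sum>i<n. c * ab k i (y i) t)\<^sup>2 \<partial>\<nu>))" for k y
    have mab: "(\<lambda>(y, t). ab k i y t) \<in> borel_measurable (S \<Otimes>\<^sub>M \<nu>)" for k i
      using ma mb by (simp add: ab_def)
    have mabi: "(\<lambda>(y, t). ab k i (y i) t) \<in> borel_measurable (PiM I (\<lambda>_. S) \<Otimes>\<^sub>M \<nu>)" if "i \<in> I" for k i I
    proof -
      have [measurable]: "(\<lambda>y. y i) \<in> measurable (PiM I (\<lambda>_. S)) S" using that by measurable
      have "(\<lambda>(y, t). (y i, t)) \<in> measurable (PiM I (\<lambda>_. S) \<Otimes>\<^sub>M \<nu>) (S \<Otimes>\<^sub>M \<nu>)" by measurable
      from measurable_compose[OF this mab[of k i]] show ?thesis by (simp add: case_prod_beta')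
    qed
    have sfc: "square_field S \<nu> (\<lambda>y t. c * a y t)" "square_field S \<nu> (\<lambda>y t. c * b y t)"
      using a b by (auto intro: square_field_scale)
    have meanc: "(\<integral>y. c * a y t \<partial>S) = (\<integral>y. c * b y t \<partial>S)" if "t \<in> space \<nu>" for t
      using mean[OF that] by simp
    have covc: "(\<integral>y. c * a y s * (c * a y t) \<partial>S) = (\<integral>y. c * b y s * (c * b y t) \<partial>S)" if "s \<in> space \<nu>" "t \<in> space \<nu>" for s t
    proof -
      have *: "c * x * (c * z) = c\<^sup>2 * (x * z)" for x z by (simp add: power2_eq_square)
      show ?thesis unfolding * using cov[OF that] by simp
    qed
    have sfab: "square_field S \<nu> (ab k i)" for k i using a b by (simp add: ab_def)
    have step: "\<bar>(\<integral>y. G (Suc k) y \<partial>PiM {..<n} (\<lambda>_. S)) - (\<integral>y. G k y \<partial>PiM {..<n} (\<lambda>_. S))\<bar> \<le> r n" if k: "k < n" for k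
    proof -
      let ?I = "{..<n} - {k}"
      have ins: "insert k ?I = {..<n}" using k by auto
      interpret PI: prob_space "PiM ?I (\<lambda>_. S)" by (rule prob_space_PiM) (rule S.prob_space_axioms)
      interpret PN: prob_space "PiM {..<n} (\<lambda>_. S)" by (rule prob_space_PiM) (rule S.prob_space_axioms)
      have mG: "G j \<in> borel_measurable (PiM {..<n} (\<lambda>_. S))" for j
      proof -
        have "(\<lambda>(y, t). (\<Sum>i<n. c * ab j i (y i) t)\<^sup>2) \<in> borel_measurable (PiM {..<n} (\<lambda>_. S) \<Otimes>\<^sub>M \<nu>)"
          using mabi[of _ "{..<n}" j] by (auto simp: case_prod_beta' intro!: borel_measurable_power borel_measurable_sum borel_measurable_times)
        from \<nu>.borel_measurable_lebesgue_integral[OF this]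
        have [measurable]: "(\<lambda>y. \<integral>t. (\<Sum>i<n. c * ab j i (y i) t)\<^sup>2 \<partial>\<nu>) \<in> borel_measurable (PiM {..<n} (\<lambda>_. S))" .
        show ?thesis unfolding G_def by measurable
      qed
      have iG: "integrable (PiM {..<n} (\<lambda>_. S)) (G j)" for j
        by (rule PN.integrable_const_bound[of _ 1]) (use mG in \<open>auto simp: G_def intro!: AE_I2\<close>)
      \<comment> \<open>The part of the hybrid sum common to steps k and Suc k. With the other
        coordinates fixed, it is the base point u of \<open>field_swap\<close>, and coordinate k is
        integrated alone.\<close>
      define U where "U x t = (\<Sum>i\<in>?I. c * ab k i (x i) t)" for x t
      have U': "(\<Sum>i\<in>?I. c * ab (Suc k) i (x i) t) = U x t" for x t
        unfolding U_def by (rule sum.cong) (auto simp: ab_def)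
      have Gk: "G k (x(k := y)) = exp (- (\<integral>t. (U x t + c * b y t)\<^sup>2 \<partial>\<nu>))" for x y
      proof -
        have "(\<Sum>i<n. c * ab k i ((x(k := y)) i) t) = U x t + c * b y t" for t
        proof -
          have "(\<Sum>i<n. c * ab k i ((x(k := y)) i) t) = (\<Sum>i\<in>insert k ?I. c * ab k i ((x(k := y)) i) t)"
            by (simp only: ins)
          also have "\<dots> = c * ab k k ((x(k := y)) k) t + (\<Sum>i\<in>?I. c * ab k i ((x(k := y)) i) t)"
            by (rule sum.insert) simp_all
          also have "(\<Sum>i\<in>?I. c * ab k i ((x(k := y)) i) t) = U x t"
            unfolding U_def by (rule sum.cong) simp_all
          finally show ?thesis by (simp add: ab_def)
        qed
        then show ?thesis by (simp only: G_def)
      qed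
      have GSk: "G (Suc k) (x(k := y)) = exp (- (\<integral>t. (U x t + c * a y t)\<^sup>2 \<partial>\<nu>))" for x y
      proof -
        have "(\<Sum>i<n. c * ab (Suc k) i ((x(k := y)) i) t) = U x t + c * a y t" for t
        proof -
          have "(\<Sum>i<n. c * ab (Suc k) i ((x(k := y)) i) t) = (\<Sum>i\<in>insert k ?I. c * ab (Suc k) i ((x(k := y)) i) t)"
            by (simp only: ins)
          also have "\<dots> = c * ab (Suc k) k ((x(k := y)) k) t + (\<Sum>i\<in>?I. c * ab (Suc k) i ((x(k := y)) i) t)"
            by (rule sum.insert) simp_all
          also have "(\<Sum>i\<in>?I. c * ab (Suc k) i ((x(k := y)) i) t) = U x t"
            unfolding U'[symmetric] by (rule sum.cong) simp_all
          finally show ?thesis by (simp add: ab_def)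
        qed
        then show ?thesis by (simp only: G_def)
      qed
      define D where "D x = (\<integral>y. G (Suc k) (x(k := y)) \<partial>S) - (\<integral>y. G k (x(k := y)) \<partial>S)" for x
      have split: "(\<integral>y. G j y \<partial>PiM {..<n} (\<lambda>_. S)) = (\<integral>x. \<integral>y. G j (x(k := y)) \<partial>S \<partial>PiM ?I (\<lambda>_. S))" for j
        using psf.product_integral_insert[of ?I k "G j"] iG[of j] unfolding ins by simp
      have upd: "(\<lambda>(x, y). x(k := y)) \<in> measurable (PiM ?I (\<lambda>_. S) \<Otimes>\<^sub>M S) (PiM {..<n} (\<lambda>_. S))"
        using measurable_add_dim[of k ?I "\<lambda>_. S"] unfolding ins .
      have mGj: "(\<lambda>x. \<integral>y. G j (x(k := y)) \<partial>S) \<in> borel_measurable (PiM ?I (\<lambda>_. S))" for j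
        by (rule S.borel_measurable_lebesgue_integral)
           (use measurable_compose[OF upd mG[of j]] in \<open>simp add: case_prod_beta'\<close>)
      have G1: "\<bar>\<integral>y. G j (x(k := y)) \<partial>S\<bar> \<le> 1" if "x \<in> space (PiM ?I (\<lambda>_. S))" for j x
      proof -
        have "\<bar>\<integral>y. G j (x(k := y)) \<partial>S\<bar> \<le> (\<integral>y. \<bar>G j (x(k := y))\<bar> \<partial>S)" by (rule integral_abs_bound)
        also have "\<dots> \<le> (\<integral>y. 1 \<partial>S)"
        proof (rule integral_mono')
          show "\<bar>G j (x(k := y))\<bar> \<le> 1" for y by (simp add: G_def)
        qed auto
        finally show ?thesis by (simp add: S.prob_space)
      qed
      have iGj: "integrable (PiM ?I (\<lambda>_. S)) (\<lambda>x. \<integral>y. G j (x(k := y)) \<partial>S)" for j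
        by (rule PI.integrable_const_bound[of _ 1]) (use mGj G1 in \<open>auto intro!: AE_I2\<close>)
      \<comment> \<open>\<open>field_swap\<close> needs a square integrable base point, and the
        paths of the fields are square integrable only almost surely.\<close>
      have "AE x in PiM ?I (\<lambda>_. S). \<forall>i\<in>?I. integrable \<nu> (\<lambda>t. (ab k i (x i) t)\<^sup>2)"
      proof (subst AE_ball_countable, simp, rule ballI)
        fix i assume i: "i \<in> ?I"
        show "AE x in PiM ?I (\<lambda>_. S). integrable \<nu> (\<lambda>t. (ab k i (x i) t)\<^sup>2)"
          by (rule AE_PiM_component[where P="\<lambda>y. integrable \<nu> (\<lambda>t. (ab k i y t)\<^sup>2)", OF _ i field_path_square[OF sfab]])
             (rule S.prob_space_axioms)
      qed
      then have AD: "AE x in PiM ?I (\<lambda>_. S). \<bar>D x\<bar> \<le> r n"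
        using AE_space
      proof eventually_elim
        case (elim x)
        have sp: "x i \<in> space S" if "i \<in> ?I" for i using elim(2) that by (auto simp: space_PiM)
        have mp: "ab k i (x i) \<in> borel_measurable \<nu>" if "i \<in> ?I" for i
          using field_path_meas[OF sfab sp[OF that]] .
        have "integrable \<nu> (\<lambda>t. (U x t)\<^sup>2) \<and> U x \<in> borel_measurable \<nu>"
        proof -
          have "integrable \<nu> (\<lambda>t. (\<Sum>i\<in>J. c * ab k i (x i) t)\<^sup>2) \<and> (\<lambda>t. \<Sum>i\<in>J. c * ab k i (x i) t) \<in> borel_measurable \<nu>"
            if "finite J" "J \<subseteq> ?I" for J
            using that
          proof (induction J)
            case (insert j J)
            then have IH: "integrable \<nu> (\<lambda>t. (\<Sum>i\<in>J. c * ab k i (x i) t)\<^sup>2)" "(\<lambda>t. \<Sum>i\<in>J. c * ab k i (x i) t) \<in> borel_measurable \<nu>" by auto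
            have j: "integrable \<nu> (\<lambda>t. (c * ab k j (x j) t)\<^sup>2)" "(\<lambda>t. c * ab k j (x j) t) \<in> borel_measurable \<nu>"
              using elim(1) insert.prems mp[of j] by (auto simp: power_mult_distrib)
            have "(\<lambda>t. (\<Sum>i\<in>insert j J. c * ab k i (x i) t)\<^sup>2) = (\<lambda>t. (c * ab k j (x j) t)\<^sup>2
               + 2 * ((c * ab k j (x j) t) * (\<Sum>i\<in>J. c * ab k i (x i) t)) + (\<Sum>i\<in>J. c * ab k i (x i) t)\<^sup>2)"
              using insert.hyps by (simp add: power2_sum algebra_simps)
            then show ?case
              using IH j Cauchy_Schwarz_integral_square(1)[OF j(2) IH(2) j(1) IH(1)] insert.hyps by simp
          qed simp
          from this[of ?I] show ?thesis unfolding U_def[abs_def] by simp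
        qed
        then show ?case
          unfolding D_def Gk GSk r_def c_def[symmetric]
          by (intro field_swap[OF sfc meanc covc]) simp_all
      qed
      have "\<bar>\<integral>x. D x \<partial>PiM ?I (\<lambda>_. S)\<bar> \<le> (\<integral>x. \<bar>D x\<bar> \<partial>PiM ?I (\<lambda>_. S))" by (rule integral_abs_bound)
      also have "\<dots> \<le> (\<integral>x. r n \<partial>PiM ?I (\<lambda>_. S))"
        using AD iGj unfolding D_def by (intro integral_mono_AE) auto
      also have "\<dots> = r n" by (simp add: PI.prob_space)
      finally show ?thesis unfolding split D_def using iGj by simp
    qed
    have "\<bar>(\<integral>y. G k y \<partial>PiM {..<n} (\<lambda>_. S)) - (\<integral>y. G 0 y \<partial>PiM {..<n} (\<lambda>_. S))\<bar> \<le> real k * r n" if "k \<le> n" for k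
      using that
    proof (induction k)
      case (Suc k)
      then show ?case using step[of k] by (simp add: distrib_right)
    qed simp
    from this[of n] have "\<bar>(\<integral>y. G n y \<partial>PiM {..<n} (\<lambda>_. S)) - (\<integral>y. G 0 y \<partial>PiM {..<n} (\<lambda>_. S))\<bar> \<le> real n * r n" by simp
    moreover have "(\<Sum>i<n. c * ab n i (y i) t) = (\<Sum>i<n. a (y i) t) / sqrt (real n)"
      "(\<Sum>i<n. c * ab 0 i (y i) t) = (\<Sum>i<n. b (y i) t) / sqrt (real n)" for y t
      unfolding c_def ab_def by (simp_all flip: sum_distrib_left add: sum_divide_distrib)
    ultimately show ?thesis unfolding G_def by (simp only:)
  qed
  show ?thesis
    by (rule Lim_null_comparison[OF _ r], rule always_eventually, rule allI) (simp only: real_norm_def bound)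
qed

end

subsection \<open>Sequences of independent normal variables\<close>

abbreviation normal_seq :: "(nat \<Rightarrow> real) measure" where
  "normal_seq \<equiv> PiM UNIV (\<lambda>_. std_normal_distribution)"

lemma prob_space_std_normal: "prob_space std_normal_distribution"
  using real_dist_normal_dist by (simp add: real_distribution_def)

lemma prob_space_normal_seq: "prob_space normal_seq"
  by (rule prob_space_PiM) (rule prob_space_std_normal)

lemma sets_normal_seq: "sets (PiM I (\<lambda>_. std_normal_distribution)) = sets (PiM I (\<lambda>_. borel))"
  by (rule sets_PiM_cong) auto

lemma space_normal_seq[simp]: "space (PiM (UNIV :: 'i set) (\<lambda>_. std_normal_distribution)) = UNIV"
  by (simp add: space_PiM PiE_def extensional_def)

lemma normal_coord_measurable[measurable]:
  "(\<lambda>y. y k) \<in> borel_measurable (PiM (UNIV :: 'i set) (\<lambda>_. std_normal_distribution))"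
proof -
  have "(\<lambda>y. y k) \<in> measurable (PiM (UNIV :: 'i set) (\<lambda>_. std_normal_distribution)) std_normal_distribution"
    by (rule measurable_component_singleton) simp
  then show ?thesis by simp
qed

lemma measurable_into_normal_seq:
  assumes "\<And>k. (\<lambda>x. f x k) \<in> borel_measurable M"
  shows "f \<in> measurable M (PiM (UNIV :: 'i set) (\<lambda>_. std_normal_distribution))"
  by (rule measurable_PiM_single') (use assms in auto)

lemma distr_normal_coord:
  "distr (PiM (UNIV :: 'i set) (\<lambda>_. std_normal_distribution)) borel (\<lambda>y. y k) = std_normal_distribution"
proof -
  have "distr (PiM (UNIV :: 'i set) (\<lambda>_. std_normal_distribution)) borel (\<lambda>y. y k)
     = distr (PiM (UNIV :: 'i set) (\<lambda>_. std_normal_distribution)) std_normal_distribution (\<lambda>y. y k)"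
    by (rule distr_cong) auto
  also have "\<dots> = std_normal_distribution"
    by (rule distr_PiM_component) (auto intro: prob_space_std_normal)
  finally show ?thesis .
qed

lemma indep_vars_normal_coord:
  "prob_space.indep_vars (PiM (UNIV :: 'i set) (\<lambda>_. std_normal_distribution)) (\<lambda>_. borel) (\<lambda>k y. y k) UNIV"
proof -
  let ?S = "PiM (UNIV :: 'i set) (\<lambda>_. std_normal_distribution)"
  interpret prob_space ?S by (rule prob_space_PiM) (rule prob_space_std_normal)
  have "distr ?S (PiM UNIV (\<lambda>_. borel)) (\<lambda>x. \<lambda>i\<in>UNIV. x i) = distr ?S ?S (\<lambda>x. x)"
    by (rule distr_cong) (auto simp: sets_normal_seq restrict_def)
  also have "\<dots> = ?S" by simp
  finally show ?thesis
    by (subst indep_vars_iff_distr_eq_PiM) (auto simp: distr_normal_coord)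
qed

lemma char_normal_scale:
  "char (distr std_normal_distribution borel (\<lambda>x. c * x)) u = complex_of_real (exp (- (c * u)\<^sup>2 / 2))"
proof -
  have "char (distr std_normal_distribution borel (\<lambda>x. c * x)) u = char std_normal_distribution (c * u)"
    unfolding char_def by (subst integral_distr) (auto simp: mult_ac)
  then show ?thesis by (simp add: char_std_normal_distribution)
qed

text \<open>The law is written as the image of the standard normal law under scaling rather than by
  a density, so that zero variance needs no separate treatment. Independence turns the
  characteristic function into a product of Gaussian ones.\<close>

lemma (in prob_space) distr_normal_combination:
  assumes ind: "indep_vars (\<lambda>_. borel) X A" and A: "finite A"
    and X: "\<And>i. i \<in> A \<Longrightarrow> distr M borel (X i) = std_normal_distribution"
  shows "distr M borel (\<lambda>\<omega>. \<Sum>i\<in>A. d i * X i \<omega>) = distr std_normal_distribution borel (\<lambda>x. sqrt (\<Sum>i\<in>A. (d i)\<^sup>2) * x)"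
proof (rule Levy_uniqueness)
  have meas: "X i \<in> borel_measurable M" if "i \<in> A" for i using ind that by (auto simp: indep_vars_def)
  show "real_distribution (distr M borel (\<lambda>\<omega>. \<Sum>i\<in>A. d i * X i \<omega>))"
    by (rule real_distribution_distr) (use meas in auto)
  interpret N: prob_space std_normal_distribution by (rule prob_space_std_normal)
  show "real_distribution (distr std_normal_distribution borel (\<lambda>x. sqrt (\<Sum>i\<in>A. (d i)\<^sup>2) * x))"
    by (rule N.real_distribution_distr) auto
  have ind': "indep_vars (\<lambda>_. borel) (\<lambda>i \<omega>. d i * X i \<omega>) A"
    by (rule indep_vars_compose2[OF ind]) auto
  show "char (distr M borel (\<lambda>\<omega>. \<Sum>i\<in>A. d i * X i \<omega>))
      = char (distr std_normal_distribution borel (\<lambda>x. sqrt (\<Sum>i\<in>A. (d i)\<^sup>2) * x))"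
  proof
    fix u
    have "char (distr M borel (\<lambda>\<omega>. \<Sum>i\<in>A. d i * X i \<omega>)) u = (\<Prod>i\<in>A. char (distr M borel (\<lambda>\<omega>. d i * X i \<omega>)) u)"
      by (rule char_distr_sum[OF ind'])
    also have "\<dots> = (\<Prod>i\<in>A. complex_of_real (exp (- (d i * u)\<^sup>2 / 2)))"
    proof (rule prod.cong[OF refl])
      fix i assume i: "i \<in> A"
      have "distr M borel (\<lambda>\<omega>. d i * X i \<omega>) = distr (distr M borel (X i)) borel (\<lambda>x. d i * x)"
        by (subst distr_distr) (use meas[OF i] in \<open>auto simp: comp_def\<close>)
      then show "char (distr M borel (\<lambda>\<omega>. d i * X i \<omega>)) u = complex_of_real (exp (- (d i * u)\<^sup>2 / 2))"
        using X[OF i] by (simp add: char_normal_scale)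
    qed
    also have "\<dots> = complex_of_real (exp (\<Sum>i\<in>A. - (d i * u)\<^sup>2 / 2))"
      by (simp add: exp_sum A)
    also have "(\<Sum>i\<in>A. - (d i * u)\<^sup>2 / 2) = - (sqrt (\<Sum>i\<in>A. (d i)\<^sup>2) * u)\<^sup>2 / 2"
      by (simp add: power_mult_distrib sum_nonneg sum_negf sum_distrib_right sum_divide_distrib)
    finally show "char (distr M borel (\<lambda>\<omega>. \<Sum>i\<in>A. d i * X i \<omega>)) u
      = char (distr std_normal_distribution borel (\<lambda>x. sqrt (\<Sum>i\<in>A. (d i)\<^sup>2) * x)) u"
      by (simp add: char_normal_scale)
  qed
qed

text \<open>The expected sum of |d k * y k| is the sum of |d k| times the first absolute moment of a
  standard normal variable, hence finite; so the sum itself is finite almost surely.\<close>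

lemma normal_series_summable:
  assumes d: "summable (\<lambda>k. \<bar>d k\<bar>)"
  shows "AE y in normal_seq. summable (\<lambda>k. \<bar>d k * y k\<bar>)"
proof -
  define m where "m = (\<integral>\<^sup>+x. ennreal \<bar>x\<bar> \<partial>std_normal_distribution)"
  have m: "m < \<top>"
    using integrable_std_normal_distribution_moment[of 1] unfolding m_def by (auto simp: integrable_iff_bounded)
  have 1: "(\<integral>\<^sup>+y. ennreal \<bar>d k * y k\<bar> \<partial>normal_seq) = ennreal \<bar>d k\<bar> * m" for k
  proof -
    have "(\<integral>\<^sup>+y. ennreal \<bar>d k * y k\<bar> \<partial>normal_seq) = (\<integral>\<^sup>+y. ennreal \<bar>d k\<bar> * ennreal \<bar>y k\<bar> \<partial>normal_seq)"
      by (simp add: abs_mult ennreal_mult)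
    also have "\<dots> = ennreal \<bar>d k\<bar> * (\<integral>\<^sup>+y. ennreal \<bar>y k\<bar> \<partial>normal_seq)"
      by (rule nn_integral_cmult) measurable
    also have "(\<integral>\<^sup>+y. ennreal \<bar>y k\<bar> \<partial>normal_seq) = (\<integral>\<^sup>+x. ennreal \<bar>x\<bar> \<partial>distr normal_seq borel (\<lambda>y. y k))"
      by (subst nn_integral_distr) auto
    finally show ?thesis by (simp add: distr_normal_coord m_def)
  qed
  have "(\<integral>\<^sup>+y. (\<Sum>k. ennreal \<bar>d k * y k\<bar>) \<partial>normal_seq) = (\<Sum>k. \<integral>\<^sup>+y. ennreal \<bar>d k * y k\<bar> \<partial>normal_seq)"
    by (rule nn_integral_suminf) measurable
  also have "\<dots> = (\<Sum>k. ennreal \<bar>d k\<bar>) * m" unfolding 1 by (rule ennreal_suminf_multc)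
  also have "(\<Sum>k. ennreal \<bar>d k\<bar>) = ennreal (\<Sum>k. \<bar>d k\<bar>)" by (rule suminf_ennreal2) (use d in auto)
  also have "\<dots> * m < \<top>" using m by (simp add: ennreal_mult_less_top)
  finally have "AE y in normal_seq. (\<Sum>k. ennreal \<bar>d k * y k\<bar>) \<noteq> \<infinity>"
    by (intro nn_integral_noteq_infinite) auto
  then show ?thesis
    by eventually_elim (rule summable_suminf_not_top, auto)
qed

lemma distr_normal_series:
  assumes d: "summable (\<lambda>k. \<bar>d k\<bar>)"
  shows "distr normal_seq borel (\<lambda>y. \<Sum>k. d k * y k)
    = distr std_normal_distribution borel (\<lambda>x. sqrt (\<Sum>k. (d k)\<^sup>2) * x)"
proof (rule Levy_uniqueness)
  interpret S: prob_space normal_seq by (rule prob_space_normal_seq)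
  interpret N: prob_space std_normal_distribution by (rule prob_space_std_normal)
  show "real_distribution (distr normal_seq borel (\<lambda>y. \<Sum>k. d k * y k))"
    by (rule S.real_distribution_distr) auto
  show "real_distribution (distr std_normal_distribution borel (\<lambda>x. sqrt (\<Sum>k. (d k)\<^sup>2) * x))"
    by (rule N.real_distribution_distr) auto
  \<comment> \<open>Absolutely summable terms are eventually below 1 in absolute value, and from
    there on their squares are smaller than they are.\<close>
  have d2: "summable (\<lambda>k. (d k)\<^sup>2)"
  proof (rule summable_comparison_test_ev[OF _ d])
    have "eventually (\<lambda>k. \<bar>d k\<bar> < 1) sequentially"
      using order_tendstoD(2)[OF summable_LIMSEQ_zero[OF d], of 1] by simp
    then show "eventually (\<lambda>k. norm ((d k)\<^sup>2) \<le> \<bar>d k\<bar>) sequentially"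
    proof eventually_elim
      case (elim k)
      then have "\<bar>d k\<bar> * \<bar>d k\<bar> \<le> \<bar>d k\<bar> * 1" by (intro mult_left_mono) auto
      then show ?case by (simp add: power2_eq_square)
    qed
  qed
  show "char (distr normal_seq borel (\<lambda>y. \<Sum>k. d k * y k))
      = char (distr std_normal_distribution borel (\<lambda>x. sqrt (\<Sum>k. (d k)\<^sup>2) * x))"
  proof
    fix u
    have "(\<lambda>m. \<integral>y. iexp (u * (\<Sum>k<m. d k * y k)) \<partial>normal_seq) \<longlonglongrightarrow> (\<integral>y. iexp (u * (\<Sum>k. d k * y k)) \<partial>normal_seq)"
    proof (rule integral_dominated_convergence[where w="\<lambda>_. 1"])
      show "AE y in normal_seq. (\<lambda>m. iexp (u * (\<Sum>k<m. d k * y k))) \<longlonglongrightarrow> iexp (u * (\<Sum>k. d k * y k))"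
        using normal_series_summable[OF d]
      proof eventually_elim
        case (elim y)
        then have "summable (\<lambda>k. d k * y k)" by (rule summable_rabs_cancel)
        from summable_LIMSEQ[OF this] show ?case by (intro tendsto_intros)
      qed
    qed auto
    moreover have "(\<integral>y. iexp (u * (\<Sum>k<m. d k * y k)) \<partial>normal_seq) = complex_of_real (exp (- (u\<^sup>2 * (\<Sum>k<m. (d k)\<^sup>2)) / 2))" for m
    proof -
      have "(\<integral>y. iexp (u * (\<Sum>k<m. d k * y k)) \<partial>normal_seq) = char (distr normal_seq borel (\<lambda>y. \<Sum>k<m. d k * y k)) u"
        unfolding char_def by (subst integral_distr) auto
      also have "\<dots> = char (distr std_normal_distribution borel (\<lambda>x. sqrt (\<Sum>k<m. (d k)\<^sup>2) * x)) u"
        by (subst S.distr_normal_combination)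
           (auto intro: S.indep_vars_subset[OF indep_vars_normal_coord] simp: distr_normal_coord)
      finally show ?thesis unfolding char_normal_scale by (simp add: power_mult_distrib sum_nonneg mult_ac)
    qed
    moreover have "(\<lambda>m. complex_of_real (exp (- (u\<^sup>2 * (\<Sum>k<m. (d k)\<^sup>2)) / 2))) \<longlonglongrightarrow> complex_of_real (exp (- (u\<^sup>2 * (\<Sum>k. (d k)\<^sup>2)) / 2))"
      by (intro tendsto_intros summable_LIMSEQ d2) auto
    ultimately have "(\<integral>y. iexp (u * (\<Sum>k. d k * y k)) \<partial>normal_seq) = complex_of_real (exp (- (u\<^sup>2 * (\<Sum>k. (d k)\<^sup>2)) / 2))"
      using LIMSEQ_unique by force
    moreover have "char (distr normal_seq borel (\<lambda>y. \<Sum>k. d k * y k)) u = (\<integral>y. iexp (u * (\<Sum>k. d k * y k)) \<partial>normal_seq)"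
      unfolding char_def by (subst integral_distr) auto
    ultimately show "char (distr normal_seq borel (\<lambda>y. \<Sum>k. d k * y k)) u = char (distr std_normal_distribution borel (\<lambda>x. sqrt (\<Sum>k. (d k)\<^sup>2) * x)) u"
      unfolding char_normal_scale using suminf_nonneg[OF d2] by (simp add: power_mult_distrib mult_ac)
  qed
qed

lemma (in prob_space) distr_scaled_normal_moments:
  assumes Z: "Z \<in> borel_measurable M" and distr: "distr M borel Z = distr std_normal_distribution borel (\<lambda>x. sqrt v * x)" and v: "0 \<le> v"
  shows "integral\<^sup>L M Z = 0" "integrable M (\<lambda>\<omega>. (Z \<omega>)\<^sup>2)" "(\<integral>\<omega>. (Z \<omega>)\<^sup>2 \<partial>M) = v"
    and "v > 0 \<Longrightarrow> distributed M lborel Z (normal_density 0 (sqrt v))"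
proof -
  have m1: "integral\<^sup>L std_normal_distribution (\<lambda>x. x) = 0"
    using integral_std_normal_distribution_moment_odd[of 1] by simp
  have m2: "(\<integral>x. x\<^sup>2 \<partial>std_normal_distribution) = 1" "integrable std_normal_distribution (\<lambda>x. x\<^sup>2)"
    using std_normal_distribution_even_moments[of 1] by simp_all
  have "integral\<^sup>L M Z = (\<integral>x. x \<partial>distr M borel Z)" by (subst integral_distr) (use Z in auto)
  also have "\<dots> = (\<integral>x. sqrt v * x \<partial>std_normal_distribution)" unfolding distr by (subst integral_distr) auto
  finally show "integral\<^sup>L M Z = 0" using m1 by simp
  have "integrable (distr M borel Z) (\<lambda>x. x\<^sup>2)"
    unfolding distr by (subst integrable_distr_eq) (use m2 in \<open>auto simp: power_mult_distrib\<close>)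
  then show "integrable M (\<lambda>\<omega>. (Z \<omega>)\<^sup>2)" by (subst (asm) integrable_distr_eq) (use Z in auto)
  have "(\<integral>\<omega>. (Z \<omega>)\<^sup>2 \<partial>M) = (\<integral>x. x\<^sup>2 \<partial>distr M borel Z)" by (subst integral_distr) (use Z in auto)
  also have "\<dots> = (\<integral>x. (sqrt v * x)\<^sup>2 \<partial>std_normal_distribution)" unfolding distr by (subst integral_distr) auto
  finally show "(\<integral>\<omega>. (Z \<omega>)\<^sup>2 \<partial>M) = v" using m2 v by (simp add: power_mult_distrib)
  assume v0: "v > 0"
  interpret N: prob_space std_normal_distribution by (rule prob_space_std_normal)
  have "distributed std_normal_distribution lborel (\<lambda>x. x) std_normal_density"
    unfolding distributed_def by (simp add: distr_id2)
  from N.normal_density_affine[OF this, of "sqrt v" 0] v0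
  have "distributed std_normal_distribution lborel (\<lambda>x. sqrt v * x) (normal_density 0 (sqrt v))" by simp
  then have "distr std_normal_distribution lborel (\<lambda>x. sqrt v * x) = density lborel (normal_density 0 (sqrt v))"
    by (simp add: distributed_def)
  moreover have "distr M lborel Z = distr M borel Z" "distr std_normal_distribution lborel (\<lambda>x. sqrt v * x) = distr std_normal_distribution borel (\<lambda>x. sqrt v * x)"
    by (auto intro!: distr_cong)
  ultimately show "distributed M lborel Z (normal_density 0 (sqrt v))"
    using Z distr unfolding distributed_def by simp
qed

subsection \<open>The limiting Gaussian process\<close>

text \<open>The covariance is \<open>phi1 s * phi1 t\<close> times the exponential series of \<open>s * t\<close> with the terms of order 0, 2
  and, for \<open>c = 1\<close>, 1 removed; this gives the expansion of the process.\<close>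

definition gauss_coeff :: "real \<Rightarrow> nat \<Rightarrow> real \<Rightarrow> real" where
  "gauss_coeff c k t = (if k = 0 \<or> k = 2 then 0 else if k = 1 then 1 - c else 1) * phi1 t * t ^ k / sqrt (fact k)"

definition gauss_path :: "real \<Rightarrow> (nat \<Rightarrow> real) \<Rightarrow> real \<Rightarrow> real" where
  "gauss_path c y t = (\<Sum>k. gauss_coeff c k t * y k)"

lemma summable_power_over_sqrt_fact:
  fixes r :: real assumes "0 \<le> r" shows "summable (\<lambda>k. r ^ k / sqrt (fact k))"
proof (cases "r = 0")
  case True
  have "summable (\<lambda>k. if k = 0 then 1 else 0 :: real)" by simp
  moreover have "(\<lambda>k. r ^ k / sqrt (fact k)) = (\<lambda>k. if k = 0 then 1 else 0)"
    using True by (auto simp: power_0_left)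
  ultimately show ?thesis by simp
next
  case False
  with assms have r: "r > 0" by simp
  have "(\<lambda>k. r / sqrt (real (Suc k))) \<longlonglongrightarrow> 0" by real_asymp
  then have "eventually (\<lambda>k. r / sqrt (real (Suc k)) < 1/2) sequentially" by (rule order_tendstoD) simp
  then obtain N where N: "\<And>k. k \<ge> N \<Longrightarrow> r / sqrt (real (Suc k)) < 1/2" by (auto simp: eventually_sequentially)
  show ?thesis
  proof (rule summable_ratio_test[where c="1/2" and N=N])
    fix k assume k: "N \<le> k"
    have "r ^ Suc k / sqrt (fact (Suc k)) = (r / sqrt (real (Suc k))) * (r ^ k / sqrt (fact k))"
      by (simp add: real_sqrt_mult)
    also have "\<dots> \<le> 1/2 * (r ^ k / sqrt (fact k))"
      using N[OF k] r by (intro mult_right_mono) auto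
    finally show "norm (r ^ Suc k / sqrt (fact (Suc k))) \<le> 1/2 * norm (r ^ k / sqrt (fact k))"
      using r by simp
  qed simp
qed

lemma abs_gauss_coeff_le:
  assumes "c \<in> {0, 1}" shows "\<bar>gauss_coeff c k t\<bar> \<le> \<bar>t\<bar> ^ k / sqrt (fact k)"
proof -
  have 1: "\<bar>(if k = 0 \<or> k = 2 then 0 else if k = 1 then 1 - c else 1)\<bar> \<le> 1" using assms by auto
  have 2: "\<bar>phi1 t\<bar> \<le> 1" by (simp add: phi1_def)
  have "\<bar>gauss_coeff c k t\<bar> = \<bar>(if k = 0 \<or> k = 2 then 0 else if k = 1 then 1 - c else 1)\<bar> * \<bar>phi1 t\<bar> * (\<bar>t\<bar> ^ k / sqrt (fact k))"
    unfolding gauss_coeff_def abs_mult abs_divide power_abs by simp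
  also have "\<dots> \<le> 1 * 1 * (\<bar>t\<bar> ^ k / sqrt (fact k))"
    by (intro mult_right_mono mult_mono 1 2) auto
  finally show ?thesis by simp
qed

lemma summable_gauss_coeff:
  assumes "c \<in> {0, 1}" shows "summable (\<lambda>k. \<bar>gauss_coeff c k t\<bar>)"
  by (rule summable_comparison_test'[OF summable_power_over_sqrt_fact[of "\<bar>t\<bar>"], of 0])
     (use abs_gauss_coeff_le[OF assms] in auto)

text \<open>The exceptional null set must not depend on t. For |t| \<le> m the coefficients are
  dominated by m^k / sqrt (fact k), so the countably many series for natural m control all real t at
  once.\<close>

lemma gauss_path_summable:
  assumes "c \<in> {0, 1}"
  shows "AE y in normal_seq. \<forall>t. summable (\<lambda>k. \<bar>gauss_coeff c k t * y k\<bar>)"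
proof -
  have "AE y in normal_seq. \<forall>m::nat. summable (\<lambda>k. \<bar>real m ^ k / sqrt (fact k) * y k\<bar>)"
    unfolding AE_all_countable
    by (intro allI normal_series_summable) (use summable_power_over_sqrt_fact in auto)
  then show ?thesis
  proof eventually_elim
    case (elim y)
    show ?case
    proof
      fix t
      obtain m :: nat where m: "\<bar>t\<bar> \<le> real m" using real_arch_simple by blast
      show "summable (\<lambda>k. \<bar>gauss_coeff c k t * y k\<bar>)"
      proof (rule summable_comparison_test'[OF elim[rule_format, of m], of 0])
        fix k
        have "\<bar>gauss_coeff c k t\<bar> \<le> real m ^ k / sqrt (fact k)"
          by (rule order_trans[OF abs_gauss_coeff_le[OF assms]]) (intro divide_right_mono power_mono m, auto)
        then show "norm \<bar>gauss_coeff c k t * y k\<bar> \<le> \<bar>real m ^ k / sqrt (fact k) * y k\<bar>"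
          using mult_right_mono[of "\<bar>gauss_coeff c k t\<bar>" "real m ^ k / sqrt (fact k)" "\<bar>y k\<bar>"]
          by (simp only: abs_mult real_norm_def abs_abs abs_divide power_abs) simp
      qed
    qed
  qed
qed

lemma gauss_coeff_sums:
  assumes "c \<in> {0, 1}"
  shows "(\<lambda>k. gauss_coeff c k s * gauss_coeff c k t) sums score_cov c s t"
proof -
  let ?g = "\<lambda>k::nat. (if k = 0 \<or> k = 2 then 0 else if k = 1 then 1 - c else 1)"
  let ?x = "s * t"
  have "(\<lambda>k. ?x ^ k /\<^sub>R fact k) sums exp ?x" by (rule exp_converges)
  moreover have "(\<lambda>k. if k \<in> {0,1,2} then (1 - ?g k) * (?x ^ k / fact k) else 0) sums (\<Sum>k\<in>{0,1,2}. (1 - ?g k) * (?x ^ k / fact k))"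
    by (rule sums_If_finite_set) simp
  ultimately have "(\<lambda>k. ?x ^ k /\<^sub>R fact k - (if k \<in> {0,1,2} then (1 - ?g k) * (?x ^ k / fact k) else 0)) sums
    (exp ?x - (\<Sum>k\<in>{0,1,2}. (1 - ?g k) * (?x ^ k / fact k)))" by (rule sums_diff)
  moreover have "?x ^ k /\<^sub>R fact k - (if k \<in> {0,1,2} then (1 - ?g k) * (?x ^ k / fact k) else 0) = ?g k * (?x ^ k / fact k)" for k
    by (auto simp: field_simps)
  moreover have "(\<Sum>k\<in>{0,1,2}. (1 - ?g k) * (?x ^ k / fact k)) = 1 + c * ?x + ?x\<^sup>2 / 2" by simp
  ultimately have "(\<lambda>k. ?g k * (?x ^ k / fact k)) sums (exp ?x - (1 + c * ?x + ?x\<^sup>2 / 2))" by (simp only:)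
  from sums_mult[OF this, of "phi1 s * phi1 t"]
  have "(\<lambda>k. phi1 s * phi1 t * (?g k * (?x ^ k / fact k))) sums (phi1 s * phi1 t * (exp ?x - (1 + c * ?x + ?x\<^sup>2 / 2)))" .
  moreover have "phi1 s * phi1 t * (?g k * (?x ^ k / fact k)) = gauss_coeff c k s * gauss_coeff c k t" for k
  proof -
    have g: "?g k * ?g k = ?g k" using assms by auto
    have f: "sqrt (fact k) * sqrt (fact k) = (fact k :: real)" by simp
    have "gauss_coeff c k s * gauss_coeff c k t = (?g k * ?g k) * (phi1 s * phi1 t) * (s ^ k * t ^ k) / (sqrt (fact k) * sqrt (fact k))"
      unfolding gauss_coeff_def by (simp add: mult_ac)
    then show ?thesis unfolding g f by (simp add: power_mult_distrib)
  qed
  moreover have "phi1 s * phi1 t * (exp ?x - (1 + c * ?x + ?x\<^sup>2 / 2)) = score_cov c s t"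
  proof -
    have 1: "phi1 s * phi1 t = exp (- (1/2) * (s\<^sup>2 + t\<^sup>2))" by (simp add: phi1_def exp_add[symmetric] algebra_simps)
    have 2: "exp (- (1/2) * (s\<^sup>2 + t\<^sup>2)) * exp ?x = exp (- (1/2) * (s - t)\<^sup>2)"
      by (simp add: exp_add[symmetric] power2_eq_square field_simps)
    show ?thesis unfolding 1 right_diff_distrib 2 score_cov_def by (simp add: power_mult_distrib algebra_simps)
  qed
  ultimately show ?thesis by (simp only:)
qed

lemma gauss_coeff_measurable[measurable]: "gauss_coeff c k \<in> borel_measurable borel"
  unfolding gauss_coeff_def by measurable

lemma gauss_path_measurable[measurable]: "(\<lambda>(y, t). gauss_path c y t) \<in> borel_measurable (normal_seq \<Otimes>\<^sub>M borel)"
  unfolding gauss_path_def by measurable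

lemma gauss_path_coord_measurable[measurable]: "(\<lambda>y. gauss_path c y t) \<in> borel_measurable normal_seq"
  unfolding gauss_path_def by measurable

text \<open>A finite combination of values of the process is again one series in the normal
  coordinates, with coefficients \<open>d k\<close>. The squares of these sum to the covariance
  form, which is therefore nonnegative; if it is 0, all coefficients vanish and so does the
  combination, almost surely.\<close>

lemma distr_gauss_combination:
  assumes c: "c \<in> {0, 1}" and I: "finite I"
  shows "distr normal_seq borel (\<lambda>y. \<Sum>t\<in>I. w t * gauss_path c y t)
     = distr std_normal_distribution borel (\<lambda>x. sqrt (\<Sum>s\<in>I. \<Sum>t\<in>I. w s * w t * score_cov c s t) * x)"
    and "0 \<le> (\<Sum>s\<in>I. \<Sum>t\<in>I. w s * w t * score_cov c s t)"
    and "(\<Sum>s\<in>I. \<Sum>t\<in>I. w s * w t * score_cov c s t) = 0 \<Longrightarrow> AE y in normal_seq. (\<Sum>t\<in>I. w t * gauss_path c y t) = 0"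
proof -
  define d where "d k = (\<Sum>t\<in>I. w t * gauss_coeff c k t)" for k
  have "summable (\<lambda>k. \<Sum>t\<in>I. \<bar>w t\<bar> * \<bar>gauss_coeff c k t\<bar>)"
    by (intro summable_sum summable_mult summable_gauss_coeff c)
  then have sd: "summable (\<lambda>k. \<bar>d k\<bar>)"
    by (rule summable_comparison_test'[of _ 0]) (auto simp: d_def abs_mult[symmetric])
  have "(\<lambda>k. \<Sum>s\<in>I. \<Sum>t\<in>I. w s * w t * (gauss_coeff c k s * gauss_coeff c k t)) sums (\<Sum>s\<in>I. \<Sum>t\<in>I. w s * w t * score_cov c s t)"
    by (intro sums_sum sums_mult gauss_coeff_sums c)
  moreover have "(\<Sum>s\<in>I. \<Sum>t\<in>I. w s * w t * (gauss_coeff c k s * gauss_coeff c k t)) = (d k)\<^sup>2" for k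
    by (simp add: d_def power2_eq_square sum_product mult_ac)
  ultimately have d2: "(\<lambda>k. (d k)\<^sup>2) sums (\<Sum>s\<in>I. \<Sum>t\<in>I. w s * w t * score_cov c s t)" by simp
  then have v: "(\<Sum>s\<in>I. \<Sum>t\<in>I. w s * w t * score_cov c s t) = (\<Sum>k. (d k)\<^sup>2)" by (rule sums_unique)
  then show "0 \<le> (\<Sum>s\<in>I. \<Sum>t\<in>I. w s * w t * score_cov c s t)"
    using suminf_nonneg[OF sums_summable[OF d2]] by simp
  have ae: "AE y in normal_seq. (\<Sum>t\<in>I. w t * gauss_path c y t) = (\<Sum>k. d k * y k)"
    using gauss_path_summable[OF c]
  proof eventually_elim
    case (elim y)
    have s: "summable (\<lambda>k. gauss_coeff c k t * y k)" for t using elim by (auto intro: summable_rabs_cancel)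
    have "(\<Sum>k. d k * y k) = (\<Sum>k. \<Sum>t\<in>I. w t * (gauss_coeff c k t * y k))"
      by (simp add: d_def sum_distrib_right mult.assoc)
    also have "\<dots> = (\<Sum>t\<in>I. \<Sum>k. w t * (gauss_coeff c k t * y k))" by (rule suminf_sum) (intro summable_mult s)
    also have "\<dots> = (\<Sum>t\<in>I. w t * gauss_path c y t)" unfolding gauss_path_def by (intro sum.cong refl suminf_mult s)
    finally show ?case by simp
  qed
  have "distr normal_seq borel (\<lambda>y. \<Sum>t\<in>I. w t * gauss_path c y t) = distr normal_seq borel (\<lambda>y. \<Sum>k. d k * y k)"
    by (rule distr_cong_AE) (use ae in auto)
  also have "\<dots> = distr std_normal_distribution borel (\<lambda>x. sqrt (\<Sum>s\<in>I. \<Sum>t\<in>I. w s * w t * score_cov c s t) * x)"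
    unfolding v by (rule distr_normal_series[OF sd])
  finally show "distr normal_seq borel (\<lambda>y. \<Sum>t\<in>I. w t * gauss_path c y t)
     = distr std_normal_distribution borel (\<lambda>x. sqrt (\<Sum>s\<in>I. \<Sum>t\<in>I. w s * w t * score_cov c s t) * x)" .
  assume "(\<Sum>s\<in>I. \<Sum>t\<in>I. w s * w t * score_cov c s t) = 0"
  then have "(\<Sum>k. (d k)\<^sup>2) = 0" using v by simp
  then have "d k = 0" for k using suminf_eq_zero_iff[OF sums_summable[OF d2]] by simp
  then show "AE y in normal_seq. (\<Sum>t\<in>I. w t * gauss_path c y t) = 0" using ae by simp
qed

text \<open>Known are the laws of linear combinations, so the mixed moment comes by polarisation
  from the variance of the sum of the values at s and t.\<close>

lemma gauss_path_moments:
  assumes c: "c \<in> {0, 1}"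
  shows "(\<integral>y. gauss_path c y t \<partial>normal_seq) = 0"
    and "integrable normal_seq (\<lambda>y. (gauss_path c y t)\<^sup>2)"
    and "(\<integral>y. gauss_path c y s * gauss_path c y t \<partial>normal_seq) = score_cov c s t"
proof -
  interpret S: prob_space normal_seq by (rule prob_space_normal_seq)
  have 1: "integral\<^sup>L normal_seq (\<lambda>y. gauss_path c y t) = 0"
    "integrable normal_seq (\<lambda>y. (gauss_path c y t)\<^sup>2)" "(\<integral>y. (gauss_path c y t)\<^sup>2 \<partial>normal_seq) = score_cov c t t" for t
    using S.distr_scaled_normal_moments(1-3)[OF _ distr_gauss_combination(1)[OF c, of "{t}" "\<lambda>_. 1"] distr_gauss_combination(2)[OF c, of "{t}" "\<lambda>_. 1"]]
    by simp_all
  show "(\<integral>y. gauss_path c y t \<partial>normal_seq) = 0" "integrable normal_seq (\<lambda>y. (gauss_path c y t)\<^sup>2)" by (rule 1)+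
  show "(\<integral>y. gauss_path c y s * gauss_path c y t \<partial>normal_seq) = score_cov c s t"
  proof (cases "s = t")
    case True then show ?thesis using 1(3)[of t] by (simp add: power2_eq_square)
  next
    case False
    have sym: "score_cov c t s = score_cov c s t" by (simp add: score_cov_def power2_commute mult_ac add_ac)
    have 2: "integrable normal_seq (\<lambda>y. (gauss_path c y s + gauss_path c y t)\<^sup>2)"
      "(\<integral>y. (gauss_path c y s + gauss_path c y t)\<^sup>2 \<partial>normal_seq) = score_cov c s s + 2 * score_cov c s t + score_cov c t t"
      using S.distr_scaled_normal_moments(2,3)[OF _ distr_gauss_combination(1)[OF c, of "{s, t}" "\<lambda>_. 1"] distr_gauss_combination(2)[OF c, of "{s, t}" "\<lambda>_. 1"]] False sym
      by (simp_all add: algebra_simps)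
    have "gauss_path c y s * gauss_path c y t = ((gauss_path c y s + gauss_path c y t)\<^sup>2 - (gauss_path c y s)\<^sup>2 - (gauss_path c y t)\<^sup>2) / 2" for y
      by (simp add: power2_sum)
    then show ?thesis using 1(2,3) 2 by (simp only:) simp
  qed
qed

section \<open>The score field and the Gaussian field on a common space\<close>

lemma (in field_pair) square_fieldI:
  assumes meas: "(\<lambda>(y, t). a y t) \<in> borel_measurable (S \<Otimes>\<^sub>M \<nu>)"
    and int: "\<And>t. t \<in> space \<nu> \<Longrightarrow> integrable S (\<lambda>y. (a y t)\<^sup>2)"
    and iint: "integrable \<nu> (\<lambda>t. \<integral>y. (a y t)\<^sup>2 \<partial>S)"
  shows "square_field S \<nu> a"
  unfolding square_field_def
proof (intro conjI ballI meas int)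
  have [measurable]: "(\<lambda>(y, t). a y t) \<in> borel_measurable (S \<Otimes>\<^sub>M \<nu>)" by fact
  have "(\<integral>\<^sup>+z. ennreal (norm (case z of (y, t) \<Rightarrow> (a y t)\<^sup>2)) \<partial>(S \<Otimes>\<^sub>M \<nu>)) = (\<integral>\<^sup>+t. \<integral>\<^sup>+y. ennreal ((a y t)\<^sup>2) \<partial>S \<partial>\<nu>)"
    by (subst nn_integral_snd[symmetric]) (simp_all add: case_prod_beta')
  also have "\<dots> = (\<integral>\<^sup>+t. ennreal (\<integral>y. (a y t)\<^sup>2 \<partial>S) \<partial>\<nu>)"
    by (intro nn_integral_cong nn_integral_eq_integral int) auto
  also have "\<dots> < \<infinity>" using iint by (simp add: integrable_iff_bounded)
  finally show "integrable (S \<Otimes>\<^sub>M \<nu>) (\<lambda>(y, t). (a y t)\<^sup>2)"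
    by (intro integrableI_bounded) auto
qed

lemma score_cov_measurable[measurable]: "(\<lambda>t. score_cov c t t) \<in> borel_measurable borel"
  unfolding score_cov_def by measurable

lemma score_measurable[measurable]: "(\<lambda>(x, t). score c t x) \<in> borel_measurable (borel \<Otimes>\<^sub>M borel)"
  unfolding score_def by measurable

text \<open>\<nu> stands for the measure with density \<open>W\<close>. Integrability of the
  variance function is finiteness of the trace of the covariance operator, that is, of the expected
  squared norm of either field.\<close>

locale weight_measure = \<nu>: sigma_finite_measure \<nu> for \<nu> :: "real measure" +
  fixes c :: real
  assumes sets_\<nu>: "sets \<nu> = sets borel" and c01: "c \<in> {0, 1}"
    and cov_integrable: "integrable \<nu> (\<lambda>t. score_cov c t t)"
begin

lemma space_\<nu>[simp]: "space \<nu> = UNIV"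
  using sets_eq_imp_space_eq[OF sets_\<nu>] by simp

sublocale field_pair normal_seq \<nu>
  by (simp add: field_pair_def prob_space_normal_seq \<nu>.sigma_finite_measure_axioms)

lemma borel_pair_\<nu>: "sets (N \<Otimes>\<^sub>M \<nu>) = sets (N \<Otimes>\<^sub>M borel)"
  by (rule sets_pair_measure_cong) (simp_all add: sets_\<nu>)

lemma square_field_gauss: "square_field normal_seq \<nu> (gauss_path c)"
proof (rule square_fieldI)
  show "(\<lambda>(y, t). gauss_path c y t) \<in> borel_measurable (normal_seq \<Otimes>\<^sub>M \<nu>)"
    using gauss_path_measurable[of c] by (simp add: measurable_cong_sets[OF borel_pair_\<nu> refl])
  show "integrable \<nu> (\<lambda>t. \<integral>y. (gauss_path c y t)\<^sup>2 \<partial>normal_seq)"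
    using cov_integrable gauss_path_moments(3)[OF c01] by (simp add: power2_eq_square)
qed (rule gauss_path_moments(2)[OF c01])

text \<open>The score is read off coordinate 0 of a normal sequence, so that it lives on the same
  space \<open>normal_seq\<close> as the Gaussian field, as the replacement argument requires of the
  two fields it exchanges.\<close>

lemma score_coord_moments:
  "(\<integral>y. score c t (y 0) \<partial>normal_seq) = 0"
  "integrable normal_seq (\<lambda>y. (score c t (y 0))\<^sup>2)"
  "(\<integral>y. score c s (y 0) * score c t (y 0) \<partial>normal_seq) = score_cov c s t"
proof -
  have m: "(\<lambda>y. y 0) \<in> measurable normal_seq borel" by (rule normal_coord_measurable)
  have [measurable]: "score c t \<in> borel_measurable borel" for t unfolding score_def by measurable
  note t = integral_distr[OF m, unfolded distr_normal_coord] integrable_distr_eq[OF m, unfolded distr_normal_coord]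
  have c2: "c\<^sup>2 = c" using c01 by auto
  note cov = score_covariance[OF c2, unfolded has_bochner_integral_iff]
  show "(\<integral>y. score c t (y 0) \<partial>normal_seq) = 0"
    using t(1)[of "score c t"] score_mean[of c t] by (simp add: has_bochner_integral_iff)
  show "integrable normal_seq (\<lambda>y. (score c t (y 0))\<^sup>2)"
    using t(2)[of "\<lambda>x. score c t x * score c t x"] cov[of t t] by (simp add: power2_eq_square)
  show "(\<integral>y. score c s (y 0) * score c t (y 0) \<partial>normal_seq) = score_cov c s t"
    using t(1)[of "\<lambda>x. score c s x * score c t x"] cov[of s t] by simp
qed

lemma square_field_score: "square_field normal_seq \<nu> (\<lambda>y t. score c t (y 0))"
proof (rule square_fieldI)
  have "(\<lambda>(y, t). score c t (y 0)) \<in> borel_measurable (normal_seq \<Otimes>\<^sub>M borel)"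
    unfolding score_def by measurable
  then show "(\<lambda>(y, t). score c t (y 0)) \<in> borel_measurable (normal_seq \<Otimes>\<^sub>M \<nu>)"
    by (simp add: measurable_cong_sets[OF borel_pair_\<nu> refl])
  show "integrable \<nu> (\<lambda>t. \<integral>y. (score c t (y 0))\<^sup>2 \<partial>normal_seq)"
    using cov_integrable score_coord_moments(3) by (simp add: power2_eq_square)
qed (rule score_coord_moments(2))

end

subsection \<open>Rotation invariance of the normal sequence\<close>

lemma rotation_measurable:
  "(\<lambda>y k. (\<Sum>i<n. y i k) / sqrt (real n)) \<in> measurable (PiM {..<n} (\<lambda>_. normal_seq)) normal_seq"
proof (rule measurable_into_normal_seq)
  fix k
  have "(\<lambda>y. y i k) \<in> borel_measurable (PiM {..<n} (\<lambda>_. normal_seq))" if "i \<in> {..<n}" for i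
    using measurable_compose[OF measurable_component_singleton[OF that] normal_coord_measurable[of k]] .
  then have "(\<lambda>y. \<Sum>i<n. y i k) \<in> borel_measurable (PiM {..<n} (\<lambda>_. normal_seq))" by (rule borel_measurable_sum)
  then show "(\<lambda>y. (\<Sum>i<n. y i k) / sqrt (real n)) \<in> borel_measurable (PiM {..<n} (\<lambda>_. normal_seq))"
    by (rule borel_measurable_divide) (rule borel_measurable_const)
qed

text \<open>A doubly indexed array of independent normal variables is read in two ways. Its rows are
  independent normal sequences, so \<phi> carries the array to the n-fold product; its normalised
  column sums are again independent standard normal variables, so \<open>rot\<close> after \<phi>
  has the law of one normal sequence.\<close>

lemma distr_rotated_normal_seq:
  assumes n: "n > 0"
  shows "distr (PiM {..<n} (\<lambda>_. normal_seq)) normal_seq (\<lambda>y k. (\<Sum>i<n. y i k) / sqrt (real n)) = normal_seq"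
proof -
  let ?Q = "PiM (UNIV :: (nat \<times> nat) set) (\<lambda>_. std_normal_distribution)"
  interpret Q: prob_space ?Q by (rule prob_space_PiM) (rule prob_space_std_normal)
  define \<phi> where "\<phi> x = (\<lambda>i\<in>{..<n}. \<lambda>k. x (i, k))" for x :: "nat \<times> nat \<Rightarrow> real"
  define rot where "rot y k = (\<Sum>i<n. y i k) / sqrt (real n)" for y :: "nat \<Rightarrow> nat \<Rightarrow> real" and k
  have row: "(\<lambda>x k. x (i, k)) \<in> measurable ?Q normal_seq" for i
    by (rule measurable_into_normal_seq) simp
  have row_distr: "distr ?Q normal_seq (\<lambda>x k. x (i, k)) = normal_seq" for i
    using distr_PiM_reindex[of "UNIV :: (nat \<times> nat) set" "\<lambda>_. std_normal_distribution" "\<lambda>k. (i, k)" "UNIV :: nat set"]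
      prob_space_std_normal by (simp add: inj_on_def restrict_def)
  have "Q.indep_vars (\<lambda>i. PiM ({i} \<times> UNIV) (\<lambda>_. borel)) (\<lambda>i x. restrict (\<lambda>p. x p) ({i} \<times> UNIV)) {..<n}"
    by (rule Q.indep_vars_restrict[OF indep_vars_normal_coord]) (auto simp: disjoint_family_on_def)
  then have "Q.indep_vars (\<lambda>_. normal_seq) (\<lambda>i x. (\<lambda>z k. z (i, k)) (restrict (\<lambda>p. x p) ({i} \<times> UNIV))) {..<n}"
  proof (rule Q.indep_vars_compose2)
    show "(\<lambda>z k. z (i, k)) \<in> measurable (PiM ({i} \<times> UNIV) (\<lambda>_. borel)) normal_seq" if "i \<in> {..<n}" for i
      by (rule measurable_into_normal_seq) (rule measurable_component_singleton, simp)
  qed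
  then have ind: "Q.indep_vars (\<lambda>_. normal_seq) (\<lambda>i x k. x (i, k)) {..<n}" by simp
  have ne: "{..<n} \<noteq> {}" using n by auto
  have \<phi>: "distr ?Q (PiM {..<n} (\<lambda>_. normal_seq)) \<phi> = PiM {..<n} (\<lambda>_. normal_seq)"
    using Q.indep_vars_iff_distr_eq_PiM'[where I="{..<n}" and M'="\<lambda>_. normal_seq" and X="\<lambda>i x k. x (i, k)"] ind row ne
    by (simp add: row_distr \<phi>_def[abs_def])
  have \<phi>_meas: "\<phi> \<in> measurable ?Q (PiM {..<n} (\<lambda>_. normal_seq))"
    unfolding \<phi>_def by (rule measurable_restrict) (rule row)
  have rot_meas: "rot \<in> measurable (PiM {..<n} (\<lambda>_. normal_seq)) normal_seq"
    unfolding rot_def[abs_def] by (rule rotation_measurable)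
  have col: "distr ?Q borel (\<lambda>x. (\<Sum>i<n. x (i, k)) / sqrt (real n)) = std_normal_distribution" for k
  proof -
    have "Q.indep_vars (\<lambda>i. PiM {(i, k)} (\<lambda>_. borel)) (\<lambda>i x. restrict (\<lambda>p. x p) {(i, k)}) {..<n}"
      by (rule Q.indep_vars_restrict[OF indep_vars_normal_coord]) (auto simp: disjoint_family_on_def)
    then have "Q.indep_vars (\<lambda>_. borel) (\<lambda>i x. (\<lambda>z. z (i, k)) (restrict (\<lambda>p. x p) {(i, k)})) {..<n}"
    proof (rule Q.indep_vars_compose2)
      show "(\<lambda>z. z (i, k)) \<in> measurable (PiM {(i, k)} (\<lambda>_. borel)) borel" if "i \<in> {..<n}" for i
        by (rule measurable_component_singleton) simp
    qed
    then have "Q.indep_vars (\<lambda>_. borel) (\<lambda>i x. x (i, k)) {..<n}" by simp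
    from Q.distr_normal_combination[OF this, of "\<lambda>_. 1 / sqrt (real n)"]
    have "distr ?Q borel (\<lambda>x. \<Sum>i<n. 1 / sqrt (real n) * x (i, k)) = distr std_normal_distribution borel (\<lambda>x. x)"
      using n by (simp add: distr_normal_coord power_divide)
    also have "\<dots> = distr std_normal_distribution std_normal_distribution (\<lambda>x. x)" by (rule distr_cong) auto
    finally show ?thesis by (simp add: sum_divide_distrib)
  qed
  have "Q.indep_vars (\<lambda>k. PiM (UNIV \<times> {k}) (\<lambda>_. borel)) (\<lambda>k x. restrict (\<lambda>p. x p) (UNIV \<times> {k})) UNIV"
    by (rule Q.indep_vars_restrict[OF indep_vars_normal_coord]) (auto simp: disjoint_family_on_def)
  then have "Q.indep_vars (\<lambda>_. borel) (\<lambda>k x. (\<lambda>z. (\<Sum>i<n. z (i, k)) / sqrt (real n)) (restrict (\<lambda>p. x p) (UNIV \<times> {k}))) UNIV"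
  proof (rule Q.indep_vars_compose2)
    show "(\<lambda>z. (\<Sum>i<n. z (i, k)) / sqrt (real n)) \<in> measurable (PiM (UNIV \<times> {k}) (\<lambda>_. borel)) borel" for k
      by (intro borel_measurable_divide borel_measurable_sum measurable_component_singleton) auto
  qed
  then have indc: "Q.indep_vars (\<lambda>_. borel) (\<lambda>k x. (\<Sum>i<n. x (i, k)) / sqrt (real n)) UNIV" by simp
  then have "distr ?Q (PiM UNIV (\<lambda>_. borel)) (\<lambda>x k. (\<Sum>i<n. x (i, k)) / sqrt (real n)) = normal_seq"
    by (subst (asm) Q.indep_vars_iff_distr_eq_PiM) (auto simp: col restrict_def)
  moreover have "distr ?Q normal_seq (\<lambda>x k. (\<Sum>i<n. x (i, k)) / sqrt (real n)) = distr ?Q (PiM UNIV (\<lambda>_. borel)) (\<lambda>x k. (\<Sum>i<n. x (i, k)) / sqrt (real n))"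
    by (rule distr_cong) (auto simp: sets_normal_seq)
  moreover have "rot \<circ> \<phi> = (\<lambda>x k. (\<Sum>i<n. x (i, k)) / sqrt (real n))"
    by (auto simp: rot_def \<phi>_def fun_eq_iff)
  ultimately have "distr ?Q normal_seq (rot \<circ> \<phi>) = normal_seq" by simp
  then have "distr (distr ?Q (PiM {..<n} (\<lambda>_. normal_seq)) \<phi>) normal_seq rot = normal_seq"
    by (subst distr_distr[OF rot_meas \<phi>_meas])
  then show ?thesis unfolding \<phi> rot_def[abs_def] .
qed

context weight_measure
begin

lemma gauss_norm_measurable[measurable]: "(\<lambda>y. \<integral>t. (gauss_path c y t)\<^sup>2 \<partial>\<nu>) \<in> borel_measurable normal_seq"
  using field_norm_integrable[OF square_field_gauss] by auto

text \<open>The path is linear in the sequence wherever its series converges, so almost surely the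
  normalised sum of n paths is the path of the normalised sum of the sequences, and that sum is
  again a normal sequence.\<close>

lemma gauss_laplace_invariant:
  assumes n: "n > 0"
  shows "(\<integral>y. exp (- (\<kappa> * (\<integral>t. ((\<Sum>i<n. gauss_path c (y i) t) / sqrt (real n))\<^sup>2 \<partial>\<nu>))) \<partial>PiM {..<n} (\<lambda>_. normal_seq))
       = (\<integral>y. exp (- (\<kappa> * (\<integral>t. (gauss_path c y t)\<^sup>2 \<partial>\<nu>))) \<partial>normal_seq)"
proof -
  let ?P = "PiM {..<n} (\<lambda>_. normal_seq)"
  let ?r = "\<lambda>y k. (\<Sum>i<n. y i k) / sqrt (real n)"
  have rm: "?r \<in> measurable ?P normal_seq" by (rule rotation_measurable)
  have Gm: "(\<lambda>(y, t). gauss_path c y t) \<in> borel_measurable (normal_seq \<Otimes>\<^sub>M \<nu>)"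
    by (rule field_meas[OF square_field_gauss])
  have mm: "(\<lambda>y. \<integral>t. ((\<Sum>i<n. gauss_path c (y i) t) / sqrt (real n))\<^sup>2 \<partial>\<nu>) \<in> borel_measurable ?P"
  proof (rule \<nu>.borel_measurable_lebesgue_integral)
    have "(\<lambda>(y, t). gauss_path c (y i) t) \<in> borel_measurable (?P \<Otimes>\<^sub>M \<nu>)" if "i < n" for i
    proof -
      have [measurable]: "(\<lambda>y. y i) \<in> measurable ?P normal_seq"
        by (rule measurable_component_singleton) (use that in simp)
      have "(\<lambda>(y, t). (y i, t)) \<in> measurable (?P \<Otimes>\<^sub>M \<nu>) (normal_seq \<Otimes>\<^sub>M \<nu>)" by measurable
      from measurable_compose[OF this Gm] show ?thesis by (simp add: case_prod_beta')
    qed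
    then show "(\<lambda>(y, t). ((\<Sum>i<n. gauss_path c (y i) t) / sqrt (real n))\<^sup>2) \<in> borel_measurable (?P \<Otimes>\<^sub>M \<nu>)"
      unfolding case_prod_beta' by (intro borel_measurable_power borel_measurable_divide borel_measurable_sum) auto
  qed
  have "AE y in ?P. \<forall>i\<in>{..<n}. \<forall>t. summable (\<lambda>k. \<bar>gauss_coeff c k t * y i k\<bar>)"
  proof (subst AE_ball_countable, simp, rule ballI)
    fix i assume i: "i \<in> {..<n}"
    show "AE y in ?P. \<forall>t. summable (\<lambda>k. \<bar>gauss_coeff c k t * y i k\<bar>)"
      by (rule AE_PiM_component[where P="\<lambda>y. \<forall>t. summable (\<lambda>k. \<bar>gauss_coeff c k t * y k\<bar>)", OF _ i gauss_path_summable[OF c01]])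
         (rule prob_space_normal_seq)
  qed
  then have ae: "AE y in ?P. \<forall>t. (\<Sum>i<n. gauss_path c (y i) t) / sqrt (real n) = gauss_path c (?r y) t"
  proof eventually_elim
    case (elim y)
    show ?case
    proof
      fix t
      have s: "summable (\<lambda>k. gauss_coeff c k t * y i k)" if "i \<in> {..<n}" for i
        using elim that by (auto intro: summable_rabs_cancel)
      have "gauss_path c (?r y) t = (\<Sum>k. (\<Sum>i<n. gauss_coeff c k t * y i k) / sqrt (real n))"
        unfolding gauss_path_def by (simp add: sum_distrib_left)
      also have "\<dots> = (\<Sum>k. \<Sum>i<n. gauss_coeff c k t * y i k) / sqrt (real n)"
        by (rule suminf_divide) (intro summable_sum s)
      also have "(\<Sum>k. \<Sum>i<n. gauss_coeff c k t * y i k) = (\<Sum>i<n. gauss_path c (y i) t)"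
        unfolding gauss_path_def by (rule suminf_sum) (rule s)
      finally show "(\<Sum>i<n. gauss_path c (y i) t) / sqrt (real n) = gauss_path c (?r y) t" by simp
    qed
  qed
  have "(\<integral>y. exp (- (\<kappa> * (\<integral>t. ((\<Sum>i<n. gauss_path c (y i) t) / sqrt (real n))\<^sup>2 \<partial>\<nu>))) \<partial>?P)
      = (\<integral>y. exp (- (\<kappa> * (\<integral>t. (gauss_path c (?r y) t)\<^sup>2 \<partial>\<nu>))) \<partial>?P)"
  proof (rule integral_cong_AE)
    show "(\<lambda>y. exp (- (\<kappa> * (\<integral>t. ((\<Sum>i<n. gauss_path c (y i) t) / sqrt (real n))\<^sup>2 \<partial>\<nu>)))) \<in> borel_measurable ?P"
      using mm by measurable
    show "(\<lambda>y. exp (- (\<kappa> * (\<integral>t. (gauss_path c (?r y) t)\<^sup>2 \<partial>\<nu>)))) \<in> borel_measurable ?P"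
      using measurable_compose[OF rm gauss_norm_measurable] by measurable
    show "AE y in ?P. exp (- (\<kappa> * (\<integral>t. ((\<Sum>i<n. gauss_path c (y i) t) / sqrt (real n))\<^sup>2 \<partial>\<nu>)))
       = exp (- (\<kappa> * (\<integral>t. (gauss_path c (?r y) t)\<^sup>2 \<partial>\<nu>)))"
      using ae by eventually_elim simp
  qed
  also have "\<dots> = (\<integral>y. exp (- (\<kappa> * (\<integral>t. (gauss_path c y t)\<^sup>2 \<partial>\<nu>))) \<partial>distr ?P normal_seq ?r)"
    by (subst integral_distr[OF rm]) auto
  also have "distr ?P normal_seq ?r = normal_seq" by (rule distr_rotated_normal_seq[OF n])
  finally show ?thesis .
qed

text \<open>The factor \<kappa> is absorbed by scaling both fields with sqrt \<kappa>. On the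
  Gaussian side the expectation does not depend on n > 0, so the vanishing difference supplied by
  \<open>lindeberg_field\<close> becomes convergence to a known limit.\<close>

lemma score_laplace_limit:
  assumes \<kappa>: "0 \<le> \<kappa>"
  shows "(\<lambda>n. \<integral>y. exp (- (\<kappa> * (\<integral>t. ((\<Sum>i<n. score c t (y i 0)) / sqrt (real n))\<^sup>2 \<partial>\<nu>))) \<partial>PiM {..<n} (\<lambda>_. normal_seq))
     \<longlonglongrightarrow> (\<integral>y. exp (- (\<kappa> * (\<integral>t. (gauss_path c y t)\<^sup>2 \<partial>\<nu>))) \<partial>normal_seq)"
proof -
  have sc: "(\<integral>t. ((\<Sum>i<n. sqrt \<kappa> * f i t) / sqrt (real n))\<^sup>2 \<partial>\<nu>) = \<kappa> * (\<integral>t. ((\<Sum>i<n. f i t) / sqrt (real n))\<^sup>2 \<partial>\<nu>)" for n and f :: "nat \<Rightarrow> real \<Rightarrow> real"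
  proof -
    have "((\<Sum>i<n. sqrt \<kappa> * f i t) / sqrt (real n))\<^sup>2 = \<kappa> * ((\<Sum>i<n. f i t) / sqrt (real n))\<^sup>2" for t
      using \<kappa> by (simp add: sum_distrib_left[symmetric] power_mult_distrib power_divide)
    then show ?thesis by simp
  qed
  have c2: "sqrt \<kappa> * x * (sqrt \<kappa> * y) = \<kappa> * (x * y)" for x y
  proof -
    have "sqrt \<kappa> * x * (sqrt \<kappa> * y) = (sqrt \<kappa> * sqrt \<kappa>) * (x * y)" by (simp only: mult_ac)
    then show ?thesis using \<kappa> by simp
  qed
  have "(\<lambda>n. (\<integral>y. exp (- (\<integral>t. ((\<Sum>i<n. sqrt \<kappa> * score c t (y i 0)) / sqrt (real n))\<^sup>2 \<partial>\<nu>)) \<partial>PiM {..<n} (\<lambda>_. normal_seq))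
            - (\<integral>y. exp (- (\<integral>t. ((\<Sum>i<n. sqrt \<kappa> * gauss_path c (y i) t) / sqrt (real n))\<^sup>2 \<partial>\<nu>)) \<partial>PiM {..<n} (\<lambda>_. normal_seq))) \<longlonglongrightarrow> 0"
  proof (rule lindeberg_field[OF square_field_scale[OF square_field_score] square_field_scale[OF square_field_gauss]])
    show "(\<integral>y. sqrt \<kappa> * score c t (y 0) \<partial>normal_seq) = (\<integral>y. sqrt \<kappa> * gauss_path c y t \<partial>normal_seq)" for t
      using score_coord_moments(1) gauss_path_moments(1)[OF c01] by simp
    show "(\<integral>y. sqrt \<kappa> * score c s (y 0) * (sqrt \<kappa> * score c t (y 0)) \<partial>normal_seq)
       = (\<integral>y. sqrt \<kappa> * gauss_path c y s * (sqrt \<kappa> * gauss_path c y t) \<partial>normal_seq)" for s t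
      unfolding c2 using score_coord_moments(3) gauss_path_moments(3)[OF c01] by simp
  qed
  then have *: "(\<lambda>n. (\<integral>y. exp (- (\<kappa> * (\<integral>t. ((\<Sum>i<n. score c t (y i 0)) / sqrt (real n))\<^sup>2 \<partial>\<nu>))) \<partial>PiM {..<n} (\<lambda>_. normal_seq))
            - (\<integral>y. exp (- (\<kappa> * (\<integral>t. ((\<Sum>i<n. gauss_path c (y i) t) / sqrt (real n))\<^sup>2 \<partial>\<nu>))) \<partial>PiM {..<n} (\<lambda>_. normal_seq))) \<longlonglongrightarrow> 0"
    unfolding sc .
  have "(\<lambda>n. (\<integral>y. exp (- (\<kappa> * (\<integral>t. ((\<Sum>i<n. score c t (y i 0)) / sqrt (real n))\<^sup>2 \<partial>\<nu>))) \<partial>PiM {..<n} (\<lambda>_. normal_seq))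
            - (\<integral>y. exp (- (\<kappa> * (\<integral>t. (gauss_path c y t)\<^sup>2 \<partial>\<nu>))) \<partial>normal_seq)) \<longlonglongrightarrow> 0"
    by (rule Lim_transform_eventually[OF *])
       (auto intro!: eventually_mono[OF eventually_gt_at_top[of 0]] simp: gauss_laplace_invariant)
  then show ?thesis by (rule LIM_zero_cancel)
qed

end

section \<open>Transfer to the given errors\<close>

lemma indep_vars_PiM_coordinates:
  assumes P: "\<And>i. i \<in> I \<Longrightarrow> prob_space (N i)" and I: "I \<noteq> {}"
  shows "prob_space.indep_vars (PiM I N) N (\<lambda>i y. y i) I"
proof -
  interpret prob_space "PiM I N" by (rule prob_space_PiM) (rule P)
  have "distr (PiM I N) (PiM I N) (\<lambda>x. \<lambda>i\<in>I. x i) = distr (PiM I N) (PiM I N) (\<lambda>x. x)"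
    by (rule distr_cong) (auto simp: space_PiM)
  also have "\<dots> = PiM I N" by (rule distr_id)
  also have "PiM I N = PiM I (\<lambda>i. distr (PiM I N) (N i) (\<lambda>y. y i))"
    by (rule PiM_cong[OF refl], rule distr_PiM_component[OF P, symmetric]) auto
  finally show ?thesis
    by (subst indep_vars_iff_distr_eq_PiM'[OF I]) (auto intro: measurable_component_singleton)
qed

lemma normal_sample_expectation:
  fixes e :: "nat \<Rightarrow> 'a \<Rightarrow> real" and \<Phi> :: "(nat \<Rightarrow> real) \<Rightarrow> real"
  assumes M: "prob_space M" and ind: "prob_space.indep_vars M (\<lambda>_. borel) e {..<n}" and n: "n > 0"
    and e: "\<And>i. i < n \<Longrightarrow> distr M borel (e i) = std_normal_distribution"
    and \<Phi>: "\<Phi> \<in> borel_measurable (PiM {..<n} (\<lambda>_. borel))"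
  shows "(\<integral>\<omega>. \<Phi> (\<lambda>i\<in>{..<n}. e i \<omega>) \<partial>M) = (\<integral>x. \<Phi> x \<partial>PiM {..<n} (\<lambda>_. std_normal_distribution))"
proof -
  interpret prob_space M by fact
  have ne: "{..<n} \<noteq> {}" using n by auto
  have m: "e i \<in> borel_measurable M" if "i \<in> {..<n}" for i using ind that by (auto simp: indep_vars_def)
  have "distr M (PiM {..<n} (\<lambda>_. borel)) (\<lambda>\<omega>. \<lambda>i\<in>{..<n}. e i \<omega>) = PiM {..<n} (\<lambda>i. distr M borel (e i))"
    using indep_vars_iff_distr_eq_PiM'[where I="{..<n}" and M'="\<lambda>_. borel" and X=e, OF ne m] ind by simp
  also have "\<dots> = PiM {..<n} (\<lambda>_. std_normal_distribution)"
    by (rule PiM_cong) (auto simp: e)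
  finally have d: "distr M (PiM {..<n} (\<lambda>_. borel)) (\<lambda>\<omega>. \<lambda>i\<in>{..<n}. e i \<omega>) = PiM {..<n} (\<lambda>_. std_normal_distribution)" .
  have "(\<lambda>\<omega>. \<lambda>i\<in>{..<n}. e i \<omega>) \<in> measurable M (PiM {..<n} (\<lambda>_. borel))"
    by (rule measurable_restrict) (rule m)
  from integral_distr[OF this \<Phi>] show ?thesis unfolding d by simp
qed

text \<open>The coordinates \<open>y i 0\<close> and the errors \<open>e i\<close> are both
  independent standard normal samples, so every measurable functional of the first n of them has the
  same expectation for both.\<close>

lemma (in weight_measure) score_statistic_laplace:
  fixes e :: "nat \<Rightarrow> 'a \<Rightarrow> real"
  assumes M: "prob_space M" and ind: "prob_space.indep_vars M (\<lambda>_. borel) e UNIV"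
    and e: "\<And>i. distr M borel (e i) = std_normal_distribution" and \<kappa>: "0 \<le> \<kappa>"
  shows "(\<lambda>n. \<integral>\<omega>. exp (- (\<kappa> * (\<integral>t. ((\<Sum>i<n. score c t (e i \<omega>)) / sqrt (real n))\<^sup>2 \<partial>\<nu>))) \<partial>M)
     \<longlonglongrightarrow> (\<integral>y. exp (- (\<kappa> * (\<integral>t. (gauss_path c y t)\<^sup>2 \<partial>\<nu>))) \<partial>normal_seq)"
proof (rule Lim_transform_eventually[OF score_laplace_limit[OF \<kappa>]])
  have "(\<integral>y. exp (- (\<kappa> * (\<integral>t. ((\<Sum>i<n. score c t (y i 0)) / sqrt (real n))\<^sup>2 \<partial>\<nu>))) \<partial>PiM {..<n} (\<lambda>_. normal_seq))
    = (\<integral>\<omega>. exp (- (\<kappa> * (\<integral>t. ((\<Sum>i<n. score c t (e i \<omega>)) / sqrt (real n))\<^sup>2 \<partial>\<nu>))) \<partial>M)" if n: "n > 0" for n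
  proof -
    let ?P = "PiM {..<n} (\<lambda>_. normal_seq)"
    define \<Phi> where "\<Phi> x = exp (- (\<kappa> * (\<integral>t. ((\<Sum>i<n. score c t (x i)) / sqrt (real n))\<^sup>2 \<partial>\<nu>)))" for x
    have ne: "{..<n} \<noteq> {}" using n by auto
    have \<Phi>: "\<Phi> \<in> borel_measurable (PiM {..<n} (\<lambda>_. borel))"
    proof -
      have "(\<lambda>(x, t). score c t (x i)) \<in> borel_measurable (PiM {..<n} (\<lambda>_. borel) \<Otimes>\<^sub>M borel)" if "i \<in> {..<n}" for i
      proof -
        have [measurable]: "(\<lambda>x. x i) \<in> borel_measurable (PiM {..<n} (\<lambda>_. borel :: real measure))"
          by (rule measurable_component_singleton) (rule that)
        show ?thesis unfolding score_def by measurable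
      qed
      then have "(\<lambda>(x, t). ((\<Sum>i<n. score c t (x i)) / sqrt (real n))\<^sup>2) \<in> borel_measurable (PiM {..<n} (\<lambda>_. borel) \<Otimes>\<^sub>M borel)"
        unfolding case_prod_beta' by (intro borel_measurable_power borel_measurable_divide borel_measurable_sum borel_measurable_const)
      then have "(\<lambda>(x, t). ((\<Sum>i<n. score c t (x i)) / sqrt (real n))\<^sup>2) \<in> borel_measurable (PiM {..<n} (\<lambda>_. borel) \<Otimes>\<^sub>M \<nu>)"
        by (simp only: measurable_cong_sets[OF borel_pair_\<nu> refl])
      from \<nu>.borel_measurable_lebesgue_integral[OF this]
      have [measurable]: "(\<lambda>x. \<integral>t. ((\<Sum>i<n. score c t (x i)) / sqrt (real n))\<^sup>2 \<partial>\<nu>) \<in> borel_measurable (PiM {..<n} (\<lambda>_. borel))" .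
      show ?thesis unfolding \<Phi>_def by measurable
    qed
    \<comment> \<open>Points of the finite product space are extensional functions, while the
      statistic is written with plain sequences; \<Phi> looks only at indices below n.\<close>
    have r: "\<Phi> (\<lambda>i\<in>{..<n}. x i) = \<Phi> x" for x
    proof -
      have "(\<Sum>i<n. score c t (restrict x {..<n} i)) = (\<Sum>i<n. score c t (x i))" for t
        by (rule sum.cong) simp_all
      then show ?thesis unfolding \<Phi>_def by (simp only:)
    qed
    interpret P: prob_space ?P by (rule prob_space_PiM) (rule prob_space_normal_seq)
    interpret M: prob_space M by fact
    have "P.indep_vars (\<lambda>_. normal_seq) (\<lambda>i y. y i) {..<n}"
      by (rule indep_vars_PiM_coordinates) (use prob_space_normal_seq ne in auto)
    then have iP: "P.indep_vars (\<lambda>_. borel) (\<lambda>i y. y i 0) {..<n}"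
      by (rule P.indep_vars_compose2[where Y="\<lambda>i y. y 0"]) (rule normal_coord_measurable)
    have dP: "distr ?P borel (\<lambda>y. y i 0) = std_normal_distribution" if i: "i < n" for i
    proof -
      have "distr ?P borel (\<lambda>y. y i 0) = distr (distr ?P normal_seq (\<lambda>y. y i)) borel (\<lambda>y. y 0)"
        by (subst distr_distr) (use i in \<open>auto simp: comp_def intro: measurable_component_singleton\<close>)
      also have "distr ?P normal_seq (\<lambda>y. y i) = normal_seq"
        by (rule distr_PiM_component) (use i prob_space_normal_seq in auto)
      finally show ?thesis by (simp add: distr_normal_coord)
    qed
    have "(\<integral>y. \<Phi> (\<lambda>i\<in>{..<n}. y i 0) \<partial>?P) = (\<integral>\<omega>. \<Phi> (\<lambda>i\<in>{..<n}. e i \<omega>) \<partial>M)"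
      using normal_sample_expectation[OF P.prob_space_axioms iP n dP \<Phi>]
        normal_sample_expectation[OF M M.indep_vars_subset[OF ind] n e \<Phi>] by simp
    then have "(\<integral>y. \<Phi> (\<lambda>i. y i 0) \<partial>?P) = (\<integral>\<omega>. \<Phi> (\<lambda>i. e i \<omega>) \<partial>M)" by (simp only: r)
    then show ?thesis unfolding \<Phi>_def .
  qed
  then show "\<forall>\<^sub>F n in sequentially.
    (\<integral>y. exp (- (\<kappa> * (\<integral>t. ((\<Sum>i<n. score c t (y i 0)) / sqrt (real n))\<^sup>2 \<partial>\<nu>))) \<partial>PiM {..<n} (\<lambda>_. normal_seq))
    = (\<integral>\<omega>. exp (- (\<kappa> * (\<integral>t. ((\<Sum>i<n. score c t (e i \<omega>)) / sqrt (real n))\<^sup>2 \<partial>\<nu>))) \<partial>M)"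
    by (rule eventually_mono[OF eventually_gt_at_top[of 0]])
qed

subsection \<open>A normal sequence on the real line\<close>

text \<open>A real sequence is coded by the bits telling which rationals lie below its terms, and the bits by a
  decimal expansion with digits 0 and 1, which can be decoded measurably.\<close>

definition bit_code :: "(nat \<Rightarrow> bool) \<Rightarrow> real" where
  "bit_code b = (\<Sum>m. of_bool (b m) / 10 ^ Suc m)"

primrec digit_rem :: "nat \<Rightarrow> real \<Rightarrow> real" where
  "digit_rem 0 x = x"
| "digit_rem (Suc m) x = frac (10 * digit_rem m x)"

lemma geometric_tenth: "(\<lambda>m. 1 / 10 ^ Suc m :: real) sums (1 / 9)"
  using sums_mult[OF geometric_sums[of "1/10 :: real"], of "1/10"] by (simp add: power_divide)

lemma summable_bit_code: "summable (\<lambda>m. of_bool (b m) / 10 ^ Suc m :: real)"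
  by (rule summable_comparison_test'[OF sums_summable[OF geometric_tenth], of 0]) (simp add: divide_right_mono)

lemma bit_code_range: "0 \<le> bit_code b" "bit_code b < 1"
proof -
  show "0 \<le> bit_code b" unfolding bit_code_def by (rule suminf_nonneg[OF summable_bit_code]) simp
  have "bit_code b \<le> (\<Sum>m. 1 / 10 ^ Suc m)" unfolding bit_code_def
    by (rule suminf_le[OF _ summable_bit_code sums_summable[OF geometric_tenth]]) (simp add: divide_right_mono)
  also have "\<dots> = 1 / 9" using sums_unique[OF geometric_tenth] by simp
  finally show "bit_code b < 1" by simp
qed

lemma bit_code_shift: "10 * bit_code b = of_bool (b 0) + bit_code (\<lambda>m. b (Suc m))"
proof -
  have "bit_code b = of_bool (b 0) / 10 + (\<Sum>m. of_bool (b (Suc m)) / 10 ^ Suc (Suc m))"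
    unfolding bit_code_def using suminf_split_head[OF summable_bit_code[of b]] by simp
  also have "(\<Sum>m. of_bool (b (Suc m)) / 10 ^ Suc (Suc m)) = (\<Sum>m. of_bool (b (Suc m)) / 10 ^ Suc m) / (10::real)"
    using suminf_divide[OF summable_bit_code[of "\<lambda>m. b (Suc m)"], of 10] by (simp add: mult.commute)
  finally show ?thesis by (simp add: bit_code_def)
qed

lemma digit_rem_bit_code: "digit_rem m (bit_code b) = bit_code (\<lambda>j. b (m + j))"
proof (induction m)
  case (Suc m)
  have "frac (10 * bit_code (\<lambda>j. b (m + j))) = bit_code (\<lambda>j. b (Suc m + j))"
    unfolding bit_code_shift using bit_code_range[of "\<lambda>j. b (Suc (m + j))"]
    by (auto simp: frac_unique_iff)
  then show ?case using Suc by simp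
qed simp

text \<open>With digits 0 and 1 in base ten every tail is at most 1/9, so after multiplication by
  ten the leading digit is the integer part and no carry can occur.\<close>

lemma bit_code_decode: "1 \<le> 10 * digit_rem m (bit_code b) \<longleftrightarrow> b m"
  using bit_code_range[of "\<lambda>j. b (Suc (m + j))"] by (simp add: digit_rem_bit_code bit_code_shift)

lemma digit_rem_measurable[measurable]: "digit_rem m \<in> borel_measurable borel"
  by (induction m) (auto simp: frac_def intro!: borel_measurable_diff borel_measurable_times measurable_compose[OF _ borel_measurable_real_floor])

definition code_seq :: "(nat \<Rightarrow> real) \<Rightarrow> real" where
  "code_seq y = bit_code (\<lambda>m. real_of_rat (from_nat (snd (prod_decode m))) < y (fst (prod_decode m)))"

text \<open>A real number is recovered as the supremum of the rationals below it. In the extended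
  reals this countable supremum exists for every input, which makes the decoder total and
  measurable; on codes its value is finite.\<close>

definition decode_seq :: "real \<Rightarrow> nat \<Rightarrow> real" where
  "decode_seq x k = real_of_ereal (SUP q. if 1 \<le> 10 * digit_rem (prod_encode (k, q)) x
     then ereal (real_of_rat (from_nat q)) else - \<infinity>)"

lemma decode_code_seq: "decode_seq (code_seq y) = y"
proof
  fix k
  have "(SUP q. if real_of_rat (from_nat q) < y k then ereal (real_of_rat (from_nat q)) else - \<infinity>) = ereal (y k)"
  proof (rule antisym)
    show "ereal (y k) \<le> (SUP q. if real_of_rat (from_nat q) < y k then ereal (real_of_rat (from_nat q)) else - \<infinity>)"
      unfolding le_SUP_iff
    proof (intro allI impI)
      fix w assume "w < ereal (y k)"
      then obtain r where r: "w < ereal r" "ereal r < ereal (y k)" using ereal_dense2 by blast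
      then obtain q :: rat where q: "r < of_rat q" "of_rat q < y k" using of_rat_dense[of r "y k"] by auto
      have "w < (if real_of_rat (from_nat (to_nat q)) < y k then ereal (real_of_rat (from_nat (to_nat q))) else - \<infinity>)"
        using q r(1) less_trans[of w "ereal r" "ereal (of_rat q)"] by simp
      then show "\<exists>q\<in>UNIV. w < (if real_of_rat (from_nat q) < y k then ereal (real_of_rat (from_nat q)) else - \<infinity>)" by blast
    qed
    show "(SUP q. if real_of_rat (from_nat q) < y k then ereal (real_of_rat (from_nat q)) else - \<infinity>) \<le> ereal (y k)"
      by (rule SUP_least) simp
  qed
  then show "decode_seq (code_seq y) k = y k"
    by (simp add: decode_seq_def code_seq_def bit_code_decode)
qed

lemma code_seq_measurable: "code_seq \<in> borel_measurable normal_seq"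
  unfolding code_seq_def bit_code_def by measurable

lemma decode_seq_measurable: "decode_seq \<in> measurable borel normal_seq"
proof (rule measurable_into_normal_seq)
  show "(\<lambda>x. decode_seq x k) \<in> borel_measurable borel" for k
    unfolding decode_seq_def by measurable
qed

text \<open>The limit process is to live on a probability measure over the reals, so the law of the
  code of a normal sequence serves as that measure and decoding recovers the sequence.\<close>

lemma normal_seq_on_reals:
  obtains N :: "real measure" where "prob_space N" "decode_seq \<in> measurable N normal_seq"
    "distr N normal_seq decode_seq = normal_seq"
proof
  interpret prob_space normal_seq by (rule prob_space_normal_seq)
  show "prob_space (distr normal_seq borel code_seq)" by (rule prob_space_distr) (rule code_seq_measurable)
  show m: "decode_seq \<in> measurable (distr normal_seq borel code_seq) normal_seq"
    using decode_seq_measurable by simp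
  have "distr (distr normal_seq borel code_seq) normal_seq decode_seq = distr normal_seq normal_seq (\<lambda>y. y)"
    by (subst distr_distr[OF decode_seq_measurable code_seq_measurable]) (simp add: comp_def decode_code_seq)
  then show "distr (distr normal_seq borel code_seq) normal_seq decode_seq = normal_seq" by simp
qed

lemma gaussian_process_transfer:
  assumes N: "prob_space N" and f: "f \<in> measurable N normal_seq" and d: "distr N normal_seq f = normal_seq"
    and c: "c \<in> {0, 1}"
  shows "centred_gaussian_process N (\<lambda>t \<omega>. gauss_path c (f \<omega>) t) (score_cov c)"
    and "(\<lambda>(\<omega>, t). gauss_path c (f \<omega>) t) \<in> borel_measurable (N \<Otimes>\<^sub>M lborel)"
proof -
  interpret prob_space N by fact
  have m: "(\<lambda>\<omega>. gauss_path c (f \<omega>) t) \<in> borel_measurable N" for t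
    by (rule measurable_compose[OF f gauss_path_coord_measurable])
  show "centred_gaussian_process N (\<lambda>t \<omega>. gauss_path c (f \<omega>) t) (score_cov c)"
    unfolding centred_gaussian_process_def Let_def
  proof (intro conjI allI impI N m)
    fix I :: "real set" and w :: "real \<Rightarrow> real" assume I: "finite I"
    let ?v = "\<Sum>s\<in>I. \<Sum>t\<in>I. w s * w t * score_cov c s t"
    let ?Z = "\<lambda>\<omega>. \<Sum>t\<in>I. w t * gauss_path c (f \<omega>) t"
    note G = distr_gauss_combination[OF c I, of w]
    have mZ: "(\<lambda>y. \<Sum>t\<in>I. w t * gauss_path c y t) \<in> borel_measurable normal_seq" by measurable
    have "distr N borel ?Z = distr (distr N normal_seq f) borel (\<lambda>y. \<Sum>t\<in>I. w t * gauss_path c y t)"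
      by (subst distr_distr[OF mZ f]) (simp add: comp_def)
    also have "\<dots> = distr std_normal_distribution borel (\<lambda>x. sqrt ?v * x)" unfolding d by (rule G(1))
    finally have dZ: "distr N borel ?Z = distr std_normal_distribution borel (\<lambda>x. sqrt ?v * x)" .
    show "if ?v = 0 then AE \<omega> in N. ?Z \<omega> = 0 else distributed N lborel ?Z (normal_density 0 (sqrt ?v))"
    proof (cases "?v = 0")
      case True
      have "AE y in distr N normal_seq f. (\<Sum>t\<in>I. w t * gauss_path c y t) = 0" unfolding d by (rule G(3)[OF True])
      from AE_distrD[OF f this] show ?thesis using True by simp
    next
      case False
      then have "?v > 0" using G(2) by simp
      from distr_scaled_normal_moments(4)[OF _ dZ G(2) this] show ?thesis
        using False m by (auto intro!: borel_measurable_sum borel_measurable_times)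
    qed
  qed
  have "(\<lambda>(\<omega>, t). (f \<omega>, t)) \<in> measurable (N \<Otimes>\<^sub>M lborel) (normal_seq \<Otimes>\<^sub>M borel)"
    using f by measurable
  from measurable_compose[OF this gauss_path_measurable]
  show "(\<lambda>(\<omega>, t). gauss_path c (f \<omega>) t) \<in> borel_measurable (N \<Otimes>\<^sub>M lborel)" by (simp add: case_prod_beta')
qed

subsection \<open>Taylor expansion of the residual process\<close>

definition mean_upto :: "nat \<Rightarrow> (nat \<Rightarrow> 'v::real_vector) \<Rightarrow> 'v" where
  "mean_upto n f = (\<Sum>j<n. f j) /\<^sub>R real n"

lemma mean_upto_add: "mean_upto n (\<lambda>j. f j + g j) = mean_upto n f + mean_upto n g"
  by (simp add: mean_upto_def sum.distrib scaleR_add_right)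

lemma mean_upto_diff: "mean_upto n (\<lambda>j. f j - g j) = mean_upto n f - mean_upto n g"
  by (simp add: mean_upto_def sum_subtractf scaleR_diff_right)

lemma mean_upto_const: "n > 0 \<Longrightarrow> mean_upto n (\<lambda>j. c) = c"
  by (simp add: mean_upto_def scaleR_conv_of_real flip: of_nat_sum) (simp add: sum_constant_scaleR)

lemma mean_upto_linear: "linear h \<Longrightarrow> h (mean_upto n f) = mean_upto n (\<lambda>j. h (f j))"
  by (simp add: mean_upto_def linear_scale linear_sum)

lemma mean_upto_mult: "mean_upto n (\<lambda>j. c * f j) = c * mean_upto n f" for c :: real
  by (simp add: mean_upto_def sum_distrib_left[symmetric] mult.left_commute)

lemma mean_upto_mono: "(\<And>j. j < n \<Longrightarrow> f j \<le> g j) \<Longrightarrow> mean_upto n f \<le> (mean_upto n g :: real)"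
  unfolding mean_upto_def by (intro scaleR_left_mono sum_mono) auto

lemma abs_mean_upto_le: "\<bar>mean_upto n f\<bar> \<le> mean_upto n (\<lambda>j. \<bar>f j\<bar>)" for f :: "nat \<Rightarrow> real"
proof -
  have "\<bar>\<Sum>j<n. f j\<bar> \<le> (\<Sum>j<n. \<bar>f j\<bar>)" by (rule sum_abs)
  then show ?thesis by (simp add: mean_upto_def abs_mult mult_left_mono)
qed

lemma abs_add_le_add: "\<bar>x\<bar> \<le> p \<Longrightarrow> \<bar>y\<bar> \<le> q \<Longrightarrow> \<bar>x + y\<bar> \<le> p + q" for x y p q :: real
  by linarith

lemma abs_diff_le_add: "\<bar>x\<bar> \<le> p \<Longrightarrow> \<bar>y\<bar> \<le> q \<Longrightarrow> \<bar>x - y\<bar> \<le> p + q" for x y p q :: real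
  by linarith

text \<open>\<open>ker\<close> is sin + cos without its linear part. Its derivative
  \<open>ker'\<close> then vanishes at 0 and satisfies |ker' y| \<le> 2 |y|, so a first order term t
  * \<delta> * ker' (t * x) carries two factors t.\<close>

definition ker :: "real \<Rightarrow> real" where "ker y = sin y + cos y - y"
definition ker' :: "real \<Rightarrow> real" where "ker' y = cos y - sin y - 1"

text \<open>The second derivative -sin - cos is at most 2 in absolute value, and the Taylor formula
  halves it.\<close>

lemma ker_taylor: "\<bar>ker (y + d) - ker y - d * ker' y\<bar> \<le> d\<^sup>2"
proof -
  define diff where "diff m x = (if m = 0 then ker (y + x) else if m = 1 then ker' (y + x) else - sin (y + x) - cos (y + x))" for m :: nat and x
  have der: "\<forall>m t. m < 2 \<and> \<bar>t\<bar> \<le> \<bar>d\<bar> \<longrightarrow> DERIV (diff m) t :> diff (Suc m) t"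
  proof (intro allI impI)
    fix m :: nat and t :: real assume "m < 2 \<and> \<bar>t\<bar> \<le> \<bar>d\<bar>"
    then have "m = 0 \<or> m = 1" by auto
    then show "DERIV (diff m) t :> diff (Suc m) t"
      by (elim disjE) (auto simp: diff_def[abs_def] ker_def ker'_def intro!: derivative_eq_intros)
  qed
  obtain t where "diff 0 d = (\<Sum>m<2. diff m 0 / fact m * d ^ m) + diff 2 t / fact 2 * d ^ 2"
    using Maclaurin_bi_le[of diff "diff 0" 2 d, OF refl der] by blast
  then have e: "ker (y + d) - ker y - d * ker' y = (- sin (y + t) - cos (y + t)) / 2 * d\<^sup>2"
    by (simp add: diff_def numeral_2_eq_2)
  have "\<bar>- sin (y + t) - cos (y + t)\<bar> \<le> 2"
    using abs_sin_le_one[of "y + t"] abs_cos_le_one[of "y + t"] by linarith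
  then have "\<bar>(- sin (y + t) - cos (y + t)) / 2\<bar> * d\<^sup>2 \<le> 1 * d\<^sup>2" by (intro mult_right_mono) auto
  then show ?thesis unfolding e abs_mult by simp
qed

lemma abs_ker'_le: "\<bar>ker' y\<bar> \<le> 2 * \<bar>y\<bar>" "\<bar>ker' y\<bar> \<le> 3"
proof -
  have "1 - cos y = 2 * (sin (y/2))\<^sup>2" using cos_double_sin[of "y/2"] by simp
  moreover have "(sin (y/2))\<^sup>2 \<le> \<bar>sin (y/2)\<bar> * 1"
    unfolding power2_eq_square abs_mult_self_eq[of "sin (y/2)", symmetric] by (intro mult_left_mono) auto
  moreover have "\<bar>sin (y/2)\<bar> \<le> \<bar>y/2\<bar>" by (rule abs_sin_x_le_abs_x)
  ultimately have "\<bar>1 - cos y\<bar> \<le> \<bar>y\<bar>" using cos_le_one[of y] by simp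
  then show "\<bar>ker' y\<bar> \<le> 2 * \<bar>y\<bar>" unfolding ker'_def using abs_sin_x_le_abs_x[of y] by linarith
  show "\<bar>ker' y\<bar> \<le> 3" unfolding ker'_def using abs_sin_le_one[of y] abs_cos_le_one[of y] by linarith
qed

lemma ker'_measurable[measurable]: "ker' \<in> borel_measurable borel"
  unfolding ker'_def by measurable

lemma one_minus_phi1_times_le: "(1 - phi1 t) * \<bar>t\<bar> \<le> t\<^sup>2"
proof (cases "\<bar>t\<bar> \<le> 1")
  case True
  have "(1 - phi1 t) * \<bar>t\<bar> \<le> t\<^sup>2 * 1" using phi1_simps(3,4)[of t] one_minus_phi1_le[of t] True by (intro mult_mono) auto
  then show ?thesis by simp
next
  case False
  have "(1 - phi1 t) * \<bar>t\<bar> \<le> \<bar>t\<bar> * \<bar>t\<bar>" using phi1_simps(3,4)[of t] False by (intro mult_right_mono) auto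
  then show ?thesis by (simp add: power2_eq_square)
qed

lemma ker'_mean: "has_std_normal_mean (\<lambda>x. ker' (t * x)) (phi1 t - 1)"
  and x_ker'_mean: "has_std_normal_mean (\<lambda>x. x * ker' (t * x)) (- (t * phi1 t))"
proof -
  have "has_std_normal_mean (\<lambda>x. cos (t * x) - sin (t * x) - 1) (phi1 t - 0 - 1)" by (intro has_mean_intros)
  then show "has_std_normal_mean (\<lambda>x. ker' (t * x)) (phi1 t - 1)" by (simp add: ker'_def)
  have "has_std_normal_mean (\<lambda>x. x * cos (t * x) - x * sin (t * x) - x) (0 - t * phi1 t - 0)" by (intro has_mean_intros)
  then show "has_std_normal_mean (\<lambda>x. x * ker' (t * x)) (- (t * phi1 t))"
    by (simp add: ker'_def right_diff_distrib)
qed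

text \<open>Since the linear part of \<open>sin + cos\<close> is split off into \<open>\<rho>\<close>, every remaining term carries a factor \<open>t\<^sup>2\<close>, which is what a weight with only a fourth
  moment can absorb.\<close>

lemma residual_expansion_bound:
  fixes e :: "nat \<Rightarrow> real" and X :: "nat \<Rightarrow> 'h::real_inner" and b xb :: 'h and \<kappa> m t :: real
  assumes n: "n > 0"
  defines "r \<equiv> \<lambda>j. \<kappa> * (e j - m - inner (X j - xb) b)"
  defines "\<delta> \<equiv> \<lambda>j. r j - e j"
  defines "\<rho> \<equiv> mean_upto n r - mean_upto n e + m"
  defines "s2 \<equiv> mean_upto n (\<lambda>j. (e j)\<^sup>2 - 1)"
  defines "A1 \<equiv> mean_upto n (\<lambda>j. e j * ker' (t * e j) + t * phi1 t)"
  defines "A2 \<equiv> mean_upto n (\<lambda>j. ker' (t * e j) - (phi1 t - 1))"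
  defines "A3 \<equiv> mean_upto n (\<lambda>j. (ker' (t * e j) - (phi1 t - 1)) *\<^sub>R X j)"
  defines "N \<equiv> sqrt (real n)"
  shows "\<bar>N * (mean_upto n (\<lambda>j. sin (t * r j) + cos (t * r j)) - phi1 t)
     - N * (mean_upto n (\<lambda>j. sin (t * e j) + cos (t * e j)) - phi1 t - t * phi1 t * m + t\<^sup>2 / 2 * phi1 t * s2)\<bar>
   \<le> \<bar>t\<bar> * \<bar>N * \<rho>\<bar>
     + t\<^sup>2 * (\<bar>N * (\<kappa> - 1) + N * s2 / 2\<bar> + \<bar>\<kappa> - 1\<bar> * \<bar>N * m\<bar> + \<bar>\<kappa>\<bar> * norm b * (N * norm (mean_upto n X - xb))
          + N * mean_upto n (\<lambda>j. (\<delta> j)\<^sup>2))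
     + (N * \<bar>t * A1\<bar>) * \<bar>\<kappa> - 1\<bar> + (N * \<bar>t * A2\<bar>) * (\<bar>\<kappa>\<bar> * \<bar>m\<bar> + \<bar>\<kappa>\<bar> * norm b * norm xb)
     + (N * norm (t *\<^sub>R A3)) * (\<bar>\<kappa>\<bar> * norm b)"
    (is "\<bar>?D\<bar> \<le> ?B")
proof -
  let ?c = "phi1 t - 1"
  have N0: "N \<ge> 0" by (simp add: N_def)
  have p: "0 < phi1 t" "phi1 t \<le> 1" using phi1_simps by auto
  have c_le: "\<bar>t\<bar> * \<bar>?c\<bar> \<le> t\<^sup>2" using one_minus_phi1_times_le[of t] p by (simp add: mult.commute)
  \<comment> \<open>The averaged second order remainder. The first order terms in \<delta> are kept
    exactly, since they contribute at the order of the statistic.\<close>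
  define Rm where "Rm = mean_upto n (\<lambda>j. ker (t * r j) - ker (t * e j) - (t * \<delta> j) * ker' (t * e j))"
  have Rm: "\<bar>Rm\<bar> \<le> t\<^sup>2 * mean_upto n (\<lambda>j. (\<delta> j)\<^sup>2)"
  proof -
    have "\<bar>Rm\<bar> \<le> mean_upto n (\<lambda>j. \<bar>ker (t * r j) - ker (t * e j) - (t * \<delta> j) * ker' (t * e j)\<bar>)"
      unfolding Rm_def by (rule abs_mean_upto_le)
    also have "\<dots> \<le> mean_upto n (\<lambda>j. t\<^sup>2 * (\<delta> j)\<^sup>2)"
    proof (rule mean_upto_mono)
      fix j
      have "t * r j = t * e j + t * \<delta> j" by (simp add: \<delta>_def algebra_simps)
      then show "\<bar>ker (t * r j) - ker (t * e j) - (t * \<delta> j) * ker' (t * e j)\<bar> \<le> t\<^sup>2 * (\<delta> j)\<^sup>2"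
        using ker_taylor[of "t * e j" "t * \<delta> j"] by (simp add: power_mult_distrib)
    qed
    finally show ?thesis by (simp add: mean_upto_mult)
  qed
  have \<delta>: "\<delta> j = (\<kappa> - 1) * e j - \<kappa> * m - \<kappa> * inner (X j - xb) b" for j
    by (simp add: \<delta>_def r_def algebra_simps)
  have A1: "mean_upto n (\<lambda>j. e j * ker' (t * e j)) = A1 - t * phi1 t"
    unfolding A1_def mean_upto_add using n by (simp add: mean_upto_const)
  have A2: "mean_upto n (\<lambda>j. ker' (t * e j)) = A2 + ?c"
    unfolding A2_def mean_upto_diff using n by (simp add: mean_upto_const)
  have A3: "mean_upto n (\<lambda>j. ker' (t * e j) *\<^sub>R (X j - xb)) = A3 - A2 *\<^sub>R xb + ?c *\<^sub>R (mean_upto n X - xb)"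
  proof -
    have "ker' (t * e j) *\<^sub>R (X j - xb) = (ker' (t * e j) - ?c) *\<^sub>R X j - (ker' (t * e j) - ?c) *\<^sub>R xb + ?c *\<^sub>R (X j - xb)" for j
      by (simp add: algebra_simps)
    moreover have "mean_upto n (\<lambda>j. (ker' (t * e j) - ?c) *\<^sub>R xb) = A2 *\<^sub>R xb"
      unfolding A2_def by (rule mean_upto_linear[symmetric]) (rule linear_scaleR_left)
    moreover have "mean_upto n (\<lambda>j. ?c *\<^sub>R (X j - xb)) = ?c *\<^sub>R (mean_upto n X - xb)"
      using mean_upto_linear[OF linear_scaleR, of ?c n "\<lambda>j. X j - xb"] n
      by (simp only: mean_upto_diff mean_upto_const)
    ultimately show ?thesis by (simp only: mean_upto_add mean_upto_diff A3_def)
  qed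
  \<comment> \<open>Each mean of a function of the errors is split into its centred version
    \<open>A1\<close>, \<open>A2\<close> or \<open>A3\<close> and its expectation. Only
    \<open>A3\<close> meets the direction \<open>b\<close>, by an inner product, so the
    sample-dependent \<open>b\<close> can later be separated by Cauchy-Schwarz.\<close>
  have S: "mean_upto n (\<lambda>j. (t * \<delta> j) * ker' (t * e j))
     = t * ((\<kappa> - 1) * (A1 - t * phi1 t) - \<kappa> * m * (A2 + ?c) - \<kappa> * inner (A3 - A2 *\<^sub>R xb + ?c *\<^sub>R (mean_upto n X - xb)) b)"
  proof -
    have "(t * \<delta> j) * ker' (t * e j) = t * ((\<kappa> - 1) * (e j * ker' (t * e j)) - \<kappa> * m * ker' (t * e j) - \<kappa> * inner (ker' (t * e j) *\<^sub>R (X j - xb)) b)" for j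
      unfolding \<delta> by (simp add: algebra_simps)
    moreover have "mean_upto n (\<lambda>j. inner (ker' (t * e j) *\<^sub>R (X j - xb)) b) = inner (A3 - A2 *\<^sub>R xb + ?c *\<^sub>R (mean_upto n X - xb)) b"
      unfolding A3[symmetric] by (rule mean_upto_linear[symmetric]) (simp add: linear_iff inner_add_left)
    ultimately show ?thesis by (simp only: mean_upto_mult mean_upto_diff A1 A2)
  qed
  have K: "mean_upto n (\<lambda>j. sin (t * z j) + cos (t * z j)) = mean_upto n (\<lambda>j. ker (t * z j)) + t * mean_upto n z" for z
    by (simp add: ker_def mean_upto_diff mean_upto_add mean_upto_mult)
  have RmS: "mean_upto n (\<lambda>j. ker (t * r j)) - mean_upto n (\<lambda>j. ker (t * e j)) = Rm + mean_upto n (\<lambda>j. (t * \<delta> j) * ker' (t * e j))"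
    unfolding Rm_def mean_upto_diff by simp
  \<comment> \<open>Two cancellations are visible here. The expectation -t * phi1 t in
    \<open>A1\<close>, multiplied by t (\<kappa> - 1), meets t^2 / 2 * phi1 t * s2 and leaves
    \<kappa> - 1 + s2 / 2, which is small because \<kappa> is approximately 1 - s2 / 2. The two
    terms with \<open>?c * m\<close> combine to the factor \<kappa> - 1.\<close>
  have D: "?D = t * (N * \<rho>) + N * Rm - t\<^sup>2 * phi1 t * (N * (\<kappa> - 1) + N * s2 / 2) - (t * ?c) * ((\<kappa> - 1) * (N * m))
      - \<kappa> * (t * ?c) * (N * inner (mean_upto n X - xb) b)
      + (N * (t * A1)) * (\<kappa> - 1) - (N * (t * A2)) * (\<kappa> * m) + (N * (t * A2)) * (\<kappa> * inner xb b)
      - N * inner (t *\<^sub>R A3) b * \<kappa>"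
  proof -
    have D1: "?D = N * (t * \<rho> + Rm + mean_upto n (\<lambda>j. (t * \<delta> j) * ker' (t * e j)) + t * ?c * m - t\<^sup>2 / 2 * phi1 t * s2)"
    unfolding K \<rho>_def using RmS by (simp add: algebra_simps)
    have ring: "h * (x * r' + R + x * (k1 * (a1 - x * p') - k * m' * (a2 + c') - k * (i1 - a2 * i2 + c' * i3)) + x * c' * m' - x\<^sup>2 / 2 * p' * q)
      = x * (h * r') + h * R - x\<^sup>2 * p' * (h * k1 + h * q / 2) - (x * c') * (k1 * (h * m')) - k * (x * c') * (h * i3)
      + (h * (x * a1)) * k1 - (h * (x * a2)) * (k * m') + (h * (x * a2)) * (k * i2) - h * (x * i1) * k"
      if "k1 = k - 1" for h x r' R k k1 a1 a2 p' m' c' i1 i2 i3 q :: real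
      unfolding that by (simp add: algebra_simps power2_eq_square)
    show ?thesis
      unfolding D1 S inner_add_left inner_diff_left inner_scaleR_left by (rule ring[OF refl])
  qed
  have "\<bar>?D\<bar> \<le> \<bar>t\<bar> * \<bar>N * \<rho>\<bar> + N * (t\<^sup>2 * mean_upto n (\<lambda>j. (\<delta> j)\<^sup>2)) + t\<^sup>2 * \<bar>N * (\<kappa> - 1) + N * s2 / 2\<bar>
      + t\<^sup>2 * (\<bar>\<kappa> - 1\<bar> * \<bar>N * m\<bar>) + t\<^sup>2 * (\<bar>\<kappa>\<bar> * norm b * (N * norm (mean_upto n X - xb)))
      + (N * \<bar>t * A1\<bar>) * \<bar>\<kappa> - 1\<bar> + (N * \<bar>t * A2\<bar>) * (\<bar>\<kappa>\<bar> * \<bar>m\<bar>) + (N * \<bar>t * A2\<bar>) * (\<bar>\<kappa>\<bar> * (norm b * norm xb))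
      + (N * norm (t *\<^sub>R A3)) * (\<bar>\<kappa>\<bar> * norm b)"
  proof -
    have 1: "\<bar>t * (N * \<rho>)\<bar> = \<bar>t\<bar> * \<bar>N * \<rho>\<bar>" by (rule abs_mult)
    have 2: "\<bar>N * Rm\<bar> \<le> N * (t\<^sup>2 * mean_upto n (\<lambda>j. (\<delta> j)\<^sup>2))"
      using mult_left_mono[OF Rm N0] N0 by (simp add: abs_mult)
    have 3: "\<bar>t\<^sup>2 * phi1 t * (N * (\<kappa> - 1) + N * s2 / 2)\<bar> \<le> t\<^sup>2 * \<bar>N * (\<kappa> - 1) + N * s2 / 2\<bar>"
    proof -
      have "t\<^sup>2 * phi1 t \<le> t\<^sup>2 * 1" using p by (intro mult_left_mono) auto
      then show ?thesis unfolding abs_mult[of "t\<^sup>2 * phi1 t"] using p by (intro mult_right_mono) auto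
    qed
    have tc: "\<bar>t * ?c\<bar> \<le> t\<^sup>2" using c_le by (simp only: abs_mult)
    have 4: "\<bar>(t * ?c) * ((\<kappa> - 1) * (N * m))\<bar> \<le> t\<^sup>2 * (\<bar>\<kappa> - 1\<bar> * \<bar>N * m\<bar>)"
      unfolding abs_mult[of "t * ?c"] abs_mult[of "\<kappa> - 1"] by (intro mult_right_mono tc) auto
    have 5: "\<bar>\<kappa> * (t * ?c) * (N * inner (mean_upto n X - xb) b)\<bar> \<le> t\<^sup>2 * (\<bar>\<kappa>\<bar> * norm b * (N * norm (mean_upto n X - xb)))"
    proof -
      have "\<bar>\<kappa> * (t * ?c) * (N * inner (mean_upto n X - xb) b)\<bar> = \<bar>t * ?c\<bar> * (\<bar>\<kappa>\<bar> * (N * \<bar>inner (mean_upto n X - xb) b\<bar>))"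
        using N0 by (simp add: abs_mult)
      also have "\<dots> \<le> t\<^sup>2 * (\<bar>\<kappa>\<bar> * (N * (norm (mean_upto n X - xb) * norm b)))"
        using N0 by (intro mult_mono tc Cauchy_Schwarz_ineq2 order_refl mult_nonneg_nonneg) auto
      finally show ?thesis by (simp add: mult_ac)
    qed
    have 6: "\<bar>(N * (t * A1)) * (\<kappa> - 1)\<bar> = (N * \<bar>t * A1\<bar>) * \<bar>\<kappa> - 1\<bar>" using N0 by (simp add: abs_mult)
    have 7: "\<bar>(N * (t * A2)) * (\<kappa> * m)\<bar> = (N * \<bar>t * A2\<bar>) * (\<bar>\<kappa>\<bar> * \<bar>m\<bar>)" using N0 by (simp add: abs_mult)
    have 8: "\<bar>(N * (t * A2)) * (\<kappa> * inner xb b)\<bar> \<le> (N * \<bar>t * A2\<bar>) * (\<bar>\<kappa>\<bar> * (norm b * norm xb))"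
    proof -
      have "\<bar>(N * (t * A2)) * (\<kappa> * inner xb b)\<bar> = (N * \<bar>t * A2\<bar>) * (\<bar>\<kappa>\<bar> * \<bar>inner xb b\<bar>)" using N0 by (simp add: abs_mult)
      also have "\<dots> \<le> (N * \<bar>t * A2\<bar>) * (\<bar>\<kappa>\<bar> * (norm b * norm xb))"
        using Cauchy_Schwarz_ineq2[of xb b] N0 by (intro mult_left_mono) (auto simp: mult.commute)
      finally show ?thesis .
    qed
    have 9: "\<bar>N * inner (t *\<^sub>R A3) b * \<kappa>\<bar> \<le> (N * norm (t *\<^sub>R A3)) * (\<bar>\<kappa>\<bar> * norm b)"
    proof -
      have "\<bar>N * inner (t *\<^sub>R A3) b * \<kappa>\<bar> = N * \<bar>inner (t *\<^sub>R A3) b\<bar> * \<bar>\<kappa>\<bar>" using N0 by (simp add: abs_mult)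
      also have "\<dots> \<le> N * (norm (t *\<^sub>R A3) * norm b) * \<bar>\<kappa>\<bar>"
        using N0 by (intro mult_right_mono mult_left_mono Cauchy_Schwarz_ineq2) auto
      finally show ?thesis by (simp add: mult_ac)
    qed
    show ?thesis
      unfolding D by (intro abs_add_le_add abs_diff_le_add 2 3 4 5 8 9 eq_refl[OF 1] eq_refl[OF 6] eq_refl[OF 7])
  qed
  also have "\<dots> = ?B"
  proof -
    have ring: "a1 + h * (y * a2) + y * a3 + y * a4 + y * a5 + a6 + p * a7 + p * (k * (a8 * a8')) + a9
       = a1 + y * (a3 + a4 + a5 + h * a2) + a6 + p * (a7 + k * a8 * a8') + a9"
      for a1 a2 a3 a4 a5 a6 a7 a8 a8' a9 h y p k :: real
      by (simp add: algebra_simps)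
    show ?thesis by (rule ring)
  qed
  finally show ?thesis .
qed

subsection \<open>Sample means\<close>

text \<open>Without integrability the left-hand side is 0 by convention, so the bound holds for any
  function and no pathwise integrability has to be checked before it is used.\<close>

lemma abs_integral_le_nn: "ennreal \<bar>integral\<^sup>L M f\<bar> \<le> (\<integral>\<^sup>+x. ennreal \<bar>f x\<bar> \<partial>M)"
proof (cases "integrable M f")
  case True
  then show ?thesis using integral_norm_bound_ennreal[of M f] by simp
next
  case False
  then show ?thesis by (simp add: not_integrable_integral_eq)
qed

text \<open>Tonelli and Markov: a bound on the expectation for each t, integrable against \<nu>,
  bounds the expectation of the weighted integral uniformly in n.\<close>

lemma (in prob_space) O_P_weighted_integral:
  fixes A :: "nat \<Rightarrow> 'a \<Rightarrow> 't \<Rightarrow> real"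
  assumes \<nu>: "sigma_finite_measure \<nu>"
    and meas: "\<And>n. (\<lambda>(\<omega>, t). A n \<omega> t) \<in> borel_measurable (M \<Otimes>\<^sub>M \<nu>)"
    and int: "\<And>n t. n > 0 \<Longrightarrow> t \<in> space \<nu> \<Longrightarrow> integrable M (\<lambda>\<omega>. A n \<omega> t)"
    and nn: "\<And>n \<omega> t. 0 \<le> A n \<omega> t"
    and le: "\<And>n t. n > 0 \<Longrightarrow> t \<in> space \<nu> \<Longrightarrow> (\<integral>\<omega>. A n \<omega> t \<partial>M) \<le> g t"
    and g: "integrable \<nu> g"
  shows "O_P M (\<lambda>n \<omega>. \<integral>t. A n \<omega> t \<partial>\<nu>)"
proof (rule O_P_bounded_expectation)
  interpret \<nu>: sigma_finite_measure \<nu> by fact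
  interpret pair_sigma_finite M \<nu> ..
  fix n :: nat assume n: "n > 0"
  show "(\<lambda>\<omega>. \<integral>t. A n \<omega> t \<partial>\<nu>) \<in> borel_measurable M"
    using meas[of n] by (intro \<nu>.borel_measurable_lebesgue_integral)
  note [measurable] = meas[of n]
  have "(\<integral>\<^sup>+\<omega>. ennreal \<bar>\<integral>t. A n \<omega> t \<partial>\<nu>\<bar> \<partial>M) \<le> (\<integral>\<^sup>+\<omega>. \<integral>\<^sup>+t. ennreal \<bar>A n \<omega> t\<bar> \<partial>\<nu> \<partial>M)"
    by (intro nn_integral_mono abs_integral_le_nn)
  also have "\<dots> = (\<integral>\<^sup>+\<omega>. \<integral>\<^sup>+t. ennreal (A n \<omega> t) \<partial>\<nu> \<partial>M)" by (simp add: nn)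
  also have "\<dots> = (\<integral>\<^sup>+t. \<integral>\<^sup>+\<omega>. ennreal (A n \<omega> t) \<partial>M \<partial>\<nu>)"
    by (rule Fubini'[symmetric]) measurable
  also have "\<dots> = (\<integral>\<^sup>+t. ennreal (\<integral>\<omega>. A n \<omega> t \<partial>M) \<partial>\<nu>)"
    by (intro nn_integral_cong nn_integral_eq_integral int n AE_I2 nn)
  also have "\<dots> \<le> (\<integral>\<^sup>+t. ennreal \<bar>g t\<bar> \<partial>\<nu>)"
    by (intro nn_integral_mono ennreal_leI order_trans[OF le[OF n] abs_ge_self])
  also have "\<dots> = ennreal (\<integral>t. \<bar>g t\<bar> \<partial>\<nu>)"
    by (rule nn_integral_eq_integral) (use g in auto)
  finally show "(\<integral>\<^sup>+\<omega>. ennreal \<bar>\<integral>t. A n \<omega> t \<partial>\<nu>\<bar> \<partial>M) \<le> ennreal (\<integral>t. \<bar>g t\<bar> \<partial>\<nu>)" .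
qed simp

text \<open>The squared norm of the sum is a double sum of inner products whose off-diagonal
  expectations vanish; of the n^2 terms only n remain. It is used for real and for vector valued
  summands alike.\<close>

lemma (in finite_measure) mean_square_orthogonal:
  fixes \<xi> :: "nat \<Rightarrow> 'a \<Rightarrow> 'v::{real_inner, second_countable_topology}"
  assumes meas[measurable]: "\<And>i. \<xi> i \<in> borel_measurable M"
    and int: "\<And>i. integrable M (\<lambda>\<omega>. (norm (\<xi> i \<omega>))\<^sup>2)"
    and le: "\<And>i. (\<integral>\<omega>. (norm (\<xi> i \<omega>))\<^sup>2 \<partial>M) \<le> v"
    and orth: "\<And>i j. i \<noteq> j \<Longrightarrow> (\<integral>\<omega>. inner (\<xi> i \<omega>) (\<xi> j \<omega>) \<partial>M) = 0"
    and n: "n > 0"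
  shows "integrable M (\<lambda>\<omega>. (norm (mean_upto n (\<lambda>i. \<xi> i \<omega>)))\<^sup>2)"
    and "(\<integral>\<omega>. (norm (mean_upto n (\<lambda>i. \<xi> i \<omega>)))\<^sup>2 \<partial>M) \<le> v / real n"
proof -
  have e: "(norm (mean_upto n (\<lambda>i. \<xi> i \<omega>)))\<^sup>2 = (\<Sum>i<n. \<Sum>j<n. inner (\<xi> i \<omega>) (\<xi> j \<omega>)) / (real n)\<^sup>2" for \<omega>
    unfolding mean_upto_def norm_scaleR power_mult_distrib power2_norm_eq_inner inner_sum_left inner_sum_right
    by (simp add: field_simps) (rule disjI2, rule sum.swap)
  have i: "integrable M (\<lambda>\<omega>. inner (\<xi> i \<omega>) (\<xi> j \<omega>))" for i j
  proof (rule Bochner_Integration.integrable_bound[OF Bochner_Integration.integrable_add[OF int[of i] int[of j]]])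
    show "AE \<omega> in M. norm (inner (\<xi> i \<omega>) (\<xi> j \<omega>)) \<le> norm ((norm (\<xi> i \<omega>))\<^sup>2 + (norm (\<xi> j \<omega>))\<^sup>2)"
    proof (rule AE_I2)
      fix \<omega>
      have "\<bar>inner (\<xi> i \<omega>) (\<xi> j \<omega>)\<bar> \<le> norm (\<xi> i \<omega>) * norm (\<xi> j \<omega>)" by (rule Cauchy_Schwarz_ineq2)
      also have "\<dots> \<le> (norm (\<xi> i \<omega>))\<^sup>2 + (norm (\<xi> j \<omega>))\<^sup>2"
        using square_sum_bound[of "norm (\<xi> i \<omega>)" "norm (\<xi> j \<omega>)"] by simp
      finally show "norm (inner (\<xi> i \<omega>) (\<xi> j \<omega>)) \<le> norm ((norm (\<xi> i \<omega>))\<^sup>2 + (norm (\<xi> j \<omega>))\<^sup>2)" by simp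
    qed
  qed simp
  show "integrable M (\<lambda>\<omega>. (norm (mean_upto n (\<lambda>i. \<xi> i \<omega>)))\<^sup>2)"
    unfolding e by (intro integrable_divide Bochner_Integration.integrable_sum i)
  have "(\<integral>\<omega>. (norm (mean_upto n (\<lambda>i. \<xi> i \<omega>)))\<^sup>2 \<partial>M) = (\<Sum>i<n. \<Sum>j<n. \<integral>\<omega>. inner (\<xi> i \<omega>) (\<xi> j \<omega>) \<partial>M) / (real n)\<^sup>2"
    unfolding e by (simp add: i)
  also have "(\<Sum>i<n. \<Sum>j<n. \<integral>\<omega>. inner (\<xi> i \<omega>) (\<xi> j \<omega>) \<partial>M) \<le> (\<Sum>i<n. \<Sum>j<n. if i = j then v else 0)"
    using le orth by (intro sum_mono) (auto simp: power2_norm_eq_inner)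
  also have "(\<Sum>i<n. \<Sum>j<n. if i = j then v else 0) = real n * v" by simp
  finally show "(\<integral>\<omega>. (norm (mean_upto n (\<lambda>i. \<xi> i \<omega>)))\<^sup>2 \<partial>M) \<le> v / real n"
    using n by (simp add: divide_right_mono power2_eq_square field_simps)
qed

lemma (in finite_measure) O_P_root_mean:
  fixes \<xi> :: "nat \<Rightarrow> 'a \<Rightarrow> 'v::{real_inner, second_countable_topology}"
  assumes meas: "\<And>i. \<xi> i \<in> borel_measurable M"
    and int: "\<And>i. integrable M (\<lambda>\<omega>. (norm (\<xi> i \<omega>))\<^sup>2)"
    and le: "\<And>i. (\<integral>\<omega>. (norm (\<xi> i \<omega>))\<^sup>2 \<partial>M) \<le> v"
    and orth: "\<And>i j. i \<noteq> j \<Longrightarrow> (\<integral>\<omega>. inner (\<xi> i \<omega>) (\<xi> j \<omega>) \<partial>M) = 0"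
  shows "O_P M (\<lambda>n \<omega>. sqrt (real n) * norm (mean_upto n (\<lambda>i. \<xi> i \<omega>)))"
proof -
  have "O_P M (\<lambda>n \<omega>. real n * (norm (mean_upto n (\<lambda>i. \<xi> i \<omega>)))\<^sup>2)"
  proof (rule O_P_bounded_integral)
    fix n :: nat assume n: "n > 0"
    note m = mean_square_orthogonal[OF meas int le orth n]
    show "integrable M (\<lambda>\<omega>. real n * (norm (mean_upto n (\<lambda>i. \<xi> i \<omega>)))\<^sup>2)" using m(1) by simp
    show "(\<integral>\<omega>. real n * (norm (mean_upto n (\<lambda>i. \<xi> i \<omega>)))\<^sup>2 \<partial>M) \<le> v"
      using m(2) n by (simp add: field_simps)
  qed auto
  from O_P_sqrt[OF this] show ?thesis by (simp add: real_sqrt_mult)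
qed

text \<open>With w = sqrt (1 + s) one has s = (w - 1)(w + 1), and both remainders become rational
  functions of w, namely -s / (w (w + 1)) and s^2 (w + 2) / (2 w (w + 1)^2). The bounds w \<ge> 1/2
  and w^2 \<ge> 1/2 give w (w + 1) \<ge> 1.\<close>

lemma inverse_sqrt_taylor:
  fixes s :: real assumes "\<bar>s\<bar> \<le> 1/2"
  shows "\<bar>1 / sqrt (1 + s) - 1\<bar> \<le> \<bar>s\<bar>" "\<bar>1 / sqrt (1 + s) - 1 + s / 2\<bar> \<le> s\<^sup>2"
proof -
  define w where "w = sqrt (1 + s)"
  have "w\<^sup>2 = 1 + s" unfolding w_def using assms by (intro real_sqrt_pow2) linarith
  then have s: "s = (w - 1) * (w + 1)" by (simp add: power2_eq_square algebra_simps)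
  have "sqrt (1/4) \<le> w" unfolding w_def using assms by (intro real_sqrt_le_mono) auto
  then have w: "1/2 \<le> w" by (simp add: real_sqrt_divide)
  have w2: "w\<^sup>2 \<ge> 1/2" unfolding w_def using assms by (subst real_sqrt_pow2) linarith+
  have ww: "w * (w + 1) \<ge> 1" using w w2 by (simp add: power2_eq_square algebra_simps)
  have "- s = (1 - w) * (w + 1)" unfolding s by (simp add: algebra_simps)
  then have "- s / (w * (w + 1)) = (1 - w) / w" using w by simp
  then have "1 / w - 1 = - s / (w * (w + 1))" using w by (simp add: diff_divide_distrib)
  then have "\<bar>1 / w - 1\<bar> = \<bar>s\<bar> / (w * (w + 1))" using w by (simp add: abs_mult)
  also have "\<dots> \<le> \<bar>s\<bar> / 1" using ww by (intro divide_left_mono) auto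
  finally show "\<bar>1 / sqrt (1 + s) - 1\<bar> \<le> \<bar>s\<bar>" by (simp add: w_def)
  have f1: "1 / w - 1 + s / 2 = s\<^sup>2 * ((w + 2) / (2 * w * (w + 1)\<^sup>2))"
  proof -
    have "s\<^sup>2 * ((w + 2) / (2 * w * (w + 1)\<^sup>2)) = (w - 1)\<^sup>2 * (w + 2) / (2 * w)"
      unfolding s using w by (simp add: power_mult_distrib)
    moreover have "1 / w - 1 + s / 2 = (w - 1)\<^sup>2 * (w + 2) / (2 * w)"
      unfolding s using w by (simp add: field_simps power2_eq_square)
    ultimately show ?thesis by simp
  qed
  have f2: "(w + 2) / (2 * w * (w + 1)\<^sup>2) \<le> 1"
  proof -
    have "w + 2 \<le> 2 * 1 * (w + 1)" using w by simp
    also have "\<dots> \<le> 2 * (w * (w + 1)) * (w + 1)" using ww w by (intro mult_right_mono mult_left_mono) auto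
    finally show ?thesis using w by (simp add: power2_eq_square mult.assoc)
  qed
  have f3: "0 \<le> (w + 2) / (2 * w * (w + 1)\<^sup>2)" using w by simp
  have "\<bar>1 / w - 1 + s / 2\<bar> = s\<^sup>2 * ((w + 2) / (2 * w * (w + 1)\<^sup>2))"
    unfolding f1 by (rule abs_of_nonneg) (rule mult_nonneg_nonneg[OF zero_le_power2 f3])
  also have "\<dots> \<le> s\<^sup>2 * 1" by (rule mult_left_mono[OF f2]) simp
  finally show "\<bar>1 / sqrt (1 + s) - 1 + s / 2\<bar> \<le> s\<^sup>2" by (simp add: w_def)
qed

text \<open>\<open>e\<close> are the standardised errors. \<open>factor\<close> is the form in which
  independence of errors and covariates is used: products of functions of two errors split from
  inner products of two covariates. The case i = j is included and supplies second moments.\<close>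

locale error_sample = prob_space M for M :: "'a measure" +
  fixes X :: "nat \<Rightarrow> 'a \<Rightarrow> 'h::{real_inner, complete_space, second_countable_topology}"
    and e :: "nat \<Rightarrow> 'a \<Rightarrow> real" and B2 :: real
  assumes X_meas[measurable]: "\<And>i. X i \<in> borel_measurable M"
    and e_indep: "indep_vars (\<lambda>_. borel) e UNIV"
    and e_distr: "\<And>i. distr M borel (e i) = std_normal_distribution"
    and X_square: "\<And>i. integrable M (\<lambda>\<omega>. (norm (X i \<omega>))\<^sup>2)"
    and X_square_mean: "\<And>i. (\<integral>\<omega>. (norm (X i \<omega>))\<^sup>2 \<partial>M) = B2"
    and factor: "\<And>i j f. f \<in> borel_measurable borel \<Longrightarrow> integrable M (\<lambda>\<omega>. f (e i \<omega>) * f (e j \<omega>)) \<Longrightarrow>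
        integrable M (\<lambda>\<omega>. (f (e i \<omega>) * f (e j \<omega>)) * inner (X i \<omega>) (X j \<omega>)) \<and>
        (\<integral>\<omega>. (f (e i \<omega>) * f (e j \<omega>)) * inner (X i \<omega>) (X j \<omega>) \<partial>M)
          = (\<integral>\<omega>. f (e i \<omega>) * f (e j \<omega>) \<partial>M) * (\<integral>\<omega>. inner (X i \<omega>) (X j \<omega>) \<partial>M)"
begin

lemma e_meas[measurable]: "e i \<in> borel_measurable M"
  using e_indep by (auto simp: indep_vars_def)

lemma e_integral:
  fixes f :: "real \<Rightarrow> real"
  assumes "f \<in> borel_measurable borel"
  shows "(\<integral>\<omega>. f (e i \<omega>) \<partial>M) = (\<integral>x. f x \<partial>std_normal_distribution)"
    and "integrable M (\<lambda>\<omega>. f (e i \<omega>)) \<longleftrightarrow> integrable std_normal_distribution f"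
  by (rule integral_distr[OF e_meas[of i] assms, unfolded e_distr, symmetric])
     (rule integrable_distr_eq[OF e_meas[of i] assms, unfolded e_distr, symmetric])

context
  fixes f :: "real \<Rightarrow> real" and v :: real
  assumes f_meas[measurable]: "f \<in> borel_measurable borel"
    and f_mean: "integral\<^sup>L std_normal_distribution f = 0"
    and f_sq: "integrable std_normal_distribution (\<lambda>x. (f x)\<^sup>2)"
    and f_var: "(\<integral>x. (f x)\<^sup>2 \<partial>std_normal_distribution) \<le> v"
begin

lemma fe_sq: "integrable M (\<lambda>\<omega>. (f (e i \<omega>))\<^sup>2)" "(\<integral>\<omega>. (f (e i \<omega>))\<^sup>2 \<partial>M) \<le> v"
  using e_integral[of "\<lambda>x. (f x)\<^sup>2" i] f_sq f_var by simp_all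

lemma fe_int: "integrable M (\<lambda>\<omega>. f (e i \<omega>))"
  by (rule square_integrable_imp_integrable[OF _ fe_sq(1)]) simp

lemma fe_orth:
  assumes "i \<noteq> j"
  shows "integrable M (\<lambda>\<omega>. f (e i \<omega>) * f (e j \<omega>))" "(\<integral>\<omega>. f (e i \<omega>) * f (e j \<omega>) \<partial>M) = 0"
proof -
  have "indep_vars (\<lambda>_. borel) (\<lambda>k \<omega>. f (e k \<omega>)) {i, j}"
    by (rule indep_vars_compose2[OF indep_vars_subset[OF e_indep]]) (simp_all add: f_meas)
  note I = indep_vars_integrable[OF _ this fe_int] indep_vars_lebesgue_integral[OF _ this fe_int]
  show "integrable M (\<lambda>\<omega>. f (e i \<omega>) * f (e j \<omega>))" "(\<integral>\<omega>. f (e i \<omega>) * f (e j \<omega>) \<partial>M) = 0"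
    using I assms e_integral(1)[OF f_meas, of i] f_mean by simp_all
qed

lemma scalar_mean_square:
  assumes "n > 0"
  shows "integrable M (\<lambda>\<omega>. (mean_upto n (\<lambda>i. f (e i \<omega>)))\<^sup>2)" "(\<integral>\<omega>. (mean_upto n (\<lambda>i. f (e i \<omega>)))\<^sup>2 \<partial>M) \<le> v / real n"
  using mean_square_orthogonal[of "\<lambda>i \<omega>. f (e i \<omega>)" v n] fe_sq fe_orth(2) assms by (simp_all add: mult.commute)

lemma O_P_scalar_mean: "O_P M (\<lambda>n \<omega>. sqrt (real n) * \<bar>mean_upto n (\<lambda>i. f (e i \<omega>))\<bar>)"
  using O_P_root_mean[of "\<lambda>i \<omega>. f (e i \<omega>)" v] fe_sq fe_orth(2) by (simp add: mult.commute)

text \<open>By \<open>factor\<close>, the expected inner product of two different summands contains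
  the factor E[f(e i) f(e j)], which is 0 because \<open>f\<close> is centred and the errors are
  independent. The covariates may be correlated in any way.\<close>

lemma fX_conditions:
  "integrable M (\<lambda>\<omega>. (norm (f (e i \<omega>) *\<^sub>R X i \<omega>))\<^sup>2)" "(\<integral>\<omega>. (norm (f (e i \<omega>) *\<^sub>R X i \<omega>))\<^sup>2 \<partial>M) \<le> v * B2"
  "i \<noteq> j \<Longrightarrow> (\<integral>\<omega>. inner (f (e i \<omega>) *\<^sub>R X i \<omega>) (f (e j \<omega>) *\<^sub>R X j \<omega>) \<partial>M) = 0"
proof -
  have B2: "0 \<le> B2" using X_square_mean[of 0] by (metis integral_nonneg_AE AE_I2 zero_le_power2)
  have n2: "(norm (f (e i \<omega>) *\<^sub>R X i \<omega>))\<^sup>2 = (f (e i \<omega>) * f (e i \<omega>)) * inner (X i \<omega>) (X i \<omega>)" for \<omega>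
    by (simp only: power2_norm_eq_inner inner_scaleR_left inner_scaleR_right mult.assoc)
  have "integrable M (\<lambda>\<omega>. f (e i \<omega>) * f (e i \<omega>))" using fe_sq(1)[of i] by (simp add: power2_eq_square)
  note F = factor[OF f_meas this]
  show "integrable M (\<lambda>\<omega>. (norm (f (e i \<omega>) *\<^sub>R X i \<omega>))\<^sup>2)" unfolding n2 using F by simp
  have "(\<integral>\<omega>. (norm (f (e i \<omega>) *\<^sub>R X i \<omega>))\<^sup>2 \<partial>M) = (\<integral>\<omega>. (f (e i \<omega>))\<^sup>2 \<partial>M) * B2"
    unfolding n2 using F X_square_mean[of i, unfolded power2_norm_eq_inner] by (simp add: power2_eq_square)
  also have "\<dots> \<le> v * B2" using fe_sq(2) B2 by (rule mult_right_mono)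
  finally show "(\<integral>\<omega>. (norm (f (e i \<omega>) *\<^sub>R X i \<omega>))\<^sup>2 \<partial>M) \<le> v * B2" .
  show "(\<integral>\<omega>. inner (f (e i \<omega>) *\<^sub>R X i \<omega>) (f (e j \<omega>) *\<^sub>R X j \<omega>) \<partial>M) = 0" if "i \<noteq> j"
  proof -
    have "inner (f (e i \<omega>) *\<^sub>R X i \<omega>) (f (e j \<omega>) *\<^sub>R X j \<omega>) = (f (e i \<omega>) * f (e j \<omega>)) * inner (X i \<omega>) (X j \<omega>)" for \<omega>
      by simp
    then have "(\<integral>\<omega>. inner (f (e i \<omega>) *\<^sub>R X i \<omega>) (f (e j \<omega>) *\<^sub>R X j \<omega>) \<partial>M)
      = (\<integral>\<omega>. (f (e i \<omega>) * f (e j \<omega>)) * inner (X i \<omega>) (X j \<omega>) \<partial>M)" by (simp only:)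
    then show ?thesis using factor[OF f_meas fe_orth(1)[OF that]] fe_orth(2)[OF that] by (simp only: mult_zero_left)
  qed
qed

lemma fX_meas[measurable]: "(\<lambda>\<omega>. f (e i \<omega>) *\<^sub>R X i \<omega>) \<in> borel_measurable M"
  by measurable

lemma vector_mean_square:
  assumes "n > 0"
  shows "integrable M (\<lambda>\<omega>. (norm (mean_upto n (\<lambda>i. f (e i \<omega>) *\<^sub>R X i \<omega>)))\<^sup>2)"
    "(\<integral>\<omega>. (norm (mean_upto n (\<lambda>i. f (e i \<omega>) *\<^sub>R X i \<omega>)))\<^sup>2 \<partial>M) \<le> v * B2 / real n"
  by (rule mean_square_orthogonal(1)[OF fX_meas fX_conditions assms], assumption)
     (rule mean_square_orthogonal(2)[OF fX_meas fX_conditions assms], assumption)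

lemma O_P_vector_mean: "O_P M (\<lambda>n \<omega>. sqrt (real n) * norm (mean_upto n (\<lambda>i. f (e i \<omega>) *\<^sub>R X i \<omega>)))"
  by (rule O_P_root_mean[OF fX_meas fX_conditions])

end

lemma O_P_mean_norm_square: "O_P M (\<lambda>n \<omega>. mean_upto n (\<lambda>j. (norm (X j \<omega>))\<^sup>2))"
proof (rule O_P_bounded_integral[where C=B2])
  fix n :: nat assume n: "n > 0"
  show "integrable M (\<lambda>\<omega>. mean_upto n (\<lambda>j. (norm (X j \<omega>))\<^sup>2))"
    unfolding mean_upto_def by (intro integrable_scaleR_right Bochner_Integration.integrable_sum X_square)
  show "(\<integral>\<omega>. mean_upto n (\<lambda>j. (norm (X j \<omega>))\<^sup>2) \<partial>M) \<le> B2"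
    unfolding mean_upto_def using n X_square by (simp add: X_square_mean mult.assoc[symmetric])
qed (auto simp: mean_upto_def intro!: mult_nonneg_nonneg sum_nonneg)

lemma norm_mean_upto_le: "norm (mean_upto n x) \<le> 1 + mean_upto n (\<lambda>j. (norm (x j))\<^sup>2)" for x :: "nat \<Rightarrow> 'h"
proof (cases "n = 0")
  case False
  have "norm (mean_upto n x) \<le> mean_upto n (\<lambda>j. norm (x j))"
    using norm_sum[of x "{..<n}"] by (simp add: mean_upto_def mult_left_mono)
  also have "\<dots> \<le> mean_upto n (\<lambda>j. 1 + (norm (x j))\<^sup>2)"
    using abs_le_1_plus_square by (intro mean_upto_mono) (metis abs_norm_cancel)
  also have "\<dots> = 1 + mean_upto n (\<lambda>j. (norm (x j))\<^sup>2)" using False by (simp add: mean_upto_add mean_upto_const)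
  finally show ?thesis .
qed (simp add: mean_upto_def)

lemma mean_upto_nonneg: "(\<And>j. 0 \<le> x j) \<Longrightarrow> 0 \<le> (mean_upto n x :: real)"
  by (simp add: mean_upto_def sum_nonneg)

lemma O_P_mean_X: "O_P M (\<lambda>n \<omega>. norm (mean_upto n (\<lambda>j. X j \<omega>)))"
proof (rule O_P_dom[OF O_P_add[OF O_P_const[of 1] O_P_mean_norm_square]])
  fix n \<omega>
  have "0 \<le> mean_upto n (\<lambda>j. (norm (X j \<omega>))\<^sup>2)" by (rule mean_upto_nonneg) simp
  then show "\<bar>norm (mean_upto n (\<lambda>j. X j \<omega>))\<bar> \<le> \<bar>1 + mean_upto n (\<lambda>j. (norm (X j \<omega>))\<^sup>2)\<bar>"
    using norm_mean_upto_le[of n "\<lambda>j. X j \<omega>"] by simp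
qed

lemma O_P_mean_e: "O_P M (\<lambda>n \<omega>. sqrt (real n) * \<bar>mean_upto n (\<lambda>i. e i \<omega>)\<bar>)"
  by (rule O_P_scalar_mean[where f="\<lambda>x. x" and v=1])
     (use std_normal_moments in \<open>auto simp: has_bochner_integral_iff\<close>)

lemma O_P_mean_e2: "O_P M (\<lambda>n \<omega>. sqrt (real n) * \<bar>mean_upto n (\<lambda>i. (e i \<omega>)\<^sup>2 - 1)\<bar>)"
proof (rule O_P_scalar_mean[where v=2])
  have "has_std_normal_mean (\<lambda>x. x\<^sup>2 - 1) (1 - 1)" by (intro has_mean_intros)
  then show "integral\<^sup>L std_normal_distribution (\<lambda>x. x\<^sup>2 - 1) = 0" by (simp add: has_bochner_integral_iff)
  have "has_std_normal_mean (\<lambda>x. x ^ 4 - 2 * x\<^sup>2 + 1) (3 - 2 * 1 + 1)" by (intro has_mean_intros)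
  moreover have "(\<lambda>x::real. x ^ 4 - 2 * x\<^sup>2 + 1) = (\<lambda>x. (x\<^sup>2 - 1)\<^sup>2)"
    by (rule ext) (simp add: power2_eq_square power4_eq_xxxx algebra_simps)
  ultimately have "has_std_normal_mean (\<lambda>x. (x\<^sup>2 - 1)\<^sup>2) 2" by simp
  then show "integrable std_normal_distribution (\<lambda>x. (x\<^sup>2 - 1)\<^sup>2)" "(\<integral>x. (x\<^sup>2 - 1)\<^sup>2 \<partial>std_normal_distribution) \<le> 2"
    by (simp_all add: has_bochner_integral_iff)
qed simp

lemma O_P_mean_eX: "O_P M (\<lambda>n \<omega>. sqrt (real n) * norm (mean_upto n (\<lambda>i. e i \<omega> *\<^sub>R X i \<omega>)))"
  by (rule O_P_vector_mean[where f="\<lambda>x. x" and v=1])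
     (use std_normal_moments in \<open>auto simp: has_bochner_integral_iff\<close>)

lemma O_P_mean_e_square: "O_P M (\<lambda>n \<omega>. mean_upto n (\<lambda>i. (e i \<omega>)\<^sup>2))"
proof (rule O_P_dom[OF O_P_add[OF O_P_mean_e2 O_P_const[of 1]]])
  fix n :: nat and \<omega> assume n: "n > 0"
  have "mean_upto n (\<lambda>i. (e i \<omega>)\<^sup>2) = mean_upto n (\<lambda>i. (e i \<omega>)\<^sup>2 - 1) + 1"
    using n by (simp add: mean_upto_diff mean_upto_const)
  moreover have "1 * \<bar>mean_upto n (\<lambda>i. (e i \<omega>)\<^sup>2 - 1)\<bar> \<le> sqrt (real n) * \<bar>mean_upto n (\<lambda>i. (e i \<omega>)\<^sup>2 - 1)\<bar>"
    using n by (intro mult_right_mono) auto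
  ultimately show "\<bar>mean_upto n (\<lambda>i. (e i \<omega>)\<^sup>2)\<bar> \<le> \<bar>sqrt (real n) * \<bar>mean_upto n (\<lambda>i. (e i \<omega>)\<^sup>2 - 1)\<bar> + 1\<bar>"
    by linarith
qed

end

subsection \<open>The standardised residuals\<close>

text \<open>Brings the normalised sum of scores into the shape of the linearised term in
  \<open>residual_expansion_bound\<close>, with m equal to c times the mean error.\<close>

lemma score_eq_mean:
  assumes n: "n > 0"
  shows "(\<Sum>i<n. score c t (x i)) / sqrt (real n) = sqrt (real n) * (mean_upto n (\<lambda>j. sin (t * x j) + cos (t * x j)) - phi1 t
      - t * phi1 t * (c * mean_upto n x) + t\<^sup>2 / 2 * phi1 t * mean_upto n (\<lambda>j. (x j)\<^sup>2 - 1))"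
proof -
  have s: "score c t y = ((sin (t * y) + cos (t * y)) - phi1 t - (t * phi1 t * c) * y) + (t\<^sup>2 / 2 * phi1 t) * (y\<^sup>2 - 1)" for y
    by (simp add: score_def algebra_simps)
  have "mean_upto n (\<lambda>j. score c t (x j)) = mean_upto n (\<lambda>j. sin (t * x j) + cos (t * x j)) - phi1 t
      - t * phi1 t * (c * mean_upto n x) + t\<^sup>2 / 2 * phi1 t * mean_upto n (\<lambda>j. (x j)\<^sup>2 - 1)"
    unfolding s mean_upto_add[of n "\<lambda>j. (sin (t * x j) + cos (t * x j)) - phi1 t - (t * phi1 t * c) * x j"]
      mean_upto_diff[of n "\<lambda>j. (sin (t * x j) + cos (t * x j)) - phi1 t"]
      mean_upto_diff[of n "\<lambda>j. (sin (t * x j) + cos (t * x j))" "\<lambda>j. phi1 t"] mean_upto_mult mean_upto_const[OF n]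
    by (simp only: mult.assoc)
  moreover have "(\<Sum>i<n. score c t (x i)) / sqrt (real n) = sqrt (real n) * mean_upto n (\<lambda>j. score c t (x j))"
    using n by (simp add: mean_upto_def field_simps real_sqrt_mult_self[symmetric] del: real_sqrt_mult_self) simp
  ultimately show ?thesis by (simp only:)
qed

text \<open>\<open>b\<close> is the standardised estimation error of the slope; \<open>xb\<close> is
  the point at which the covariates are centred, the sample mean in part (i) and 0 in part (ii).
  \<open>centred\<close> states the dichotomy for the linear term of the expansion: either it
  vanishes identically, or \<nu> has a second moment to absorb it.\<close>

locale residual_sample = error_sample M X e B2 + weight_measure \<nu> c
  for M :: "'a measure" and X :: "nat \<Rightarrow> 'a \<Rightarrow> 'h::{real_inner, complete_space, second_countable_topology}"
    and e :: "nat \<Rightarrow> 'a \<Rightarrow> real" and B2 :: real and \<nu> :: "real measure" and c :: real +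
  fixes b xb :: "nat \<Rightarrow> 'a \<Rightarrow> 'h"
  assumes b_rate: "o_P M (\<lambda>n \<omega>. sqrt (sqrt (real n)) * norm (b n \<omega>)) (\<lambda>_. 1)"
    and O_P_xb: "O_P M (\<lambda>n \<omega>. norm (xb n \<omega>))"
    and O_P_mean_X_xb: "O_P M (\<lambda>n \<omega>. sqrt (real n) * norm (mean_upto n (\<lambda>j. X j \<omega>) - xb n \<omega>))"
    and t4: "integrable \<nu> (\<lambda>t. t ^ 4)"
    and centred: "(c = 1 \<and> (\<forall>n. \<forall>\<omega>\<in>space M. xb n \<omega> = mean_upto n (\<lambda>j. X j \<omega>))) \<or> integrable \<nu> (\<lambda>t. t\<^sup>2)"
begin

text \<open>\<open>res\<close> are the residuals divided by the true standard deviation,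
  \<open>V\<close> is the square of the ratio of estimated to true standard deviation and
  \<open>kap\<close> the inverse ratio, so that \<open>r\<close> are the fully standardised
  residuals. \<open>m\<close> is the part of the mean error that the estimated intercept
  removes.\<close>

definition "m n \<omega> = c * mean_upto n (\<lambda>j. e j \<omega>)"
definition "res n \<omega> j = e j \<omega> - m n \<omega> - inner (X j \<omega> - xb n \<omega>) (b n \<omega>)"
definition "V n \<omega> = mean_upto n (\<lambda>j. (res n \<omega> j)\<^sup>2)"
definition "kap n \<omega> = 1 / sqrt (V n \<omega>)"
definition "r n \<omega> j = kap n \<omega> * res n \<omega> j"
definition "s2 n \<omega> = mean_upto n (\<lambda>j. (e j \<omega>)\<^sup>2 - 1)"
definition "\<delta> n \<omega> j = r n \<omega> j - e j \<omega>"
definition "XX n \<omega> = mean_upto n (\<lambda>j. (norm (X j \<omega> - xb n \<omega>))\<^sup>2)"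
abbreviation "eb n \<omega> \<equiv> mean_upto n (\<lambda>j. e j \<omega>)"
abbreviation "Xd n \<omega> \<equiv> mean_upto n (\<lambda>j. X j \<omega>) - xb n \<omega>"

lemma c_abs: "\<bar>c\<bar> \<le> 1" using c01 by auto

lemma O_P_m: "O_P M (\<lambda>n \<omega>. sqrt (real n) * \<bar>m n \<omega>\<bar>)"
proof (rule O_P_dom[OF O_P_mean_e])
  fix n \<omega>
  have "\<bar>m n \<omega>\<bar> \<le> 1 * \<bar>eb n \<omega>\<bar>" unfolding m_def abs_mult using c_abs by (intro mult_right_mono) auto
  then show "\<bar>sqrt (real n) * \<bar>m n \<omega>\<bar>\<bar> \<le> \<bar>sqrt (real n) * \<bar>eb n \<omega>\<bar>\<bar>"
    by (simp add: abs_mult mult_left_mono)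
qed

lemma o_P_of_root:
  assumes "O_P M (\<lambda>n \<omega>. sqrt (real n) * Z n \<omega>)" shows "o_P M Z (\<lambda>_. 1)"
proof (rule o_P_dom)
  have "(\<lambda>n. 1 / sqrt (real n)) \<longlonglongrightarrow> 0" by real_asymp
  from o_P_mult[OF o_P_deterministic[OF this] assms]
  show "o_P M (\<lambda>n \<omega>. 1 / sqrt (real n) * (sqrt (real n) * Z n \<omega>)) (\<lambda>_. 1)" .
qed auto

lemma o_P_m: "o_P M (\<lambda>n \<omega>. \<bar>m n \<omega>\<bar>) (\<lambda>_. 1)"
  by (rule o_P_of_root[OF O_P_m])

lemma o_P_b: "o_P M (\<lambda>n \<omega>. norm (b n \<omega>)) (\<lambda>_. 1)"
proof (rule o_P_dom[OF b_rate])
  fix n :: nat and \<omega> assume "n > 0"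
  then have "1 \<le> sqrt (sqrt (real n))" by simp
  then have "1 * norm (b n \<omega>) \<le> sqrt (sqrt (real n)) * norm (b n \<omega>)" by (rule mult_right_mono) simp
  then show "\<bar>norm (b n \<omega>)\<bar> \<le> \<bar>sqrt (sqrt (real n)) * norm (b n \<omega>)\<bar>" by simp
qed

text \<open>This is where the rate n^(-1/4) is spent: the quantity is the square of n^(1/4) * norm
  b.\<close>

lemma o_P_b2: "o_P M (\<lambda>n \<omega>. sqrt (real n) * (norm (b n \<omega>))\<^sup>2) (\<lambda>_. 1)"
  using o_P_power2[OF b_rate] by (simp add: power_mult_distrib)

lemma O_P_XX: "O_P M XX"
proof (rule O_P_dom[OF O_P_add[OF O_P_mult[OF O_P_const[of 2] O_P_mean_norm_square] O_P_mult[OF O_P_const[of 2] O_P_power2[OF O_P_xb]]]])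
  fix n :: nat and \<omega> assume n: "n > 0"
  have "(norm (x - y))\<^sup>2 \<le> 2 * (norm x)\<^sup>2 + 2 * (norm y)\<^sup>2" for x y :: 'h
  proof -
    have "(norm (x - y))\<^sup>2 \<le> (norm x + norm y)\<^sup>2" by (intro power_mono norm_triangle_ineq4) auto
    also have "\<dots> \<le> 2 * (norm x)\<^sup>2 + 2 * (norm y)\<^sup>2"
      using zero_le_power2[of "norm x - norm y"] unfolding power2_sum power2_diff by simp
    finally show ?thesis .
  qed
  then have "XX n \<omega> \<le> mean_upto n (\<lambda>j. 2 * (norm (X j \<omega>))\<^sup>2 + 2 * (norm (xb n \<omega>))\<^sup>2)"
    unfolding XX_def by (intro mean_upto_mono)
  also have "\<dots> = 2 * mean_upto n (\<lambda>j. (norm (X j \<omega>))\<^sup>2) + 2 * (norm (xb n \<omega>))\<^sup>2"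
    using n by (simp add: mean_upto_add mean_upto_mult mean_upto_const)
  finally have "XX n \<omega> \<le> 2 * mean_upto n (\<lambda>j. (norm (X j \<omega>))\<^sup>2) + 2 * (norm (xb n \<omega>))\<^sup>2" .
  moreover have "0 \<le> XX n \<omega>" unfolding XX_def by (rule mean_upto_nonneg) simp
  ultimately show "\<bar>XX n \<omega>\<bar> \<le> \<bar>2 * mean_upto n (\<lambda>j. (norm (X j \<omega>))\<^sup>2) + 2 * (norm (xb n \<omega>))\<^sup>2\<bar>" by linarith
qed

lemma mean_inner_square_le: "mean_upto n (\<lambda>j. (inner (X j \<omega> - xb n \<omega>) (b n \<omega>))\<^sup>2) \<le> (norm (b n \<omega>))\<^sup>2 * XX n \<omega>"
proof -
  have "(inner x y)\<^sup>2 \<le> (norm y)\<^sup>2 * (norm x)\<^sup>2" for x y :: 'h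
    using power_mono[OF Cauchy_Schwarz_ineq2[of x y], of 2] by (simp add: power_mult_distrib mult.commute)
  then show ?thesis unfolding XX_def mean_upto_mult[symmetric] by (intro mean_upto_mono)
qed

lemma V_expand:
  assumes n: "n > 0"
  shows "V n \<omega> - 1 - s2 n \<omega> = (m n \<omega>)\<^sup>2 - 2 * m n \<omega> * eb n \<omega> - 2 * inner (mean_upto n (\<lambda>j. e j \<omega> *\<^sub>R X j \<omega>)) (b n \<omega>)
     + 2 * eb n \<omega> * inner (xb n \<omega>) (b n \<omega>) + 2 * m n \<omega> * inner (Xd n \<omega>) (b n \<omega>)
     + mean_upto n (\<lambda>j. (inner (X j \<omega> - xb n \<omega>) (b n \<omega>))\<^sup>2)"
proof -
  have lin: "linear (\<lambda>x. inner x (b n \<omega>))" by (simp add: linear_iff inner_add_left)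
  have "(res n \<omega> j)\<^sup>2 = ((e j \<omega>)\<^sup>2 - 1) + (1 + (m n \<omega>)\<^sup>2) - (2 * m n \<omega>) * e j \<omega> - 2 * inner (e j \<omega> *\<^sub>R X j \<omega>) (b n \<omega>)
     + (2 * inner (xb n \<omega>) (b n \<omega>)) * e j \<omega> + (2 * m n \<omega>) * inner (X j \<omega> - xb n \<omega>) (b n \<omega>) + (inner (X j \<omega> - xb n \<omega>) (b n \<omega>))\<^sup>2" for j
    by (simp add: res_def inner_diff_left power2_eq_square algebra_simps)
  then have "V n \<omega> = mean_upto n (\<lambda>j. ((e j \<omega>)\<^sup>2 - 1) + (1 + (m n \<omega>)\<^sup>2) - (2 * m n \<omega>) * e j \<omega> - 2 * inner (e j \<omega> *\<^sub>R X j \<omega>) (b n \<omega>)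
     + (2 * inner (xb n \<omega>) (b n \<omega>)) * e j \<omega> + (2 * m n \<omega>) * inner (X j \<omega> - xb n \<omega>) (b n \<omega>) + (inner (X j \<omega> - xb n \<omega>) (b n \<omega>))\<^sup>2)"
    unfolding V_def by (simp only:)
  also have "\<dots> = s2 n \<omega> + (1 + (m n \<omega>)\<^sup>2) - (2 * m n \<omega>) * eb n \<omega> - 2 * mean_upto n (\<lambda>j. inner (e j \<omega> *\<^sub>R X j \<omega>) (b n \<omega>))
     + (2 * inner (xb n \<omega>) (b n \<omega>)) * eb n \<omega> + (2 * m n \<omega>) * mean_upto n (\<lambda>j. inner (X j \<omega> - xb n \<omega>) (b n \<omega>))
     + mean_upto n (\<lambda>j. (inner (X j \<omega> - xb n \<omega>) (b n \<omega>))\<^sup>2)"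
    unfolding s2_def
    by (subst (1) mean_upto_add, subst (1) mean_upto_add, subst (1) mean_upto_add, subst (1) mean_upto_diff, subst (1) mean_upto_diff, subst (1) mean_upto_add)
       (simp only: mean_upto_mult mean_upto_const[OF n])
  also have "mean_upto n (\<lambda>j. inner (e j \<omega> *\<^sub>R X j \<omega>) (b n \<omega>)) = inner (mean_upto n (\<lambda>j. e j \<omega> *\<^sub>R X j \<omega>)) (b n \<omega>)"
    by (rule mean_upto_linear[OF lin, symmetric])
  also have "mean_upto n (\<lambda>j. inner (X j \<omega> - xb n \<omega>) (b n \<omega>)) = inner (Xd n \<omega>) (b n \<omega>)"
    unfolding mean_upto_linear[OF lin, symmetric] mean_upto_diff mean_upto_const[OF n] ..
  finally show ?thesis by simp
qed

text \<open>Every term of \<open>V_expand\<close> is a product of at least two small factors. Terms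
  with a mean of errors or of error times covariate gain n^(-1/2) from that mean and smallness from
  the other factor; the term quadratic in \<open>b\<close> is handled by
  \<open>o_P_b2\<close>.\<close>

lemma o_P_V_s2: "o_P M (\<lambda>n \<omega>. sqrt (real n) * (V n \<omega> - 1 - s2 n \<omega>)) (\<lambda>_. 1)"
proof -
  let ?N = "\<lambda>n. sqrt (real n)"
  have "o_P M (\<lambda>n \<omega>. \<bar>m n \<omega>\<bar> * (?N n * \<bar>m n \<omega>\<bar>) + \<bar>m n \<omega>\<bar> * (2 * (?N n * \<bar>eb n \<omega>\<bar>))
     + norm (b n \<omega>) * (2 * (?N n * norm (mean_upto n (\<lambda>j. e j \<omega> *\<^sub>R X j \<omega>))))
     + norm (b n \<omega>) * (2 * (?N n * \<bar>eb n \<omega>\<bar> * norm (xb n \<omega>)))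
     + norm (b n \<omega>) * (2 * (\<bar>m n \<omega>\<bar> * (?N n * norm (Xd n \<omega>))))
     + (?N n * (norm (b n \<omega>))\<^sup>2) * XX n \<omega>) (\<lambda>_. 1)"
    by (intro o_P_add o_P_mult o_P_m o_P_b o_P_b2 O_P_mult O_P_m O_P_const O_P_mean_e O_P_mean_eX O_P_xb O_P_mean_X_xb O_P_XX o_P_imp_O_P[OF o_P_m])
  then show ?thesis
  proof (rule o_P_dom)
    fix n :: nat and \<omega> assume n: "n > 0"
    let ?b = "b n \<omega>" and ?m = "m n \<omega>" and ?e = "eb n \<omega>"
    let ?eX = "mean_upto n (\<lambda>j. e j \<omega> *\<^sub>R X j \<omega>)"
    let ?q = "mean_upto n (\<lambda>j. (inner (X j \<omega> - xb n \<omega>) ?b)\<^sup>2)"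
    have q0: "0 \<le> ?q" by (rule mean_upto_nonneg) simp
    have CS: "\<bar>inner x ?b\<bar> \<le> norm x * norm ?b" for x by (rule Cauchy_Schwarz_ineq2)
    have "\<bar>V n \<omega> - 1 - s2 n \<omega>\<bar> \<le> \<bar>?m\<bar> * \<bar>?m\<bar> + 2 * (\<bar>?m\<bar> * \<bar>?e\<bar>) + 2 * (norm ?eX * norm ?b) + 2 * (\<bar>?e\<bar> * (norm (xb n \<omega>) * norm ?b))
        + 2 * (\<bar>?m\<bar> * (norm (Xd n \<omega>) * norm ?b)) + (norm ?b)\<^sup>2 * XX n \<omega>"
      unfolding V_expand[OF n]
    proof (intro abs_add_le_add abs_diff_le_add)
      show "\<bar>?m\<^sup>2\<bar> \<le> \<bar>?m\<bar> * \<bar>?m\<bar>" by (simp add: power2_eq_square)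
      show "\<bar>2 * ?m * ?e\<bar> \<le> 2 * (\<bar>?m\<bar> * \<bar>?e\<bar>)" by (simp add: abs_mult)
      show "\<bar>2 * inner ?eX ?b\<bar> \<le> 2 * (norm ?eX * norm ?b)" using CS[of ?eX] by simp
      show "\<bar>2 * ?e * inner (xb n \<omega>) ?b\<bar> \<le> 2 * (\<bar>?e\<bar> * (norm (xb n \<omega>) * norm ?b))"
        using mult_left_mono[OF CS[of "xb n \<omega>"], of "\<bar>?e\<bar>"] by (simp add: abs_mult)
      show "\<bar>2 * ?m * inner (Xd n \<omega>) ?b\<bar> \<le> 2 * (\<bar>?m\<bar> * (norm (Xd n \<omega>) * norm ?b))"
        using mult_left_mono[OF CS[of "Xd n \<omega>"], of "\<bar>?m\<bar>"] by (simp add: abs_mult)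
      show "\<bar>?q\<bar> \<le> (norm ?b)\<^sup>2 * XX n \<omega>" using q0 mean_inner_square_le[of n \<omega>] by simp
    qed
    then have "?N n * \<bar>V n \<omega> - 1 - s2 n \<omega>\<bar> \<le> ?N n * (\<bar>?m\<bar> * \<bar>?m\<bar> + 2 * (\<bar>?m\<bar> * \<bar>?e\<bar>) + 2 * (norm ?eX * norm ?b) + 2 * (\<bar>?e\<bar> * (norm (xb n \<omega>) * norm ?b))
        + 2 * (\<bar>?m\<bar> * (norm (Xd n \<omega>) * norm ?b)) + (norm ?b)\<^sup>2 * XX n \<omega>)"
      by (rule mult_left_mono) simp
    also have "\<dots> = \<bar>?m\<bar> * (?N n * \<bar>?m\<bar>) + \<bar>?m\<bar> * (2 * (?N n * \<bar>?e\<bar>)) + norm ?b * (2 * (?N n * norm ?eX))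
     + norm ?b * (2 * (?N n * \<bar>?e\<bar> * norm (xb n \<omega>))) + norm ?b * (2 * (\<bar>?m\<bar> * (?N n * norm (Xd n \<omega>))))
     + (?N n * (norm ?b)\<^sup>2) * XX n \<omega>" by (simp only: distrib_left mult_ac)
    finally have "\<bar>?N n * (V n \<omega> - 1 - s2 n \<omega>)\<bar> \<le> \<bar>?m\<bar> * (?N n * \<bar>?m\<bar>) + \<bar>?m\<bar> * (2 * (?N n * \<bar>?e\<bar>)) + norm ?b * (2 * (?N n * norm ?eX))
     + norm ?b * (2 * (?N n * \<bar>?e\<bar> * norm (xb n \<omega>))) + norm ?b * (2 * (\<bar>?m\<bar> * (?N n * norm (Xd n \<omega>))))
     + (?N n * (norm ?b)\<^sup>2) * XX n \<omega>" by (simp only: abs_mult real_sqrt_abs2 abs_of_nonneg[OF real_sqrt_ge_zero[OF of_nat_0_le_iff]])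
    from order_trans[OF this abs_ge_self]
    show "\<bar>?N n * (V n \<omega> - 1 - s2 n \<omega>)\<bar> \<le> \<bar>\<bar>?m\<bar> * (?N n * \<bar>?m\<bar>) + \<bar>?m\<bar> * (2 * (?N n * \<bar>?e\<bar>)) + norm ?b * (2 * (?N n * norm ?eX))
     + norm ?b * (2 * (?N n * \<bar>?e\<bar> * norm (xb n \<omega>))) + norm ?b * (2 * (\<bar>?m\<bar> * (?N n * norm (Xd n \<omega>))))
     + (?N n * (norm ?b)\<^sup>2) * XX n \<omega>\<bar>" .
  qed
qed

lemma O_P_V: "O_P M (\<lambda>n \<omega>. sqrt (real n) * (V n \<omega> - 1))"
proof -
  have "O_P M (\<lambda>n \<omega>. sqrt (real n) * s2 n \<omega>)"
    by (rule O_P_dom[OF O_P_mean_e2]) (simp add: s2_def abs_mult)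
  from O_P_add[OF o_P_imp_O_P[OF o_P_V_s2] this] show ?thesis
    by (rule O_P_dom) (simp add: algebra_simps)
qed

lemma o_P_V: "o_P M (\<lambda>n \<omega>. V n \<omega> - 1) (\<lambda>_. 1)"
  by (rule o_P_of_root[OF O_P_V])

lemma o_P_kap: "o_P M (\<lambda>n \<omega>. \<bar>kap n \<omega> - 1\<bar>) (\<lambda>_. 1)"
  by (rule o_P_local[OF o_P_V O_P_const[of 1] o_P_V, of "1/2"])
     (use inverse_sqrt_taylor(1)[of "V _ _ - 1"] in \<open>simp_all add: kap_def\<close>)

lemma O_P_root_kap: "O_P M (\<lambda>n \<omega>. sqrt (real n) * \<bar>kap n \<omega> - 1\<bar>)"
proof (rule O_P_local[OF O_P_V o_P_V, of "1/2"])
  fix n \<omega> assume "\<bar>V n \<omega> - 1\<bar> \<le> 1/2"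
  from inverse_sqrt_taylor(1)[OF this]
  show "\<bar>sqrt (real n) * \<bar>kap n \<omega> - 1\<bar>\<bar> \<le> \<bar>sqrt (real n) * (V n \<omega> - 1)\<bar>"
    by (simp add: kap_def abs_mult mult_left_mono)
qed simp

lemma O_P_kap: "O_P M (\<lambda>n \<omega>. \<bar>kap n \<omega>\<bar>)"
  by (rule O_P_dom[OF O_P_add[OF O_P_const[of 1] o_P_imp_O_P[OF o_P_kap]]]) simp

text \<open>The effect of estimating the scale: to first order \<open>kap\<close> is 1 - s2 / 2.
  This is the origin of the term with x^2 - 1 in the score.\<close>

lemma o_P_kap_expansion: "o_P M (\<lambda>n \<omega>. sqrt (real n) * (kap n \<omega> - 1) + sqrt (real n) * s2 n \<omega> / 2) (\<lambda>_. 1)"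
proof -
  have "o_P M (\<lambda>n \<omega>. sqrt (real n) * (kap n \<omega> - 1 + (V n \<omega> - 1) / 2)) (\<lambda>_. 1)"
  proof (rule o_P_local[OF o_P_V O_P_V o_P_V, of "1/2"])
    fix n \<omega> assume "\<bar>V n \<omega> - 1\<bar> \<le> 1/2"
    from inverse_sqrt_taylor(2)[OF this]
    have "sqrt (real n) * \<bar>kap n \<omega> - 1 + (V n \<omega> - 1) / 2\<bar> \<le> sqrt (real n) * (V n \<omega> - 1)\<^sup>2"
      by (intro mult_left_mono) (simp_all add: kap_def)
    then show "\<bar>sqrt (real n) * (kap n \<omega> - 1 + (V n \<omega> - 1) / 2)\<bar> \<le> \<bar>V n \<omega> - 1\<bar> * \<bar>sqrt (real n) * (V n \<omega> - 1)\<bar>"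
      by (simp add: abs_mult power2_eq_square mult.left_commute)
  qed simp
  from o_P_diff[OF this O_P_mult_o_P[OF O_P_const[of "1/2"] o_P_V_s2]]
  show ?thesis
  proof (rule o_P_dom)
    fix n \<omega>
    have "sqrt (real n) * (kap n \<omega> - 1) + sqrt (real n) * s2 n \<omega> / 2
      = sqrt (real n) * (kap n \<omega> - 1 + (V n \<omega> - 1) / 2) - 1 / 2 * (sqrt (real n) * (V n \<omega> - 1 - s2 n \<omega>))"
      by (simp add: algebra_simps add_divide_distrib diff_divide_distrib)
    then show "\<bar>sqrt (real n) * (kap n \<omega> - 1) + sqrt (real n) * s2 n \<omega> / 2\<bar>
      \<le> \<bar>sqrt (real n) * (kap n \<omega> - 1 + (V n \<omega> - 1) / 2) - 1 / 2 * (sqrt (real n) * (V n \<omega> - 1 - s2 n \<omega>))\<bar>"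
      by (simp only: order_refl)
  qed
qed

lemma \<delta>_expand: "\<delta> n \<omega> j = (kap n \<omega> - 1) * e j \<omega> - kap n \<omega> * m n \<omega> - kap n \<omega> * inner (X j \<omega> - xb n \<omega>) (b n \<omega>)"
  by (simp add: \<delta>_def r_def res_def algebra_simps)

text \<open>Only quadratic quantities occur: (kap - 1)^2 and m^2 are of order 1/n, and norm b ^ 2 is
  o_P(n^(-1/2)) by the assumed rate.\<close>

lemma o_P_\<delta>: "o_P M (\<lambda>n \<omega>. sqrt (real n) * mean_upto n (\<lambda>j. (\<delta> n \<omega> j)\<^sup>2)) (\<lambda>_. 1)"
proof -
  let ?N = "\<lambda>n. sqrt (real n)"
  have "o_P M (\<lambda>n \<omega>. \<bar>kap n \<omega> - 1\<bar> * (3 * ((?N n * \<bar>kap n \<omega> - 1\<bar>) * mean_upto n (\<lambda>j. (e j \<omega>)\<^sup>2)))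
     + \<bar>m n \<omega>\<bar> * (3 * (\<bar>kap n \<omega>\<bar> * \<bar>kap n \<omega>\<bar> * (?N n * \<bar>m n \<omega>\<bar>)))
     + (?N n * (norm (b n \<omega>))\<^sup>2) * (3 * (\<bar>kap n \<omega>\<bar> * \<bar>kap n \<omega>\<bar> * XX n \<omega>))) (\<lambda>_. 1)"
    by (intro o_P_add o_P_mult O_P_mult O_P_const o_P_kap O_P_root_kap O_P_mean_e_square o_P_m O_P_kap O_P_m o_P_b2 O_P_XX)
  then show ?thesis
  proof (rule o_P_dom)
    fix n :: nat and \<omega> assume n: "n > 0"
    let ?k = "kap n \<omega>" and ?m = "m n \<omega>" and ?b = "b n \<omega>"
    \<comment> \<open>The difference of the two sides is (x + y)^2 + (x + z)^2 + (y - z)^2.\<close>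
    have sq3: "(x - y - z)\<^sup>2 \<le> 3 * x\<^sup>2 + 3 * y\<^sup>2 + 3 * z\<^sup>2" for x y z :: real
    proof -
      have "0 \<le> (x + y)\<^sup>2 + (x + z)\<^sup>2 + (y - z)\<^sup>2" by simp
      then show ?thesis by (simp add: power2_eq_square algebra_simps)
    qed
    have "mean_upto n (\<lambda>j. (\<delta> n \<omega> j)\<^sup>2) \<le> mean_upto n (\<lambda>j. (3 * (?k - 1)\<^sup>2) * (e j \<omega>)\<^sup>2 + 3 * (?k * ?m)\<^sup>2
        + (3 * ?k\<^sup>2) * (inner (X j \<omega> - xb n \<omega>) ?b)\<^sup>2)"
    proof (rule mean_upto_mono)
      fix j show "(\<delta> n \<omega> j)\<^sup>2 \<le> (3 * (?k - 1)\<^sup>2) * (e j \<omega>)\<^sup>2 + 3 * (?k * ?m)\<^sup>2 + (3 * ?k\<^sup>2) * (inner (X j \<omega> - xb n \<omega>) ?b)\<^sup>2"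
        using sq3[of "(?k - 1) * e j \<omega>" "?k * ?m" "?k * inner (X j \<omega> - xb n \<omega>) ?b"]
        unfolding \<delta>_expand power_mult_distrib by (simp only: mult.assoc)
    qed
    also have "\<dots> = (3 * (?k - 1)\<^sup>2) * mean_upto n (\<lambda>j. (e j \<omega>)\<^sup>2) + 3 * (?k * ?m)\<^sup>2
        + (3 * ?k\<^sup>2) * mean_upto n (\<lambda>j. (inner (X j \<omega> - xb n \<omega>) ?b)\<^sup>2)"
      by (subst mean_upto_add, subst mean_upto_add) (simp only: mean_upto_mult mean_upto_const[OF n])
    also have "\<dots> \<le> (3 * (?k - 1)\<^sup>2) * mean_upto n (\<lambda>j. (e j \<omega>)\<^sup>2) + 3 * (?k * ?m)\<^sup>2
        + (3 * ?k\<^sup>2) * ((norm ?b)\<^sup>2 * XX n \<omega>)"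
      by (intro add_left_mono mult_left_mono mean_inner_square_le) simp
    finally have "?N n * mean_upto n (\<lambda>j. (\<delta> n \<omega> j)\<^sup>2) \<le> ?N n * ((3 * (?k - 1)\<^sup>2) * mean_upto n (\<lambda>j. (e j \<omega>)\<^sup>2) + 3 * (?k * ?m)\<^sup>2
        + (3 * ?k\<^sup>2) * ((norm ?b)\<^sup>2 * XX n \<omega>))" by (rule mult_left_mono) simp
    also have "\<dots> = \<bar>?k - 1\<bar> * (3 * ((?N n * \<bar>?k - 1\<bar>) * mean_upto n (\<lambda>j. (e j \<omega>)\<^sup>2)))
     + \<bar>?m\<bar> * (3 * (\<bar>?k\<bar> * \<bar>?k\<bar> * (?N n * \<bar>?m\<bar>))) + (?N n * (norm ?b)\<^sup>2) * (3 * (\<bar>?k\<bar> * \<bar>?k\<bar> * XX n \<omega>))"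
    proof -
      have sq: "x\<^sup>2 = \<bar>x\<bar> * \<bar>x\<bar>" for x :: real by (simp add: power2_eq_square)
      show ?thesis unfolding power_mult_distrib sq[of "?k - 1"] sq[of ?k] sq[of ?m] by (simp only: distrib_left mult_ac)
    qed
    finally show "\<bar>?N n * mean_upto n (\<lambda>j. (\<delta> n \<omega> j)\<^sup>2)\<bar> \<le> \<bar>\<bar>?k - 1\<bar> * (3 * ((?N n * \<bar>?k - 1\<bar>) * mean_upto n (\<lambda>j. (e j \<omega>)\<^sup>2)))
     + \<bar>?m\<bar> * (3 * (\<bar>?k\<bar> * \<bar>?k\<bar> * (?N n * \<bar>?m\<bar>))) + (?N n * (norm ?b)\<^sup>2) * (3 * (\<bar>?k\<bar> * \<bar>?k\<bar> * XX n \<omega>))\<bar>"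
      using mean_upto_nonneg[of "\<lambda>j. (\<delta> n \<omega> j)\<^sup>2" n] by (smt (verit) mult_nonneg_nonneg real_sqrt_ge_zero of_nat_0_le_iff zero_le_power2)
  qed
qed

definition "\<rho> n \<omega> = mean_upto n (r n \<omega>) - eb n \<omega> + m n \<omega>"

text \<open>In part (i) both summands vanish identically, since then \<open>m\<close> equals the
  mean error and the covariates are centred at their sample mean. In part (ii) each is a product of
  a small factor and a factor of order n^(-1/2).\<close>

lemma \<rho>_eq:
  assumes n: "n > 0"
  shows "\<rho> n \<omega> = (kap n \<omega> - 1) * (eb n \<omega> - m n \<omega>) - kap n \<omega> * inner (Xd n \<omega>) (b n \<omega>)"
proof -
  have lin: "linear (\<lambda>x. inner x (b n \<omega>))" by (simp add: linear_iff inner_add_left)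
  have "mean_upto n (r n \<omega>) = kap n \<omega> * mean_upto n (\<lambda>j. e j \<omega> - m n \<omega> - inner (X j \<omega> - xb n \<omega>) (b n \<omega>))"
    unfolding r_def[abs_def] res_def mean_upto_mult ..
  also have "mean_upto n (\<lambda>j. e j \<omega> - m n \<omega> - inner (X j \<omega> - xb n \<omega>) (b n \<omega>)) = eb n \<omega> - m n \<omega> - inner (Xd n \<omega>) (b n \<omega>)"
    unfolding mean_upto_diff[of n "\<lambda>j. e j \<omega> - m n \<omega>"] mean_upto_diff[of n "\<lambda>j. e j \<omega>"] mean_upto_linear[OF lin, symmetric]
      mean_upto_diff[of n "\<lambda>j. X j \<omega>"] mean_upto_const[OF n] ..
  finally show ?thesis by (simp add: \<rho>_def algebra_simps)
qed

lemma o_P_\<rho>: "o_P M (\<lambda>n \<omega>. sqrt (real n) * \<rho> n \<omega>) (\<lambda>_. 1)"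
proof -
  let ?N = "\<lambda>n. sqrt (real n)"
  have "o_P M (\<lambda>n \<omega>. \<bar>kap n \<omega> - 1\<bar> * (?N n * \<bar>eb n \<omega>\<bar> + ?N n * \<bar>m n \<omega>\<bar>) + norm (b n \<omega>) * (\<bar>kap n \<omega>\<bar> * (?N n * norm (Xd n \<omega>)))) (\<lambda>_. 1)"
    by (intro o_P_add o_P_mult O_P_add O_P_mult o_P_kap O_P_mean_e O_P_m o_P_b O_P_kap O_P_mean_X_xb)
  then show ?thesis
  proof (rule o_P_dom)
    fix n :: nat and \<omega> assume n: "n > 0"
    let ?k = "kap n \<omega>"
    have "\<bar>\<rho> n \<omega>\<bar> \<le> \<bar>?k - 1\<bar> * (\<bar>eb n \<omega>\<bar> + \<bar>m n \<omega>\<bar>) + \<bar>?k\<bar> * (norm (Xd n \<omega>) * norm (b n \<omega>))"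
      unfolding \<rho>_eq[OF n]
      by (rule abs_diff_le_add) (auto simp: abs_mult intro!: mult_left_mono Cauchy_Schwarz_ineq2 abs_triangle_ineq4)
    then have "?N n * \<bar>\<rho> n \<omega>\<bar> \<le> ?N n * (\<bar>?k - 1\<bar> * (\<bar>eb n \<omega>\<bar> + \<bar>m n \<omega>\<bar>) + \<bar>?k\<bar> * (norm (Xd n \<omega>) * norm (b n \<omega>)))"
      by (rule mult_left_mono) simp
    also have "\<dots> = \<bar>?k - 1\<bar> * (?N n * \<bar>eb n \<omega>\<bar> + ?N n * \<bar>m n \<omega>\<bar>) + norm (b n \<omega>) * (\<bar>?k\<bar> * (?N n * norm (Xd n \<omega>)))"
      by (simp add: algebra_simps)
    finally show "\<bar>?N n * \<rho> n \<omega>\<bar> \<le> \<bar>\<bar>?k - 1\<bar> * (?N n * \<bar>eb n \<omega>\<bar> + ?N n * \<bar>m n \<omega>\<bar>) + norm (b n \<omega>) * (\<bar>?k\<bar> * (?N n * norm (Xd n \<omega>)))\<bar>"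
      unfolding abs_mult[of "?N n"] by simp
  qed
qed

end

section \<open>Comparison of the residual process with the score process\<close>

lemma mean_fun_bound:
  assumes "\<And>x. \<bar>f x\<bar> \<le> 2 * \<bar>t\<bar> * (1 + x\<^sup>2)"
  shows "\<bar>mean_upto n (\<lambda>j. f (y j))\<bar> \<le> 2 * \<bar>t\<bar> * mean_upto n (\<lambda>j. 1 + (y j)\<^sup>2)"
    and "norm (mean_upto n (\<lambda>j. f (y j) *\<^sub>R x j)) \<le> 2 * \<bar>t\<bar> * mean_upto n (\<lambda>j. (1 + (y j)\<^sup>2) * norm (x j))"
proof -
  show "\<bar>mean_upto n (\<lambda>j. f (y j))\<bar> \<le> 2 * \<bar>t\<bar> * mean_upto n (\<lambda>j. 1 + (y j)\<^sup>2)"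
    unfolding mean_upto_mult[symmetric] by (rule order_trans[OF abs_mean_upto_le mean_upto_mono]) (rule assms)
  have "norm (mean_upto n (\<lambda>j. f (y j) *\<^sub>R x j)) \<le> mean_upto n (\<lambda>j. norm (f (y j) *\<^sub>R x j))"
    using norm_sum[of "\<lambda>j. f (y j) *\<^sub>R x j" "{..<n}"] by (simp add: mean_upto_def mult_left_mono)
  also have "\<dots> \<le> mean_upto n (\<lambda>j. 2 * \<bar>t\<bar> * ((1 + (y j)\<^sup>2) * norm (x j)))"
    using mult_right_mono[OF assms norm_ge_zero] by (intro mean_upto_mono) (simp add: mult.assoc)
  finally show "norm (mean_upto n (\<lambda>j. f (y j) *\<^sub>R x j)) \<le> 2 * \<bar>t\<bar> * mean_upto n (\<lambda>j. (1 + (y j)\<^sup>2) * norm (x j))"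
    unfolding mean_upto_mult .
qed

lemma integrable_square_of_t4:
  fixes P :: "real \<Rightarrow> real"
  assumes t4: "integrable \<nu> (\<lambda>t. t ^ 4)" and P: "P \<in> borel_measurable \<nu>" and le: "\<And>t. \<bar>P t\<bar> \<le> C * t\<^sup>2"
  shows "integrable \<nu> (\<lambda>t. (P t)\<^sup>2)"
proof (rule Bochner_Integration.integrable_bound)
  show "integrable \<nu> (\<lambda>t. C\<^sup>2 * t ^ 4)" using t4 by simp
  show "AE t in \<nu>. norm ((P t)\<^sup>2) \<le> norm (C\<^sup>2 * t ^ 4)"
  proof (rule AE_I2)
    fix t
    have "\<bar>P t\<bar>\<^sup>2 \<le> (C * t\<^sup>2)\<^sup>2" using le[of t] by (intro power_mono) auto
    then show "norm ((P t)\<^sup>2) \<le> norm (C\<^sup>2 * t ^ 4)" by (simp add: power_mult_distrib)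
  qed
qed (use P in measurable)

lemma score_process_square_integrable:
  assumes t4: "integrable \<nu> (\<lambda>t. t ^ 4)" and sets: "sets \<nu> = sets borel" and c: "c \<in> {0, 1}"
    and t2: "c = 1 \<or> integrable \<nu> (\<lambda>t. t\<^sup>2)"
  shows "integrable \<nu> (\<lambda>t. ((\<Sum>i<n. score c t (x i)) / N)\<^sup>2)"
proof -
  have m: "(\<lambda>t. (\<Sum>i<n. score c t (x i)) / N) \<in> borel_measurable borel" unfolding score_def by measurable
  have [measurable]: "(\<lambda>t. (\<Sum>i<n. score c t (x i)) / N) \<in> borel_measurable \<nu>"
    using m by (simp only: measurable_cong_sets[OF sets refl])
  define A where "A = (\<Sum>i<n. 3 * (1 + (x i)\<^sup>2)) / \<bar>N\<bar>"
  define B where "B = (\<Sum>i<n. (1 - c) * \<bar>x i\<bar>) / \<bar>N\<bar>"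
  have le: "\<bar>(\<Sum>i<n. score c t (x i)) / N\<bar> \<le> A * t\<^sup>2 + B * \<bar>t\<bar>" for t
  proof -
    have "\<bar>\<Sum>i<n. score c t (x i)\<bar> \<le> (\<Sum>i<n. \<bar>score c t (x i)\<bar>)" by (rule sum_abs)
    also have "\<dots> \<le> (\<Sum>i<n. 3 * t\<^sup>2 * (1 + (x i)\<^sup>2) + (1 - c) * \<bar>t * x i\<bar>)" by (intro sum_mono score_bound c)
    also have "\<dots> = (\<Sum>i<n. 3 * (1 + (x i)\<^sup>2)) * t\<^sup>2 + (\<Sum>i<n. (1 - c) * \<bar>x i\<bar>) * \<bar>t\<bar>"
      by (simp only: sum.distrib sum_distrib_left sum_distrib_right abs_mult mult_ac)
    finally have "\<bar>\<Sum>i<n. score c t (x i)\<bar> / \<bar>N\<bar> \<le> ((\<Sum>i<n. 3 * (1 + (x i)\<^sup>2)) * t\<^sup>2 + (\<Sum>i<n. (1 - c) * \<bar>x i\<bar>) * \<bar>t\<bar>) / \<bar>N\<bar>"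
      by (rule divide_right_mono) simp
    then show ?thesis by (simp add: A_def B_def add_divide_distrib)
  qed
  have A0: "0 \<le> A" by (simp add: A_def sum_nonneg)
  have B0: "0 \<le> B" using c by (auto simp: B_def sum_nonneg)
  show ?thesis
  proof (cases "c = 1")
    case True
    then have "B = 0" by (simp add: B_def)
    then show ?thesis using le by (intro integrable_square_of_t4[OF t4, where C=A]) auto
  next
    case False
    then have t2: "integrable \<nu> (\<lambda>t. t\<^sup>2)" using t2 by simp
    have i: "integrable \<nu> (\<lambda>t. 2 * A\<^sup>2 * t ^ 4 + 2 * B\<^sup>2 * t\<^sup>2)" using t4 t2 by simp
    show ?thesis
    proof (rule Bochner_Integration.integrable_bound[OF i])
      show "AE t in \<nu>. norm (((\<Sum>i<n. score c t (x i)) / N)\<^sup>2) \<le> norm (2 * A\<^sup>2 * t ^ 4 + 2 * B\<^sup>2 * t\<^sup>2)"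
      proof (rule AE_I2)
        fix t
        have "\<bar>(\<Sum>i<n. score c t (x i)) / N\<bar>\<^sup>2 \<le> (A * t\<^sup>2 + B * \<bar>t\<bar>)\<^sup>2" using le by (intro power_mono) auto
        also have "\<dots> \<le> 2 * (A * t\<^sup>2)\<^sup>2 + 2 * (B * \<bar>t\<bar>)\<^sup>2"
          using zero_le_power2[of "A * t\<^sup>2 - B * \<bar>t\<bar>"] unfolding power2_sum power2_diff by simp
        finally show "norm (((\<Sum>i<n. score c t (x i)) / N)\<^sup>2) \<le> norm (2 * A\<^sup>2 * t ^ 4 + 2 * B\<^sup>2 * t\<^sup>2)"
          by (simp add: power_mult_distrib power_divide)
      qed
    qed simp
  qed
qed

context residual_sample
begin

lemma measurable_\<nu>: "measurable \<nu> N = measurable borel N" "measurable (M \<Otimes>\<^sub>M \<nu>) N = measurable (M \<Otimes>\<^sub>M borel) N"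
  by (rule measurable_cong_sets[OF sets_\<nu> refl]) (rule measurable_cong_sets[OF borel_pair_\<nu> refl])

text \<open>Since |f t x| \<le> 2 |t| (1 + x^2), the variance of \<open>f t\<close> is at most 4 t^2
  K, where K is the second moment of 1 + x^2. The further factor t gives a second moment of order
  t^4 / n for the mean, which the weight can integrate. The last two claims are the pathwise
  counterparts for fixed n.\<close>

lemma O_P_weighted_means:
  fixes f :: "real \<Rightarrow> real \<Rightarrow> real"
  assumes fm: "(\<lambda>(t, x). f t x) \<in> borel_measurable (borel \<Otimes>\<^sub>M borel)"
    and f0: "\<And>t. integral\<^sup>L std_normal_distribution (f t) = 0"
    and fb: "\<And>t x. \<bar>f t x\<bar> \<le> 2 * \<bar>t\<bar> * (1 + x\<^sup>2)"
  shows "O_P M (\<lambda>n \<omega>. \<integral>t. (sqrt (real n) * \<bar>t * mean_upto n (\<lambda>j. f t (e j \<omega>))\<bar>)\<^sup>2 \<partial>\<nu>)"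
    and "O_P M (\<lambda>n \<omega>. \<integral>t. (sqrt (real n) * norm (t *\<^sub>R mean_upto n (\<lambda>j. f t (e j \<omega>) *\<^sub>R X j \<omega>)))\<^sup>2 \<partial>\<nu>)"
    and "integrable \<nu> (\<lambda>t. (sqrt (real n) * \<bar>t * mean_upto n (\<lambda>j. f t (e j \<omega>))\<bar>)\<^sup>2)"
    and "integrable \<nu> (\<lambda>t. (sqrt (real n) * norm (t *\<^sub>R mean_upto n (\<lambda>j. f t (e j \<omega>) *\<^sub>R X j \<omega>)))\<^sup>2)"
proof -
  note [measurable] = fm
  define K where "K = (\<integral>x. (1 + x\<^sup>2)\<^sup>2 \<partial>std_normal_distribution)"
  have ft[measurable]: "f t \<in> borel_measurable borel" for t
    using measurable_compose[OF measurable_Pair1'[of t borel borel] fm] by simp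
  have f2: "(f t x)\<^sup>2 \<le> 4 * t\<^sup>2 * (1 + x\<^sup>2)\<^sup>2" for t x
    using power_mono[OF fb[of t x], of 2] by (simp add: power_mult_distrib)
  have i2: "integrable std_normal_distribution (\<lambda>x. (f t x)\<^sup>2)" for t
    by (rule integrable_std_normal_poly_bound[where C="4 * t\<^sup>2" and m=2]) (use f2 in auto)
  have v: "(\<integral>x. (f t x)\<^sup>2 \<partial>std_normal_distribution) \<le> 4 * t\<^sup>2 * K" for t
    unfolding K_def integral_mult_right_zero[symmetric]
    by (intro integral_mono i2 integrable_mult_right integrable_std_normal_power f2)
  have B2: "0 \<le> B2" using X_square_mean[of 0] by (metis integral_nonneg_AE AE_I2 zero_le_power2)
  show "O_P M (\<lambda>n \<omega>. \<integral>t. (sqrt (real n) * \<bar>t * mean_upto n (\<lambda>j. f t (e j \<omega>))\<bar>)\<^sup>2 \<partial>\<nu>)"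
  proof (rule O_P_weighted_integral[OF \<nu>.sigma_finite_measure_axioms, where g="\<lambda>t. 4 * K * t ^ 4"])
    show "(\<lambda>(\<omega>, t). (sqrt (real n) * \<bar>t * mean_upto n (\<lambda>j. f t (e j \<omega>))\<bar>)\<^sup>2) \<in> borel_measurable (M \<Otimes>\<^sub>M \<nu>)" for n
      unfolding measurable_\<nu> mean_upto_def by measurable
    fix n :: nat and t assume n: "n > 0"
    note s = scalar_mean_square[OF ft f0 i2 v n]
    have eq: "(sqrt (real n) * \<bar>t * y\<bar>)\<^sup>2 = (real n * t\<^sup>2) * y\<^sup>2" for y by (simp add: power_mult_distrib)
    show "integrable M (\<lambda>\<omega>. (sqrt (real n) * \<bar>t * mean_upto n (\<lambda>j. f t (e j \<omega>))\<bar>)\<^sup>2)"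
      unfolding eq by (intro integrable_mult_right s(1))
    have "(real n * t\<^sup>2) * (\<integral>\<omega>. (mean_upto n (\<lambda>j. f t (e j \<omega>)))\<^sup>2 \<partial>M) \<le> (real n * t\<^sup>2) * (4 * t\<^sup>2 * K / real n)"
      by (rule mult_left_mono[OF s(2)]) simp
    also have "\<dots> = 4 * K * t ^ 4" using n by (simp add: power2_eq_square power4_eq_xxxx)
    finally show "(\<integral>\<omega>. (sqrt (real n) * \<bar>t * mean_upto n (\<lambda>j. f t (e j \<omega>))\<bar>)\<^sup>2 \<partial>M) \<le> 4 * K * t ^ 4"
      unfolding eq by simp
  qed (use t4 in auto)
  show "O_P M (\<lambda>n \<omega>. \<integral>t. (sqrt (real n) * norm (t *\<^sub>R mean_upto n (\<lambda>j. f t (e j \<omega>) *\<^sub>R X j \<omega>)))\<^sup>2 \<partial>\<nu>)"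
  proof (rule O_P_weighted_integral[OF \<nu>.sigma_finite_measure_axioms, where g="\<lambda>t. 4 * K * B2 * t ^ 4"])
    show "(\<lambda>(\<omega>, t). (sqrt (real n) * norm (t *\<^sub>R mean_upto n (\<lambda>j. f t (e j \<omega>) *\<^sub>R X j \<omega>)))\<^sup>2) \<in> borel_measurable (M \<Otimes>\<^sub>M \<nu>)" for n
      unfolding measurable_\<nu> mean_upto_def by measurable
    fix n :: nat and t assume n: "n > 0"
    note s = vector_mean_square[OF ft f0 i2 v n]
    have eq: "(sqrt (real n) * norm (t *\<^sub>R y))\<^sup>2 = (real n * t\<^sup>2) * (norm y)\<^sup>2" for y :: 'h by (simp add: power_mult_distrib)
    show "integrable M (\<lambda>\<omega>. (sqrt (real n) * norm (t *\<^sub>R mean_upto n (\<lambda>j. f t (e j \<omega>) *\<^sub>R X j \<omega>)))\<^sup>2)"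
      unfolding eq by (intro integrable_mult_right s(1))
    have "(real n * t\<^sup>2) * (\<integral>\<omega>. (norm (mean_upto n (\<lambda>j. f t (e j \<omega>) *\<^sub>R X j \<omega>)))\<^sup>2 \<partial>M) \<le> (real n * t\<^sup>2) * (4 * t\<^sup>2 * K * B2 / real n)"
      by (rule mult_left_mono[OF s(2)]) simp
    also have "\<dots> = 4 * K * B2 * t ^ 4" using n by (simp add: power2_eq_square power4_eq_xxxx)
    finally show "(\<integral>\<omega>. (sqrt (real n) * norm (t *\<^sub>R mean_upto n (\<lambda>j. f t (e j \<omega>) *\<^sub>R X j \<omega>)))\<^sup>2 \<partial>M) \<le> 4 * K * B2 * t ^ 4"
      unfolding eq by simp
  qed (use t4 in auto)
  have tt: "\<bar>t\<bar> * (2 * \<bar>t\<bar> * y) = 2 * y * t\<^sup>2" for t y :: real by (simp add: power2_eq_square)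
  show "integrable \<nu> (\<lambda>t. (sqrt (real n) * \<bar>t * mean_upto n (\<lambda>j. f t (e j \<omega>))\<bar>)\<^sup>2)"
  proof (rule integrable_square_of_t4[OF t4, where C="sqrt (real n) * (2 * mean_upto n (\<lambda>j. 1 + (e j \<omega>)\<^sup>2))"])
    show "(\<lambda>t. sqrt (real n) * \<bar>t * mean_upto n (\<lambda>j. f t (e j \<omega>))\<bar>) \<in> borel_measurable \<nu>"
      unfolding measurable_\<nu> mean_upto_def by measurable
    fix t
    have "\<bar>t\<bar> * \<bar>mean_upto n (\<lambda>j. f t (e j \<omega>))\<bar> \<le> \<bar>t\<bar> * (2 * \<bar>t\<bar> * mean_upto n (\<lambda>j. 1 + (e j \<omega>)\<^sup>2))"
      by (intro mult_left_mono mean_fun_bound fb) simp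
    then have "sqrt (real n) * (\<bar>t\<bar> * \<bar>mean_upto n (\<lambda>j. f t (e j \<omega>))\<bar>) \<le> sqrt (real n) * (2 * mean_upto n (\<lambda>j. 1 + (e j \<omega>)\<^sup>2) * t\<^sup>2)"
      unfolding tt by (rule mult_left_mono) simp
    then show "\<bar>sqrt (real n) * \<bar>t * mean_upto n (\<lambda>j. f t (e j \<omega>))\<bar>\<bar> \<le> sqrt (real n) * (2 * mean_upto n (\<lambda>j. 1 + (e j \<omega>)\<^sup>2)) * t\<^sup>2"
      by (simp add: abs_mult mult.assoc)
  qed
  show "integrable \<nu> (\<lambda>t. (sqrt (real n) * norm (t *\<^sub>R mean_upto n (\<lambda>j. f t (e j \<omega>) *\<^sub>R X j \<omega>)))\<^sup>2)"
  proof (rule integrable_square_of_t4[OF t4, where C="sqrt (real n) * (2 * mean_upto n (\<lambda>j. (1 + (e j \<omega>)\<^sup>2) * norm (X j \<omega>)))"])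
    show "(\<lambda>t. sqrt (real n) * norm (t *\<^sub>R mean_upto n (\<lambda>j. f t (e j \<omega>) *\<^sub>R X j \<omega>))) \<in> borel_measurable \<nu>"
      unfolding measurable_\<nu> mean_upto_def by measurable
    fix t
    have "\<bar>t\<bar> * norm (mean_upto n (\<lambda>j. f t (e j \<omega>) *\<^sub>R X j \<omega>)) \<le> \<bar>t\<bar> * (2 * \<bar>t\<bar> * mean_upto n (\<lambda>j. (1 + (e j \<omega>)\<^sup>2) * norm (X j \<omega>)))"
      by (intro mult_left_mono mean_fun_bound fb) simp
    then have "sqrt (real n) * (\<bar>t\<bar> * norm (mean_upto n (\<lambda>j. f t (e j \<omega>) *\<^sub>R X j \<omega>))) \<le> sqrt (real n) * (2 * mean_upto n (\<lambda>j. (1 + (e j \<omega>)\<^sup>2) * norm (X j \<omega>)) * t\<^sup>2)"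
      unfolding tt by (rule mult_left_mono) simp
    then show "\<bar>sqrt (real n) * norm (t *\<^sub>R mean_upto n (\<lambda>j. f t (e j \<omega>) *\<^sub>R X j \<omega>))\<bar> \<le> sqrt (real n) * (2 * mean_upto n (\<lambda>j. (1 + (e j \<omega>)\<^sup>2) * norm (X j \<omega>))) * t\<^sup>2"
      by (simp add: abs_mult mult.assoc)
  qed
qed

text \<open>The summands of \<open>A1\<close>, \<open>A2\<close> and \<open>A3\<close> in the
  expansion: x * ker' (t * x) and ker' (t * x), centred by their means -t * phi1 t and phi1 t -
  1.\<close>

definition "f1 t x = x * ker' (t * x) + t * phi1 t"
definition "f2 t x = ker' (t * x) - (phi1 t - 1)"

lemma f1_conditions:
  "(\<lambda>(t, x). f1 t x) \<in> borel_measurable (borel \<Otimes>\<^sub>M borel)" "integral\<^sup>L std_normal_distribution (f1 t) = 0"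
  "\<bar>f1 t x\<bar> \<le> 2 * \<bar>t\<bar> * (1 + x\<^sup>2)"
proof -
  show "(\<lambda>(t, x). f1 t x) \<in> borel_measurable (borel \<Otimes>\<^sub>M borel)" unfolding f1_def by measurable
  have "has_std_normal_mean (\<lambda>x. x * ker' (t * x) + (t * phi1 t) * 1) (- (t * phi1 t) + (t * phi1 t) * 1)"
    by (intro has_mean_intros x_ker'_mean)
  then show "integral\<^sup>L std_normal_distribution (f1 t) = 0" by (simp add: has_bochner_integral_iff f1_def[abs_def])
  have "\<bar>x\<bar> * \<bar>ker' (t * x)\<bar> \<le> \<bar>x\<bar> * (2 * \<bar>t * x\<bar>)" by (rule mult_left_mono[OF abs_ker'_le(1)]) simp
  also have "\<dots> = 2 * \<bar>t\<bar> * x\<^sup>2" by (simp add: abs_mult power2_eq_square)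
  finally have "\<bar>x * ker' (t * x)\<bar> \<le> 2 * \<bar>t\<bar> * x\<^sup>2" by (simp add: abs_mult)
  moreover have "\<bar>t * phi1 t\<bar> \<le> \<bar>t\<bar> * 1" unfolding abs_mult using phi1_simps(3,4)[of t] by (intro mult_left_mono) auto
  ultimately have "\<bar>f1 t x\<bar> \<le> 2 * \<bar>t\<bar> * x\<^sup>2 + \<bar>t\<bar> * 1" unfolding f1_def by (rule abs_add_le_add)
  also have "\<dots> \<le> 2 * \<bar>t\<bar> * (1 + x\<^sup>2)" by (simp add: algebra_simps)
  finally show "\<bar>f1 t x\<bar> \<le> 2 * \<bar>t\<bar> * (1 + x\<^sup>2)" .
qed

lemma f2_conditions:
  "(\<lambda>(t, x). f2 t x) \<in> borel_measurable (borel \<Otimes>\<^sub>M borel)" "integral\<^sup>L std_normal_distribution (f2 t) = 0"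
  "\<bar>f2 t x\<bar> \<le> 2 * \<bar>t\<bar> * (1 + x\<^sup>2)"
proof -
  show "(\<lambda>(t, x). f2 t x) \<in> borel_measurable (borel \<Otimes>\<^sub>M borel)" unfolding f2_def by measurable
  have "has_std_normal_mean (\<lambda>x. ker' (t * x) - (phi1 t - 1) * 1) ((phi1 t - 1) - (phi1 t - 1) * 1)"
    by (intro has_mean_intros ker'_mean)
  then show "integral\<^sup>L std_normal_distribution (f2 t) = 0" by (simp add: has_bochner_integral_iff f2_def[abs_def])
  have "\<bar>ker' (t * x)\<bar> \<le> 2 * \<bar>t * x\<bar>" by (rule abs_ker'_le)
  also have "\<dots> = \<bar>t\<bar> * (2 * \<bar>x\<bar>)" by (simp add: abs_mult)
  also have "\<dots> \<le> \<bar>t\<bar> * (1 + x\<^sup>2)"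
  proof (rule mult_left_mono)
    show "2 * \<bar>x\<bar> \<le> 1 + x\<^sup>2" using zero_le_power2[of "\<bar>x\<bar> - 1"] unfolding power2_diff by simp
  qed simp
  finally have 1: "\<bar>ker' (t * x)\<bar> \<le> \<bar>t\<bar> * (1 + x\<^sup>2)" .
  have "1 - phi1 t \<le> \<bar>t\<bar>"
  proof (cases "\<bar>t\<bar> \<le> 1")
    case True
    then have "\<bar>t\<bar> * \<bar>t\<bar> \<le> \<bar>t\<bar> * 1" by (intro mult_left_mono) auto
    then show ?thesis using one_minus_phi1_le[of t] by (simp add: power2_eq_square)
  next
    case False then show ?thesis using phi1_simps(3)[of t] by linarith
  qed
  then have 2: "\<bar>phi1 t - 1\<bar> \<le> \<bar>t\<bar> * 1" using phi1_simps(4)[of t] by simp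
  have "\<bar>f2 t x\<bar> \<le> \<bar>t\<bar> * (1 + x\<^sup>2) + \<bar>t\<bar> * 1" unfolding f2_def by (rule abs_diff_le_add[OF 1 2])
  also have "\<dots> \<le> 2 * \<bar>t\<bar> * (1 + x\<^sup>2)" by (simp add: algebra_simps)
  finally show "\<bar>f2 t x\<bar> \<le> 2 * \<bar>t\<bar> * (1 + x\<^sup>2)" .
qed

text \<open>The squares of \<open>U\<close> and \<open>S\<close> integrate against \<nu> to the test
  statistic and to its approximation.\<close>

definition "U n \<omega> t = sqrt (real n) * (mean_upto n (\<lambda>j. sin (t * r n \<omega> j) + cos (t * r n \<omega> j)) - phi1 t)"
definition "S n \<omega> t = (\<Sum>j<n. score c t (e j \<omega>)) / sqrt (real n)"

definition "g1 n \<omega> = \<bar>sqrt (real n) * (kap n \<omega> - 1) + sqrt (real n) * s2 n \<omega> / 2\<bar> + \<bar>kap n \<omega> - 1\<bar> * \<bar>sqrt (real n) * m n \<omega>\<bar>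
   + \<bar>kap n \<omega>\<bar> * norm (b n \<omega>) * (sqrt (real n) * norm (Xd n \<omega>)) + sqrt (real n) * mean_upto n (\<lambda>j. (\<delta> n \<omega> j)\<^sup>2)"
definition "g3 n \<omega> = \<bar>kap n \<omega>\<bar> * \<bar>m n \<omega>\<bar> + \<bar>kap n \<omega>\<bar> * norm (b n \<omega>) * norm (xb n \<omega>)"
definition "g4 n \<omega> = \<bar>kap n \<omega>\<bar> * norm (b n \<omega>)"
definition "P2 n \<omega> t = sqrt (real n) * \<bar>t * mean_upto n (\<lambda>j. f1 t (e j \<omega>))\<bar>"
definition "P3 n \<omega> t = sqrt (real n) * \<bar>t * mean_upto n (\<lambda>j. f2 t (e j \<omega>))\<bar>"
definition "P4 n \<omega> t = sqrt (real n) * norm (t *\<^sub>R mean_upto n (\<lambda>j. f2 t (e j \<omega>) *\<^sub>R X j \<omega>))"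

lemma U_S_bound:
  assumes n: "n > 0"
  shows "\<bar>U n \<omega> t - S n \<omega> t\<bar> \<le> \<bar>t\<bar> * \<bar>sqrt (real n) * \<rho> n \<omega>\<bar> + t\<^sup>2 * g1 n \<omega> + P2 n \<omega> t * \<bar>kap n \<omega> - 1\<bar>
     + P3 n \<omega> t * g3 n \<omega> + P4 n \<omega> t * g4 n \<omega>"
proof -
  have r': "(\<lambda>j. kap n \<omega> * (e j \<omega> - m n \<omega> - inner (X j \<omega> - xb n \<omega>) (b n \<omega>))) = r n \<omega>"
    by (simp add: r_def[abs_def] res_def)
  have \<delta>': "(\<lambda>j. (kap n \<omega> * (e j \<omega> - m n \<omega> - inner (X j \<omega> - xb n \<omega>) (b n \<omega>)) - e j \<omega>)\<^sup>2) = (\<lambda>j. (\<delta> n \<omega> j)\<^sup>2)"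
    by (simp add: \<delta>_def[abs_def] r_def res_def)
  have s': "(\<lambda>j. sin (t * (kap n \<omega> * (e j \<omega> - m n \<omega> - inner (X j \<omega> - xb n \<omega>) (b n \<omega>)))) + cos (t * (kap n \<omega> * (e j \<omega> - m n \<omega> - inner (X j \<omega> - xb n \<omega>) (b n \<omega>)))))
    = (\<lambda>j. sin (t * r n \<omega> j) + cos (t * r n \<omega> j))"
    by (simp add: r_def[abs_def] res_def)
  show ?thesis
    unfolding U_def S_def score_eq_mean[OF n] g1_def g3_def g4_def P2_def P3_def P4_def f1_def f2_def \<rho>_def s2_def m_def[symmetric]
    using residual_expansion_bound[OF n, where \<kappa>="kap n \<omega>" and e="\<lambda>j. e j \<omega>" and m="m n \<omega>" and X="\<lambda>j. X j \<omega>"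
      and xb="xb n \<omega>" and b="b n \<omega>" and t=t]
    unfolding r' \<delta>' s' .
qed

lemma o_P_g: "o_P M g1 (\<lambda>_. 1)" "o_P M g3 (\<lambda>_. 1)" "o_P M g4 (\<lambda>_. 1)"
proof -
  have a: "o_P M (\<lambda>n \<omega>. \<bar>sqrt (real n) * (kap n \<omega> - 1) + sqrt (real n) * s2 n \<omega> / 2\<bar>) (\<lambda>_. 1)"
    by (rule o_P_dom[OF o_P_kap_expansion]) simp
  have b: "O_P M (\<lambda>n \<omega>. \<bar>sqrt (real n) * m n \<omega>\<bar>)"
    by (rule O_P_dom[OF O_P_m]) (simp add: abs_mult)
  show g4: "o_P M g4 (\<lambda>_. 1)"
    unfolding g4_def[abs_def] by (rule O_P_mult_o_P[OF O_P_kap o_P_b])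
  show "o_P M g1 (\<lambda>_. 1)"
    unfolding g1_def[abs_def] by (intro o_P_add a o_P_\<delta> o_P_mult o_P_kap b g4[unfolded g4_def[abs_def]] O_P_mean_X_xb)
  show "o_P M g3 (\<lambda>_. 1)"
    unfolding g3_def[abs_def] by (intro o_P_add o_P_mult[OF g4[unfolded g4_def[abs_def]] O_P_xb] O_P_mult_o_P[OF O_P_kap o_P_m])
qed

lemma tail_condition: "c = 1 \<or> integrable \<nu> (\<lambda>t. t\<^sup>2)"
  using centred by blast

lemma S_square_integrable: "integrable \<nu> (\<lambda>t. (S n \<omega> t)\<^sup>2)"
  unfolding S_def by (rule score_process_square_integrable[OF t4 sets_\<nu> c01 tail_condition])

lemma S_measurable[measurable]: "S n \<omega> \<in> borel_measurable \<nu>"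
  unfolding measurable_\<nu> S_def[abs_def] score_def by measurable

lemma U_measurable[measurable]: "U n \<omega> \<in> borel_measurable \<nu>"
  unfolding measurable_\<nu> U_def[abs_def] mean_upto_def by measurable

lemma O_P_S: "O_P M (\<lambda>n \<omega>. \<integral>t. (S n \<omega> t)\<^sup>2 \<partial>\<nu>)"
proof (rule O_P_weighted_integral[OF \<nu>.sigma_finite_measure_axioms, where g="\<lambda>t. score_cov c t t"])
  show "(\<lambda>(\<omega>, t). (S n \<omega> t)\<^sup>2) \<in> borel_measurable (M \<Otimes>\<^sub>M \<nu>)" for n
    unfolding measurable_\<nu> S_def score_def by measurable
  fix n :: nat and t assume n: "n > 0"
  have [measurable]: "score c t \<in> borel_measurable borel" unfolding score_def by measurable
  have c2: "c\<^sup>2 = c" using c01 by auto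
  note sc = score_covariance[OF c2, of t t, unfolded has_bochner_integral_iff power2_eq_square[symmetric]]
  have eq: "(S n \<omega> t)\<^sup>2 = real n * (mean_upto n (\<lambda>j. score c t (e j \<omega>)))\<^sup>2" for \<omega>
    using n by (simp add: S_def mean_upto_def power_divide power_mult_distrib power2_eq_square field_simps)
  have f0: "integral\<^sup>L std_normal_distribution (score c t) = 0"
    using score_mean[of c t] by (simp add: has_bochner_integral_iff)
  have s: "integrable M (\<lambda>\<omega>. (mean_upto n (\<lambda>j. score c t (e j \<omega>)))\<^sup>2)"
    "(\<integral>\<omega>. (mean_upto n (\<lambda>j. score c t (e j \<omega>)))\<^sup>2 \<partial>M) \<le> score_cov c t t / real n"
    by (rule scalar_mean_square[OF _ f0 _ _ n, of "score_cov c t t"]; use sc in simp)+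
  show "integrable M (\<lambda>\<omega>. (S n \<omega> t)\<^sup>2)" unfolding eq by (intro integrable_mult_right s)
  show "(\<integral>\<omega>. (S n \<omega> t)\<^sup>2 \<partial>M) \<le> score_cov c t t"
    unfolding eq using s(2) n by (simp add: field_simps)
qed (use cov_integrable in auto)

lemma difference_square:
  assumes n: "n > 0" and \<omega>: "\<omega> \<in> space M"
  shows "integrable \<nu> (\<lambda>t. (U n \<omega> t - S n \<omega> t)\<^sup>2)"
    and "(\<integral>t. (U n \<omega> t - S n \<omega> t)\<^sup>2 \<partial>\<nu>) \<le> 5 * ((sqrt (real n) * \<rho> n \<omega>)\<^sup>2 * (\<integral>t. t\<^sup>2 \<partial>\<nu>) + (g1 n \<omega>)\<^sup>2 * (\<integral>t. t ^ 4 \<partial>\<nu>)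
       + \<bar>kap n \<omega> - 1\<bar>\<^sup>2 * (\<integral>t. (P2 n \<omega> t)\<^sup>2 \<partial>\<nu>) + (g3 n \<omega>)\<^sup>2 * (\<integral>t. (P3 n \<omega> t)\<^sup>2 \<partial>\<nu>) + (g4 n \<omega>)\<^sup>2 * (\<integral>t. (P4 n \<omega> t)\<^sup>2 \<partial>\<nu>))"
proof -
  define B where "B t = 5 * ((sqrt (real n) * \<rho> n \<omega>)\<^sup>2 * t\<^sup>2 + (g1 n \<omega>)\<^sup>2 * t ^ 4
       + \<bar>kap n \<omega> - 1\<bar>\<^sup>2 * (P2 n \<omega> t)\<^sup>2 + (g3 n \<omega>)\<^sup>2 * (P3 n \<omega> t)\<^sup>2 + (g4 n \<omega>)\<^sup>2 * (P4 n \<omega> t)\<^sup>2)" for t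
  have le: "(U n \<omega> t - S n \<omega> t)\<^sup>2 \<le> B t" for t
  proof -
    have five: "(x1 + x2 + x3 + x4 + x5)\<^sup>2 \<le> 5 * (x1\<^sup>2 + x2\<^sup>2 + x3\<^sup>2 + x4\<^sup>2 + x5\<^sup>2)" for x1 x2 x3 x4 x5 :: real
    proof -
      have "0 \<le> (x1 - x2)\<^sup>2 + (x1 - x3)\<^sup>2 + (x1 - x4)\<^sup>2 + (x1 - x5)\<^sup>2 + (x2 - x3)\<^sup>2 + (x2 - x4)\<^sup>2 + (x2 - x5)\<^sup>2
        + (x3 - x4)\<^sup>2 + (x3 - x5)\<^sup>2 + (x4 - x5)\<^sup>2" by simp
      then show ?thesis by (simp add: power2_eq_square algebra_simps)
    qed
    have "\<bar>U n \<omega> t - S n \<omega> t\<bar>\<^sup>2 \<le> (\<bar>t\<bar> * \<bar>sqrt (real n) * \<rho> n \<omega>\<bar> + t\<^sup>2 * g1 n \<omega> + P2 n \<omega> t * \<bar>kap n \<omega> - 1\<bar>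
     + P3 n \<omega> t * g3 n \<omega> + P4 n \<omega> t * g4 n \<omega>)\<^sup>2"
      by (rule power_mono[OF U_S_bound[OF n]]) simp
    also have "\<dots> \<le> 5 * ((\<bar>t\<bar> * \<bar>sqrt (real n) * \<rho> n \<omega>\<bar>)\<^sup>2 + (t\<^sup>2 * g1 n \<omega>)\<^sup>2 + (P2 n \<omega> t * \<bar>kap n \<omega> - 1\<bar>)\<^sup>2
     + (P3 n \<omega> t * g3 n \<omega>)\<^sup>2 + (P4 n \<omega> t * g4 n \<omega>)\<^sup>2)" by (rule five)
    also have "\<dots> = B t"
    proof -
      have t4: "(t\<^sup>2)\<^sup>2 = t ^ 4" by simp
      show ?thesis unfolding B_def power_mult_distrib power2_abs t4 by (simp only: mult_ac)
    qed
    finally show ?thesis by simp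
  qed
  \<comment> \<open>If t^2 is not integrable its integral is 0 by convention, so the bound is sound
    only because \<rho> is then identically 0: by \<open>centred\<close> this can happen only for c
    = 1 with exact centring.\<close>
  have i1: "integrable \<nu> (\<lambda>t. (sqrt (real n) * \<rho> n \<omega>)\<^sup>2 * t\<^sup>2)"
  proof (cases "integrable \<nu> (\<lambda>t. t\<^sup>2)")
    case False
    then have c1: "c = 1" and xb: "xb n \<omega> = mean_upto n (\<lambda>j. X j \<omega>)" using centred \<omega> by auto
    have "m n \<omega> = eb n \<omega>" unfolding m_def by (subst c1) simp
    then have "\<rho> n \<omega> = 0" unfolding \<rho>_eq[OF n] xb by simp
    then show ?thesis by simp
  qed simp
  have i2: "integrable \<nu> (\<lambda>t. (P2 n \<omega> t)\<^sup>2)" unfolding P2_def by (rule O_P_weighted_means(3)[OF f1_conditions])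
  have i3: "integrable \<nu> (\<lambda>t. (P3 n \<omega> t)\<^sup>2)" unfolding P3_def by (rule O_P_weighted_means(3)[OF f2_conditions])
  have i4: "integrable \<nu> (\<lambda>t. (P4 n \<omega> t)\<^sup>2)" unfolding P4_def by (rule O_P_weighted_means(4)[OF f2_conditions])
  have j: "integrable \<nu> (\<lambda>t. (g1 n \<omega>)\<^sup>2 * t ^ 4)" "integrable \<nu> (\<lambda>t. \<bar>kap n \<omega> - 1\<bar>\<^sup>2 * (P2 n \<omega> t)\<^sup>2)"
    "integrable \<nu> (\<lambda>t. (g3 n \<omega>)\<^sup>2 * (P3 n \<omega> t)\<^sup>2)" "integrable \<nu> (\<lambda>t. (g4 n \<omega>)\<^sup>2 * (P4 n \<omega> t)\<^sup>2)"
    using t4 i2 i3 i4 by simp_all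
  have iB: "integrable \<nu> B" unfolding B_def[abs_def]
    by (rule integrable_mult_right, intro Bochner_Integration.integrable_add i1 j)
  show iD: "integrable \<nu> (\<lambda>t. (U n \<omega> t - S n \<omega> t)\<^sup>2)"
    by (rule Bochner_Integration.integrable_bound[OF iB]) (use le in \<open>auto intro!: AE_I2 order_trans[OF _ abs_ge_self]\<close>)
  have "(\<integral>t. (U n \<omega> t - S n \<omega> t)\<^sup>2 \<partial>\<nu>) \<le> (\<integral>t. B t \<partial>\<nu>)" by (rule integral_mono[OF iD iB le])
  also have "\<dots> = 5 * ((\<integral>t. (sqrt (real n) * \<rho> n \<omega>)\<^sup>2 * t\<^sup>2 \<partial>\<nu>) + (g1 n \<omega>)\<^sup>2 * (\<integral>t. t ^ 4 \<partial>\<nu>)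
       + \<bar>kap n \<omega> - 1\<bar>\<^sup>2 * (\<integral>t. (P2 n \<omega> t)\<^sup>2 \<partial>\<nu>) + (g3 n \<omega>)\<^sup>2 * (\<integral>t. (P3 n \<omega> t)\<^sup>2 \<partial>\<nu>) + (g4 n \<omega>)\<^sup>2 * (\<integral>t. (P4 n \<omega> t)\<^sup>2 \<partial>\<nu>))"
    unfolding B_def using i1 j by simp
  finally show "(\<integral>t. (U n \<omega> t - S n \<omega> t)\<^sup>2 \<partial>\<nu>) \<le> 5 * ((sqrt (real n) * \<rho> n \<omega>)\<^sup>2 * (\<integral>t. t\<^sup>2 \<partial>\<nu>) + (g1 n \<omega>)\<^sup>2 * (\<integral>t. t ^ 4 \<partial>\<nu>)
       + \<bar>kap n \<omega> - 1\<bar>\<^sup>2 * (\<integral>t. (P2 n \<omega> t)\<^sup>2 \<partial>\<nu>) + (g3 n \<omega>)\<^sup>2 * (\<integral>t. (P3 n \<omega> t)\<^sup>2 \<partial>\<nu>) + (g4 n \<omega>)\<^sup>2 * (\<integral>t. (P4 n \<omega> t)\<^sup>2 \<partial>\<nu>))"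
    by simp
qed

lemma o_P_difference: "o_P M (\<lambda>n \<omega>. \<integral>t. (U n \<omega> t - S n \<omega> t)\<^sup>2 \<partial>\<nu>) (\<lambda>_. 1)"
proof -
  have "O_P M (\<lambda>n \<omega>. \<integral>t. (P2 n \<omega> t)\<^sup>2 \<partial>\<nu>)" unfolding P2_def by (rule O_P_weighted_means(1)[OF f1_conditions])
  moreover have "O_P M (\<lambda>n \<omega>. \<integral>t. (P3 n \<omega> t)\<^sup>2 \<partial>\<nu>)" unfolding P3_def by (rule O_P_weighted_means(1)[OF f2_conditions])
  moreover have "O_P M (\<lambda>n \<omega>. \<integral>t. (P4 n \<omega> t)\<^sup>2 \<partial>\<nu>)" unfolding P4_def by (rule O_P_weighted_means(2)[OF f2_conditions])
  ultimately have "o_P M (\<lambda>n \<omega>. 5 * ((sqrt (real n) * \<rho> n \<omega>)\<^sup>2 * (\<integral>t. t\<^sup>2 \<partial>\<nu>) + (g1 n \<omega>)\<^sup>2 * (\<integral>t. t ^ 4 \<partial>\<nu>)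
       + \<bar>kap n \<omega> - 1\<bar>\<^sup>2 * (\<integral>t. (P2 n \<omega> t)\<^sup>2 \<partial>\<nu>) + (g3 n \<omega>)\<^sup>2 * (\<integral>t. (P3 n \<omega> t)\<^sup>2 \<partial>\<nu>) + (g4 n \<omega>)\<^sup>2 * (\<integral>t. (P4 n \<omega> t)\<^sup>2 \<partial>\<nu>))) (\<lambda>_. 1)"
    by (intro O_P_mult_o_P[OF O_P_const] o_P_add o_P_mult o_P_power2 o_P_\<rho> o_P_g o_P_kap O_P_const)
  then show ?thesis
  proof (rule o_P_dom)
    fix n :: nat and \<omega> assume "n > 0" "\<omega> \<in> space M"
    from difference_square(2)[OF this] show "\<bar>\<integral>t. (U n \<omega> t - S n \<omega> t)\<^sup>2 \<partial>\<nu>\<bar> \<le> \<bar>5 * ((sqrt (real n) * \<rho> n \<omega>)\<^sup>2 * (\<integral>t. t\<^sup>2 \<partial>\<nu>) + (g1 n \<omega>)\<^sup>2 * (\<integral>t. t ^ 4 \<partial>\<nu>)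
       + \<bar>kap n \<omega> - 1\<bar>\<^sup>2 * (\<integral>t. (P2 n \<omega> t)\<^sup>2 \<partial>\<nu>) + (g3 n \<omega>)\<^sup>2 * (\<integral>t. (P3 n \<omega> t)\<^sup>2 \<partial>\<nu>) + (g4 n \<omega>)\<^sup>2 * (\<integral>t. (P4 n \<omega> t)\<^sup>2 \<partial>\<nu>))\<bar>"
      by (rule order_trans[OF eq_refl[OF abs_of_nonneg] order_trans[OF _ abs_ge_self], rotated]) simp
  qed
qed

text \<open>The squared norms of U and S differ by at most the squared norm of U - S plus twice the
  product of the norms of U - S and S. The first norm is o_P(1) and the second O_P(1).\<close>

theorem statistic_close: "o_P M (\<lambda>n \<omega>. (\<integral>t. (U n \<omega> t)\<^sup>2 \<partial>\<nu>) - (\<integral>t. (S n \<omega> t)\<^sup>2 \<partial>\<nu>)) (\<lambda>_. 1)"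
proof -
  let ?D = "\<lambda>n \<omega>. \<integral>t. (U n \<omega> t - S n \<omega> t)\<^sup>2 \<partial>\<nu>" and ?S = "\<lambda>n \<omega>. \<integral>t. (S n \<omega> t)\<^sup>2 \<partial>\<nu>"
  have "o_P M (\<lambda>n \<omega>. ?D n \<omega> + sqrt (?D n \<omega>) * (2 * sqrt (?S n \<omega>))) (\<lambda>_. 1)"
    by (intro o_P_add o_P_difference o_P_mult o_P_sqrt O_P_mult O_P_const O_P_sqrt O_P_S)
  then show ?thesis
  proof (rule o_P_dom)
    fix n :: nat and \<omega> assume n: "n > 0" "\<omega> \<in> space M"
    note iD = difference_square(1)[OF n] and iS = S_square_integrable[of n \<omega>]
    have mD: "(\<lambda>t. U n \<omega> t - S n \<omega> t) \<in> borel_measurable \<nu>" by measurable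
    note cs = Cauchy_Schwarz_integral_square[OF mD S_measurable iD iS]
    have "(\<integral>t. (U n \<omega> t)\<^sup>2 \<partial>\<nu>) = (\<integral>t. (U n \<omega> t - S n \<omega> t)\<^sup>2 + 2 * ((U n \<omega> t - S n \<omega> t) * S n \<omega> t) + (S n \<omega> t)\<^sup>2 \<partial>\<nu>)"
      by (rule Bochner_Integration.integral_cong[OF refl]) (simp add: power2_eq_square algebra_simps)
    also have "\<dots> = ?D n \<omega> + 2 * (\<integral>t. (U n \<omega> t - S n \<omega> t) * S n \<omega> t \<partial>\<nu>) + ?S n \<omega>"
      using iD iS cs(1) by simp
    finally have e: "(\<integral>t. (U n \<omega> t)\<^sup>2 \<partial>\<nu>) - ?S n \<omega> = ?D n \<omega> + 2 * (\<integral>t. (U n \<omega> t - S n \<omega> t) * S n \<omega> t \<partial>\<nu>)" by simp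
    have "\<bar>\<integral>t. (U n \<omega> t - S n \<omega> t) * S n \<omega> t \<partial>\<nu>\<bar> = sqrt ((\<integral>t. (U n \<omega> t - S n \<omega> t) * S n \<omega> t \<partial>\<nu>)\<^sup>2)" by simp
    also have "\<dots> \<le> sqrt (?D n \<omega>) * sqrt (?S n \<omega>)" unfolding real_sqrt_mult[symmetric] by (rule real_sqrt_le_mono[OF cs(2)])
    finally have "\<bar>2 * (\<integral>t. (U n \<omega> t - S n \<omega> t) * S n \<omega> t \<partial>\<nu>)\<bar> \<le> sqrt (?D n \<omega>) * (2 * sqrt (?S n \<omega>))" by simp
    then have "\<bar>?D n \<omega> + 2 * (\<integral>t. (U n \<omega> t - S n \<omega> t) * S n \<omega> t \<partial>\<nu>)\<bar> \<le> ?D n \<omega> + sqrt (?D n \<omega>) * (2 * sqrt (?S n \<omega>))"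
      by (intro abs_add_le_add) simp_all
    then show "\<bar>(\<integral>t. (U n \<omega> t)\<^sup>2 \<partial>\<nu>) - ?S n \<omega>\<bar> \<le> \<bar>?D n \<omega> + sqrt (?D n \<omega>) * (2 * sqrt (?S n \<omega>))\<bar>"
      unfolding e by (rule order_trans[OF _ abs_ge_self])
  qed
qed

end

subsection \<open>The statistics as integrals of squares\<close>

lemma reflect_integral:
  fixes f :: "real \<Rightarrow> real"
  shows "(\<integral>t. f (- t) \<partial>lborel) = (\<integral>t. f t \<partial>lborel)"
    and "integrable lborel (\<lambda>t. f (- t)) \<longleftrightarrow> integrable lborel f"
  using lborel_integral_real_affine[of "-1" f 0] lborel_integrable_real_affine_iff[of "-1" f 0] by simp_all

text \<open>The cross term of the even and the odd part integrates to zero against a symmetric weight; if one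
  of the integrals does not exist then neither does the other, and both have the value 0.\<close>

lemma even_odd_square_integral:
  fixes C S W :: "real \<Rightarrow> real"
  assumes [measurable]: "C \<in> borel_measurable borel" "S \<in> borel_measurable borel" "W \<in> borel_measurable borel"
    and W: "\<And>t. 0 \<le> W t" "\<And>t. W (- t) = W t" and C: "\<And>t. C (- t) = C t" and S: "\<And>t. S (- t) = - S t"
  shows "(\<integral>t. ((C t)\<^sup>2 + (S t)\<^sup>2) * W t \<partial>lborel) = (\<integral>t. (C t + S t)\<^sup>2 * W t \<partial>lborel)"
proof (cases "integrable lborel (\<lambda>t. (C t + S t)\<^sup>2 * W t)")
  case True
  define f where "f t = (C t + S t)\<^sup>2 * W t" for t
  have i: "integrable lborel f" using True by (simp add: f_def[abs_def])
  have i': "integrable lborel (\<lambda>t. f (- t))" using i by (simp add: reflect_integral)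
  have "((C t)\<^sup>2 + (S t)\<^sup>2) * W t = (f t + f (- t)) / 2" for t
    by (simp add: f_def C S W power2_eq_square field_simps)
  then have "(\<integral>t. ((C t)\<^sup>2 + (S t)\<^sup>2) * W t \<partial>lborel) = ((\<integral>t. f t \<partial>lborel) + (\<integral>t. f (- t) \<partial>lborel)) / 2"
    using i i' by (simp only: integral_divide_zero Bochner_Integration.integral_add)
  then have "(\<integral>t. ((C t)\<^sup>2 + (S t)\<^sup>2) * W t \<partial>lborel) = (\<integral>t. f t \<partial>lborel)"
    unfolding reflect_integral(1) by simp
  then show ?thesis by (simp only: f_def)
next
  case False
  have "\<not> integrable lborel (\<lambda>t. ((C t)\<^sup>2 + (S t)\<^sup>2) * W t)"
  proof
    assume "integrable lborel (\<lambda>t. ((C t)\<^sup>2 + (S t)\<^sup>2) * W t)"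
    then have "integrable lborel (\<lambda>t. 2 * (((C t)\<^sup>2 + (S t)\<^sup>2) * W t))" by simp
    then have "integrable lborel (\<lambda>t. (C t + S t)\<^sup>2 * W t)"
    proof (rule Bochner_Integration.integrable_bound)
      show "AE t in lborel. norm ((C t + S t)\<^sup>2 * W t) \<le> norm (2 * (((C t)\<^sup>2 + (S t)\<^sup>2) * W t))"
      proof (rule AE_I2)
        fix t
        have "(C t + S t)\<^sup>2 \<le> 2 * ((C t)\<^sup>2 + (S t)\<^sup>2)"
          using zero_le_power2[of "C t - S t"] unfolding power2_sum power2_diff by simp
        from mult_right_mono[OF this W(1)[of t]]
        show "norm ((C t + S t)\<^sup>2 * W t) \<le> norm (2 * (((C t)\<^sup>2 + (S t)\<^sup>2) * W t))" using W(1)[of t] by (simp add: algebra_simps)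
      qed
    qed simp
    with False show False by simp
  qed
  then show ?thesis using False by (simp add: not_integrable_integral_eq)
qed

lemma mean_upto_real: "mean_upto n f = (\<Sum>j<n. f j) / real n" for f :: "nat \<Rightarrow> real"
  by (simp add: mean_upto_def field_simps)

text \<open>The real part of the difference is even in t and its imaginary part odd, so by symmetry
  of \<open>W\<close> the squared modulus integrates like the square of the sum of both
  parts.\<close>

lemma T_C2_eq:
  assumes W[measurable]: "W \<in> borel_measurable borel" and W0: "\<And>t. 0 \<le> W t" "\<And>t. W (- t) = W t"
  shows "T_C2 W n y = real n * (\<integral>t. (mean_upto n (\<lambda>j. sin (t * (y j / theta_hat n y)) + cos (t * (y j / theta_hat n y))) - phi1 t)\<^sup>2 * W t \<partial>lborel)"
proof -
  define z where "z j = y j / theta_hat n y" for j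
  define C where "C t = mean_upto n (\<lambda>j. cos (t * z j)) - phi1 t" for t
  define S where "S t = mean_upto n (\<lambda>j. sin (t * z j))" for t
  have "(cmod (phi_hat n y (t / theta_hat n y) - complex_of_real (phi1 t)))\<^sup>2 = (C t)\<^sup>2 + (S t)\<^sup>2" for t
  proof -
    have "Re (phi_hat n y (t / theta_hat n y) - complex_of_real (phi1 t)) = C t"
      by (simp add: phi_hat_def C_def mean_upto_real z_def Re_divide_of_nat)
    moreover have "Im (phi_hat n y (t / theta_hat n y) - complex_of_real (phi1 t)) = S t"
      by (simp add: phi_hat_def S_def mean_upto_real z_def Im_divide_of_nat)
    ultimately show ?thesis by (simp add: cmod_power2)
  qed
  then have "T_C2 W n y = real n * (\<integral>t. ((C t)\<^sup>2 + (S t)\<^sup>2) * W t \<partial>lborel)" by (simp add: T_C2_def)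
  also have "(\<integral>t. ((C t)\<^sup>2 + (S t)\<^sup>2) * W t \<partial>lborel) = (\<integral>t. (C t + S t)\<^sup>2 * W t \<partial>lborel)"
  proof (rule even_odd_square_integral)
    show "C \<in> borel_measurable borel" "S \<in> borel_measurable borel"
      unfolding C_def[abs_def] S_def[abs_def] mean_upto_def by measurable
    show "C (- t) = C t" "S (- t) = - S t" for t
      by (simp_all add: C_def S_def mean_upto_def phi1_simps sum_negf)
  qed (use W W0 in auto)
  also have "\<dots> = (\<integral>t. (mean_upto n (\<lambda>j. sin (t * z j) + cos (t * z j)) - phi1 t)\<^sup>2 * W t \<partial>lborel)"
    by (rule Bochner_Integration.integral_cong[OF refl]) (simp add: C_def S_def mean_upto_add algebra_simps)
  finally show ?thesis by (simp only: z_def)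
qed

lemma T_C2_nonneg: "(\<And>t. 0 \<le> W t) \<Longrightarrow> 0 \<le> T_C2 W n y"
  unfolding T_C2_def by (intro mult_nonneg_nonneg integral_nonneg_AE AE_I2) auto

lemma R_C2_eq:
  assumes n: "n > 0"
  shows "R_C2 W (\<lambda>t. c * phi1 t) (\<lambda>_. 0) (\<lambda>_. 0) (\<lambda>t. t * phi1 t) n x = (\<integral>t. ((\<Sum>i<n. score c t (x i)) / sqrt (real n))\<^sup>2 * W t \<partial>lborel)"
proof -
  have "real n * ((1 / real n) * (\<Sum>j<n. sin (t * x j) - c * phi1 t * t * x j - 0 * (t / 2) * ((x j)\<^sup>2 - 1)
                        + cos (t * x j) + 0 * t * x j + t * phi1 t * (t / 2) * ((x j)\<^sup>2 - 1)) - phi1 t)\<^sup>2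
     = ((\<Sum>i<n. score c t (x i)) / sqrt (real n))\<^sup>2" for t
  proof -
    define Q where "Q = (\<Sum>j<n. sin (t * x j) - c * phi1 t * t * x j - 0 * (t / 2) * ((x j)\<^sup>2 - 1)
                        + cos (t * x j) + 0 * t * x j + t * phi1 t * (t / 2) * ((x j)\<^sup>2 - 1))"
    have "(\<Sum>i<n. score c t (x i)) = (\<Sum>j<n. (sin (t * x j) - c * phi1 t * t * x j - 0 * (t / 2) * ((x j)\<^sup>2 - 1)
                        + cos (t * x j) + 0 * t * x j + t * phi1 t * (t / 2) * ((x j)\<^sup>2 - 1)) - phi1 t)"
      by (rule sum.cong) (simp_all add: score_def power2_eq_square algebra_simps)
    then have s: "(\<Sum>i<n. score c t (x i)) = Q - real n * phi1 t" by (simp add: sum_subtractf Q_def)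
    have "real n * ((1 / real n) * Q - phi1 t)\<^sup>2 = ((Q - real n * phi1 t) / sqrt (real n))\<^sup>2"
      using n by (simp add: power_divide power2_eq_square field_simps)
    then show ?thesis unfolding s Q_def .
  qed
  then show ?thesis unfolding R_C2_def
    by (simp only: integral_mult_right_zero[symmetric] mult.assoc[symmetric])
qed

lemma density_weight:
  fixes f :: "real \<Rightarrow> real"
  assumes W[measurable]: "W \<in> borel_measurable borel" and W0: "\<And>t. 0 \<le> W t"
  defines "\<nu> \<equiv> density lborel (\<lambda>t. ennreal (W t))"
  shows "sigma_finite_measure \<nu>" "sets \<nu> = sets borel"
    and "f \<in> borel_measurable borel \<Longrightarrow> integral\<^sup>L \<nu> f = (\<integral>t. f t * W t \<partial>lborel)"
    and "f \<in> borel_measurable borel \<Longrightarrow> integrable \<nu> f \<longleftrightarrow> integrable lborel (\<lambda>t. f t * W t)"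
proof -
  show "sigma_finite_measure \<nu>" unfolding \<nu>_def
    by (subst sigma_finite_measure.sigma_finite_iff_density_finite'[OF sigma_finite_lborel]) auto
  show "sets \<nu> = sets borel" by (simp add: \<nu>_def)
  show "integral\<^sup>L \<nu> f = (\<integral>t. f t * W t \<partial>lborel)" if "f \<in> borel_measurable borel"
    unfolding \<nu>_def using that W0 by (subst integral_density) (auto simp: mult.commute)
  show "integrable \<nu> f \<longleftrightarrow> integrable lborel (\<lambda>t. f t * W t)" if "f \<in> borel_measurable borel"
    unfolding \<nu>_def using that W0 by (subst integrable_density) (auto simp: mult.commute)
qed

text \<open>The variance is the mean of the squared score, and squaring \<open>score_bound\<close>
  with (x + y)^2 \<le> 2 x^2 + 2 y^2 turns its factor 3 into 18. The t^2 term carries the factor 1 -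
  c, so for c = 1 the fourth moment suffices.\<close>

lemma score_cov_integrable:
  assumes \<nu>: "sets \<nu> = sets borel" and t4: "integrable \<nu> (\<lambda>t. t ^ 4)" and c: "c \<in> {0, 1}"
    and t2: "c = 1 \<or> integrable \<nu> (\<lambda>t. t\<^sup>2)"
  shows "integrable \<nu> (\<lambda>t. score_cov c t t)"
proof -
  have c2: "c\<^sup>2 = c" using c by auto
  define K where "K = (\<integral>x. (1 + x\<^sup>2)\<^sup>2 \<partial>std_normal_distribution)"
  have le: "0 \<le> score_cov c t t" "score_cov c t t \<le> 18 * K * t ^ 4 + 2 * (1 - c)\<^sup>2 * t\<^sup>2" for t
  proof -
    note sc = score_covariance[OF c2, of t t, unfolded has_bochner_integral_iff power2_eq_square[symmetric]]
    have e: "score_cov c t t = (\<integral>x. (score c t x)\<^sup>2 \<partial>std_normal_distribution)" using sc by simp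
    show "0 \<le> score_cov c t t" unfolding e by simp
    have b: "(score c t x)\<^sup>2 \<le> 18 * t ^ 4 * (1 + x\<^sup>2)\<^sup>2 + 2 * (1 - c)\<^sup>2 * t\<^sup>2 * x\<^sup>2" for x
    proof -
      have "\<bar>score c t x\<bar>\<^sup>2 \<le> (3 * t\<^sup>2 * (1 + x\<^sup>2) + (1 - c) * \<bar>t * x\<bar>)\<^sup>2"
        by (rule power_mono[OF score_bound[OF c]]) simp
      also have "\<dots> \<le> 2 * (3 * t\<^sup>2 * (1 + x\<^sup>2))\<^sup>2 + 2 * ((1 - c) * \<bar>t * x\<bar>)\<^sup>2"
        using zero_le_power2[of "3 * t\<^sup>2 * (1 + x\<^sup>2) - (1 - c) * \<bar>t * x\<bar>"] unfolding power2_sum power2_diff by simp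
      also have "\<dots> = 18 * t ^ 4 * (1 + x\<^sup>2)\<^sup>2 + 2 * (1 - c)\<^sup>2 * t\<^sup>2 * x\<^sup>2"
        by (simp add: power_mult_distrib)
      finally show ?thesis by simp
    qed
    have i: "integrable std_normal_distribution (\<lambda>x. (1 + x\<^sup>2)\<^sup>2)" "integrable std_normal_distribution (\<lambda>x. x\<^sup>2)"
      by (rule integrable_std_normal_power integrable_std_normal_distribution_moment)+
    have "score_cov c t t \<le> (\<integral>x. 18 * t ^ 4 * (1 + x\<^sup>2)\<^sup>2 + 2 * (1 - c)\<^sup>2 * t\<^sup>2 * x\<^sup>2 \<partial>std_normal_distribution)"
      unfolding e by (rule integral_mono) (use sc i b in auto)
    also have "\<dots> = 18 * t ^ 4 * K + 2 * (1 - c)\<^sup>2 * t\<^sup>2 * 1"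
      using i std_normal_moments(3) by (simp add: K_def has_bochner_integral_iff)
    finally show "score_cov c t t \<le> 18 * K * t ^ 4 + 2 * (1 - c)\<^sup>2 * t\<^sup>2" by (simp add: mult_ac)
  qed
  have i: "integrable \<nu> (\<lambda>t. 18 * K * t ^ 4 + 2 * (1 - c)\<^sup>2 * t\<^sup>2)"
    using t2 t4 by (cases "c = 1") auto
  show ?thesis
  proof (rule Bochner_Integration.integrable_bound[OF i])
    show "(\<lambda>t. score_cov c t t) \<in> borel_measurable \<nu>"
      using score_cov_measurable[of c] by (simp only: measurable_cong_sets[OF \<nu> refl])
    show "AE t in \<nu>. norm (score_cov c t t) \<le> norm (18 * K * t ^ 4 + 2 * (1 - c)\<^sup>2 * t\<^sup>2)"
      using le by (intro AE_I2) (simp add: order_trans[OF _ abs_ge_self])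
  qed
qed

lemma (in prob_space) laplace_of_o_P:
  assumes o: "o_P M (\<lambda>n \<omega>. T n \<omega> - R n \<omega>) (\<lambda>_. 1)"
    and T: "\<And>n. T n \<in> borel_measurable M" "\<And>n \<omega>. 0 \<le> T n \<omega>"
    and R: "\<And>n. R n \<in> borel_measurable M" "\<And>n \<omega>. 0 \<le> R n \<omega>"
    and lim: "(\<lambda>n. \<integral>\<omega>. exp (- (real k * R n \<omega>)) \<partial>M) \<longlonglongrightarrow> l"
  shows "(\<lambda>n. \<integral>\<omega>. exp (- (real k * T n \<omega>)) \<partial>M) \<longlonglongrightarrow> l"
proof -
  have "(\<lambda>n. \<integral>\<omega>. exp (- (real k * T n \<omega>)) - exp (- (real k * R n \<omega>)) \<partial>M) \<longlonglongrightarrow> 0"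
  proof (rule o_P_bounded_integral_tendsto[OF o, where c="real k + 1"])
    show "(\<lambda>\<omega>. exp (- (real k * T n \<omega>)) - exp (- (real k * R n \<omega>))) \<in> borel_measurable M" for n
      using T(1)[of n] R(1)[of n] by measurable
    fix n \<omega>
    have "\<bar>exp (- (real k * T n \<omega>)) - exp (- (real k * R n \<omega>))\<bar> \<le> \<bar>real k * T n \<omega> - real k * R n \<omega>\<bar>"
      by (rule abs_exp_neg_diff_le) (use T R in auto)
    also have "\<dots> = real k * \<bar>T n \<omega> - R n \<omega>\<bar>" by (simp add: abs_mult right_diff_distrib[symmetric])
    also have "\<dots> \<le> (real k + 1) * \<bar>T n \<omega> - R n \<omega>\<bar>" by (intro mult_right_mono) auto
    finally show "\<bar>exp (- (real k * T n \<omega>)) - exp (- (real k * R n \<omega>))\<bar> \<le> 1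
      \<and> \<bar>exp (- (real k * T n \<omega>)) - exp (- (real k * R n \<omega>))\<bar> \<le> (real k + 1) * \<bar>T n \<omega> - R n \<omega>\<bar>"
      using abs_exp_neg_diff_le(1)[of "real k * T n \<omega>" "real k * R n \<omega>"] T(2) R(2) by simp
  qed simp
  moreover have "(\<integral>\<omega>. exp (- (real k * T n \<omega>)) - exp (- (real k * R n \<omega>)) \<partial>M)
    = (\<integral>\<omega>. exp (- (real k * T n \<omega>)) \<partial>M) - (\<integral>\<omega>. exp (- (real k * R n \<omega>)) \<partial>M)" for n
    by (rule Bochner_Integration.integral_diff; rule integrable_const_bound[of _ 1]; use T R in auto)
  ultimately have "(\<lambda>n. (\<integral>\<omega>. exp (- (real k * T n \<omega>)) \<partial>M) - (\<integral>\<omega>. exp (- (real k * R n \<omega>)) \<partial>M)) \<longlonglongrightarrow> 0" by simp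
  from tendsto_add[OF this lim] show ?thesis by simp
qed

lemma T_C2_measurable:
  assumes W[measurable]: "W \<in> borel_measurable borel" and W0: "\<And>t. 0 \<le> W t" "\<And>t. W (- t) = W t"
    and y[measurable]: "\<And>j. y j \<in> borel_measurable M"
  shows "(\<lambda>\<omega>. T_C2 W n (\<lambda>j. y j \<omega>)) \<in> borel_measurable M"
proof -
  have "(\<lambda>(\<omega>, t). (mean_upto n (\<lambda>j. sin (t * (y j \<omega> / theta_hat n (\<lambda>j. y j \<omega>))) + cos (t * (y j \<omega> / theta_hat n (\<lambda>j. y j \<omega>)))) - phi1 t)\<^sup>2 * W t)
     \<in> borel_measurable (M \<Otimes>\<^sub>M lborel)"
    unfolding mean_upto_def theta_hat_def by measurable
  from sigma_finite_measure.borel_measurable_lebesgue_integral[OF sigma_finite_lborel this]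
  show ?thesis unfolding T_C2_eq[OF W W0] by (intro borel_measurable_times borel_measurable_const)
qed

subsection \<open>Weights without a second moment\<close>

text \<open>From a t = f - (f - a t) follows a^2 t^2 \<le> 2 f^2 + 2 C^2 t^4. Integrability of f^2
  against the weight would therefore force that of t^2, given the fourth moment.\<close>

lemma linear_square_not_integrable:
  fixes W f :: "real \<Rightarrow> real"
  assumes W0: "\<And>t. 0 \<le> W t" and t4: "integrable lborel (\<lambda>t. t ^ 4 * W t)"
    and t2: "\<not> integrable lborel (\<lambda>t. t\<^sup>2 * W t)" and W[measurable]: "W \<in> borel_measurable borel"
    and a: "a \<noteq> 0" and le: "\<And>t. \<bar>f t - a * t\<bar> \<le> C * t\<^sup>2"
  shows "\<not> integrable lborel (\<lambda>t. (f t)\<^sup>2 * W t)"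
proof
  assume i: "integrable lborel (\<lambda>t. (f t)\<^sup>2 * W t)"
  have "integrable lborel (\<lambda>t. (2 / a\<^sup>2) * ((f t)\<^sup>2 * W t) + (2 * C\<^sup>2 / a\<^sup>2) * (t ^ 4 * W t))"
    using i t4 by simp
  then have "integrable lborel (\<lambda>t. t\<^sup>2 * W t)"
  proof (rule Bochner_Integration.integrable_bound)
    show "AE t in lborel. norm (t\<^sup>2 * W t) \<le> norm ((2 / a\<^sup>2) * ((f t)\<^sup>2 * W t) + (2 * C\<^sup>2 / a\<^sup>2) * (t ^ 4 * W t))"
    proof (rule AE_I2)
      fix t
      have "\<bar>f t - a * t\<bar>\<^sup>2 \<le> (C * t\<^sup>2)\<^sup>2" using le by (intro power_mono) auto
      then have 1: "(f t - a * t)\<^sup>2 \<le> C\<^sup>2 * t ^ 4" by (simp add: power_mult_distrib)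
      have "a\<^sup>2 * t\<^sup>2 = (f t - (f t - a * t))\<^sup>2" by (simp add: power_mult_distrib)
      also have "\<dots> \<le> 2 * (f t)\<^sup>2 + 2 * (f t - a * t)\<^sup>2"
        using zero_le_power2[of "f t + (f t - a * t)"] unfolding power2_sum power2_diff[of "f t" "f t - a * t"] by linarith
      also have "\<dots> \<le> 2 * (f t)\<^sup>2 + 2 * (C\<^sup>2 * t ^ 4)" using 1 by simp
      finally have "t\<^sup>2 \<le> (2 / a\<^sup>2) * (f t)\<^sup>2 + (2 * C\<^sup>2 / a\<^sup>2) * t ^ 4" using a by (simp add: field_simps)
      from mult_right_mono[OF this W0[of t]]
      show "norm (t\<^sup>2 * W t) \<le> norm ((2 / a\<^sup>2) * ((f t)\<^sup>2 * W t) + (2 * C\<^sup>2 / a\<^sup>2) * (t ^ 4 * W t))"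
        using W0[of t] by (simp add: distrib_right mult.assoc)
    qed
  qed simp
  with t2 show False by simp
qed

lemma mean_sin_cos_linear:
  assumes n: "n > 0"
  shows "\<bar>mean_upto n (\<lambda>j. sin (t * z j) + cos (t * z j)) - phi1 t - mean_upto n z * t\<bar> \<le> (3/2 * mean_upto n (\<lambda>j. (z j)\<^sup>2) + 1/2) * t\<^sup>2"
proof -
  have "mean_upto n (\<lambda>j. sin (t * z j) + cos (t * z j)) - phi1 t - mean_upto n z * t
    = mean_upto n (\<lambda>j. sin (t * z j) - t * z j + cos (t * z j) - 1) + (1 - phi1 t)"
  proof -
    have "mean_upto n (\<lambda>j. sin (t * z j) - t * z j + cos (t * z j) - 1)
      = mean_upto n (\<lambda>j. sin (t * z j)) - t * mean_upto n z + mean_upto n (\<lambda>j. cos (t * z j)) - 1"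
      by (simp only: mean_upto_diff mean_upto_add mean_upto_mult mean_upto_const[OF n])
    then show ?thesis by (simp add: mean_upto_add)
  qed
  also have "\<bar>\<dots>\<bar> \<le> mean_upto n (\<lambda>j. 3/2 * t\<^sup>2 * (z j)\<^sup>2) + t\<^sup>2 / 2"
  proof (rule abs_add_le_add)
    show "\<bar>1 - phi1 t\<bar> \<le> t\<^sup>2 / 2" using one_minus_phi1_le[of t] phi1_simps(4)[of t] by simp
    have "\<bar>sin (t * z j) - t * z j + cos (t * z j) - 1\<bar> \<le> 3/2 * t\<^sup>2 * (z j)\<^sup>2" for j
      using sin_cos_bounds[of "t * z j"] by (simp add: power_mult_distrib)
    then show "\<bar>mean_upto n (\<lambda>j. sin (t * z j) - t * z j + cos (t * z j) - 1)\<bar> \<le> mean_upto n (\<lambda>j. 3/2 * t\<^sup>2 * (z j)\<^sup>2)"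
      by (intro order_trans[OF abs_mean_upto_le mean_upto_mono])
  qed
  also have "\<dots> = (3/2 * mean_upto n (\<lambda>j. (z j)\<^sup>2) + 1/2) * t\<^sup>2"
    unfolding mean_upto_mult by (simp add: algebra_simps)
  finally show ?thesis .
qed

lemma std_normal_small_ball:
  assumes "0 \<le> \<eta>" shows "measure std_normal_distribution {- \<eta>..\<eta>} \<le> 2 * \<eta>"
proof -
  have d: "std_normal_density x \<le> 1" for x
  proof -
    have "1 / sqrt (2 * pi) \<le> 1" using pi_gt3 by (simp add: real_le_rsqrt)
    moreover have "exp (- x\<^sup>2 / 2) \<le> 1" by simp
    ultimately have "1 / sqrt (2 * pi) * exp (- x\<^sup>2 / 2) \<le> 1 * 1" by (intro mult_mono) auto
    then show ?thesis by (simp add: std_normal_density_def)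
  qed
  have "emeasure std_normal_distribution {- \<eta>..\<eta>} = (\<integral>\<^sup>+x. ennreal (std_normal_density x) * indicator {- \<eta>..\<eta>} x \<partial>lborel)"
    by (rule emeasure_density) auto
  also have "\<dots> \<le> (\<integral>\<^sup>+x. indicator {- \<eta>..\<eta>} x \<partial>lborel)"
    using d by (intro nn_integral_mono) (auto simp: indicator_def)
  also have "\<dots> = ennreal (2 * \<eta>)" using assms by simp
  finally show ?thesis using assms unfolding measure_def by (intro enn2real_leI) auto
qed

text \<open>The normalised mean of the errors is exactly standard normal for every n, and its
  density is at most 1; the bound is hence uniform in n.\<close>

lemma (in error_sample) root_mean_small_ball:
  assumes n: "n > 0" and \<eta>: "0 \<le> \<eta>"
  shows "measure M {\<omega> \<in> space M. \<bar>sqrt (real n) * mean_upto n (\<lambda>j. e j \<omega>)\<bar> \<le> \<eta>} \<le> 2 * \<eta>"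
proof -
  have d: "distr M borel (\<lambda>\<omega>. \<Sum>i<n. 1 / sqrt (real n) * e i \<omega>) = distr std_normal_distribution borel (\<lambda>x. sqrt (\<Sum>i<n. (1 / sqrt (real n))\<^sup>2) * x)"
    by (rule distr_normal_combination[OF indep_vars_subset[OF e_indep]]) (auto simp: e_distr)
  have "(\<Sum>i<n. (1 / sqrt (real n))\<^sup>2) = 1" using n by (simp add: power_divide)
  then have d: "distr M borel (\<lambda>\<omega>. \<Sum>i<n. 1 / sqrt (real n) * e i \<omega>) = distr std_normal_distribution borel (\<lambda>x. x)"
    using d by simp
  also have "\<dots> = distr std_normal_distribution std_normal_distribution (\<lambda>x. x)" by (rule distr_cong) auto
  finally have d: "distr M borel (\<lambda>\<omega>. \<Sum>i<n. 1 / sqrt (real n) * e i \<omega>) = std_normal_distribution" by simp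
  have e: "sqrt (real n) * mean_upto n (\<lambda>j. e j \<omega>) = (\<Sum>i<n. 1 / sqrt (real n) * e i \<omega>)" for \<omega>
  proof -
    have "sqrt (real n) * (S / real n) = S / sqrt (real n)" for S
      using n by (simp add: field_simps)
    then show ?thesis unfolding mean_upto_real by (simp only:) (simp add: sum_divide_distrib)
  qed
  have "measure M {\<omega> \<in> space M. \<bar>sqrt (real n) * mean_upto n (\<lambda>j. e j \<omega>)\<bar> \<le> \<eta>}
      = measure M ((\<lambda>\<omega>. \<Sum>i<n. 1 / sqrt (real n) * e i \<omega>) -` {- \<eta>..\<eta>} \<inter> space M)"
    unfolding e by (rule arg_cong[where f="measure M"]) (auto simp: abs_le_iff)
  also have "\<dots> = measure (distr M borel (\<lambda>\<omega>. \<Sum>i<n. 1 / sqrt (real n) * e i \<omega>)) {- \<eta>..\<eta>}"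
    by (rule measure_distr[symmetric]) measurable
  also have "\<dots> \<le> 2 * \<eta>" unfolding d by (rule std_normal_small_ball[OF \<eta>])
  finally show ?thesis .
qed

text \<open>If the weight does not integrate \<open>t\<^sup>2\<close>, then a statistic whose integrand has a nonzero linear part at 0
  is the integral of a function that is not integrable, hence 0 by convention.\<close>

lemma (in error_sample) degenerate_statistic:
  assumes Z: "\<And>n \<omega>. n > 0 \<Longrightarrow> \<omega> \<in> space M \<Longrightarrow> sqrt (real n) * (mean_upto n (\<lambda>j. e j \<omega>) + z n \<omega>) \<noteq> 0 \<Longrightarrow> T n \<omega> = 0"
    and z: "o_P M (\<lambda>n \<omega>. sqrt (real n) * z n \<omega>) (\<lambda>_. 1)"
  shows "o_P M T (\<lambda>_. 1)"
  unfolding o_P_iff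
proof (intro allI impI)
  fix \<epsilon> \<delta> :: real assume ed: "\<epsilon> > 0" "\<delta> > 0"
  \<comment> \<open>The small ball then has probability at most 2 \<eta> = \<delta> / 4, strictly
    below the available \<delta> / 2. Outside both exceptional events the mean error exceeds \<eta>
    and the perturbation does not, so the linear coefficient is nonzero.\<close>
  define \<eta> where "\<eta> = \<delta> / 8"
  let ?A = "\<lambda>n. {\<omega> \<in> space M. \<bar>sqrt (real n) * mean_upto n (\<lambda>j. e j \<omega>)\<bar> \<le> \<eta>}"
  have 1: "eventually (\<lambda>n. outer_lt M {\<omega> \<in> space M. \<eta> * 1 < \<bar>sqrt (real n) * z n \<omega>\<bar>} (\<delta> / 2)) sequentially"
    using z[unfolded o_P_iff, rule_format, of \<eta> "\<delta> / 2"] ed by (simp add: \<eta>_def)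
  have 2: "eventually (\<lambda>n. outer_lt M (?A n) (\<delta> / 2)) sequentially"
  proof (rule eventually_mono[OF eventually_gt_at_top[of 0]])
    fix n :: nat assume n: "n > 0"
    have "?A n \<in> sets M" unfolding mean_upto_def by measurable
    moreover have "measure M (?A n) < \<delta> / 2"
      using root_mean_small_ball[OF n, of \<eta>] ed by (simp add: \<eta>_def)
    ultimately show "outer_lt M (?A n) (\<delta> / 2)" unfolding outer_lt_def by blast
  qed
  have 3: "{\<omega> \<in> space M. \<epsilon> * 1 < \<bar>T n \<omega>\<bar>} \<subseteq> {\<omega> \<in> space M. \<eta> * 1 < \<bar>sqrt (real n) * z n \<omega>\<bar>} \<union> ?A n" if n: "n > 0" for n
  proof (rule subsetI, rule ccontr)
    fix \<omega> assume w: "\<omega> \<in> {\<omega> \<in> space M. \<epsilon> * 1 < \<bar>T n \<omega>\<bar>}"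
      and "\<omega> \<notin> {\<omega> \<in> space M. \<eta> * 1 < \<bar>sqrt (real n) * z n \<omega>\<bar>} \<union> ?A n"
    then have "\<bar>sqrt (real n) * z n \<omega>\<bar> \<le> \<eta>" "\<eta> < \<bar>sqrt (real n) * mean_upto n (\<lambda>j. e j \<omega>)\<bar>" by auto
    then have "sqrt (real n) * mean_upto n (\<lambda>j. e j \<omega>) + sqrt (real n) * z n \<omega> \<noteq> 0" by linarith
    then have "T n \<omega> = 0" using Z[OF n] w by (simp add: distrib_left)
    then show False using w ed by simp
  qed
  show "eventually (\<lambda>n. outer_lt M {\<omega> \<in> space M. \<epsilon> * 1 < \<bar>T n \<omega>\<bar>} \<delta>) sequentially"
    by (rule ev_outer_lt_Un[OF 1 2]) (rule eventually_mono[OF eventually_gt_at_top[of 0] 3])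
qed

text \<open>The path for c = 0 is the path for c = 1 plus phi1 t * t * y 1. The latter path is
  almost surely square integrable under the fourth moment alone, so square integrability of the
  former would force that of phi1 t * t, hence of t, because y 1 is almost surely nonzero. The
  integral therefore takes its default value 0.\<close>

lemma gauss_path_degenerate:
  fixes W :: "real \<Rightarrow> real"
  assumes W[measurable]: "W \<in> borel_measurable borel" and W0: "\<And>t. 0 \<le> W t"
    and t4: "integrable lborel (\<lambda>t. t ^ 4 * W t)" and t2: "\<not> integrable lborel (\<lambda>t. t\<^sup>2 * W t)"
  shows "AE y in normal_seq. (\<integral>t. (gauss_path 0 y t)\<^sup>2 * W t \<partial>lborel) = 0"
proof -
  define \<nu> where "\<nu> = density lborel (\<lambda>t. ennreal (W t))"
  note dw = density_weight[OF W W0, folded \<nu>_def]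
  have "integrable \<nu> (\<lambda>t. score_cov 1 t t)"
    by (rule score_cov_integrable[OF dw(2)]) (use dw(4)[of "\<lambda>t. t ^ 4"] t4 in auto)
  then interpret weight_measure \<nu> 1
    by (intro weight_measure.intro weight_measure_axioms.intro dw) auto
  have 1: "AE y in normal_seq. integrable \<nu> (\<lambda>t. (gauss_path 1 y t)\<^sup>2)" by (rule field_path_square[OF square_field_gauss])
  have 2: "AE y in normal_seq. y 1 \<noteq> 0"
  proof -
    have "AE x in std_normal_distribution. x \<noteq> 0"
    proof (subst AE_density)
      show "AE x in lborel. 0 < ennreal (std_normal_density x) \<longrightarrow> x \<noteq> 0"
        by (rule eventually_mono[OF AE_lborel_singleton[of 0]]) simp
    qed simp
    then have "AE x in distr normal_seq borel (\<lambda>y. y 1). x \<noteq> 0" unfolding distr_normal_coord .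
    from AE_distrD[OF normal_coord_measurable this] show ?thesis .
  qed
  show ?thesis using 1 2 gauss_path_summable[of 0, simplified] gauss_path_summable[of 1, simplified]
  proof eventually_elim
    case (elim y)
    have e: "gauss_path 0 y t = gauss_path 1 y t + phi1 t * t * y 1" for t
    proof -
      have "gauss_coeff 0 k t * y k = gauss_coeff 1 k t * y k + (if k = 1 then phi1 t * t * y 1 else 0)" for k
        by (auto simp: gauss_coeff_def)
      moreover have "(\<lambda>k. gauss_coeff 1 k t * y k) sums gauss_path 1 y t"
        unfolding gauss_path_def by (rule summable_sums) (use elim(4) in \<open>auto intro: summable_rabs_cancel\<close>)
      moreover have "(\<lambda>k. if k = 1 then phi1 t * t * y 1 else 0) sums (phi1 t * t * y 1)" by (rule sums_single)
      ultimately have "(\<lambda>k. gauss_coeff 0 k t * y k) sums (gauss_path 1 y t + phi1 t * t * y 1)"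
        using sums_add by (simp only:)
      then show ?thesis unfolding gauss_path_def[of 0] by (rule sums_unique[symmetric])
    qed
    have gm[measurable]: "gauss_path c y \<in> borel_measurable borel" for c
      unfolding gauss_path_def[abs_def] by measurable
    have i1: "integrable lborel (\<lambda>t. (gauss_path 1 y t)\<^sup>2 * W t)"
      using elim(1) dw(4)[of "\<lambda>t. (gauss_path 1 y t)\<^sup>2"] by simp
    have "\<not> integrable lborel (\<lambda>t. (gauss_path 0 y t)\<^sup>2 * W t)"
    proof
      assume i0: "integrable lborel (\<lambda>t. (gauss_path 0 y t)\<^sup>2 * W t)"
      \<comment> \<open>For |t| \<le> 1 the square of phi1 t is at least exp(-1) \<ge> 1/3, which
        gives a factor 3; (a - b)^2 \<le> 2 a^2 + 2 b^2 gives a factor 2. For |t| > 1 the term t^4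
        already dominates t^2.\<close>
      let ?c = "6 / (y 1)\<^sup>2"
      have "integrable lborel (\<lambda>t. ?c * ((gauss_path 0 y t)\<^sup>2 * W t) + ?c * ((gauss_path 1 y t)\<^sup>2 * W t) + t ^ 4 * W t)"
        using i0 i1 t4 by simp
      then have "integrable lborel (\<lambda>t. t\<^sup>2 * W t)"
      proof (rule Bochner_Integration.integrable_bound)
        show "AE t in lborel. norm (t\<^sup>2 * W t) \<le> norm (?c * ((gauss_path 0 y t)\<^sup>2 * W t) + ?c * ((gauss_path 1 y t)\<^sup>2 * W t) + t ^ 4 * W t)"
        proof (rule AE_I2)
          fix t
          let ?a = "gauss_path 0 y t" and ?b = "gauss_path 1 y t"
          have "t\<^sup>2 \<le> ?c * ?a\<^sup>2 + ?c * ?b\<^sup>2 + t ^ 4"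
          proof (cases "\<bar>t\<bar> \<le> 1")
            case True
            have "t\<^sup>2 \<le> 1" using True by (simp add: abs_square_le_1)
            have "exp (1::real) \<le> 3" by (rule exp_le)
            then have "1/3 \<le> exp (-1 :: real)" by (simp add: exp_minus field_simps)
            also have "\<dots> \<le> exp (- t\<^sup>2)" using \<open>t\<^sup>2 \<le> 1\<close> by simp
            also have "exp (- t\<^sup>2) = (phi1 t)\<^sup>2" by (simp add: phi1_def power2_eq_square exp_add[symmetric])
            finally have "1/3 \<le> (phi1 t)\<^sup>2" .
            then have "t\<^sup>2 * (1/3) \<le> t\<^sup>2 * (phi1 t)\<^sup>2" by (rule mult_left_mono) simp
            then have "t\<^sup>2 \<le> 3 * (phi1 t * t)\<^sup>2" by (simp add: power_mult_distrib mult.commute)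
            moreover have "(phi1 t * t)\<^sup>2 * (y 1)\<^sup>2 \<le> 2 * ?a\<^sup>2 + 2 * ?b\<^sup>2"
            proof -
              have "phi1 t * t * y 1 = ?a - ?b" using e[of t] by simp
              then have "(phi1 t * t)\<^sup>2 * (y 1)\<^sup>2 = (?a - ?b)\<^sup>2" by (metis power_mult_distrib)
              also have "\<dots> \<le> 2 * ?a\<^sup>2 + 2 * ?b\<^sup>2"
                using zero_le_power2[of "?a + ?b"] unfolding power2_sum power2_diff by linarith
              finally show ?thesis .
            qed
            then have "(phi1 t * t)\<^sup>2 \<le> (2 * ?a\<^sup>2 + 2 * ?b\<^sup>2) / (y 1)\<^sup>2" using elim(2) by (simp add: field_simps)
            moreover have "3 * ((2 * ?a\<^sup>2 + 2 * ?b\<^sup>2) / (y 1)\<^sup>2) = ?c * ?a\<^sup>2 + ?c * ?b\<^sup>2" by (simp add: add_divide_distrib distrib_left)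
            moreover have "0 \<le> t ^ 4" by simp
            ultimately show ?thesis by linarith
          next
            case False
            then have "1 \<le> t\<^sup>2" by (metis abs_square_le_1 linear power2_abs one_power2 power_mono zero_le_one abs_ge_zero)
            then have "1 * t\<^sup>2 \<le> t\<^sup>2 * t\<^sup>2" by (rule mult_right_mono) simp
            then have "t\<^sup>2 \<le> t ^ 4" by (simp add: power2_eq_square power4_eq_xxxx mult.assoc)
            moreover have "0 \<le> ?c * ?a\<^sup>2 + ?c * ?b\<^sup>2" by simp
            ultimately show ?thesis by linarith
          qed
          from mult_right_mono[OF this W0[of t]]
          show "norm (t\<^sup>2 * W t) \<le> norm (?c * (?a\<^sup>2 * W t) + ?c * (?b\<^sup>2 * W t) + t ^ 4 * W t)"
            using W0[of t] by (simp add: distrib_right mult.assoc)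
        qed
      qed simp
      with t2 show False by simp
    qed
    then show ?case by (simp add: not_integrable_integral_eq)
  qed
qed

subsection \<open>The limit theorem\<close>

lemma gaussian_limit_statement:
  assumes M: "prob_space M" and c: "c \<in> {0, 1}" and W[measurable]: "W \<in> borel_measurable borel" and W0: "\<And>t. 0 \<le> W t"
    and T: "\<And>n. T n \<in> borel_measurable M" "\<And>n \<omega>. 0 \<le> T n \<omega>"
    and lap: "\<And>k::nat. (\<lambda>n. \<integral>\<omega>. exp (- (real k * T n \<omega>)) \<partial>M)
        \<longlonglongrightarrow> (\<integral>y. exp (- (real k * (\<integral>t. (gauss_path c y t)\<^sup>2 * W t \<partial>lborel))) \<partial>normal_seq)"
  shows "\<exists>(N :: real measure) G. centred_gaussian_process N G (score_cov c) \<and>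
     (\<lambda>(\<omega>, t). G t \<omega>) \<in> borel_measurable (N \<Otimes>\<^sub>M lborel) \<and>
     conv_distr M T N (\<lambda>\<omega>. LINT t|lborel. (G t \<omega>)\<^sup>2 * W t)"
proof -
  obtain N :: "real measure" where N: "prob_space N" and f: "decode_seq \<in> measurable N normal_seq"
    and d: "distr N normal_seq decode_seq = normal_seq" by (rule normal_seq_on_reals)
  define L where "L y = (\<integral>t. (gauss_path c y t)\<^sup>2 * W t \<partial>lborel)" for y
  have "(\<lambda>(y, t). (gauss_path c y t)\<^sup>2 * W t) \<in> borel_measurable (normal_seq \<Otimes>\<^sub>M lborel)"
    unfolding gauss_path_def by measurable
  from sigma_finite_measure.borel_measurable_lebesgue_integral[OF sigma_finite_lborel this]
  have L: "L \<in> borel_measurable normal_seq" by (simp add: L_def[abs_def])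
  have L0: "0 \<le> L y" for y unfolding L_def using W0 by (intro integral_nonneg_AE AE_I2) auto
  have Lf: "(\<lambda>\<omega>. L (decode_seq \<omega>)) \<in> borel_measurable N" by (rule measurable_compose[OF f L])
  have "weak_conv_m (\<lambda>n. distr M borel (T n)) (distr N borel (\<lambda>\<omega>. L (decode_seq \<omega>)))"
  proof (rule weak_conv_of_laplace[OF M N T(1) _ Lf])
    fix k :: nat
    have m: "(\<lambda>y. exp (- (real k * L y))) \<in> borel_measurable normal_seq" using L by measurable
    have "(\<integral>\<omega>. exp (- (real k * L (decode_seq \<omega>))) \<partial>N) = (\<integral>y. exp (- (real k * L y)) \<partial>normal_seq)"
      using integral_distr[OF f m] unfolding d by simp
    then show "(\<lambda>n. \<integral>\<omega>. exp (- (real k * T n \<omega>)) \<partial>M) \<longlonglongrightarrow> (\<integral>\<omega>. exp (- (real k * L (decode_seq \<omega>))) \<partial>N)"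
      using lap[of k] by (simp add: L_def)
  qed (use T L0 in auto)
  then have "conv_distr M T N (\<lambda>\<omega>. LINT t|lborel. (gauss_path c (decode_seq \<omega>) t)\<^sup>2 * W t)"
    unfolding conv_distr_def using T(1) Lf by (simp add: L_def)
  with gaussian_process_transfer[OF N f d c] show ?thesis by blast
qed

text \<open>The statistic is scale invariant: the estimated scale of \<theta> * res is \<theta> *
  sqrt V, so \<theta> cancels. This includes V = 0, where both sides divide by zero and give
  0.\<close>

lemma (in residual_sample) T_C2_residual:
  assumes W: "W \<in> borel_measurable borel" "\<And>t. 0 \<le> W t" "\<And>t. W (- t) = W t"
    and \<theta>: "\<theta> > 0" and n: "n > 0" and y: "\<And>j. y j = \<theta> * res n \<omega> j"
  shows "T_C2 W n y = (\<integral>t. (U n \<omega> t)\<^sup>2 * W t \<partial>lborel)"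
proof -
  have th: "theta_hat n y = \<theta> * sqrt (V n \<omega>)"
  proof -
    have "(\<Sum>j<n. (y j)\<^sup>2) / real n = \<theta>\<^sup>2 * V n \<omega>"
      by (simp add: V_def mean_upto_real y power_mult_distrib sum_distrib_left)
    then show ?thesis using \<theta> by (simp add: theta_hat_def real_sqrt_mult)
  qed
  have "y j / theta_hat n y = r n \<omega> j" for j
    using \<theta> by (simp add: th y r_def kap_def)
  then have "T_C2 W n y = real n * (\<integral>t. (mean_upto n (\<lambda>j. sin (t * r n \<omega> j) + cos (t * r n \<omega> j)) - phi1 t)\<^sup>2 * W t \<partial>lborel)"
    by (simp only: T_C2_eq[OF W])
  also have "\<dots> = (\<integral>t. (U n \<omega> t)\<^sup>2 * W t \<partial>lborel)"
    by (simp add: U_def power_mult_distrib mult.assoc)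
  finally show ?thesis .
qed

text \<open>Treats both parts at once: c = 1 with \<open>xb\<close> the sample mean, and c = 0 with
  \<open>xb\<close> = 0. If c = 1 or t^2 is integrable against the weight, the comparison of
  processes applies. Otherwise both statistics tend to 0 in probability and the limit functional is
  almost surely 0, so the same two conclusions hold.\<close>

lemma centred_errors_limit:
  fixes X :: "nat \<Rightarrow> 'a \<Rightarrow> 'h::{real_inner, complete_space, second_countable_topology}" and W :: "real \<Rightarrow> real"
  assumes ES: "error_sample M X e B2" and c: "c \<in> {0, 1}"
    and W: "W \<in> borel_measurable borel" "\<And>t. 0 \<le> W t" "\<And>t. W (- t) = W t" and W4: "integrable lborel (\<lambda>t. t ^ 4 * W t)"
    and b: "o_P M (\<lambda>n \<omega>. sqrt (sqrt (real n)) * norm (b n \<omega>)) (\<lambda>_. 1)"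
    and xb: "O_P M (\<lambda>n \<omega>. norm (xb n \<omega>))"
      "O_P M (\<lambda>n \<omega>. sqrt (real n) * norm (mean_upto n (\<lambda>j. X j \<omega>) - xb n \<omega>))"
      "\<And>n \<omega>. c = 1 \<Longrightarrow> \<omega> \<in> space M \<Longrightarrow> xb n \<omega> = mean_upto n (\<lambda>j. X j \<omega>)"
    and \<theta>: "\<theta> > 0" and ym: "\<And>n j. y n j \<in> borel_measurable M"
    and y: "\<And>n \<omega> j. n > 0 \<Longrightarrow> \<omega> \<in> space M \<Longrightarrow>
        y n j \<omega> = \<theta> * (e j \<omega> - c * mean_upto n (\<lambda>j. e j \<omega>) - inner (X j \<omega> - xb n \<omega>) (b n \<omega>))"
  defines "T \<equiv> \<lambda>n \<omega>. T_C2 W n (\<lambda>j. y n j \<omega>)"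
    and "R \<equiv> \<lambda>n \<omega>. R_C2 W (\<lambda>t. c * phi1 t) (\<lambda>_. 0) (\<lambda>_. 0) (\<lambda>t. t * phi1 t) n (\<lambda>j. e j \<omega>)"
  shows "o_P M (\<lambda>n \<omega>. T n \<omega> - R n \<omega>) (\<lambda>_. 1)"
    and "\<exists>(N :: real measure) G. centred_gaussian_process N G (score_cov c) \<and>
     (\<lambda>(\<omega>, t). G t \<omega>) \<in> borel_measurable (N \<Otimes>\<^sub>M lborel) \<and>
     conv_distr M T N (\<lambda>\<omega>. LINT t|lborel. (G t \<omega>)\<^sup>2 * W t)"
proof -
  interpret ES: error_sample M X e B2 by fact
  define \<nu> where "\<nu> = density lborel (\<lambda>t. ennreal (W t))"
  note dw = density_weight[OF W(1,2), folded \<nu>_def]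
  have t4: "integrable \<nu> (\<lambda>t. t ^ 4)" using dw(4)[of "\<lambda>t. t ^ 4"] W4 by simp
  have T: "T n \<in> borel_measurable M" "0 \<le> T n \<omega>" for n \<omega>
    unfolding T_def by (rule T_C2_measurable[OF W ym], rule T_C2_nonneg[OF W(2)])
  define Sp where "Sp n \<omega> t = (\<Sum>j<n. score c t (e j \<omega>)) / sqrt (real n)" for n \<omega> t
  define R' where "R' n \<omega> = (\<integral>t. (Sp n \<omega> t)\<^sup>2 * W t \<partial>lborel)" for n \<omega>
  have R: "R n \<omega> = R' n \<omega>" if "n > 0" for n \<omega>
    unfolding R_def R'_def Sp_def by (rule R_C2_eq[OF that])
  have "(\<lambda>(\<omega>, t). (Sp n \<omega> t)\<^sup>2 * W t) \<in> borel_measurable (M \<Otimes>\<^sub>M lborel)" for n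
    unfolding Sp_def score_def using W(1) by measurable
  from sigma_finite_measure.borel_measurable_lebesgue_integral[OF sigma_finite_lborel this]
  have R': "R' n \<in> borel_measurable M" "0 \<le> R' n \<omega>" for n \<omega>
    using W(2) by (auto simp: R'_def[abs_def] intro!: integral_nonneg_AE AE_I2)
  have Sp_m: "Sp n \<omega> \<in> borel_measurable borel" for n \<omega> unfolding Sp_def[abs_def] score_def by measurable
  have TR: "o_P M (\<lambda>n \<omega>. T n \<omega> - R n \<omega>) (\<lambda>_. 1) \<and> o_P M (\<lambda>n \<omega>. T n \<omega> - R' n \<omega>) (\<lambda>_. 1)"
    if "o_P M (\<lambda>n \<omega>. T n \<omega> - R' n \<omega>) (\<lambda>_. 1)"
    using that ES.o_P_dom[OF that, of "\<lambda>n \<omega>. T n \<omega> - R n \<omega>"] R by simp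
  have main: "o_P M (\<lambda>n \<omega>. T n \<omega> - R' n \<omega>) (\<lambda>_. 1) \<and> (\<forall>k::nat. (\<lambda>n. \<integral>\<omega>. exp (- (real k * R' n \<omega>)) \<partial>M)
        \<longlonglongrightarrow> (\<integral>y. exp (- (real k * (\<integral>t. (gauss_path c y t)\<^sup>2 * W t \<partial>lborel))) \<partial>normal_seq))"
  proof (cases "c = 1 \<or> integrable \<nu> (\<lambda>t. t\<^sup>2)")
    case True
    have cov: "integrable \<nu> (\<lambda>t. score_cov c t t)" by (rule score_cov_integrable[OF dw(2) t4 c True])
    have "(c = 1 \<and> (\<forall>n. \<forall>\<omega>\<in>space M. xb n \<omega> = mean_upto n (\<lambda>j. X j \<omega>))) \<or> integrable \<nu> (\<lambda>t. t\<^sup>2)"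
      using True xb(3) by blast
    then interpret RS: residual_sample M X e B2 \<nu> c b xb
      using ES dw cov c b xb t4 by (intro residual_sample.intro residual_sample_axioms.intro weight_measure.intro weight_measure_axioms.intro)
    have TU: "T n \<omega> = (\<integral>t. (RS.U n \<omega> t)\<^sup>2 \<partial>\<nu>)" if "n > 0" "\<omega> \<in> space M" for n \<omega>
    proof -
      have "T n \<omega> = (\<integral>t. (RS.U n \<omega> t)\<^sup>2 * W t \<partial>lborel)"
        unfolding T_def by (rule RS.T_C2_residual[OF W \<theta> that(1)]) (simp add: y[OF that] RS.res_def RS.m_def)
      then show ?thesis using dw(3)[of "\<lambda>t. (RS.U n \<omega> t)\<^sup>2"] RS.U_measurable[of n \<omega>]
        by (simp add: RS.measurable_\<nu>)
    qed
    have RS: "R' n \<omega> = (\<integral>t. (RS.S n \<omega> t)\<^sup>2 \<partial>\<nu>)" for n \<omega>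
      using dw(3)[of "\<lambda>t. (Sp n \<omega> t)\<^sup>2"] Sp_m[of n \<omega>] by (simp add: R'_def Sp_def RS.S_def)
    have "o_P M (\<lambda>n \<omega>. T n \<omega> - R' n \<omega>) (\<lambda>_. 1)"
      by (rule ES.o_P_dom[OF RS.statistic_close]) (simp add: TU RS)
    moreover have "(\<lambda>n. \<integral>\<omega>. exp (- (real k * R' n \<omega>)) \<partial>M)
        \<longlonglongrightarrow> (\<integral>y. exp (- (real k * (\<integral>t. (gauss_path c y t)\<^sup>2 * W t \<partial>lborel))) \<partial>normal_seq)" for k :: nat
    proof -
      have gm: "gauss_path c y \<in> borel_measurable borel" for y unfolding gauss_path_def[abs_def] by measurable
      have "(\<integral>t. (gauss_path c y t)\<^sup>2 \<partial>\<nu>) = (\<integral>t. (gauss_path c y t)\<^sup>2 * W t \<partial>lborel)" for y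
        by (rule dw(3)) (use gm in measurable)
      then show ?thesis
        using RS.score_statistic_laplace[OF ES.prob_space_axioms ES.e_indep ES.e_distr, of "real k"]
        by (simp add: RS RS.S_def)
    qed
    ultimately show ?thesis by blast
  next
    case False
    then have c0: "c = 0" using c by auto
    have t2: "\<not> integrable lborel (\<lambda>t. t\<^sup>2 * W t)" using False dw(4)[of "\<lambda>t. t\<^sup>2"] by simp
    \<comment> \<open>The given weight violates the moment dichotomy of
      \<open>residual_sample\<close>, but the bounds on \<open>kap\<close> and \<rho> do not involve
      the weight. The null measure satisfies every integrability condition and so makes these bounds
      available.\<close>
    define \<nu>0 where "\<nu>0 = null_measure (borel :: real measure)"
    have fin: "finite_measure \<nu>0" by (rule finite_measureI) (simp add: \<nu>0_def)
    have i0: "integrable \<nu>0 f" if "f \<in> borel_measurable borel" for f :: "real \<Rightarrow> real"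
    proof (rule integrableI_bounded)
      have "borel_measurable \<nu>0 = (borel_measurable borel :: (real \<Rightarrow> real) set)"
        by (rule measurable_cong_sets) (auto simp: \<nu>0_def)
      then show "f \<in> borel_measurable \<nu>0" using that by simp
      have "AE x in \<nu>0. ennreal (norm (f x)) = 0" by (rule AE_I'[where N=UNIV]) (auto simp: \<nu>0_def null_sets_def)
      then have "(\<integral>\<^sup>+x. ennreal (norm (f x)) \<partial>\<nu>0) = (\<integral>\<^sup>+x. 0 \<partial>\<nu>0)" by (rule nn_integral_cong_AE)
      then show "(\<integral>\<^sup>+x. ennreal (norm (f x)) \<partial>\<nu>0) < \<infinity>" by simp
    qed
    interpret RS: residual_sample M X e B2 \<nu>0 c b xb
    proof (intro residual_sample.intro residual_sample_axioms.intro weight_measure.intro weight_measure_axioms.intro ES b xb(1,2) c)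
      show "sigma_finite_measure \<nu>0" using fin by (simp add: finite_measure_def)
      show "sets \<nu>0 = sets borel" by (simp add: \<nu>0_def)
      show "integrable \<nu>0 (\<lambda>t. score_cov c t t)" by (rule i0) measurable
      show "integrable \<nu>0 (\<lambda>t. t ^ 4)" by (rule i0) measurable
      show "(c = 1 \<and> (\<forall>n. \<forall>\<omega>\<in>space M. xb n \<omega> = mean_upto n (\<lambda>j. X j \<omega>))) \<or> integrable \<nu>0 (\<lambda>t. t\<^sup>2)"
        by (rule disjI2, rule i0) measurable
    qed
    have m0: "RS.m n \<omega> = 0" for n \<omega> unfolding RS.m_def by (subst c0) simp
    have oT: "o_P M T (\<lambda>_. 1)"
    proof (rule ES.degenerate_statistic[OF _ RS.o_P_\<rho>])
      fix n :: nat and \<omega> assume n: "n > 0" and w: "\<omega> \<in> space M"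
        and ne: "sqrt (real n) * (mean_upto n (\<lambda>j. e j \<omega>) + RS.\<rho> n \<omega>) \<noteq> 0"
      \<comment> \<open>The linear coefficient of U at t = 0 is sqrt n times the mean of the
        standardised residuals; since \<open>m\<close> is 0 here, that mean is the mean error
        perturbed by \<rho>.\<close>
      have a: "mean_upto n (\<lambda>j. e j \<omega>) + RS.\<rho> n \<omega> = mean_upto n (RS.r n \<omega>)" by (simp add: RS.\<rho>_def m0)
      have "T n \<omega> = (\<integral>t. (RS.U n \<omega> t)\<^sup>2 * W t \<partial>lborel)"
        unfolding T_def by (rule RS.T_C2_residual[OF W \<theta> n]) (simp add: y[OF n w] RS.res_def RS.m_def)
      moreover have "\<not> integrable lborel (\<lambda>t. (RS.U n \<omega> t)\<^sup>2 * W t)"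
      proof (rule linear_square_not_integrable[OF W(2) W4 t2 W(1)])
        show "sqrt (real n) * mean_upto n (RS.r n \<omega>) \<noteq> 0" using ne a by simp
        fix t
        have "\<bar>RS.U n \<omega> t - sqrt (real n) * mean_upto n (RS.r n \<omega>) * t\<bar>
          = sqrt (real n) * \<bar>mean_upto n (\<lambda>j. sin (t * RS.r n \<omega> j) + cos (t * RS.r n \<omega> j)) - phi1 t - mean_upto n (RS.r n \<omega>) * t\<bar>"
        proof -
          have "RS.U n \<omega> t - sqrt (real n) * mean_upto n (RS.r n \<omega>) * t
            = sqrt (real n) * (mean_upto n (\<lambda>j. sin (t * RS.r n \<omega> j) + cos (t * RS.r n \<omega> j)) - phi1 t - mean_upto n (RS.r n \<omega>) * t)"
            by (simp add: RS.U_def right_diff_distrib mult.assoc)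
          then show ?thesis by (simp only: abs_mult) simp
        qed
        also have "\<dots> \<le> sqrt (real n) * ((3/2 * mean_upto n (\<lambda>j. (RS.r n \<omega> j)\<^sup>2) + 1/2) * t\<^sup>2)"
          by (intro mult_left_mono mean_sin_cos_linear[OF n]) simp
        finally show "\<bar>RS.U n \<omega> t - sqrt (real n) * mean_upto n (RS.r n \<omega>) * t\<bar>
          \<le> sqrt (real n) * (3/2 * mean_upto n (\<lambda>j. (RS.r n \<omega> j)\<^sup>2) + 1/2) * t\<^sup>2" by (simp only: mult.assoc)
      qed
      ultimately show "T n \<omega> = 0" by (simp add: not_integrable_integral_eq)
    qed
    have oR: "o_P M R' (\<lambda>_. 1)"
    proof (rule ES.degenerate_statistic[where z="\<lambda>_ _. 0"])
      show "o_P M (\<lambda>n \<omega>. sqrt (real n) * 0) (\<lambda>_. 1)" using ES.o_P_0 by simp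
      fix n :: nat and \<omega> assume n: "n > 0" and ne: "sqrt (real n) * (mean_upto n (\<lambda>j. e j \<omega>) + 0) \<noteq> 0"
      let ?s = "mean_upto n (\<lambda>j. (e j \<omega>)\<^sup>2 - 1)" and ?q = "mean_upto n (\<lambda>j. (e j \<omega>)\<^sup>2)" and ?e = "mean_upto n (\<lambda>j. e j \<omega>)"
      have "\<not> integrable lborel (\<lambda>t. (Sp n \<omega> t)\<^sup>2 * W t)"
      proof (rule linear_square_not_integrable[OF W(2) W4 t2 W(1)])
        show "sqrt (real n) * ?e \<noteq> 0" using ne by simp
        fix t
        have "Sp n \<omega> t - sqrt (real n) * ?e * t = sqrt (real n) * ((mean_upto n (\<lambda>j. sin (t * e j \<omega>) + cos (t * e j \<omega>)) - phi1 t - ?e * t)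
            + t\<^sup>2 / 2 * phi1 t * ?s)"
          unfolding Sp_def score_eq_mean[OF n] by (simp add: c0 algebra_simps)
        then have "\<bar>Sp n \<omega> t - sqrt (real n) * ?e * t\<bar> = sqrt (real n) * \<bar>(mean_upto n (\<lambda>j. sin (t * e j \<omega>) + cos (t * e j \<omega>)) - phi1 t - ?e * t)
            + t\<^sup>2 / 2 * phi1 t * ?s\<bar>" by (simp only: abs_mult) simp
        also have "\<dots> \<le> sqrt (real n) * ((3/2 * ?q + 1/2) * t\<^sup>2 + \<bar>?s\<bar> * t\<^sup>2)"
        proof (intro mult_left_mono abs_add_le_add mean_sin_cos_linear[OF n])
          have "\<bar>t\<^sup>2 / 2 * phi1 t\<bar> \<le> t\<^sup>2 * 1"
            unfolding abs_mult using phi1_simps(3,4)[of t] by (intro mult_mono) auto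
          then have "\<bar>t\<^sup>2 / 2 * phi1 t\<bar> * \<bar>?s\<bar> \<le> t\<^sup>2 * 1 * \<bar>?s\<bar>" by (rule mult_right_mono) simp
          then show "\<bar>t\<^sup>2 / 2 * phi1 t * ?s\<bar> \<le> \<bar>?s\<bar> * t\<^sup>2" unfolding abs_mult[of "t\<^sup>2 / 2 * phi1 t"] by (simp add: mult.commute)
        qed simp
        finally show "\<bar>Sp n \<omega> t - sqrt (real n) * ?e * t\<bar> \<le> sqrt (real n) * (3/2 * ?q + 1/2 + \<bar>?s\<bar>) * t\<^sup>2"
          by (simp add: algebra_simps)
      qed
      then show "R' n \<omega> = 0" by (simp add: R'_def not_integrable_integral_eq)
    qed
    have "(\<lambda>n. \<integral>\<omega>. exp (- (real k * R' n \<omega>)) \<partial>M)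
        \<longlonglongrightarrow> (\<integral>y. exp (- (real k * (\<integral>t. (gauss_path c y t)\<^sup>2 * W t \<partial>lborel))) \<partial>normal_seq)" for k :: nat
    proof -
      have "(\<lambda>(y, t). (gauss_path c y t)\<^sup>2 * W t) \<in> borel_measurable (normal_seq \<Otimes>\<^sub>M lborel)"
        unfolding gauss_path_def using W(1) by measurable
      from sigma_finite_measure.borel_measurable_lebesgue_integral[OF sigma_finite_lborel this]
      have Lm[measurable]: "(\<lambda>y. \<integral>t. (gauss_path c y t)\<^sup>2 * W t \<partial>lborel) \<in> borel_measurable normal_seq" .
      have "(\<integral>y. exp (- (real k * (\<integral>t. (gauss_path c y t)\<^sup>2 * W t \<partial>lborel))) \<partial>normal_seq) = (\<integral>y. 1 \<partial>normal_seq)"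
      proof (rule integral_cong_AE)
        show "AE y in normal_seq. exp (- (real k * (\<integral>t. (gauss_path c y t)\<^sup>2 * W t \<partial>lborel))) = 1"
          using gauss_path_degenerate[OF W(1,2) W4 t2] unfolding c0 by eventually_elim simp
      qed measurable
      also have "\<dots> = 1" using prob_space.prob_space[OF prob_space_normal_seq] by simp
      finally have "(\<lambda>n. \<integral>\<omega>. exp (- (real k * 0)) \<partial>M) \<longlonglongrightarrow> (\<integral>y. exp (- (real k * (\<integral>t. (gauss_path c y t)\<^sup>2 * W t \<partial>lborel))) \<partial>normal_seq)"
        by (simp add: ES.prob_space)
      from ES.laplace_of_o_P[OF _ R' _ _ this] show ?thesis using oR by simp
    qed
    moreover have "o_P M (\<lambda>n \<omega>. T n \<omega> - R' n \<omega>) (\<lambda>_. 1)" by (rule ES.o_P_diff[OF oT oR])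
    ultimately show ?thesis by blast
  qed
  then show "o_P M (\<lambda>n \<omega>. T n \<omega> - R n \<omega>) (\<lambda>_. 1)" using TR by blast
  show "\<exists>(N :: real measure) G. centred_gaussian_process N G (score_cov c) \<and>
     (\<lambda>(\<omega>, t). G t \<omega>) \<in> borel_measurable (N \<Otimes>\<^sub>M lborel) \<and>
     conv_distr M T N (\<lambda>\<omega>. LINT t|lborel. (G t \<omega>)\<^sup>2 * W t)"
  proof (rule gaussian_limit_statement[OF ES.prob_space_axioms c W(1,2) T])
    fix k :: nat
    show "(\<lambda>n. \<integral>\<omega>. exp (- (real k * T n \<omega>)) \<partial>M)
        \<longlonglongrightarrow> (\<integral>y. exp (- (real k * (\<integral>t. (gauss_path c y t)\<^sup>2 * W t \<partial>lborel))) \<partial>normal_seq)"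
      by (rule ES.laplace_of_o_P[OF conjunct1[OF main] T R' conjunct2[OF main, rule_format]])
  qed
qed

text \<open>Gives content to the hypothesis E[X] = 0 of part (ii), since a non-integrable function
  also has integral 0 by convention. Simple functions dominated by twice the norm approximate f in
  mean, so their integrals form a Cauchy sequence; completeness of the Hilbert space supplies the
  limit.\<close>

lemma integrable_if_norm_integrable:
  fixes f :: "'a \<Rightarrow> 'h :: {real_inner, complete_space, second_countable_topology}"
  assumes f[measurable]: "f \<in> borel_measurable M" and int: "integrable M (\<lambda>x. norm (f x))"
  shows "integrable M f"
proof -
  obtain s where s: "\<And>i. simple_function M (s i)"
    and lim: "\<And>x. x \<in> space M \<Longrightarrow> (\<lambda>i. s i x) \<longlonglongrightarrow> f x"
    and bd: "\<And>i x. x \<in> space M \<Longrightarrow> norm (s i x) \<le> 2 * norm (f x)"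
    using borel_measurable_implies_sequence_metric[OF f, of 0] by (auto simp: dist_norm) metis
  have [measurable]: "s i \<in> borel_measurable M" for i using s by (rule borel_measurable_simple_function)
  have fin: "(\<integral>\<^sup>+x. ennreal (2 * norm (f x)) \<partial>M) < \<infinity>"
    using int by (simp add: integrable_iff_bounded ennreal_mult nn_integral_cmult ennreal_mult_less_top)
  have sb: "Bochner_Integration.simple_bochner_integrable M (s i)" for i
  proof (rule simple_bochner_integrableI_bounded[OF s])
    have "(\<integral>\<^sup>+x. norm (s i x) \<partial>M) \<le> (\<integral>\<^sup>+x. ennreal (2 * norm (f x)) \<partial>M)"
      by (intro nn_integral_mono ennreal_leI bd)
    then show "(\<integral>\<^sup>+x. norm (s i x) \<partial>M) < \<infinity>" using fin by (rule le_less_trans)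
  qed
  have L: "(\<lambda>i. \<integral>\<^sup>+x. norm (f x - s i x) \<partial>M) \<longlonglongrightarrow> 0"
    by (rule nn_integral_dominated_convergence_norm[where w="\<lambda>x. 2 * norm (f x)"]) (use fin lim bd in auto)
  have "Cauchy (\<lambda>i. Bochner_Integration.simple_bochner_integral M (s i))"
  proof (rule metric_CauchyI)
    fix d :: real assume "0 < d"
    then have "eventually (\<lambda>i. (\<integral>\<^sup>+x. norm (f x - s i x) \<partial>M) < ennreal (d / 2)) sequentially"
      by (intro order_tendstoD(2)[OF L]) simp
    then obtain k where k: "\<And>i. i \<ge> k \<Longrightarrow> (\<integral>\<^sup>+x. norm (f x - s i x) \<partial>M) < ennreal (d / 2)"
      by (auto simp: eventually_sequentially)
    have "dist (Bochner_Integration.simple_bochner_integral M (s i)) (Bochner_Integration.simple_bochner_integral M (s j)) < d" if "i \<ge> k" "j \<ge> k" for i j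
    proof -
      have "ennreal (dist (Bochner_Integration.simple_bochner_integral M (s i)) (Bochner_Integration.simple_bochner_integral M (s j))) < ennreal (d / 2) + ennreal (d / 2)"
        unfolding dist_norm
        by (rule le_less_trans[OF simple_bochner_integral_bounded[OF f sb sb] add_strict_mono[OF k[OF that(1)] k[OF that(2)]]])
      also have "\<dots> = ennreal d" using \<open>0 < d\<close> by (simp flip: ennreal_plus)
      finally show ?thesis using \<open>0 < d\<close> by (simp add: ennreal_less_iff)
    qed
    then show "\<exists>k. \<forall>i\<ge>k. \<forall>j\<ge>k. dist (Bochner_Integration.simple_bochner_integral M (s i)) (Bochner_Integration.simple_bochner_integral M (s j)) < d" by blast
  qed
  then obtain x where "(\<lambda>i. Bochner_Integration.simple_bochner_integral M (s i)) \<longlonglongrightarrow> x"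
    using convergent_eq_Cauchy by blast
  then show ?thesis using has_bochner_integral.intros[OF f sb L] integrable.intros by blast
qed

theorem theorem4p2:
  fixes M :: "'a measure"
    and X :: "nat \<Rightarrow> 'a \<Rightarrow> 'h :: {real_inner, complete_space, second_countable_topology}"
    and Y \<epsilon> :: "nat \<Rightarrow> 'a \<Rightarrow> real"
    and \<alpha> :: real and \<beta> :: 'h and \<theta> :: real
    and \<alpha>h :: "nat \<Rightarrow> 'a \<Rightarrow> real" and \<beta>h :: "nat \<Rightarrow> 'a \<Rightarrow> 'h"
    and W :: "real \<Rightarrow> real"
  assumes P: "prob_space M"
    and X_meas: "\<And>i. X i \<in> borel_measurable M"
    and Y_meas: "\<And>i. Y i \<in> borel_measurable M"
    and XY_indep: "prob_space.indep_vars M (\<lambda>_. borel) (\<lambda>i \<omega>. (X i \<omega>, Y i \<omega>)) UNIV"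
    and XY_ident: "\<And>i. distr M borel (\<lambda>\<omega>. (X i \<omega>, Y i \<omega>)) = distr M borel (\<lambda>\<omega>. (X 0 \<omega>, Y 0 \<omega>))"
    and model: "\<And>i \<omega>. \<omega> \<in> space M \<Longrightarrow> Y i \<omega> = \<alpha> + inner (X i \<omega>) \<beta> + \<epsilon> i \<omega>"
    and eps_indep_X: "prob_space.indep_set M
        (sets (vimage_algebra (space M) (\<lambda>\<omega> i. X i \<omega>) (PiM UNIV (\<lambda>_. borel))))
        (sets (vimage_algebra (space M) (\<lambda>\<omega> i. \<epsilon> i \<omega>) (PiM UNIV (\<lambda>_. borel))))"
    and eps_indep: "prob_space.indep_vars M (\<lambda>_. borel) \<epsilon> UNIV"
    and theta_pos: "\<theta> > 0"
    and eps_normal: "\<And>i. distributed M lborel (\<epsilon> i) (normal_density 0 \<theta>)"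
    and X_moment: "integrable M (\<lambda>\<omega>. (norm (X 0 \<omega>)) ^ 4)"
    and W_meas: "W \<in> borel_measurable borel"
    and W_nonneg: "\<And>t. W t \<ge> 0"
    and W_sym: "\<And>t. W (- t) = W t"
    and W_moment: "integrable lborel (\<lambda>t. t ^ 4 * W t)"
    and \<alpha>h_meas: "\<And>n. \<alpha>h n \<in> borel_measurable M"
    and \<beta>h_meas: "\<And>n. \<beta>h n \<in> borel_measurable M"
    and \<beta>h_rate: "o_P M (\<lambda>n \<omega>. norm (\<beta>h n \<omega> - \<beta>)) (\<lambda>n. real n powr (- 1 / 4))"
  defines "T \<equiv> (\<lambda>n \<omega>. T_C2 W n (\<lambda>j. Y j \<omega> - \<alpha>h n \<omega> - inner (X j \<omega>) (\<beta>h n \<omega>)))"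
    and "Ec \<equiv> (\<lambda>t. integral\<^sup>L M (\<lambda>\<omega>. cos (t * (\<epsilon> 0 \<omega> / \<theta>))))"
    and "Ece \<equiv> (\<lambda>t. integral\<^sup>L M (\<lambda>\<omega>. cos (t * (\<epsilon> 0 \<omega> / \<theta>)) * (\<epsilon> 0 \<omega> / \<theta>)))"
    and "Es \<equiv> (\<lambda>t. integral\<^sup>L M (\<lambda>\<omega>. sin (t * (\<epsilon> 0 \<omega> / \<theta>))))"
    and "Ese \<equiv> (\<lambda>t. integral\<^sup>L M (\<lambda>\<omega>. sin (t * (\<epsilon> 0 \<omega> / \<theta>)) * (\<epsilon> 0 \<omega> / \<theta>)))"
  shows
    "((\<forall>n. \<forall>\<omega>\<in>space M. \<alpha>h n \<omega> = (\<Sum>j<n. Y j \<omega>) / real n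
                         - inner ((\<Sum>j<n. X j \<omega>) /\<^sub>R real n) (\<beta>h n \<omega>)) \<longrightarrow>
        o_P M (\<lambda>n \<omega>. T n \<omega> - R_C2 W Ec Ece Es Ese n (\<lambda>j. \<epsilon> j \<omega> / \<theta>)) (\<lambda>_. 1) \<and>
        (\<exists>(N :: real measure) G.
           centred_gaussian_process N G
             (\<lambda>s t. exp (- (1/2) * (s - t)\<^sup>2)
                    - ((1/2) * s\<^sup>2 * t\<^sup>2 + s * t + 1) * exp (- (1/2) * (s\<^sup>2 + t\<^sup>2))) \<and>
           (\<lambda>(\<omega>, t). G t \<omega>) \<in> borel_measurable (N \<Otimes>\<^sub>M lborel) \<and>
           conv_distr M T N (\<lambda>\<omega>. LINT t|lborel. (G t \<omega>)\<^sup>2 * W t)))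
   \<and>
     ((\<alpha> = 0 \<and> (\<forall>n. \<forall>\<omega>\<in>space M. \<alpha>h n \<omega> = 0) \<and> integral\<^sup>L M (X 0) = 0) \<longrightarrow>
        o_P M (\<lambda>n \<omega>. T n \<omega> - R_C2 W (\<lambda>_. 0) Ece (\<lambda>_. 0) Ese n (\<lambda>j. \<epsilon> j \<omega> / \<theta>)) (\<lambda>_. 1) \<and>
        (\<exists>(N :: real measure) G.
           centred_gaussian_process N G
             (\<lambda>s t. exp (- (1/2) * (s - t)\<^sup>2)
                    - ((1/2) * s\<^sup>2 * t\<^sup>2 + 1) * exp (- (1/2) * (s\<^sup>2 + t\<^sup>2))) \<and>
           (\<lambda>(\<omega>, t). G t \<omega>) \<in> borel_measurable (N \<Otimes>\<^sub>M lborel) \<and>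
           conv_distr M T N (\<lambda>\<omega>. LINT t|lborel. (G t \<omega>)\<^sup>2 * W t)))"
proof -
  interpret prob_space M by (rule P)
  define e where "e j \<omega> = \<epsilon> j \<omega> / \<theta>" for j \<omega>
  define B2 where "B2 = (\<integral>\<omega>. (norm (X 0 \<omega>))\<^sup>2 \<partial>M)"
  have eps_meas[measurable]: "\<epsilon> i \<in> borel_measurable M" for i
    using eps_indep by (auto simp: indep_vars_def)
  have e_meas[measurable]: "e i \<in> borel_measurable M" for i unfolding e_def by measurable
  have e_indep: "indep_vars (\<lambda>_. borel) e UNIV"
  proof -
    have "indep_vars (\<lambda>_. borel) (\<lambda>i \<omega>. (\<lambda>x. x / \<theta>) (\<epsilon> i \<omega>)) UNIV"
      by (rule indep_vars_compose2[OF eps_indep]) simp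
    then show ?thesis by (simp add: e_def[abs_def])
  qed
  have e_distr: "distr M borel (e i) = std_normal_distribution" for i
  proof -
    have "distributed M lborel (\<lambda>\<omega>. 0 + (1 / \<theta>) * \<epsilon> i \<omega>) (normal_density (0 + (1 / \<theta>) * 0) (\<bar>1 / \<theta>\<bar> * \<theta>))"
      by (rule normal_density_affine[OF eps_normal]) (use theta_pos in auto)
    then have "distributed M lborel (e i) std_normal_density" using theta_pos by (simp add: e_def[abs_def])
    then have "distr M lborel (e i) = std_normal_distribution" by (simp add: distributed_def)
    moreover have "distr M lborel (e i) = distr M borel (e i)" by (rule distr_cong) auto
    ultimately show ?thesis by simp
  qed
  have X_sq: "integrable M (\<lambda>\<omega>. (norm (X i \<omega>))\<^sup>2)" "(\<integral>\<omega>. (norm (X i \<omega>))\<^sup>2 \<partial>M) = B2" for i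
  proof -
    have XY[measurable]: "(\<lambda>\<omega>. (X i \<omega>, Y i \<omega>)) \<in> borel_measurable M" for i
      using X_meas Y_meas by (intro borel_measurable_Pair)
    have f: "(\<lambda>z :: 'h \<times> real. (norm (fst z))\<^sup>2) \<in> borel_measurable borel"
      by (intro borel_measurable_continuous_onI continuous_intros)
    have i0: "integrable M (\<lambda>\<omega>. (norm (X 0 \<omega>))\<^sup>2)"
    proof (rule Bochner_Integration.integrable_bound)
      show "integrable M (\<lambda>\<omega>. 1 + (norm (X 0 \<omega>)) ^ 4)" using X_moment by simp
      show "AE \<omega> in M. norm ((norm (X 0 \<omega>))\<^sup>2) \<le> norm (1 + (norm (X 0 \<omega>)) ^ 4)"
      proof (rule AE_I2)
        fix \<omega>
        have "(norm (X 0 \<omega>))\<^sup>2 \<le> 1 + ((norm (X 0 \<omega>))\<^sup>2)\<^sup>2" using abs_le_1_plus_square[of "(norm (X 0 \<omega>))\<^sup>2"] by simp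
        then show "norm ((norm (X 0 \<omega>))\<^sup>2) \<le> norm (1 + (norm (X 0 \<omega>)) ^ 4)" by simp
      qed
    qed (use X_meas in measurable)
    note d = integrable_distr_eq[OF XY f] integral_distr[OF XY f]
    have "integrable M (\<lambda>\<omega>. (norm (X i \<omega>))\<^sup>2) \<longleftrightarrow> integrable M (\<lambda>\<omega>. (norm (X 0 \<omega>))\<^sup>2)"
      using d(1)[of i] d(1)[of 0] unfolding XY_ident[of i] by simp
    then show "integrable M (\<lambda>\<omega>. (norm (X i \<omega>))\<^sup>2)" using i0 by simp
    show "(\<integral>\<omega>. (norm (X i \<omega>))\<^sup>2 \<partial>M) = B2"
      using d(2)[of i] d(2)[of 0] unfolding XY_ident[of i] B2_def by simp
  qed
  have inner_int: "integrable M (\<lambda>\<omega>. inner (X i \<omega>) (X j \<omega>))" for i j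
  proof (rule Bochner_Integration.integrable_bound)
    show "integrable M (\<lambda>\<omega>. (norm (X i \<omega>))\<^sup>2 + (norm (X j \<omega>))\<^sup>2)" using X_sq(1) by simp
    show "AE \<omega> in M. norm (inner (X i \<omega>) (X j \<omega>)) \<le> norm ((norm (X i \<omega>))\<^sup>2 + (norm (X j \<omega>))\<^sup>2)"
    proof (rule AE_I2)
      fix \<omega>
      have "\<bar>inner (X i \<omega>) (X j \<omega>)\<bar> \<le> norm (X i \<omega>) * norm (X j \<omega>)" by (rule Cauchy_Schwarz_ineq2)
      also have "\<dots> \<le> (norm (X i \<omega>))\<^sup>2 + (norm (X j \<omega>))\<^sup>2"
        using square_sum_bound[of "norm (X i \<omega>)" "norm (X j \<omega>)"] by simp
      finally show "norm (inner (X i \<omega>) (X j \<omega>)) \<le> norm ((norm (X i \<omega>))\<^sup>2 + (norm (X j \<omega>))\<^sup>2)" by simp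
    qed
  qed (use X_meas in measurable)
  have ES: "error_sample M X e B2"
  proof (intro error_sample.intro error_sample_axioms.intro prob_space_axioms X_meas e_indep e_distr X_sq)
    fix i j and f :: "real \<Rightarrow> real"
    assume f[measurable]: "f \<in> borel_measurable borel" and int: "integrable M (\<lambda>\<omega>. f (e i \<omega>) * f (e j \<omega>))"
    let ?VX = "vimage_algebra (space M) (\<lambda>\<omega> i. X i \<omega>) (PiM UNIV (\<lambda>_. borel))"
    let ?Ve = "vimage_algebra (space M) (\<lambda>\<omega> i. \<epsilon> i \<omega>) (PiM UNIV (\<lambda>_. borel))"
    let ?G = "\<lambda>\<omega>. inner (X i \<omega>) (X j \<omega>)" and ?F = "\<lambda>\<omega>. f (e i \<omega>) * f (e j \<omega>)"
    have c[measurable]: "(\<lambda>x. x k) \<in> measurable (PiM UNIV (\<lambda>_. borel)) borel" for k :: nat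
      by (rule measurable_component_singleton) simp
    \<comment> \<open>The two factors are measurable for the \<sigma>-algebras generated by the
      whole covariate sequence and by the whole error sequence. The \<sigma>-algebras they generate
      themselves are therefore contained in independent ones.\<close>
    have "(\<lambda>\<omega> i. X i \<omega>) \<in> measurable ?VX (PiM UNIV (\<lambda>_. borel))"
      by (rule measurable_vimage_algebra1) (simp add: space_PiM)
    moreover have "(\<lambda>x. inner (x i) (x j)) \<in> borel_measurable (PiM UNIV (\<lambda>_. borel :: 'h measure))"
      using c by measurable
    ultimately have G: "?G \<in> borel_measurable ?VX" by (rule measurable_compose)
    have "(\<lambda>\<omega> i. \<epsilon> i \<omega>) \<in> measurable ?Ve (PiM UNIV (\<lambda>_. borel))"
      by (rule measurable_vimage_algebra1) (simp add: space_PiM)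
    moreover have "(\<lambda>x. f (x i / \<theta>) * f (x j / \<theta>)) \<in> borel_measurable (PiM UNIV (\<lambda>_. borel :: real measure))"
      using c by measurable
    ultimately have F: "?F \<in> borel_measurable ?Ve" unfolding e_def by (rule measurable_compose)
    have gen: "sigma_sets (space M) {Z -` A \<inter> space M |A. A \<in> sets borel} \<subseteq> sets (vimage_algebra (space M) g N)"
      if "Z \<in> borel_measurable (vimage_algebra (space M) g N)" for Z :: "'a \<Rightarrow> real" and g and N :: "'z measure"
    proof -
      have "{Z -` A \<inter> space M |A. A \<in> sets borel} \<subseteq> sets (vimage_algebra (space M) g N)"
        using measurable_sets[OF that] by auto
      from sets.sigma_sets_subset[OF this] show ?thesis by simp
    qed
    have "indep_set (sigma_sets (space M) {?G -` A \<inter> space M |A. A \<in> sets borel}) (sigma_sets (space M) {?F -` A \<inter> space M |A. A \<in> sets borel})"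
      unfolding indep_set_def
      by (rule indep_sets_mono_sets[OF eps_indep_X[unfolded indep_set_def]])
         (use gen[OF G] gen[OF F] in \<open>auto split: bool.split\<close>)
    moreover have "?G \<in> borel_measurable M" using X_meas by measurable
    moreover have "?F \<in> borel_measurable M" by measurable
    ultimately have "indep_var borel ?G borel ?F" unfolding indep_var_eq by simp
    from indep_var_integrable[OF this inner_int int] indep_var_lebesgue_integral[OF this inner_int int]
    show "integrable M (\<lambda>\<omega>. f (e i \<omega>) * f (e j \<omega>) * inner (X i \<omega>) (X j \<omega>)) \<and>
        (\<integral>\<omega>. f (e i \<omega>) * f (e j \<omega>) * inner (X i \<omega>) (X j \<omega>) \<partial>M)
          = (\<integral>\<omega>. f (e i \<omega>) * f (e j \<omega>) \<partial>M) * (\<integral>\<omega>. inner (X i \<omega>) (X j \<omega>) \<partial>M)"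
      by (simp add: mult.commute)
  qed
  interpret ES: error_sample M X e B2 by (rule ES)
  \<comment> \<open>Standardised like the errors, so that the residual is \<theta> times an
    expression in \<open>e\<close>, \<open>X\<close> and \<open>b\<close> alone.\<close>
  define b where "b n \<omega> = (1 / \<theta>) *\<^sub>R (\<beta>h n \<omega> - \<beta>)" for n \<omega>
  have b_rate: "o_P M (\<lambda>n \<omega>. sqrt (sqrt (real n)) * norm (b n \<omega>)) (\<lambda>_. 1)"
    unfolding o_P_iff
  proof (intro allI impI)
    fix d1 d2 :: real assume d: "d1 > 0" "d2 > 0"
    have "eventually (\<lambda>n. outer_lt M {\<omega> \<in> space M. (d1 * \<theta>) * real n powr (- 1 / 4) < \<bar>norm (\<beta>h n \<omega> - \<beta>)\<bar>} d2) sequentially"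
      using \<beta>h_rate[unfolded o_P_iff, rule_format, of "d1 * \<theta>" d2] d theta_pos by simp
    then show "eventually (\<lambda>n. outer_lt M {\<omega> \<in> space M. d1 * 1 < \<bar>sqrt (sqrt (real n)) * norm (b n \<omega>)\<bar>} d2) sequentially"
      using eventually_gt_at_top[of 0]
    proof eventually_elim
      case (elim n)
      have n: "0 < sqrt (sqrt (real n))" using elim by simp
      have "sqrt (sqrt (real n)) = real n powr (1/4)"
        using elim by (simp add: powr_half_sqrt[symmetric] powr_powr)
      then have p: "real n powr (- 1 / 4) = 1 / sqrt (sqrt (real n))"
        by (simp add: powr_minus_divide)
      have "(d1 * \<theta>) * real n powr (- 1 / 4) < x" if "d1 < sqrt (sqrt (real n)) * (x / \<theta>)" for x
        unfolding p using that n theta_pos by (simp add: field_simps)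
      then have "{\<omega> \<in> space M. d1 * 1 < \<bar>sqrt (sqrt (real n)) * norm (b n \<omega>)\<bar>}
         \<subseteq> {\<omega> \<in> space M. (d1 * \<theta>) * real n powr (- 1 / 4) < \<bar>norm (\<beta>h n \<omega> - \<beta>)\<bar>}"
        using theta_pos by (auto simp: b_def abs_mult)
      from outer_lt_mono[OF elim(1) this order_refl] show ?case .
    qed
  qed
  \<comment> \<open>Two of the four coefficients are means of odd functions of a symmetric variable
    and vanish. The other two are phi1 t and t * phi1 t, so the summand of the approximating
    statistic, less phi1 t, is the score.\<close>
  have Ec: "Ec = phi1" and Ece: "Ece = (\<lambda>_. 0)" and Es: "Es = (\<lambda>_. 0)" and Ese: "Ese = (\<lambda>t. t * phi1 t)"
  proof -
    note m = ES.e_integral(1)[of _ 0, unfolded e_def]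
    show "Ec = phi1"
    proof
      fix t show "Ec t = phi1 t"
        unfolding Ec_def using m[of "\<lambda>x. cos (t * x)"] std_normal_cos[of t] by (simp only: has_bochner_integral_iff) simp
    qed
    show "Es = (\<lambda>_. 0)"
    proof
      fix t show "Es t = 0"
        unfolding Es_def using m[of "\<lambda>x. sin (t * x)"] std_normal_sin[of t] by (simp only: has_bochner_integral_iff) simp
    qed
    show "Ece = (\<lambda>_. 0)"
    proof
      fix t
      have "Ece t = (\<integral>x. cos (t * x) * x \<partial>std_normal_distribution)"
        unfolding Ece_def by (rule m) measurable
      also have "\<dots> = 0" using std_normal_x_cos[of t] by (simp add: has_bochner_integral_iff mult.commute)
      finally show "Ece t = 0" .
    qed
    show "Ese = (\<lambda>t. t * phi1 t)"
    proof
      fix t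
      have "Ese t = (\<integral>x. sin (t * x) * x \<partial>std_normal_distribution)"
        unfolding Ese_def by (rule m) measurable
      also have "\<dots> = t * phi1 t" using std_normal_x_sin[of t] by (simp add: has_bochner_integral_iff mult.commute)
      finally show "Ese t = t * phi1 t" .
    qed
  qed
  have W4: "integrable lborel (\<lambda>t. t ^ 4 * W t)" by (rule W_moment)
  have ym: "(\<lambda>\<omega>. Y j \<omega> - \<alpha>h n \<omega> - inner (X j \<omega>) (\<beta>h n \<omega>)) \<in> borel_measurable M" for n j
    using X_meas Y_meas \<alpha>h_meas \<beta>h_meas by measurable
  have epse: "\<epsilon> j \<omega> = \<theta> * e j \<omega>" for j \<omega> using theta_pos by (simp add: e_def)
  have b\<beta>: "\<beta>h n \<omega> = \<beta> + \<theta> *\<^sub>R b n \<omega>" for n \<omega> using theta_pos by (simp add: b_def)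
  have cov1: "score_cov 1 = (\<lambda>s t. exp (- (1/2) * (s - t)\<^sup>2) - ((1/2) * s\<^sup>2 * t\<^sup>2 + s * t + 1) * exp (- (1/2) * (s\<^sup>2 + t\<^sup>2)))"
    by (simp add: score_cov_def[abs_def])
  have cov0: "score_cov 0 = (\<lambda>s t. exp (- (1/2) * (s - t)\<^sup>2) - ((1/2) * s\<^sup>2 * t\<^sup>2 + 1) * exp (- (1/2) * (s\<^sup>2 + t\<^sup>2)))"
    by (simp add: score_cov_def[abs_def])
  show ?thesis
  proof (intro conjI impI)
    assume \<alpha>h: "\<forall>n. \<forall>\<omega>\<in>space M. \<alpha>h n \<omega> = (\<Sum>j<n. Y j \<omega>) / real n - inner ((\<Sum>j<n. X j \<omega>) /\<^sub>R real n) (\<beta>h n \<omega>)"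
    \<comment> \<open>Substituting the estimated intercept cancels \<alpha> and replaces errors and
      covariates by their deviations from the sample means; this is the form with c = 1 and
      \<open>xb\<close> the sample mean.\<close>
    have y: "Y j \<omega> - \<alpha>h n \<omega> - inner (X j \<omega>) (\<beta>h n \<omega>)
       = \<theta> * (e j \<omega> - 1 * mean_upto n (\<lambda>j. e j \<omega>) - inner (X j \<omega> - mean_upto n (\<lambda>j. X j \<omega>)) (b n \<omega>))"
      if n: "n > 0" and w: "\<omega> \<in> space M" for n \<omega> j
    proof -
      have lin: "linear (\<lambda>x. inner x \<beta>)" by (simp add: linear_iff inner_add_left)
      have "(\<Sum>j<n. Y j \<omega>) / real n = mean_upto n (\<lambda>j. \<alpha> + inner (X j \<omega>) \<beta> + \<theta> * e j \<omega>)"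
        by (simp add: mean_upto_real model[OF w] epse)
      also have "\<dots> = \<alpha> + inner (mean_upto n (\<lambda>j. X j \<omega>)) \<beta> + \<theta> * mean_upto n (\<lambda>j. e j \<omega>)"
        by (simp only: mean_upto_add mean_upto_const[OF n] mean_upto_mult mean_upto_linear[OF lin])
      finally have "\<alpha>h n \<omega> = \<alpha> + inner (mean_upto n (\<lambda>j. X j \<omega>)) \<beta> + \<theta> * mean_upto n (\<lambda>j. e j \<omega>) - inner (mean_upto n (\<lambda>j. X j \<omega>)) (\<beta>h n \<omega>)"
        using \<alpha>h w by (simp add: mean_upto_def[of n "\<lambda>j. X j \<omega>"])
      then show ?thesis
        unfolding model[OF w] b\<beta> epse by (simp add: inner_add_right inner_diff_left algebra_simps)
    qed
    have xb: "O_P M (\<lambda>n \<omega>. sqrt (real n) * norm (mean_upto n (\<lambda>j. X j \<omega>) - mean_upto n (\<lambda>j. X j \<omega>)))"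
      using O_P_const[of 0] by simp
    note L = centred_errors_limit[OF ES _ W_meas W_nonneg W_sym W4 b_rate ES.O_P_mean_X xb refl theta_pos ym y]
    show "o_P M (\<lambda>n \<omega>. T n \<omega> - R_C2 W Ec Ece Es Ese n (\<lambda>j. \<epsilon> j \<omega> / \<theta>)) (\<lambda>_. 1)"
      using L(1) unfolding T_def Ec Ece Es Ese by (simp add: e_def)
    show "\<exists>(N :: real measure) G. centred_gaussian_process N G
             (\<lambda>s t. exp (- (1/2) * (s - t)\<^sup>2) - ((1/2) * s\<^sup>2 * t\<^sup>2 + s * t + 1) * exp (- (1/2) * (s\<^sup>2 + t\<^sup>2))) \<and>
           (\<lambda>(\<omega>, t). G t \<omega>) \<in> borel_measurable (N \<Otimes>\<^sub>M lborel) \<and>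
           conv_distr M T N (\<lambda>\<omega>. LINT t|lborel. (G t \<omega>)\<^sup>2 * W t)"
      using L(2) unfolding T_def cov1[symmetric] by simp
  next
    assume h: "\<alpha> = 0 \<and> (\<forall>n. \<forall>\<omega>\<in>space M. \<alpha>h n \<omega> = 0) \<and> integral\<^sup>L M (X 0) = 0"
    have y: "Y j \<omega> - \<alpha>h n \<omega> - inner (X j \<omega>) (\<beta>h n \<omega>)
       = \<theta> * (e j \<omega> - 0 * mean_upto n (\<lambda>j. e j \<omega>) - inner (X j \<omega> - 0) (b n \<omega>))"
      if n: "n > 0" and w: "\<omega> \<in> space M" for n \<omega> j
      using h w unfolding model[OF w] b\<beta> epse by (simp add: inner_add_right algebra_simps)
    have X0: "integrable M (X 0)"
    proof (rule integrable_if_norm_integrable[OF X_meas])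
      show "integrable M (\<lambda>\<omega>. norm (X 0 \<omega>))"
      proof (rule Bochner_Integration.integrable_bound)
        show "integrable M (\<lambda>\<omega>. 1 + (norm (X 0 \<omega>))\<^sup>2)" using X_sq(1) by simp
        show "AE \<omega> in M. norm (norm (X 0 \<omega>)) \<le> norm (1 + (norm (X 0 \<omega>))\<^sup>2)"
        proof (rule AE_I2)
          fix \<omega> show "norm (norm (X 0 \<omega>)) \<le> norm (1 + (norm (X 0 \<omega>))\<^sup>2)"
            using abs_le_1_plus_square[of "norm (X 0 \<omega>)"] by simp
        qed
      qed (use X_meas in measurable)
    qed
    have XY[measurable]: "(\<lambda>\<omega>. (X i \<omega>, Y i \<omega>)) \<in> borel_measurable M" for i
      using X_meas Y_meas by (intro borel_measurable_Pair)
    have fm: "(fst :: 'h \<times> real \<Rightarrow> 'h) \<in> borel_measurable borel"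
      by (intro borel_measurable_continuous_onI continuous_intros)
    have Xmean: "(\<integral>\<omega>. inner x (X i \<omega>) \<partial>M) = 0" for x i
    proof -
      have fx: "(\<lambda>z :: 'h \<times> real. inner x (fst z)) \<in> borel_measurable borel"
        by (intro borel_measurable_continuous_onI continuous_intros)
      have "(\<integral>\<omega>. inner x (X i \<omega>) \<partial>M) = (\<integral>\<omega>. inner x (X 0 \<omega>) \<partial>M)"
        using integral_distr[OF XY[of i] fx] integral_distr[OF XY[of 0] fx] unfolding XY_ident[of i] by simp
      also have "\<dots> = inner x (integral\<^sup>L M (X 0))" by (rule integral_inner_right) (rule X0)
      finally show ?thesis using h by simp
    qed
    \<comment> \<open>Under the product law the inner integral is the mean of inner x (X j) for
      fixed x, which is 0. Orthogonality makes sqrt n times the norm of the mean covariate bounded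
      in probability, which is the condition on \<open>xb\<close> = 0.\<close>
    have orth: "(\<integral>\<omega>. inner (X i \<omega>) (X j \<omega>) \<partial>M) = 0" if ij: "i \<noteq> j" for i j
    proof -
      have "indep_vars (\<lambda>_. borel) (\<lambda>i \<omega>. fst (X i \<omega>, Y i \<omega>)) UNIV"
        by (rule indep_vars_compose2[OF XY_indep]) (rule fm)
      then have iX: "indep_vars (\<lambda>_. borel) X UNIV" by (simp add: fun_eq_iff)
      have "indep_var (PiM {i} (\<lambda>_. borel)) (\<lambda>\<omega>. restrict (\<lambda>k. X k \<omega>) {i}) (PiM {j} (\<lambda>_. borel)) (\<lambda>\<omega>. restrict (\<lambda>k. X k \<omega>) {j})"
        by (rule indep_var_restrict[OF iX]) (use ij in auto)
      from indep_var_compose[OF this measurable_component_singleton[of i] measurable_component_singleton[of j]]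
      have "indep_var borel (X i) borel (X j)" by (simp add: comp_def)
      then have d: "distr M borel (X i) \<Otimes>\<^sub>M distr M borel (X j) = distr M (borel \<Otimes>\<^sub>M borel) (\<lambda>\<omega>. (X i \<omega>, X j \<omega>))"
        by (simp add: indep_var_distribution_eq)
      interpret D1: prob_space "distr M borel (X i)" by (rule prob_space_distr) (rule X_meas)
      interpret D2: prob_space "distr M borel (X j)" by (rule prob_space_distr) (rule X_meas)
      interpret D: pair_sigma_finite "distr M borel (X i)" "distr M borel (X j)" ..
      have pm: "(\<lambda>\<omega>. (X i \<omega>, X j \<omega>)) \<in> measurable M (borel \<Otimes>\<^sub>M borel)" using X_meas by measurable
      have im: "(\<lambda>(x, y). inner x y :: real) \<in> borel_measurable (borel \<Otimes>\<^sub>M (borel :: 'h measure))" by measurable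
      have "integrable (distr M borel (X i) \<Otimes>\<^sub>M distr M borel (X j)) (\<lambda>(x, y). inner x y)"
        unfolding d by (subst integrable_distr_eq[OF pm im]) (simp add: inner_int)
      from D.integral_fst[OF this]
      have "(\<integral>\<omega>. inner (X i \<omega>) (X j \<omega>) \<partial>M) = (\<integral>x. \<integral>y. inner x y \<partial>distr M borel (X j) \<partial>distr M borel (X i))"
        unfolding d integral_distr[OF pm im] by simp
      also have "\<dots> = 0"
        using Xmean by (simp add: integral_distr[OF X_meas])
      finally show ?thesis .
    qed
    have xb: "O_P M (\<lambda>n \<omega>. sqrt (real n) * norm (mean_upto n (\<lambda>j. X j \<omega>) - 0))"
      using O_P_root_mean[OF X_meas X_sq(1) eq_refl[OF X_sq(2)] orth] by simp
    have x0: "O_P M (\<lambda>n \<omega>. norm (0 :: 'h))" using O_P_const[of 0] by simp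
    note L = centred_errors_limit[where c=0 and xb="\<lambda>_ _. 0", OF ES _ W_meas W_nonneg W_sym W4 b_rate x0 xb _ theta_pos ym y]
    show "o_P M (\<lambda>n \<omega>. T n \<omega> - R_C2 W (\<lambda>_. 0) Ece (\<lambda>_. 0) Ese n (\<lambda>j. \<epsilon> j \<omega> / \<theta>)) (\<lambda>_. 1)"
      using L(1) unfolding T_def Ece Ese by (simp add: e_def)
    show "\<exists>(N :: real measure) G. centred_gaussian_process N G
             (\<lambda>s t. exp (- (1/2) * (s - t)\<^sup>2) - ((1/2) * s\<^sup>2 * t\<^sup>2 + 1) * exp (- (1/2) * (s\<^sup>2 + t\<^sup>2))) \<and>
           (\<lambda>(\<omega>, t). G t \<omega>) \<in> borel_measurable (N \<Otimes>\<^sub>M lborel) \<and>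
           conv_distr M T N (\<lambda>\<omega>. LINT t|lborel. (G t \<omega>)\<^sup>2 * W t)"
      using L(2) unfolding T_def cov0[symmetric] by simp
  qed
qed

end
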